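(* Let $\Omega\subset\mathbb{R}^n$ be an open set, let $\phi\in\Phi(\Omega)$ be a generalized $\Phi$-function satisfying Assumptions (A), (aInc) and (aDec), and let $(\psi_\epsilon)_{\epsilon>0}$ be a family of functions such that $\psi_\epsilon\in L^1(0,\infty)$, $\psi_\epsilon\ge 0$, $\int_0^\infty\psi_\epsilon(r)\,dr=1$ for every $\epsilon>0$, and $\lim_{\epsilon\to0^+}\int_\gamma^\infty\psi_\epsilon(r)\,dr=0$ for every $\gamma>0$. Assume that $f\in L^1_{\rm loc}(\Omega)$. Then $$\nabla f\in L^{\phi(\cdot)}(\Omega;\mathbb{R}^n)\quad\Longleftrightarrow\quad \limsup_{\epsilon\to0^+}\varrho^\epsilon_{\#,\Omega}(f)<\infty .$$ In this case, $$\lim_{\epsilon\to0^+}\varrho^\epsilon_{\#,\Omega}(f)=\varrho_{\phi(\cdot),\Omega}(c_n|\nabla f|)\qquad\text{and}\qquad \lim_{\epsilon\to0^+}\|f\|^\epsilon_{\#,\Omega}=c_n\|\nabla f\|_{\phi(\cdot),\Omega},$$ where $c_n:=\frac{1}{|B(0,1)|}\int_{B(0,1)}|x\cdot e_1|\,dx$.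
   Context: "Increasing" means nondecreasing. $B(x,r)$ is the open ball and $\frac{1}{|B|}\int_B$ denotes the average over $B$. A $\Phi$-function is a convex, left-continuous, increasing function $\phi:[0,\infty)\to[0,\infty]$ with $\phi(0)=\lim_{t\to0^+}\phi(t)=0$ and $\lim_{t\to\infty}\phi(t)=\infty$. $\Phi(\Omega)$ is the set of $\phi:\Omega\times[0,\infty)\to[0,\infty]$ such that $\phi(\cdot,t)$ is Lebesgue measurable for every $t\ge0$ and $\phi(x,\cdot)$ is a $\Phi$-function for every $x\in\Omega$. $\phi^{-1}(x,s):=\inf\{t\ge0:\phi(x,t)\ge s\}$ is the left-continuous generalized inverse in the second variable. A function $g:D\subset\mathbb{R}\to[0,\infty]$ is almost increasing (with constant $c>0$) if $g(t_1)\le c\,g(t_2)$ for all $t_1\le t_2$ in $D$, and almost decreasing (with constant $c>0$) if $g(t_1)\ge c\,g(t_2)$ for all $t_1\le t_2$ in $D$. (aInc): there is $\phi_\uparrow>1$ such that for a.e. $x\in\Omega$ the map $s\mapsto s^{-\phi_\uparrow}\phi(x,s)$ is almost increasing with constant independent of $x$. (aDec): there is $\phi_\downarrow>1$ such that for a.e. $x\in\Omega$ the map $s\mapsto s^{-\phi_\downarrow}\phi(x,s)$ is almost decreasing with constant independent of $x$. (A): there exist $\beta,\sigma>0$ for which all of the following hold: (A0) $\phi(x,\beta\sigma)\le1\le\phi(x,\sigma)$ for all $x\in\Omega$; (A1) $\phi(x,\beta t)\le\phi(y,t)$ for every ball $B\subset\Omega$, all $x,y\in B$ and all $t\in[\sigma,\phi^{-1}(y,1/|B|)]$;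 (A2) there is $h\in L^1(\Omega)\cap L^\infty(\Omega)$ such that $\phi(x,\beta t)\le\phi(y,t)+h(x)+h(y)$ for a.e. $x,y\in\Omega$ and all $t\in[0,\sigma]$. For measurable $g$ on $\Omega$: $\varrho_{\phi(\cdot),\Omega}(g):=\int_\Omega\phi(x,|g(x)|)\,dx$; $L^{\phi(\cdot)}(\Omega)$ is the set of measurable $g$ with $\varrho_{\phi(\cdot),\Omega}(\lambda g)<\infty$ for some $\lambda>0$; $\|g\|_{\phi(\cdot),\Omega}:=\inf\{\lambda>0:\varrho_{\phi(\cdot),\Omega}(g/\lambda)\le1\}$. For vector-valued functions use the Euclidean norm $|\cdot|$ of the values. $\nabla f$ is the weak (distributional) gradient; "$\nabla f\in L^{\phi(\cdot)}$" means that it exists as a function and lies in this space. For $r>0$, $\Omega_r:=\{x\in\Omega:\operatorname{dist}(x,\partial\Omega)>r\}$ (with $\Omega_r=\mathbb{R}^n$ if $\Omega=\mathbb{R}^n$). For $f\in L^1_{\rm loc}(\Omega)$ and $x\in\Omega_r$, $$f_{B(x,r)}:=\frac{1}{|B(x,r)|}\int_{B(x,r)}f\,dy,\qquad M^\#_{B(x,r)}f:=\frac{1}{|B(x,r)|}\int_{B(x,r)}|f(y)-f_{B(x,r)}|\,dy,$$ $$\varrho^\epsilon_{\#,\Omega}(f):=\int_0^\infty\int_{\Omega_r}\phi\big(x,\tfrac1rM^\#_{B(x,r)}f\big)\,dx\,\psi_\epsilon(r)\,dr,\qquad \|f\|^\epsilon_{\#,\Omega}:=\inf\{\lambda>0:\varrho^\epsilon_{\#,\Omega}(f/\lambda)\le1\}.$$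 *)

theory Defs
  imports "HOL-Analysis.Analysis"
begin

definition Phi_function :: "(real \<Rightarrow> ennreal) \<Rightarrow> bool" where
  "Phi_function p \<longleftrightarrow>
     (\<forall>s\<ge>0. \<forall>t\<ge>0. \<forall>\<theta>\<in>{0..1}.
        p ((1 - \<theta>) * s + \<theta> * t) \<le> ennreal (1 - \<theta>) * p s + ennreal \<theta> * p t) \<and>
     (\<forall>t>0. continuous (at_left t) p) \<and>
     mono_on {0..} p \<and>
     p 0 = 0 \<and> (p \<longlongrightarrow> 0) (at_right 0) \<and> (p \<longlongrightarrow> \<infinity>) at_top"

definition generalized_Phi_function ::
    "'a::euclidean_space set \<Rightarrow> ('a \<Rightarrow> real \<Rightarrow> ennreal) \<Rightarrow> bool" where
  "generalized_Phi_function \<Omega> \<phi> \<longleftrightarrow>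
     (\<forall>t\<ge>0. (\<lambda>x. \<phi> x t) \<in> borel_measurable (lebesgue_on \<Omega>)) \<and>
     (\<forall>x\<in>\<Omega>. Phi_function (\<phi> x))"

text \<open>Extended-valued, so that the infimum of the empty set is \<open>\<infinity>\<close>.\<close>

definition phi_inverse :: "('a \<Rightarrow> real \<Rightarrow> ennreal) \<Rightarrow> 'a \<Rightarrow> ennreal \<Rightarrow> ennreal" where
  "phi_inverse \<phi> x s = (INF t\<in>{t. 0 \<le> t \<and> s \<le> \<phi> x t}. ennreal t)"

definition almost_increasing_on :: "real set \<Rightarrow> real \<Rightarrow> (real \<Rightarrow> ennreal) \<Rightarrow> bool" where
  "almost_increasing_on D c g \<longleftrightarrow>
     (\<forall>s\<in>D. \<forall>t\<in>D. s \<le> t \<longrightarrow> g s \<le> ennreal c * g t)"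

definition almost_decreasing_on :: "real set \<Rightarrow> real \<Rightarrow> (real \<Rightarrow> ennreal) \<Rightarrow> bool" where
  "almost_decreasing_on D c g \<longleftrightarrow>
     (\<forall>s\<in>D. \<forall>t\<in>D. s \<le> t \<longrightarrow> g s \<ge> ennreal c * g t)"

text \<open>The quotient \<open>s powr (- p) * \<phi> x s\<close> is considered on \<open>{0<..}\<close>, where it is defined.\<close>

definition aInc :: "'a::euclidean_space set \<Rightarrow> ('a \<Rightarrow> real \<Rightarrow> ennreal) \<Rightarrow> bool" where
  "aInc \<Omega> \<phi> \<longleftrightarrow>
     (\<exists>p>1. \<exists>c>0. AE x in lebesgue_on \<Omega>.
        almost_increasing_on {0<..} c (\<lambda>s. ennreal (s powr (- p)) * \<phi> x s))"

definition aDec :: "'a::euclidean_space set \<Rightarrow> ('a \<Rightarrow> real \<Rightarrow> ennreal) \<Rightarrow> bool" where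
  "aDec \<Omega> \<phi> \<longleftrightarrow>
     (\<exists>p>1. \<exists>c>0. AE x in lebesgue_on \<Omega>.
        almost_decreasing_on {0<..} c (\<lambda>s. ennreal (s powr (- p)) * \<phi> x s))"

definition condA0 ::
    "'a::euclidean_space set \<Rightarrow> ('a \<Rightarrow> real \<Rightarrow> ennreal) \<Rightarrow> real \<Rightarrow> real \<Rightarrow> bool" where
  "condA0 \<Omega> \<phi> \<beta> \<sigma> \<longleftrightarrow> (\<forall>x\<in>\<Omega>. \<phi> x (\<beta> * \<sigma>) \<le> 1 \<and> 1 \<le> \<phi> x \<sigma>)"

definition condA1 ::
    "'a::euclidean_space set \<Rightarrow> ('a \<Rightarrow> real \<Rightarrow> ennreal) \<Rightarrow> real \<Rightarrow> real \<Rightarrow> bool" where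
  "condA1 \<Omega> \<phi> \<beta> \<sigma> \<longleftrightarrow>
     (\<forall>z r. 0 < r \<and> ball z r \<subseteq> \<Omega> \<longrightarrow>
        (\<forall>x\<in>ball z r. \<forall>y\<in>ball z r. \<forall>t.
           \<sigma> \<le> t \<and> ennreal t \<le> phi_inverse \<phi> y (1 / emeasure lebesgue (ball z r)) \<longrightarrow>
           \<phi> x (\<beta> * t) \<le> \<phi> y t))"

text \<open>The function \<open>h\<close> may take negative values, hence the passage to \<^typ>\<open>ereal\<close>
  (in \<^typ>\<open>ennreal\<close> negative reals would be truncated to zero).\<close>

definition condA2 ::
    "'a::euclidean_space set \<Rightarrow> ('a \<Rightarrow> real \<Rightarrow> ennreal) \<Rightarrow> real \<Rightarrow> real \<Rightarrow> bool" where
  "condA2 \<Omega> \<phi> \<beta> \<sigma> \<longleftrightarrow>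
     (\<exists>h :: 'a \<Rightarrow> real.
        integrable (lebesgue_on \<Omega>) h \<and>
        (\<exists>C. AE x in lebesgue_on \<Omega>. \<bar>h x\<bar> \<le> C) \<and>
        (AE x in lebesgue_on \<Omega>. AE y in lebesgue_on \<Omega>. \<forall>t\<in>{0..\<sigma>}.
           enn2ereal (\<phi> x (\<beta> * t)) \<le> enn2ereal (\<phi> y t) + ereal (h x + h y)))"

definition condA :: "'a::euclidean_space set \<Rightarrow> ('a \<Rightarrow> real \<Rightarrow> ennreal) \<Rightarrow> bool" where
  "condA \<Omega> \<phi> \<longleftrightarrow>
     (\<exists>\<beta>>0. \<exists>\<sigma>>0. condA0 \<Omega> \<phi> \<beta> \<sigma> \<and> condA1 \<Omega> \<phi> \<beta> \<sigma> \<and> condA2 \<Omega> \<phi> \<beta> \<sigma>)"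

definition modular ::
    "('a::euclidean_space \<Rightarrow> real \<Rightarrow> ennreal) \<Rightarrow> 'a set \<Rightarrow> ('a \<Rightarrow> 'b::real_normed_vector) \<Rightarrow> ennreal"
  where "modular \<phi> \<Omega> g = (\<integral>\<^sup>+x\<in>\<Omega>. \<phi> x (norm (g x)) \<partial>lebesgue)"

definition Lphi ::
    "('a::euclidean_space \<Rightarrow> real \<Rightarrow> ennreal) \<Rightarrow> 'a set \<Rightarrow> ('a \<Rightarrow> 'b::real_normed_vector) set"
  where "Lphi \<phi> \<Omega> =
    {g \<in> borel_measurable (lebesgue_on \<Omega>). \<exists>l>0. modular \<phi> \<Omega> (\<lambda>x. l *\<^sub>R g x) < \<infinity>}"

definition phi_norm ::
    "('a::euclidean_space \<Rightarrow> real \<Rightarrow> ennreal) \<Rightarrow> 'a set \<Rightarrow> ('a \<Rightarrow> 'b::real_normed_vector) \<Rightarrow> ennreal"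
  where "phi_norm \<phi> \<Omega> g =
    (INF l\<in>{l. 0 < l \<and> modular \<phi> \<Omega> (\<lambda>x. g x /\<^sub>R l) \<le> 1}. ennreal l)"

definition locally_integrable_on ::
    "('a::euclidean_space \<Rightarrow> 'b::euclidean_space) \<Rightarrow> 'a set \<Rightarrow> bool"
    (infix \<open>locally'_integrable'_on\<close> 46)
  where "f locally_integrable_on \<Omega> \<longleftrightarrow>
    (\<forall>K. compact K \<and> K \<subseteq> \<Omega> \<longrightarrow> set_integrable lebesgue K f)"

definition partial_deriv :: "'n::finite \<Rightarrow> (real^'n \<Rightarrow> real) \<Rightarrow> real^'n \<Rightarrow> real" where
  "partial_deriv i f x = frechet_derivative f (at x) (axis i 1)"

fun Ck :: "nat \<Rightarrow> (real^'n::finite \<Rightarrow> real) \<Rightarrow> bool" where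
  "Ck 0 f \<longleftrightarrow> continuous_on UNIV f"
| "Ck (Suc k) f \<longleftrightarrow> (\<forall>x. f differentiable (at x)) \<and> (\<forall>i. Ck k (partial_deriv i f))"

definition test_function :: "(real^'n::finite) set \<Rightarrow> (real^'n \<Rightarrow> real) \<Rightarrow> bool" where
  "test_function \<Omega> \<eta> \<longleftrightarrow>
     (\<forall>k. Ck k \<eta>) \<and> compact (closure {x. \<eta> x \<noteq> 0}) \<and> closure {x. \<eta> x \<noteq> 0} \<subseteq> \<Omega>"

text \<open>A predicate rather than a function: weak gradients are unique only up to null sets.\<close>

definition weak_gradient ::
    "(real^'n::finite) set \<Rightarrow> (real^'n \<Rightarrow> real) \<Rightarrow> (real^'n \<Rightarrow> real^'n) \<Rightarrow> bool" where
  "weak_gradient \<Omega> f G \<longleftrightarrow> G locally_integrable_on \<Omega> \<and>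
     (\<forall>\<eta>. test_function \<Omega> \<eta> \<longrightarrow>
       (\<forall>i. (LINT x:\<Omega>|lebesgue. f x * partial_deriv i \<eta> x)
            = - (LINT x:\<Omega>|lebesgue. G x $ i * \<eta> x)))"

text \<open>The case distinction is needed because \<^term>\<open>infdist x {} = 0\<close>.\<close>

definition inner_part :: "'a::euclidean_space set \<Rightarrow> real \<Rightarrow> 'a set" where
  "inner_part \<Omega> r =
     (if \<Omega> = UNIV then UNIV else {x\<in>\<Omega>. r < infdist x (frontier \<Omega>)})"

definition avg :: "'a::euclidean_space set \<Rightarrow> ('a \<Rightarrow> real) \<Rightarrow> real" where
  "avg B f = (LINT y:B|lebesgue. f y) / measure lebesgue B"

definition sharp_mean :: "'a::euclidean_space set \<Rightarrow> ('a \<Rightarrow> real) \<Rightarrow> real" where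
  "sharp_mean B f = avg B (\<lambda>y. \<bar>f y - avg B f\<bar>)"

definition sharp_modular ::
    "('a::euclidean_space \<Rightarrow> real \<Rightarrow> ennreal) \<Rightarrow> 'a set \<Rightarrow> (real \<Rightarrow> real) \<Rightarrow> ('a \<Rightarrow> real) \<Rightarrow> ennreal"
  where "sharp_modular \<phi> \<Omega> w f =
    (\<integral>\<^sup>+r\<in>{0<..}. (\<integral>\<^sup>+x\<in>inner_part \<Omega> r. \<phi> x (1 / r * sharp_mean (ball x r) f) \<partial>lebesgue)
                   * ennreal (w r) \<partial>lebesgue)"

definition sharp_norm ::
    "('a::euclidean_space \<Rightarrow> real \<Rightarrow> ennreal) \<Rightarrow> 'a set \<Rightarrow> (real \<Rightarrow> real) \<Rightarrow> ('a \<Rightarrow> real) \<Rightarrow> ennreal"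
  where "sharp_norm \<phi> \<Omega> w f =
    (INF l\<in>{l. 0 < l \<and> sharp_modular \<phi> \<Omega> w (\<lambda>x. f x / l) \<le> 1}. ennreal l)"

text \<open>A finite index type has no distinguished first element, so the coordinate direction
  is a parameter; by rotation invariance the value does not depend on it.\<close>

definition c_const :: "'n::finite \<Rightarrow> real" where
  "c_const k = avg (ball 0 1) (\<lambda>x :: real^'n. \<bar>x \<bullet> axis k 1\<bar>)"

end

theory Submission
  imports Defs
begin

text \<open>If \<open>\<nabla>f\<close> lies in the Musielak--Orlicz space, the Poincare inequality on balls bounds
  \<open>r\<^sup>-\<^sup>1 M\<^sup>#f\<close> by the averages of \<open>|\<nabla>f|\<close>, and the key estimate (a Jensen inequality with error
  \<open>h\<close>, which is where (A) enters) bounds \<open>\<phi>(x, \<kappa> r\<^sup>-\<^sup>1 M\<^sup>#f)\<close> by averages of one fixed integrable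
  function.  As \<open>r \<rightarrow> 0\<close>, \<open>r\<^sup>-\<^sup>1 M\<^sup>#f(x)\<close> converges to \<open>c\<^sub>n |\<nabla>f(x)|\<close> at almost every \<open>x\<close>, because \<open>f\<close> minus
  its first order Taylor polynomial satisfies the Poincare inequality with a right-hand side
  that vanishes at Lebesgue points of \<open>\<nabla>f\<close>.  Dominated convergence gives the
  limit of the inner integrals, and averaging against \<open>\<psi>\<^sub>\<epsilon>\<close> keeps it.

  Conversely, a finite upper limit yields radii \<open>r\<^sub>j \<rightarrow> 0\<close> with bounded inner integrals.  The
  mollified gradients \<open>f * \<nabla>\<rho>\<^bsub>r\<^esub>\<close>, \<open>r = r\<^sub>j\<close>, are dominated pointwise by \<open>r\<^sup>-\<^sup>1 M\<^sup>#f\<close>, so their modulars stay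
  bounded; suitable iterated midpoints of them converge almost everywhere, and since (aInc) makes
  the family locally uniformly integrable, the limit is the weak gradient of \<open>f\<close>.  No reflexivity or duality
  theory of the space is needed.\<close>

text \<open>Jensen's inequality does not apply to \<open>\<phi> x\<close> directly: the average runs
  over \<open>y\<close>, and the modular controls \<open>\<phi> y\<close>. (A1) exchanges the two
  only up to the level 1/|B|. Beyond it convexity trades height for weight, and normalising the
  modular to 1 bounds the average weight by a constant. (aDec) has three uses: it makes
  \<open>\<phi> x\<close> finite, hence continuous, at almost every \<open>x\<close>; it bounds
  \<open>\<phi> x \<sigma>\<close>; and it absorbs the Poincare constant by doubling. The dominating
  functions change with \<open>r\<close>, but averaging over balls preserves integrals, so all of
  them have the same integral, and Fatou's lemma for the difference replaces a fixed majorant. The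
  norm limits come from the modular limits of \<open>f / l\<close> for all \<open>l\<close>. In the
  converse, bounded modulars alone give no pointwise limit. Midpoints do, and they cost nothing:
  convexity keeps the modular bound, linearity keeps the limit of the pairing with test functions.
  Since \<open>lebesgue\<close> is a completion, Fubini is applied with at most one completed
  factor.\<close>

lemma sigma_finite_lebesgue: "sigma_finite_measure (lebesgue :: 'a::euclidean_space measure)"
proof
  obtain A :: "'a set set" where "countable A" "A \<subseteq> sets lborel" "\<Union>A = space lborel"
      "\<forall>a\<in>A. emeasure lborel a \<noteq> \<infinity>"
    using lborel.sigma_finite_countable by auto
  then show "\<exists>A::'a set set. countable A \<and> A \<subseteq> sets lebesgue \<and> \<Union>A = space lebesgue
      \<and> (\<forall>a\<in>A. emeasure lebesgue a \<noteq> \<infinity>)"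
    by (intro exI[of _ A]) (auto simp: subset_iff)
qed

lemma pair_lborel_lebesgue:
  "pair_sigma_finite (lborel :: 'a::euclidean_space measure) (lebesgue :: 'b::euclidean_space measure)"
  unfolding pair_sigma_finite_def using sigma_finite_lebesgue lborel.sigma_finite_measure_axioms by blast

lemma measurable_ident_lebesgue: "(\<lambda>x. x) \<in> lebesgue \<rightarrow>\<^sub>M borel"
  by (rule measurable_completion) simp

lemma borel_measurable_lebesgueI: "g \<in> borel_measurable borel \<Longrightarrow> g \<in> borel_measurable lebesgue"
  by (rule measurable_completion) simp

section \<open>Fubini with one completed factor, and changes of variables\<close>

lemma borel_measurable_lborel_lebesgue_pair:
  fixes g :: "'a::euclidean_space \<times> 'b::euclidean_space \<Rightarrow> 'c::topological_space"
  assumes "g \<in> borel_measurable borel"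
  shows "g \<in> borel_measurable (lborel \<Otimes>\<^sub>M lebesgue)"
proof -
  have "(\<lambda>p. (fst p, snd p)) \<in> (lborel \<Otimes>\<^sub>M lebesgue) \<rightarrow>\<^sub>M ((borel :: 'a measure) \<Otimes>\<^sub>M (borel :: 'b measure))"
    using measurable_compose[OF measurable_snd measurable_ident_lebesgue]
    by (intro measurable_Pair) (auto intro: measurable_compose[OF measurable_fst])
  then have "(\<lambda>p. p) \<in> (lborel \<Otimes>\<^sub>M lebesgue) \<rightarrow>\<^sub>M (borel :: ('a \<times> 'b) measure)"
    by (simp add: borel_prod)
  from measurable_compose[OF this assms] show ?thesis .
qed

text \<open>Tonelli is applied to \<open>lborel\<close> times \<open>lebesgue\<close>: the kernel is
  Borel, so only the factor carrying \<open>F\<close> has to be completed. The outer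
  \<open>lebesgue\<close> turns into \<open>lborel\<close> by \<open>nn_integral_completion\<close>,
  with no measurability to prove.\<close>

lemma nn_integral_swap_kernel:
  fixes k :: "'a::euclidean_space \<times> 'b::euclidean_space \<Rightarrow> ennreal"
  assumes k: "k \<in> borel_measurable borel" and F: "F \<in> borel_measurable lebesgue"
  shows "(\<integral>\<^sup>+x. \<integral>\<^sup>+y. k (x, y) * F y \<partial>lebesgue \<partial>lebesgue) =
         (\<integral>\<^sup>+y. (\<integral>\<^sup>+x. k (x, y) \<partial>lebesgue) * F y \<partial>lebesgue)"
proof -
  interpret pair_sigma_finite "lborel :: 'a measure" "lebesgue :: 'b measure"
    by (rule pair_lborel_lebesgue)
  have km: "k \<in> borel_measurable (lborel \<Otimes>\<^sub>M lebesgue)"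
    by (rule borel_measurable_lborel_lebesgue_pair[OF k])
  have m: "(\<lambda>p. k p * F (snd p)) \<in> borel_measurable ((lborel :: 'a measure) \<Otimes>\<^sub>M (lebesgue :: 'b measure))"
    using measurable_compose[OF measurable_snd F] km by (intro borel_measurable_times_ennreal) auto
  have kx: "(\<lambda>x. k (x, y)) \<in> borel_measurable lborel" for y
    using measurable_compose[OF measurable_Pair2' km] by auto
  have "(\<integral>\<^sup>+x. \<integral>\<^sup>+y. k (x, y) * F y \<partial>lebesgue \<partial>lebesgue) =
      (\<integral>\<^sup>+x. \<integral>\<^sup>+y. k (x, y) * F y \<partial>lebesgue \<partial>lborel)"
    by (simp only: nn_integral_completion)
  also have "\<dots> = (\<integral>\<^sup>+y. \<integral>\<^sup>+x. k (x, y) * F y \<partial>lborel \<partial>lebesgue)"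
    using Fubini[OF m] by simp
  also have "\<dots> = (\<integral>\<^sup>+y. (\<integral>\<^sup>+x. k (x, y) \<partial>lborel) * F y \<partial>lebesgue)"
    by (intro nn_integral_cong nn_integral_multc kx)
  finally show ?thesis by (simp only: nn_integral_completion)
qed

text \<open>The bound by \<open>u x\<close> makes the inner integral of the absolute value at most
  \<open>u x\<close> times the L1 norm of \<open>F\<close>, which is integrable in \<open>x\<close>;
  this gives integrability on the product and hence Fubini.\<close>

lemma integral_swap_kernel:
  fixes k :: "'a::euclidean_space \<times> 'b::euclidean_space \<Rightarrow> real" and F :: "'b \<Rightarrow> real"
  assumes k: "k \<in> borel_measurable borel" and F: "integrable lebesgue F"
    and u: "integrable lborel u" and ku: "\<And>x y. \<bar>k (x, y)\<bar> \<le> u x"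
  shows "(LINT x|lborel. LINT y|lebesgue. k (x, y) * F y) =
         (LINT y|lebesgue. (LINT x|lborel. k (x, y)) * F y)"
proof -
  interpret pair_sigma_finite "lborel :: 'a measure" "lebesgue :: 'b measure"
    by (rule pair_lborel_lebesgue)
  have Fm: "F \<in> borel_measurable lebesgue" using F by auto
  have km: "k \<in> borel_measurable (lborel \<Otimes>\<^sub>M lebesgue)"
    by (rule borel_measurable_lborel_lebesgue_pair[OF k])
  have m: "(\<lambda>p. k p * F (snd p)) \<in> borel_measurable ((lborel :: 'a measure) \<Otimes>\<^sub>M (lebesgue :: 'b measure))"
    using measurable_compose[OF measurable_snd Fm] km by (intro borel_measurable_times) auto
  have m': "(\<lambda>p. norm (k p * F (snd p))) \<in> borel_measurable ((lborel :: 'a measure) \<Otimes>\<^sub>M (lebesgue :: 'b measure))"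
    using m by measurable
  have int: "integrable lebesgue (\<lambda>y. k (x, y) * F y)" for x
  proof (rule Bochner_Integration.integrable_bound[OF integrable_mult_right[OF integrable_norm[OF F], of "u x"]])
    show "(\<lambda>y. k (x, y) * F y) \<in> borel_measurable lebesgue"
      using measurable_compose[OF measurable_Pair1' m, of x] by auto
    show "AE y in lebesgue. norm (k (x, y) * F y) \<le> norm (u x * norm (F y))"
      using ku[of x] by (auto simp: abs_mult intro!: mult_right_mono order_trans[OF ku])
  qed
  have "integrable (lborel \<Otimes>\<^sub>M lebesgue) (\<lambda>p. k p * F (snd p))"
  proof (rule Fubini_integrable[OF m])
    show "integrable lborel (\<lambda>x. LINT y|lebesgue. norm (k (x, y) * F (snd (x, y))))"
    proof (rule Bochner_Integration.integrable_bound[OF integrable_mult_left[OF u, of "LINT y|lebesgue. norm (F y)"]])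
      show "(\<lambda>x. LINT y|lebesgue. norm (k (x, y) * F (snd (x, y)))) \<in> borel_measurable lborel"
        by (rule M2.borel_measurable_lebesgue_integral) (use m' in \<open>simp add: case_prod_beta'\<close>)
      show "AE x in lborel. norm (LINT y|lebesgue. norm (k (x, y) * F (snd (x, y))))
          \<le> norm (u x * (LINT y|lebesgue. norm (F y)))"
      proof (intro AE_I2)
        fix x
        have "(LINT y|lebesgue. norm (k (x, y) * F y)) \<le> (LINT y|lebesgue. u x * norm (F y))"
          using ku[of x] by (intro integral_mono integrable_mult_right integrable_norm F int)
            (auto simp: abs_mult intro!: mult_right_mono)
        then show "norm (LINT y|lebesgue. norm (k (x, y) * F (snd (x, y))))
          \<le> norm (u x * (LINT y|lebesgue. norm (F y)))"
          by (simp add: abs_of_nonneg[OF integral_nonneg_AE])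
      qed
    qed
    show "AE x in lborel. integrable lebesgue (\<lambda>y. k (x, y) * F (snd (x, y)))"
      using int by simp
  qed
  then have "(LINT y|lebesgue. LINT x|lborel. k (x, y) * F y) = (LINT x|lborel. LINT y|lebesgue. k (x, y) * F y)"
    by (intro Fubini_integral) (simp add: case_prod_beta')
  then show ?thesis by simp
qed

lemma nn_integral_lborel_affine:
  fixes F :: "'a::euclidean_space \<Rightarrow> ennreal"
  assumes F: "F \<in> borel_measurable borel" and c: "c \<noteq> 0"
  shows "(\<integral>\<^sup>+x. F x \<partial>lborel) = ennreal (\<bar>c\<bar> ^ DIM('a)) * (\<integral>\<^sup>+x. F (t + c *\<^sub>R x) \<partial>lborel)"
  using F by (subst lborel_affine[OF c, of t])
    (simp add: nn_integral_density nn_integral_distr nn_integral_cmult)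

lemma integral_lborel_affine:
  fixes F :: "'a::euclidean_space \<Rightarrow> real"
  assumes F: "F \<in> borel_measurable borel" and c: "c \<noteq> 0"
  shows "(LINT x|lborel. F x) = \<bar>c\<bar> ^ DIM('a) * (LINT x|lborel. F (t + c *\<^sub>R x))"
  using F by (subst lborel_affine[OF c, of t])
    (simp add: integral_density integral_distr)

lemma nn_integral_lborel_translate:
  fixes F :: "'a::euclidean_space \<Rightarrow> ennreal"
  assumes "F \<in> borel_measurable borel"
  shows "(\<integral>\<^sup>+x. F (t + x) \<partial>lborel) = (\<integral>\<^sup>+x. F x \<partial>lborel)"
  using nn_integral_lborel_affine[OF assms, of 1 t] by simp

lemma nn_integral_lborel_reflect:
  fixes F :: "'a::euclidean_space \<Rightarrow> ennreal"
  assumes "F \<in> borel_measurable borel"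
  shows "(\<integral>\<^sup>+x. F (t - x) \<partial>lborel) = (\<integral>\<^sup>+x. F x \<partial>lborel)"
  using nn_integral_lborel_affine[OF assms, of "-1" t] by simp

text \<open>Uniqueness of Haar measure: integrate \<open>f(x) g(x+y)\<close> against both measures and use the
  invariance of each.  Change of variables in the library is restricted to well-ordered index
  types.\<close>

lemma nn_integral_orthogonal_transformation:
  fixes F :: "'a::euclidean_space \<Rightarrow> ennreal" and T :: "'a \<Rightarrow> 'a"
  assumes F: "F \<in> borel_measurable borel" and T: "orthogonal_transformation T"
  shows "(\<integral>\<^sup>+x. F (T x) \<partial>lborel) = (\<integral>\<^sup>+x. F x \<partial>lborel)"
proof -
  define \<mu> where "\<mu> = distr lborel borel T"
  have lin: "linear T" using T by (rule orthogonal_transformation_linear)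
  have Tm[measurable]: "T \<in> borel_measurable borel"
    using lin by (intro borel_measurable_continuous_onI linear_continuous_on) (simp add: linear_conv_bounded_linear)
  have [measurable]: "F \<in> borel_measurable borel" by fact
  have \<mu>: "(\<integral>\<^sup>+x. H x \<partial>\<mu>) = (\<integral>\<^sup>+x. H (T x) \<partial>lborel)" if "H \<in> borel_measurable borel" for H :: "'a \<Rightarrow> ennreal"
    using that unfolding \<mu>_def by (simp add: nn_integral_distr)
  obtain S where S: "orthogonal_transformation S" "\<And>x. T (S x) = x"
    using T by (metis orthogonal_transformation_inv orthogonal_transformation_bij bij_inv_eq_iff)
  have trans: "(\<integral>\<^sup>+x. H (t + x) \<partial>\<mu>) = (\<integral>\<^sup>+x. H x \<partial>\<mu>)" if [measurable]: "H \<in> borel_measurable borel" for H :: "'a \<Rightarrow> ennreal" and t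
  proof -
    have "(\<integral>\<^sup>+x. H (t + x) \<partial>\<mu>) = (\<integral>\<^sup>+x. H (t + T x) \<partial>lborel)" by (subst \<mu>) auto
    also have "\<dots> = (\<integral>\<^sup>+x. H (T (S t + x)) \<partial>lborel)"
      by (simp add: S linear_add[OF lin])
    also have "\<dots> = (\<integral>\<^sup>+x. H (T x) \<partial>lborel)"
      by (rule nn_integral_lborel_translate[of "\<lambda>x. H (T x)" "S t"]) measurable
    finally show ?thesis by (simp add: \<mu>)
  qed
  have sf: "sigma_finite_measure \<mu>"
  proof
    show "\<exists>A. countable A \<and> A \<subseteq> sets \<mu> \<and> \<Union>A = space \<mu> \<and> (\<forall>a\<in>A. emeasure \<mu> a \<noteq> \<infinity>)"
    proof (intro exI conjI ballI)
      show "countable (range (\<lambda>n. ball (0::'a) (real n)))" by simp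
      show "\<Union> (range (\<lambda>n. ball (0::'a) (real n))) = space \<mu>"
        by (auto simp: \<mu>_def reals_Archimedean2)
      fix a assume "a \<in> range (\<lambda>n. ball (0::'a) (real n))"
      then obtain n where n: "a = ball 0 (real n)" by auto
      have "T -` ball 0 (real n) = ball 0 (real n)"
        using T by (auto simp: orthogonal_transformation_norm)
      then show "emeasure \<mu> a \<noteq> \<infinity>"
        using emeasure_lborel_ball_finite[of 0 "real n"] by (simp add: \<mu>_def n emeasure_distr less_top)
    qed (auto simp: \<mu>_def)
  qed
  interpret pair_sigma_finite \<mu> lborel
    unfolding pair_sigma_finite_def using sf lborel.sigma_finite_measure_axioms by blast
  \<comment> \<open>The unit ball is invariant under \<open>T\<close>, so \<open>g\<close> has the
    same integral against both measures, and this common value is positive and finite and can be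
    cancelled at the end.\<close>
  define g where "g = (indicator (ball (0::'a) 1) :: 'a \<Rightarrow> ennreal)"
  have [measurable]: "g \<in> borel_measurable borel"
    by (auto simp: g_def intro!: borel_measurable_indicator borel_open)
  have [measurable_cong]: "sets \<mu> = sets borel" by (simp add: \<mu>_def)
  have g1: "(\<integral>\<^sup>+x. g x \<partial>\<mu>) = emeasure lborel (ball (0::'a) 1)"
  proof -
    have "(\<integral>\<^sup>+x. g x \<partial>\<mu>) = (\<integral>\<^sup>+x. g (T x) \<partial>lborel)" by (subst \<mu>) auto
    also have "\<dots> = (\<integral>\<^sup>+x. g x \<partial>lborel)"
      using T by (auto simp: g_def indicator_def orthogonal_transformation_norm intro!: nn_integral_cong)
    finally show ?thesis by (simp add: g_def)
  qed
  have g2: "(\<integral>\<^sup>+y. g y \<partial>lborel) = emeasure lborel (ball (0::'a) 1)" by (simp add: g_def)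
  have "(\<integral>\<^sup>+x. F x \<partial>\<mu>) * (\<integral>\<^sup>+y. g y \<partial>lborel) = (\<integral>\<^sup>+x. F x * (\<integral>\<^sup>+y. g (x + y) \<partial>lborel) \<partial>\<mu>)"
    by (simp add: nn_integral_lborel_translate nn_integral_multc)
  also have "\<dots> = (\<integral>\<^sup>+x. (\<integral>\<^sup>+y. F x * g (x + y) \<partial>lborel) \<partial>\<mu>)"
    by (simp add: nn_integral_cmult)
  also have "\<dots> = (\<integral>\<^sup>+y. (\<integral>\<^sup>+x. F x * g (x + y) \<partial>\<mu>) \<partial>lborel)"
    by (rule Fubini'[symmetric]) measurable
  also have "\<dots> = (\<integral>\<^sup>+y. (\<integral>\<^sup>+x. F (x - y) * g x \<partial>\<mu>) \<partial>lborel)"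
  proof (rule nn_integral_cong)
    fix y
    have "(\<lambda>x. F (x - y) * g x) \<in> borel_measurable borel" by measurable
    from trans[OF this, of y]
    show "(\<integral>\<^sup>+x. F x * g (x + y) \<partial>\<mu>) = (\<integral>\<^sup>+x. F (x - y) * g x \<partial>\<mu>)"
      by (simp add: algebra_simps)
  qed
  also have "\<dots> = (\<integral>\<^sup>+x. (\<integral>\<^sup>+y. F (x - y) * g x \<partial>lborel) \<partial>\<mu>)"
    by (rule Fubini') measurable
  also have "\<dots> = (\<integral>\<^sup>+x. (\<integral>\<^sup>+y. F y \<partial>lborel) * g x \<partial>\<mu>)"
    by (simp add: nn_integral_multc nn_integral_lborel_reflect)
  also have "\<dots> = (\<integral>\<^sup>+y. F y \<partial>lborel) * (\<integral>\<^sup>+x. g x \<partial>\<mu>)"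
    by (simp add: nn_integral_cmult)
  finally have eq: "(\<integral>\<^sup>+x. F x \<partial>\<mu>) * emeasure lborel (ball (0::'a) 1) = (\<integral>\<^sup>+y. F y \<partial>lborel) * emeasure lborel (ball (0::'a) 1)"
    by (simp only: g1 g2)
  have "emeasure lborel (ball (0::'a) 1) \<noteq> 0"
    using content_ball_pos[of 1 "0::'a"] by (auto simp: measure_def)
  moreover have "emeasure lborel (ball (0::'a) 1) \<noteq> top"
    using emeasure_lborel_ball_finite[of "0::'a" 1] by auto
  ultimately have "(\<integral>\<^sup>+x. F x \<partial>\<mu>) = (\<integral>\<^sup>+y. F y \<partial>lborel)"
    using eq by (simp add: ennreal_mult_cancel_left mult.commute[of _ "emeasure lborel (ball (0::'a) 1)"])
  then show ?thesis by (simp add: \<mu>)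
qed

text \<open>Dominated convergence along sequences tending to \<open>a\<close>. The majorant is only
  required near \<open>a\<close>, so that a function truncated to a slightly larger ball can
  serve.\<close>

lemma isCont_integral:
  fixes u :: "'a::metric_space \<Rightarrow> 'b \<Rightarrow> 'c::{banach, second_countable_topology}"
  assumes d: "0 < d" and m: "\<And>x. dist x a < d \<Longrightarrow> u x \<in> borel_measurable M"
    and c: "AE w in M. isCont (\<lambda>x. u x w) a"
    and b: "\<And>x. dist x a < d \<Longrightarrow> AE w in M. norm (u x w) \<le> B w" and B: "integrable M B"
  shows "isCont (\<lambda>x. integral\<^sup>L M (u x)) a"
proof (rule continuous_at_sequentiallyI)
  fix s :: "nat \<Rightarrow> 'a" assume s: "s \<longlonglongrightarrow> a"
  then obtain N where N: "\<And>n. n \<ge> N \<Longrightarrow> dist (s n) a < d"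
    using d by (meson metric_LIMSEQ_D)
  have "(\<lambda>n. integral\<^sup>L M (u (s (n + N)))) \<longlonglongrightarrow> integral\<^sup>L M (u a)"
  proof (rule integral_dominated_convergence[OF _ _ B])
    show "AE x in M. (\<lambda>i. u (s (i + N)) x) \<longlonglongrightarrow> u a x"
      using c
    proof eventually_elim
      case (elim w)
      show ?case using isCont_tendsto_compose[OF elim s] by (rule LIMSEQ_ignore_initial_segment)
    qed
  qed (use N d in \<open>auto intro!: m b\<close>)
  then show "(\<lambda>n. integral\<^sup>L M (u (s n))) \<longlonglongrightarrow> integral\<^sup>L M (u a)"
    by (rule LIMSEQ_offset)
qed

section \<open>Lebesgue points\<close>

lemma emeasure_lebesgue_ball: "emeasure lebesgue (ball x r) = ennreal (measure lebesgue (ball (x::'a::euclidean_space) r))"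
  using emeasure_lborel_ball_finite[of x r] by (simp add: emeasure_eq_ennreal_measure less_top)

text \<open>Absolute continuity of the integral by truncation: the excess of \<open>g\<close> over a
  high level \<open>n\<close> has small integral, and the truncated part contributes at most
  \<open>n\<close> times the measure of \<open>A\<close>.\<close>

lemma set_integral_small_measure:
  fixes g :: "'a \<Rightarrow> real"
  assumes g: "integrable M g" and g0: "\<And>x. 0 \<le> g x" and e: "0 < e"
  obtains \<delta> where "0 < \<delta>"
    "\<And>A. A \<in> sets M \<Longrightarrow> emeasure M A \<le> ennreal \<delta> \<Longrightarrow> (\<integral>\<^sup>+x\<in>A. ennreal (g x) \<partial>M) \<le> ennreal e"
proof -
  have [measurable]: "g \<in> borel_measurable M" using g by auto
  have lim: "(\<lambda>n. LINT x|M. g x - min (g x) (real n)) \<longlonglongrightarrow> (LINT x|M. 0)"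
  proof (rule integral_dominated_convergence[OF _ _ g])
    show "AE x in M. (\<lambda>n. g x - min (g x) (real n)) \<longlonglongrightarrow> 0"
    proof (intro AE_I2)
      fix x
      obtain N where N: "g x \<le> real N" using real_arch_simple by blast
      show "(\<lambda>n. g x - min (g x) (real n)) \<longlonglongrightarrow> 0"
        by (rule tendsto_eventually, rule eventually_sequentiallyI[of N]) (use N in \<open>simp add: min_def\<close>)
    qed
    show "AE x in M. norm (g x - min (g x) (real n)) \<le> g x" for n
      using g0 by (auto simp: min_def)
  qed measurable
  obtain n where "(LINT x|M. g x - min (g x) (real n)) < e / 2"
    using order_tendstoD(2)[OF lim, of "e / 2"] e by (auto simp: eventually_sequentially)
  moreover have gi: "integrable M (\<lambda>x. g x - min (g x) (real n))"
    using g g0 by (intro Bochner_Integration.integrable_bound[OF g]) (auto simp: min_def)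
  ultimately have n: "(\<integral>\<^sup>+x. ennreal (g x - min (g x) (real n)) \<partial>M) \<le> ennreal (e / 2)"
    by (subst nn_integral_eq_integral) (auto simp: intro!: ennreal_leI)
  show thesis
  \<comment> \<open>With this \<delta> the truncated part contributes less than e/2; the added 1
    covers \<open>n = 0\<close>.\<close>
  proof (rule that[of "e / (2 * (real n + 1))"])
    show "0 < e / (2 * (real n + 1))" using e by simp
    fix A assume A: "A \<in> sets M" "emeasure M A \<le> ennreal (e / (2 * (real n + 1)))"
    have "(\<integral>\<^sup>+x\<in>A. ennreal (g x) \<partial>M) \<le>
        (\<integral>\<^sup>+x. ennreal (g x - min (g x) (real n)) + ennreal (real n) * indicator A x \<partial>M)"
      by (intro nn_integral_mono)
        (auto simp: indicator_def min_def ennreal_plus[symmetric] simp del: ennreal_plus intro!: ennreal_leI)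
    also have "\<dots> = (\<integral>\<^sup>+x. ennreal (g x - min (g x) (real n)) \<partial>M) + ennreal (real n) * emeasure M A"
      using A g by (subst nn_integral_add) (auto simp: nn_integral_cmult_indicator)
    also have "\<dots> \<le> ennreal (e / 2) + ennreal (real n) * ennreal (e / (2 * (real n + 1)))"
      by (intro add_mono n mult_left_mono A) auto
    also have "\<dots> = ennreal (e / 2 + real n * (e / (2 * (real n + 1))))"
      using e by (simp add: ennreal_mult[symmetric])
    also have "\<dots> \<le> ennreal e"
      using e by (intro ennreal_leI) (simp add: field_simps)
    finally show "(\<integral>\<^sup>+x\<in>A. ennreal (g x) \<partial>M) \<le> ennreal e" .
  qed
qed

lemma AE_not_sphere: "AE w in lebesgue. dist (c::'a::euclidean_space) w \<noteq> r"
proof -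
  have "sphere c r \<in> null_sets lebesgue"
    using negligible_sphere by (simp add: negligible_iff_null_sets)
  from AE_not_in[OF this] show ?thesis by (auto elim!: eventually_mono)
qed

text \<open>Off the sphere the indicator is locally constant in the centre. Spheres are null sets,
  so this is continuity for almost every \<open>w\<close>, which is all that dominated convergence
  needs.\<close>

lemma isCont_indicator_ball:
  assumes "dist (a::'a::metric_space) w \<noteq> r"
  shows "isCont (\<lambda>x. indicator (ball x r) w :: real) a"
proof -
  have "\<forall>\<^sub>F x in nhds a. indicator (ball x r) w = (indicator (ball a r) w :: real)"
  proof (cases "dist a w < r")
    case True
    have "open {x. dist x w < r}" by (intro open_Collect_less continuous_intros)
    then show ?thesis using True by (auto simp: eventually_nhds intro!: exI[of _ "{x. dist x w < r}"])
  next
    case False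
    have "open {x. dist x w > r}" by (intro open_Collect_less continuous_intros)
    then show ?thesis using False assms by (auto simp: eventually_nhds intro!: exI[of _ "{x. dist x w > r}"])
  qed
  then show ?thesis
    unfolding isCont_def by (intro tendsto_eventually) (auto simp: eventually_at_filter elim!: eventually_mono)
qed

lemma isCont_set_integral_ball:
  fixes g :: "'a::euclidean_space \<Rightarrow> 'b::euclidean_space"
  assumes g: "integrable lebesgue g"
  shows "isCont (\<lambda>x. LINT y:ball x r|lebesgue. g y) a"
  unfolding set_lebesgue_integral_def
proof (rule isCont_integral[of 1])
  show "AE w in lebesgue. isCont (\<lambda>x. indicator (ball x r) w *\<^sub>R g w) a"
    using AE_not_sphere[of a r] by eventually_elim (intro continuous_intros isCont_indicator_ball)
  show "integrable lebesgue (\<lambda>y. norm (g y))" using g by simp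
  show "(\<lambda>w. indicator (ball x r) w *\<^sub>R g w) \<in> borel_measurable lebesgue" for x
    using g by (intro borel_measurable_scaleR borel_measurable_indicator) auto
qed (auto simp: indicator_def)

text \<open>The covering half of Lebesgue's differentiation theorem. Let E be a bounded piece of the
  set. Take an open T containing E with integral of \<open>g\<close> over T - E at most
  \<open>e\<close>, and cover almost all of E by disjoint balls inside T on which the average of
  \<open>g\<close> exceeds \<open>a\<close>. Summing gives a|E| \<le> b|E| + e, and \<open>e\<close>
  is arbitrary.\<close>

lemma null_sets_high_average:
  fixes g :: "'a::euclidean_space \<Rightarrow> real"
  assumes g: "integrable lebesgue g" and g0: "\<And>x. 0 \<le> g x" and ba: "0 \<le> b" "b < a"
  shows "{x. g x < b \<and> (\<forall>d>0. \<exists>r. 0 < r \<and> r < d \<and>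
      a * measure lebesgue (ball x r) < (LINT y:ball x r|lebesgue. g y))} \<in> null_sets lebesgue"
    (is "{x. g x < b \<and> ?Q x} \<in> _")
proof -
  \<comment> \<open>The averages are continuous in the centre, so each \<open>U m\<close> is open
    and the set of points with high averages at arbitrarily small radii is a countable intersection
    of open sets. Measurability of the exceptional set rests on this.\<close>
  define U where "U m = (\<Union>r\<in>{0<..<1 / (real m + 1)}. {x. a * measure lebesgue (ball x r) < (LINT y:ball x r|lebesgue. g y)})" for m :: nat
  define V where "V r = measure lebesgue (ball (0::'a) r)" for r
  have mb: "measure lebesgue (ball x r) = V r" for x :: 'a and r
    by (cases "r \<ge> 0") (auto simp: V_def content_ball ball_empty)
  have op: "open (U m)" for m
    unfolding U_def mb
    by (intro open_UN ballI open_Collect_less continuous_at_imp_continuous_on isCont_set_integral_ball g) auto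
  have QU: "?Q x \<longleftrightarrow> (\<forall>m. x \<in> U m)" for x
  proof
    assume Q: "?Q x"
    show "\<forall>m. x \<in> U m"
    proof
      fix m :: nat
      from Q[rule_format, of "1 / (real m + 1)"] show "x \<in> U m" by (auto simp: U_def)
    qed
  next
    assume U: "\<forall>m. x \<in> U m"
    show "?Q x"
    proof (intro allI impI)
      fix d :: real assume "0 < d"
      then obtain m where "1 / (real m + 1) < d" using nat_approx_posE[of d] by (metis Suc_eq_plus1 of_nat_Suc add.commute)
      with U[rule_format, of m] show "\<exists>r. 0 < r \<and> r < d \<and>
          a * measure lebesgue (ball x r) < (LINT y:ball x r|lebesgue. g y)"
        unfolding U_def by (auto intro: less_trans)
    qed
  qed
  have gm[measurable]: "g \<in> borel_measurable lebesgue" using g by auto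
  \<comment> \<open>The intersection with a ball makes the measure finite, so that it can be
    subtracted in the final inequality.\<close>
  define E where "E N = {x. g x < b \<and> (\<forall>m. x \<in> U m)} \<inter> ball 0 (real N)" for N :: nat
  have Em: "E N \<in> lmeasurable" for N
  proof -
    have "{x. g x < b} \<in> sets lebesgue"
      using measurable_sets[OF gm, of "{..<b}"] by (simp add: vimage_def)
    moreover have "U m \<in> sets lebesgue" for m using op[of m] by (rule borel_open[THEN sets_completionI_sets[of _ lborel, simplified]])
    ultimately have "{x. g x < b} \<inter> (\<Inter>m. U m) \<inter> ball 0 (real N) \<in> sets lebesgue"
      by (intro sets.Int sets.countable_INT) auto
    then have "E N \<in> sets lebesgue" by (simp add: E_def Collect_conj_eq Collect_all_eq)
    then show ?thesis
      by (rule bounded_set_imp_lmeasurable[rotated]) (auto simp: E_def intro: bounded_subset[OF bounded_ball])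
  qed
  have "measure lebesgue (E N) = 0" for N
  proof -
    have "(a - b) * measure lebesgue (E N) \<le> e" if e: "e > 0" for e
    proof -
      obtain \<delta> where \<delta>: "0 < \<delta>" "\<And>A. A \<in> sets lebesgue \<Longrightarrow> emeasure lebesgue A \<le> ennreal \<delta>
          \<Longrightarrow> (\<integral>\<^sup>+x\<in>A. ennreal (g x) \<partial>lebesgue) \<le> ennreal e"
        using set_integral_small_measure[OF g g0 e] by blast
      obtain T where T: "open T" "E N \<subseteq> T" "emeasure lebesgue (T - E N) < ennreal \<delta>"
        using sets_lebesgue_outer_open[OF fmeasurableD[OF Em] \<delta>(1), of N] by blast
      then have TS: "T \<in> sets lebesgue" by simp
      define K where "K = {p. fst p \<in> E N \<and> 0 < snd p \<and> ball (fst p) (snd p) \<subseteq> T \<and>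
         a * measure lebesgue (ball (fst p) (snd p)) < (LINT y:ball (fst p) (snd p)|lebesgue. g y)}"
      have cov: "\<exists>i. i \<in> K \<and> x \<in> ball (fst i) (snd i) \<and> snd i < d" if "x \<in> E N" "0 < d" for x d
      proof -
        have xT: "x \<in> T" using \<open>E N \<subseteq> T\<close> that(1) by (rule subsetD)
        obtain s where s: "0 < s" "ball x s \<subseteq> T" using openE[OF \<open>open T\<close> xT] by metis
        have "?Q x" using that QU by (auto simp: E_def)
        moreover have "0 < min d s" using s that(2) by simp
        ultimately obtain r where r: "0 < r" "r < min d s"
          "a * measure lebesgue (ball x r) < (LINT y:ball x r|lebesgue. g y)" by metis
        have "ball x r \<subseteq> T" using r(2) s(2) subset_ball[of r s x] by auto
        then show ?thesis using r that by (intro exI[of _ "(x, r)"]) (auto simp: K_def)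
      qed
      obtain C where C: "countable C" "C \<subseteq> K"
        "pairwise (\<lambda>i j. disjnt (ball (fst i) (snd i)) (ball (fst j) (snd j))) C"
        "negligible (E N - (\<Union>i\<in>C. ball (fst i) (snd i)))"
        using Vitali_covering_theorem_balls[of "E N" K fst snd, OF cov] by blast
      let ?B = "\<lambda>i. ball (fst i) (snd i) :: 'a set"
      have dis: "disjoint_family_on ?B C"
        using C(3) by (auto simp: disjoint_family_on_def pairwise_def disjnt_def)
      \<comment> \<open>As a measure, \<nu> turns the sum of the integrals over disjoint balls into
        countable additivity.\<close>
      define \<nu> where "\<nu> = density lebesgue (\<lambda>x. ennreal (g x))"
      have [measurable]: "(\<lambda>x. ennreal (g x)) \<in> borel_measurable lebesgue" by measurable
      have "emeasure lebesgue (E N) \<le> emeasure lebesgue (\<Union>i\<in>C. ?B i)"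
      proof -
        have "open (\<Union>i\<in>C. ?B i)" by auto
        then have "(\<Union>i\<in>C. ?B i) \<in> sets borel" by (rule borel_open)
        then have CS: "(\<Union>i\<in>C. ?B i) \<in> sets lebesgue" by (intro sets_completionI_sets) simp
        then have "emeasure lebesgue (E N) \<le> emeasure lebesgue ((\<Union>i\<in>C. ?B i) \<union> (E N - (\<Union>i\<in>C. ?B i)))"
          using Em[of N] by (intro emeasure_mono) auto
        also have "\<dots> = emeasure lebesgue (\<Union>i\<in>C. ?B i)"
          using C(4) by (intro emeasure_Un_null_set CS) (simp add: negligible_iff_null_sets)
        finally show ?thesis .
      qed
      also have "\<dots> = (\<integral>\<^sup>+i. emeasure lebesgue (?B i) \<partial>count_space C)"
        by (rule emeasure_UN_countable[OF _ C(1) dis]) auto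
      finally have "ennreal a * emeasure lebesgue (E N) \<le> ennreal a * (\<integral>\<^sup>+i. emeasure lebesgue (?B i) \<partial>count_space C)"
        by (rule mult_left_mono) auto
      also have "\<dots> = (\<integral>\<^sup>+i. ennreal a * emeasure lebesgue (?B i) \<partial>count_space C)"
        by (rule nn_integral_cmult[symmetric]) auto
      also have "\<dots> \<le> (\<integral>\<^sup>+i. emeasure \<nu> (?B i) \<partial>count_space C)"
      proof (intro nn_integral_mono)
        fix i assume "i \<in> space (count_space C)"
        then have i: "a * measure lebesgue (?B i) \<le> (LINT y:?B i|lebesgue. g y)" using C by (auto simp: K_def)
        have "ennreal a * emeasure lebesgue (?B i) = ennreal (a * measure lebesgue (?B i))"
          unfolding emeasure_lebesgue_ball using ba by (simp add: ennreal_mult)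
        also have "\<dots> \<le> ennreal (LINT y:?B i|lebesgue. g y)" using i by (rule ennreal_leI)
        also have "\<dots> = (\<integral>\<^sup>+y. ennreal (indicator (?B i) y *\<^sub>R g y) \<partial>lebesgue)"
          unfolding set_lebesgue_integral_def using g g0
          by (intro nn_integral_eq_integral[symmetric] integrable_mult_indicator) auto
        also have "\<dots> = emeasure \<nu> (?B i)"
          unfolding \<nu>_def by (subst emeasure_density) (auto intro!: nn_integral_cong simp: indicator_def)
        finally show "ennreal a * emeasure lebesgue (?B i) \<le> emeasure \<nu> (?B i)" .
      qed
      also have "\<dots> = emeasure \<nu> (\<Union>i\<in>C. ?B i)"
        by (rule emeasure_UN_countable[OF _ C(1) dis, symmetric]) (auto simp: \<nu>_def)
      also have "\<dots> \<le> emeasure \<nu> (E N \<union> (T - E N))"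
        using C(2) T TS Em[of N] by (intro emeasure_mono) (auto simp: K_def \<nu>_def)
      also have "\<dots> \<le> emeasure \<nu> (E N) + emeasure \<nu> (T - E N)"
        using TS Em[of N] by (intro emeasure_subadditive) (auto simp: \<nu>_def)
      also have "\<dots> \<le> ennreal b * emeasure lebesgue (E N) + ennreal e"
      proof (rule add_mono)
        have "emeasure \<nu> (E N) = (\<integral>\<^sup>+x\<in>E N. ennreal (g x) \<partial>lebesgue)"
          unfolding \<nu>_def using Em[of N] by (subst emeasure_density) auto
        also have "\<dots> \<le> (\<integral>\<^sup>+x. ennreal b * indicator (E N) x \<partial>lebesgue)"
          by (intro nn_integral_mono) (auto simp: indicator_def E_def intro!: ennreal_leI)
        also have "\<dots> = ennreal b * emeasure lebesgue (E N)"
          using Em[of N] by (simp add: nn_integral_cmult_indicator)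
        finally show "emeasure \<nu> (E N) \<le> ennreal b * emeasure lebesgue (E N)" .
        have "emeasure \<nu> (T - E N) = (\<integral>\<^sup>+x\<in>T - E N. ennreal (g x) \<partial>lebesgue)"
          unfolding \<nu>_def using TS Em[of N] by (subst emeasure_density) auto
        then show "emeasure \<nu> (T - E N) \<le> ennreal e"
          using \<delta>(2)[of "T - E N"] T TS Em[of N] by auto
      qed
      finally have "ennreal a * emeasure lebesgue (E N) \<le> ennreal b * emeasure lebesgue (E N) + ennreal e" .
      then have "ennreal (a * measure lebesgue (E N)) \<le> ennreal (b * measure lebesgue (E N) + e)"
        using ba e Em[of N] by (simp add: emeasure_eq_measure2 ennreal_mult)
      then have "a * measure lebesgue (E N) \<le> b * measure lebesgue (E N) + e"
        using ba e by (subst (asm) ennreal_le_iff) auto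
      then show ?thesis by (simp add: algebra_simps)
    qed
    then have "(a - b) * measure lebesgue (E N) \<le> 0" by (meson field_le_epsilon le_add_same_cancel2 add_0 order_refl dense_ge)
    then show ?thesis using ba by (simp add: mult_le_0_iff) (metis measure_nonneg antisym)
  qed
  then have "E N \<in> null_sets lebesgue" for N
    using Em[of N] by (auto simp: emeasure_eq_measure2 intro!: null_setsI)
  then have "(\<Union>N. E N) \<in> null_sets lebesgue" by (rule null_sets_UN)
  moreover have "(\<Union>N. E N) = {x. g x < b \<and> ?Q x}"
    unfolding QU E_def by (auto simp: reals_Archimedean2)
  ultimately show ?thesis by simp
qed

text \<open>It suffices to compare \<open>f\<close> with countably many constants \<open>q\<close> on countably many balls
  inside \<open>\<Omega>\<close>.\<close>

lemma AE_lebesgue_point: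
  fixes f :: "'a::euclidean_space \<Rightarrow> 'b::euclidean_space"
  assumes \<Omega>: "open \<Omega>" and f: "f locally_integrable_on \<Omega>"
  shows "AE x in lebesgue. x \<in> \<Omega> \<longrightarrow>
    ((\<lambda>r. avg (ball x r) (\<lambda>y. norm (f y - f x))) \<longlongrightarrow> 0) (at_right 0)"
proof -
  obtain D :: "'a set" where D: "countable D" "\<And>X. open X \<Longrightarrow> X \<noteq> {} \<Longrightarrow> \<exists>d\<in>D. d \<in> X"
    using countable_dense_exists by blast
  obtain Q :: "'b set" where Q: "countable Q" "\<And>X. open X \<Longrightarrow> X \<noteq> {} \<Longrightarrow> \<exists>q\<in>Q. q \<in> X"
    using countable_dense_exists by blast
  \<comment> \<open>Truncation to \<open>cball c s\<close> makes the function integrable on the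
    whole space, as the covering lemma requires; near an interior point of that ball it changes
    nothing.\<close>
  define g where "g c s q y = indicator (cball c s) y * norm (f y - q)" for c :: 'a and s :: real and q y
  have gi: "integrable lebesgue (g c s q)" if "cball c s \<subseteq> \<Omega>" for c s q
  proof -
    have "integrable lebesgue (\<lambda>y. indicator (cball c s) y *\<^sub>R f y)"
      using f that unfolding locally_integrable_on_def set_integrable_def by auto
    moreover have "integrable lebesgue (\<lambda>y. indicator (cball c s) y *\<^sub>R q)"
      by (intro integrable_scaleR_left integrable_real_indicator) (auto simp: emeasure_lborel_cball_finite[simplified])
    ultimately have "integrable lebesgue (\<lambda>y. norm (indicator (cball c s) y *\<^sub>R f y - indicator (cball c s) y *\<^sub>R q))"
      by (intro integrable_norm Bochner_Integration.integrable_diff)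
    then show ?thesis
      by (rule Bochner_Integration.integrable_cong[THEN iffD1, rotated 2]) (auto simp: g_def indicator_def)
  qed
  define bad where "bad c s q k = {x. g c s q x < 1 / (real k + 1) \<and> (\<forall>d>0. \<exists>r. 0 < r \<and> r < d \<and>
      2 / (real k + 1) * measure lebesgue (ball x r) < (LINT y:ball x r|lebesgue. g c s q y))}"
    for c s q and k :: nat
  have null: "bad c s q k \<in> null_sets lebesgue" if "cball c s \<subseteq> \<Omega>" for c s q k
    unfolding bad_def
    by (rule null_sets_high_average[OF gi[OF that]]) (auto simp: g_def divide_strict_right_mono)
  define I where "I = {(c, n, q, k :: nat). c \<in> D \<and> q \<in> Q \<and> cball c (1 / (real (n::nat) + 1)) \<subseteq> \<Omega>}"
  have "countable I"
    by (rule countable_subset[of _ "D \<times> UNIV \<times> Q \<times> UNIV"]) (use D Q in \<open>auto simp: I_def\<close>)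
  then have "(\<Union>(c, n, q, k)\<in>I. bad c (1 / (real n + 1)) q k) \<in> null_sets lebesgue"
    by (intro null_sets_UN') (auto simp: I_def intro: null)
  from AE_not_in[OF this] show ?thesis
  proof eventually_elim
    case (elim x)
    show ?case
    proof
      assume x: "x \<in> \<Omega>"
      obtain e where e: "0 < e" "ball x e \<subseteq> \<Omega>" using x \<Omega> open_contains_ball by blast
      obtain n where n: "1 / (real n + 1) < e / 2"
        using nat_approx_posE[of "e/2"] e by (metis Suc_eq_plus1 of_nat_Suc add.commute half_gt_zero)
      define s where "s = 1 / (real n + 1)"
      have s: "0 < s" "s < e / 2" using n by (auto simp: s_def)
      obtain c where c: "c \<in> D" "c \<in> ball x s" using D(2)[of "ball x s"] s by auto
      have cs: "cball c s \<subseteq> \<Omega>"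
      proof -
        have "cball c s \<subseteq> ball x e" using c s by (auto simp: dist_commute) (smt (verit) dist_triangle)
        then show ?thesis using e by auto
      qed
      show "((\<lambda>r. avg (ball x r) (\<lambda>y. norm (f y - f x))) \<longlongrightarrow> 0) (at_right 0)"
      proof (rule tendstoI)
        fix \<epsilon> :: real assume \<epsilon>: "0 < \<epsilon>"
        \<comment> \<open>The average of |f - q| will be at most 2/(k+1), and replacing
          \<open>q\<close> by \<open>f x\<close> costs another 1/(k+1); the total 3/(k+1) stays
          below \<epsilon>.\<close>
        obtain k where k: "1 / (real k + 1) < \<epsilon> / 4"
          using nat_approx_posE[of "\<epsilon>/4"] \<epsilon> by (metis Suc_eq_plus1 of_nat_Suc add.commute zero_less_divide_iff zero_less_numeral)
        obtain q where q: "q \<in> Q" "q \<in> ball (f x) (1 / (real k + 1))" using Q(2)[of "ball (f x) (1 / (real k + 1))"] by auto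
        have "(c, n, q, k) \<in> I" using c q cs by (auto simp: I_def s_def)
        then have nb: "x \<notin> bad c s q k" using elim unfolding s_def by blast
        have "x \<in> cball c s" using c by (auto simp: dist_commute)
        then have "g c s q x < 1 / (real k + 1)" using q by (auto simp: g_def dist_norm)
        then obtain d where d0: "d > 0" "\<not> (\<exists>r. 0 < r \<and> r < d \<and>
            2 / (real k + 1) * measure lebesgue (ball x r) < (LINT y:ball x r|lebesgue. g c s q y))"
          using nb unfolding bad_def by blast
        then have d: "d > 0" "\<And>r. 0 < r \<Longrightarrow> r < d \<Longrightarrow>
            (LINT y:ball x r|lebesgue. g c s q y) \<le> 2 / (real k + 1) * measure lebesgue (ball x r)"
          by (force simp: not_less)+
        have xs: "0 < s - dist c x" using c by (auto simp: dist_commute)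
        have "dist (avg (ball x r) (\<lambda>y. norm (f y - f x))) 0 < \<epsilon>" if r: "0 < r" "r < min d (s - dist c x)" for r
        proof -
          have sub: "ball x r \<subseteq> cball c s"
            using r by (auto) (smt (verit) dist_triangle)
          have m: "0 < measure lebesgue (ball x r)" using r by simp
          have ii: "integrable lebesgue (\<lambda>y. indicator (ball x r) y *\<^sub>R g c s q y)"
            using gi[OF cs] by (intro integrable_mult_indicator) auto
          have jj: "integrable lebesgue (\<lambda>y. indicator (ball x r) y *\<^sub>R (1 / (real k + 1)))"
            by (intro integrable_scaleR_left integrable_real_indicator) (auto simp: emeasure_lborel_ball_finite[simplified])
          have "(LINT y:ball x r|lebesgue. norm (f y - f x)) \<le>
              (LINT y|lebesgue. indicator (ball x r) y *\<^sub>R g c s q y + indicator (ball x r) y *\<^sub>R (1 / (real k + 1)))"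
            unfolding set_lebesgue_integral_def
          proof (rule integral_mono')
            show "integrable lebesgue (\<lambda>y. indicator (ball x r) y *\<^sub>R g c s q y + indicator (ball x r) y *\<^sub>R (1 / (real k + 1)))"
              using ii jj by (rule Bochner_Integration.integrable_add)
            fix y
            have "norm (f y - f x) \<le> norm (f y - q) + norm (q - f x)" using norm_triangle_ineq[of "f y - q" "q - f x"] by simp
            then show "indicator (ball x r) y *\<^sub>R norm (f y - f x) \<le>
                indicator (ball x r) y *\<^sub>R g c s q y + indicator (ball x r) y *\<^sub>R (1 / (real k + 1))"
              using sub q by (auto simp: indicator_def g_def dist_norm norm_minus_commute)
          qed (auto simp: g_def)
          also have "\<dots> = (LINT y:ball x r|lebesgue. g c s q y) + measure lebesgue (ball x r) * (1 / (real k + 1))"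
            unfolding set_lebesgue_integral_def
            by (subst Bochner_Integration.integral_add[OF ii jj]) simp
          also have "\<dots> \<le> 2 / (real k + 1) * measure lebesgue (ball x r) + measure lebesgue (ball x r) * (1 / (real k + 1))"
            using d(2)[of r] r by simp
          also have "\<dots> = measure lebesgue (ball x r) * (3 * (1 / (real k + 1)))" by simp
          also have "\<dots> < measure lebesgue (ball x r) * \<epsilon>"
            using m k \<epsilon> by (intro mult_strict_left_mono) auto
          finally have "avg (ball x r) (\<lambda>y. norm (f y - f x)) < \<epsilon>"
            using m by (simp add: avg_def field_simps)
          moreover have "0 \<le> avg (ball x r) (\<lambda>y. norm (f y - f x))"
            unfolding avg_def set_lebesgue_integral_def by (intro divide_nonneg_nonneg integral_nonneg_AE) auto
          ultimately show ?thesis by simp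
        qed
        then show "\<forall>\<^sub>F r in at_right 0. dist (avg (ball x r) (\<lambda>y. norm (f y - f x))) 0 < \<epsilon>"
          using d xs by (auto simp: eventually_at_right_field intro!: exI[of _ "min d (s - dist c x)"])
      qed
    qed
  qed
qed

section \<open>Mollifiers\<close>

text \<open>For \<open>m = 0\<close> this is the classical function exp(-1/t) that is flat at 0. The
  powers of \<open>t\<close> make the family closed under differentiation up to linear
  combinations.\<close>

definition exp_flat :: "nat \<Rightarrow> real \<Rightarrow> real" where
  "exp_flat m t = (if t > 0 then exp (- (1 / t)) / t ^ m else 0)"

lemma exp_flat_nonneg: "0 \<le> exp_flat m t"
  by (simp add: exp_flat_def)

lemma exp_flat_eq_0: "t \<le> 0 \<Longrightarrow> exp_flat m t = 0"
  by (simp add: exp_flat_def)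

lemma exp_flat_0_le: "exp_flat 0 t \<le> 1"
  by (simp add: exp_flat_def)

text \<open>With s = 1/t this is s^2/2 \<le> exp s. Since \<open>exp_flat 2\<close> is the
  derivative of \<open>exp_flat 0\<close>, the 2 found here becomes the 4 in the bound for
  \<open>grad_moll\<close>.\<close>

lemma exp_flat_2_le: "exp_flat 2 t \<le> 2"
proof (cases "t > 0")
  case True
  have "(1 / t)\<^sup>2 / 2 \<le> exp (1 / t)"
    using exp_lower_Taylor_quadratic[of "1 / t"] True by (smt (verit) divide_nonneg_nonneg)
  then have "(1 / t)\<^sup>2 \<le> 2 * exp (1 / t)" by simp
  then have "(1 / t)\<^sup>2 * exp (- (1 / t)) \<le> 2 * exp (1 / t) * exp (- (1 / t))"
    by (intro mult_right_mono) auto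
  also have "\<dots> = 2" by (simp add: exp_minus)
  finally show ?thesis using True by (simp add: exp_flat_def power_divide)
qed (simp add: exp_flat_def)

text \<open>Only t = 0 is delicate. There the quotient from the right is s^(m+1)/exp s with s = 1/h,
  which tends to 0, the quotient from the left is 0, and the right-hand side of the formula vanishes
  too.\<close>

lemma DERIV_exp_flat:
  "(exp_flat m has_field_derivative exp_flat (m + 2) t - real m * exp_flat (m + 1) t) (at t)"
proof -
  consider "t > 0" | "t < 0" | "t = 0" by linarith
  then show ?thesis
  proof cases
    case 1
    have "((\<lambda>t. exp (- (1 / t)) * inverse (t ^ m)) has_field_derivative
       exp (- (1 / t)) * (1 / t ^ 2) * inverse (t ^ m)
        + - (inverse (t ^ m) * (real m * t ^ (m - 1)) * inverse (t ^ m)) * exp (- (1 / t))) (at t)"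
      using 1 by (auto intro!: derivative_eq_intros simp: power2_eq_square divide_inverse)
    moreover have "exp (- (1 / t)) * (1 / t ^ 2) * inverse (t ^ m)
        + - (inverse (t ^ m) * (real m * t ^ (m - 1)) * inverse (t ^ m)) * exp (- (1 / t))
      = exp_flat (m + 2) t - real m * exp_flat (m + 1) t"
      using 1 by (cases m) (auto simp: exp_flat_def field_simps power2_eq_square)
    ultimately have D: "((\<lambda>t. exp (- (1 / t)) * inverse (t ^ m)) has_field_derivative
        exp_flat (m + 2) t - real m * exp_flat (m + 1) t) (at t)" by simp
    show ?thesis
      by (rule has_field_derivative_transform_within_open[OF D, of "{0<..}"])
        (use 1 in \<open>auto simp: exp_flat_def divide_inverse\<close>)
  next
    case 2
    have D: "((\<lambda>t. 0) has_field_derivative exp_flat (m + 2) t - real m * exp_flat (m + 1) t) (at t)"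
      using 2 by (simp add: exp_flat_def)
    show ?thesis
      by (rule has_field_derivative_transform_within_open[OF D, of "{..<0}"])
        (use 2 in \<open>auto simp: exp_flat_def\<close>)
  next
    case 3
    have r: "((\<lambda>h. exp_flat m h / h) \<longlongrightarrow> 0) (at_right 0)"
    proof -
      have "((\<lambda>h::real. inverse h ^ (m + 1) / exp (inverse h)) \<longlongrightarrow> 0) (at_right 0)"
        by (rule filterlim_compose[OF tendsto_power_div_exp_0 filterlim_inverse_at_top_right])
      then show ?thesis
        by (rule Lim_transform_eventually)
          (auto simp: eventually_at_right_field exp_flat_def exp_minus field_simps intro!: exI[of _ 1])
    qed
    have l: "((\<lambda>h. exp_flat m h / h) \<longlongrightarrow> 0) (at_left 0)"
      by (rule Lim_transform_eventually[OF tendsto_const])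
        (auto simp: eventually_at_left_field exp_flat_def intro!: exI[of _ "-1"])
    have "((\<lambda>h. exp_flat m h / h) \<longlongrightarrow> 0) (at 0)"
      by (rule filterlim_split_at[OF l r])
    then show ?thesis using 3 by (simp add: has_field_derivative_iff exp_flat_def)
  qed
qed

lemma continuous_on_exp_flat[continuous_intros]:
  "continuous_on S g \<Longrightarrow> continuous_on S (\<lambda>x. exp_flat m (g x))"
  by (rule continuous_on_compose2[of UNIV "exp_flat m"])
    (auto intro!: continuous_at_imp_continuous_on DERIV_isCont[OF DERIV_exp_flat])

text \<open>A class of functions closed under partial derivatives; it contains the bump functions.\<close>

inductive smooth_fn :: "(real^'n::finite \<Rightarrow> real) \<Rightarrow> bool" where
  const: "smooth_fn (\<lambda>x. c)"
| coord: "smooth_fn (\<lambda>x. x $ i)"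
| add: "smooth_fn u \<Longrightarrow> smooth_fn v \<Longrightarrow> smooth_fn (\<lambda>x. u x + v x)"
| mult: "smooth_fn u \<Longrightarrow> smooth_fn v \<Longrightarrow> smooth_fn (\<lambda>x. u x * v x)"
| flat: "smooth_fn u \<Longrightarrow> smooth_fn (\<lambda>x. exp_flat m (u x))"

lemma partial_deriv_eq:
  assumes "(u has_derivative D) (at x)"
  shows "partial_deriv i u x = D (axis i 1)"
  unfolding partial_deriv_def using frechet_derivative_at[OF assms] by simp

lemma has_derivative_exp_flat:
  assumes "(u has_derivative D) (at x)"
  shows "((\<lambda>x. exp_flat m (u x)) has_derivative
    (\<lambda>h. (exp_flat (m + 2) (u x) - real m * exp_flat (m + 1) (u x)) * D h)) (at x)"
  using has_derivative_compose[OF assms DERIV_exp_flat[unfolded has_field_derivative_def]]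
  by simp

lemma smooth_fn_differentiable:
  fixes u :: "real^'n::finite \<Rightarrow> real"
  assumes "smooth_fn u"
  shows "(\<forall>x. u differentiable (at x)) \<and> (\<forall>i. smooth_fn (partial_deriv i u))"
  using assms
proof induction
  case (const c)
  have "partial_deriv i (\<lambda>x::real^'n. c) = (\<lambda>x. 0)" for i
    by (rule ext, subst partial_deriv_eq[OF has_derivative_const]) simp
  then show ?case by (auto intro: smooth_fn.const)
next
  case (coord j)
  have D: "((\<lambda>x::real^'n. x $ j) has_derivative (\<lambda>h. h $ j)) (at x)" for x
    by (intro bounded_linear_imp_has_derivative bounded_linear_vec_nth)
  have "partial_deriv i (\<lambda>x::real^'n. x $ j) = (\<lambda>x. axis i 1 $ j)" for i
    by (rule ext, subst partial_deriv_eq[OF D]) simp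
  then show ?case using D by (auto intro: smooth_fn.const differentiableI)
next
  case (add u v)
  then have D: "((\<lambda>x. u x + v x) has_derivative
      (\<lambda>h. frechet_derivative u (at x) h + frechet_derivative v (at x) h)) (at x)" for x
    by (auto intro!: derivative_intros simp: frechet_derivative_works)
  have "partial_deriv i (\<lambda>x. u x + v x) = (\<lambda>x. partial_deriv i u x + partial_deriv i v x)" for i
    by (rule ext, subst partial_deriv_eq[OF D]) (simp add: partial_deriv_def)
  then show ?case using D add by (auto intro: smooth_fn.add differentiableI)
next
  case (mult u v)
  then have D: "((\<lambda>x. u x * v x) has_derivative
      (\<lambda>h. u x * frechet_derivative v (at x) h + frechet_derivative u (at x) h * v x)) (at x)" for x
    by (auto intro!: derivative_intros simp: frechet_derivative_works)
  have "partial_deriv i (\<lambda>x. u x * v x) = (\<lambda>x. u x * partial_deriv i v x + partial_deriv i u x * v x)" for i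
    by (rule ext, subst partial_deriv_eq[OF D]) (simp add: partial_deriv_def)
  moreover have "smooth_fn (\<lambda>x. u x * partial_deriv i v x + partial_deriv i u x * v x)" for i
    using mult by (intro smooth_fn.add smooth_fn.mult) auto
  ultimately show ?case using D by (auto intro: differentiableI)
next
  case (flat u m)
  then have D: "((\<lambda>x. exp_flat m (u x)) has_derivative
    (\<lambda>h. (exp_flat (m + 2) (u x) - real m * exp_flat (m + 1) (u x)) * frechet_derivative u (at x) h)) (at x)" for x
    by (intro has_derivative_exp_flat) (simp add: frechet_derivative_works)
  have "partial_deriv i (\<lambda>x. exp_flat m (u x)) =
      (\<lambda>x. (exp_flat (m + 2) (u x) + (- real m) * exp_flat (m + 1) (u x)) * partial_deriv i u x)" for i
    by (rule ext, subst partial_deriv_eq[OF D]) (simp add: partial_deriv_def)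
  moreover have "smooth_fn (\<lambda>x. (exp_flat (m + 2) (u x) + (- real m) * exp_flat (m + 1) (u x)) * partial_deriv i u x)" for i
    using flat by (intro smooth_fn.add smooth_fn.mult smooth_fn.flat smooth_fn.const) auto
  ultimately have "smooth_fn (partial_deriv i (\<lambda>x. exp_flat m (u x)))" for i by metis
  then show ?case using D by (auto intro: differentiableI)
qed

lemma smooth_fn_Ck: "smooth_fn u \<Longrightarrow> Ck k u"
proof (induction k arbitrary: u)
  case 0
  then show ?case using smooth_fn_differentiable[of u]
    by (auto intro!: continuous_at_imp_continuous_on differentiable_imp_continuous_within)
next
  case (Suc k)
  then show ?case using smooth_fn_differentiable[of u] by simp
qed

lemma smooth_fn_sum:
  "finite I \<Longrightarrow> (\<And>i. i \<in> I \<Longrightarrow> smooth_fn (u i)) \<Longrightarrow> smooth_fn (\<lambda>x. \<Sum>i\<in>I. u i x)"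
  by (induction I rule: finite_induct) (auto intro: smooth_fn.const smooth_fn.add)

section \<open>The bump function, its rescalings and their gradients\<close>

definition bump :: "real^'n::finite \<Rightarrow> real" where
  "bump x = exp_flat 0 (1 - x \<bullet> x)"

definition bump_mass :: "'n::finite itself \<Rightarrow> real" where
  "bump_mass _ = (LINT x|lborel. bump (x :: real^'n))"

definition moll :: "real \<Rightarrow> real^'n::finite \<Rightarrow> real" where
  "moll r x = bump (x /\<^sub>R r) / (r ^ CARD('n) * bump_mass TYPE('n))"

text \<open>The gradient of \<open>moll r\<close> in closed form: \<open>exp_flat 2\<close> is the
  derivative of \<open>exp_flat 0\<close>, and 1 - |x/r|^2 has gradient -2x/r^2. One power of
  \<open>r\<close> sits in the exponent \<open>CARD('n) + 1\<close>, the other in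
  \<open>x /\<^sub>R r\<close>.\<close>

definition grad_moll :: "real \<Rightarrow> real^'n::finite \<Rightarrow> real^'n" where
  "grad_moll r x = (- 2 * exp_flat 2 (1 - (x /\<^sub>R r) \<bullet> (x /\<^sub>R r)) / (r ^ (CARD('n) + 1) * bump_mass TYPE('n)))
     *\<^sub>R (x /\<^sub>R r)"

lemma continuous_on_bump: "continuous_on S bump"
  unfolding bump_def by (intro continuous_intros)

lemma bump_nonneg: "0 \<le> bump x" and bump_le_1: "bump x \<le> 1"
  by (simp_all add: bump_def exp_flat_nonneg exp_flat_0_le)

lemma bump_eq_0: "1 \<le> norm x \<Longrightarrow> bump x = 0"
  unfolding bump_def by (rule exp_flat_eq_0) (simp add: power2_norm_eq_inner[symmetric] one_le_power)

lemma integrable_bounded_support: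
  fixes u :: "'a::euclidean_space \<Rightarrow> 'b::euclidean_space"
  assumes u: "u \<in> borel_measurable borel" and b: "\<And>x. norm (u x) \<le> C" and s: "\<And>x. x \<notin> cball a R \<Longrightarrow> u x = 0"
  shows "integrable lborel u"
proof (rule Bochner_Integration.integrable_bound)
  show "integrable lborel (\<lambda>x. indicator (cball a R) x * C)"
    by (intro integrable_mult_left integrable_real_indicator) (auto simp: emeasure_lborel_cball_finite[simplified])
  show "AE x in lborel. norm (u x) \<le> norm (indicator (cball a R) x * C)"
    using b s order_trans[OF norm_ge_zero b] by (auto simp: indicator_def)
qed (use u in simp)

lemma integrable_bump: "integrable lborel bump"
  by (rule integrable_bounded_support[of _ 1 0 1])
    (auto simp: bump_nonneg bump_le_1 bump_eq_0 intro!: borel_measurable_continuous_onI continuous_on_bump)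

lemma bump_mass_pos: "0 < bump_mass TYPE('n::finite)"
proof -
  let ?B = "ball (0::real^'n) (1/2)"
  \<comment> \<open>On the ball of radius 1/2 one has 1 - |x|^2 \<ge> 3/4, hence
    \<open>bump x\<close> \<ge> exp(-4/3); this constant times the volume of the ball bounds the
    mass from below.\<close>
  have "integrable lborel (\<lambda>x::real^'n. exp (- (4/3)) * indicator ?B x :: real)"
    by (intro integrable_mult_right integrable_real_indicator) (auto simp: emeasure_lborel_ball_finite[simplified])
  then have "(LINT x|lborel. exp (- (4/3)) * indicator ?B x) \<le> bump_mass TYPE('n)"
    unfolding bump_mass_def
  proof (rule integral_mono[OF _ integrable_bump])
    fix x :: "real^'n"
    show "exp (- (4/3)) * indicator ?B x \<le> bump x"
    proof (cases "x \<in> ?B")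
      case True
      then have "(norm x)\<^sup>2 \<le> (1/2)\<^sup>2" by (intro power_mono) auto
      then have "x \<bullet> x \<le> 1 / 4" unfolding power2_norm_eq_inner by (simp add: power2_eq_square)
      then have "3 / 4 \<le> 1 - x \<bullet> x" by simp
      then have "1 / (1 - x \<bullet> x) \<le> 4 / 3" and "0 < 1 - x \<bullet> x" by (auto simp: field_simps)
      then show ?thesis using True by (simp add: bump_def exp_flat_def)
    qed (simp add: bump_nonneg)
  qed
  moreover have "(LINT x|lborel. exp (- (4/3)) * indicator ?B x) = exp (- (4/3)) * measure lborel ?B" by simp
  moreover have "0 < exp (- (4/3)) * measure lborel ?B"
    by (intro mult_pos_pos) auto
  ultimately show ?thesis by linarith
qed

lemma moll_nonneg: "0 < r \<Longrightarrow> 0 \<le> moll r x"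
  using bump_mass_pos[where 'n='a] by (simp add: moll_def bump_nonneg)

lemma moll_le: "0 < r \<Longrightarrow> moll r (x :: real^'n::finite) \<le> 1 / (r ^ CARD('n) * bump_mass TYPE('n))"
  using bump_mass_pos[where 'n='n] unfolding moll_def by (intro divide_right_mono bump_le_1) auto

lemma moll_eq_0: "0 < r \<Longrightarrow> r \<le> norm x \<Longrightarrow> moll r x = 0"
  unfolding moll_def by (subst bump_eq_0) (auto simp: field_simps)

lemma grad_moll_eq_0:
  assumes "0 < r" "r \<le> norm x"
  shows "grad_moll r x = 0"
proof -
  have "1 \<le> (norm (x /\<^sub>R r))\<^sup>2" using assms by (intro one_le_power) (auto simp: field_simps)
  then have "1 - (x /\<^sub>R r) \<bullet> (x /\<^sub>R r) \<le> 0" unfolding power2_norm_eq_inner by linarith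
  then show ?thesis by (simp add: grad_moll_def exp_flat_eq_0)
qed

lemma norm_grad_moll_le:
  assumes r: "0 < r"
  shows "norm (grad_moll r (x :: real^'n::finite)) \<le> 4 / (r ^ (CARD('n) + 1) * bump_mass TYPE('n))"
proof (cases "r \<le> norm x")
  case True
  then show ?thesis using grad_moll_eq_0[OF r True] bump_mass_pos[where 'n='n] r by simp
next
  case False
  let ?a = "exp_flat 2 (1 - (x /\<^sub>R r) \<bullet> (x /\<^sub>R r))" and ?d = "r ^ (CARD('n) + 1) * bump_mass TYPE('n)"
  have d: "0 < ?d" using r bump_mass_pos[where 'n='n] by simp
  have "norm (grad_moll r x) = 2 * ?a / ?d * (norm x / r)"
    unfolding grad_moll_def using r d bump_mass_pos[where 'n='n] exp_flat_nonneg[of 2] by (simp add: abs_mult divide_inverse mult.commute)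
  also have "\<dots> \<le> 2 * 2 / ?d * 1"
    using r d False exp_flat_nonneg[of 2] exp_flat_2_le by (intro mult_mono divide_right_mono) auto
  finally show ?thesis by simp
qed

lemma continuous_on_moll: "continuous_on S (moll r)"
  unfolding moll_def bump_def divide_inverse by (intro continuous_intros)

lemma continuous_on_grad_moll: "continuous_on S (grad_moll r)"
  unfolding grad_moll_def divide_inverse by (intro continuous_intros)

lemma integral_moll:
  assumes r: "0 < r"
  shows "(LINT x|lborel. moll r (x :: real^'n::finite)) = 1"
proof -
  have "(LINT x|lborel. moll r (x :: real^'n)) = r ^ CARD('n) * (LINT x|lborel. moll r (0 + r *\<^sub>R x :: real^'n))"
    using r by (subst integral_lborel_affine[of _ r 0])
      (auto intro!: borel_measurable_continuous_onI continuous_on_moll)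
  also have "(\<lambda>x::real^'n. moll r (0 + r *\<^sub>R x)) = (\<lambda>x. bump x / (r ^ CARD('n) * bump_mass TYPE('n)))"
    using r by (simp add: moll_def)
  finally show ?thesis using r bump_mass_pos[where 'n='n]
    by (simp add: bump_mass_def)
qed

lemma has_derivative_moll:
  fixes x :: "real^'n::finite"
  assumes r: "0 < r"
  shows "(moll r has_derivative (\<lambda>h. grad_moll r x \<bullet> h)) (at x)"
proof -
  have "((\<lambda>x::real^'n. 1 - (x /\<^sub>R r) \<bullet> (x /\<^sub>R r)) has_derivative (\<lambda>h. - 2 * ((x /\<^sub>R r) \<bullet> (h /\<^sub>R r)))) (at x)"
    by (auto intro!: derivative_eq_intros simp: inner_commute)
  from has_derivative_exp_flat[OF this, of 0]
  have "((\<lambda>x. exp_flat 0 (1 - (x /\<^sub>R r) \<bullet> (x /\<^sub>R r)) / (r ^ CARD('n) * bump_mass TYPE('n))) has_derivative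
     (\<lambda>h. exp_flat 2 (1 - (x /\<^sub>R r) \<bullet> (x /\<^sub>R r)) * (- 2 * ((x /\<^sub>R r) \<bullet> (h /\<^sub>R r))) / (r ^ CARD('n) * bump_mass TYPE('n)))) (at x)"
    unfolding divide_inverse by (intro derivative_eq_intros) (auto simp: numeral_2_eq_2)
  moreover have "(\<lambda>h. exp_flat 2 (1 - (x /\<^sub>R r) \<bullet> (x /\<^sub>R r)) * (- 2 * ((x /\<^sub>R r) \<bullet> (h /\<^sub>R r))) / (r ^ CARD('n) * bump_mass TYPE('n)))
      = (\<lambda>h. grad_moll r x \<bullet> h)"
    using r by (auto simp: grad_moll_def field_simps)
  ultimately show ?thesis unfolding moll_def[abs_def] bump_def by simp
qed

text \<open>The squared norm is expanded as a polynomial in the coordinates, so that the function is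
  visibly built by the rules of \<open>smooth_fn\<close>.\<close>

lemma smooth_fn_moll_shift: "smooth_fn (\<lambda>w. moll r (p - w :: real^'n::finite))"
proof -
  have "smooth_fn (\<lambda>w. exp_flat 0 (1 + (- (inverse r ^ 2)) * (\<Sum>i\<in>UNIV. (p $ i + (-1) * w $ i) * (p $ i + (-1) * w $ i)))
      * inverse (r ^ CARD('n) * bump_mass TYPE('n)))" (is "smooth_fn ?f")
    by (intro smooth_fn.mult smooth_fn.const smooth_fn.add smooth_fn.flat smooth_fn_sum smooth_fn.coord) simp
  also have "?f = (\<lambda>w. moll r (p - w))"
    unfolding moll_def bump_def
    by (rule ext) (simp add: inner_vec_def divide_inverse power2_eq_square sum_distrib_left mult_ac sum_negf)
  finally show ?thesis .
qed

lemma has_derivative_moll_shift: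
  assumes "0 < r"
  shows "((\<lambda>w. moll r (p - w)) has_derivative (\<lambda>h. - (grad_moll r (p - w) \<bullet> h))) (at w)"
proof -
  have "((\<lambda>w. p - w) has_derivative uminus) (at w)" by (auto intro!: derivative_eq_intros)
  from has_derivative_compose[OF this has_derivative_moll[OF assms]] show ?thesis by simp
qed

lemma partial_deriv_moll_shift:
  "0 < r \<Longrightarrow> partial_deriv i (\<lambda>w. moll r (p - w)) w = - (grad_moll r (p - w) $ i)"
  by (subst partial_deriv_eq[OF has_derivative_moll_shift]) (auto simp: inner_axis)

lemma test_function_moll_shift:
  assumes r: "0 < r" and sub: "cball p r \<subseteq> \<Omega>"
  shows "test_function \<Omega> (\<lambda>w. moll r (p - w))"
proof -
  have c: "closure {w. moll r (p - w) \<noteq> 0} \<subseteq> cball p r"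
  proof (intro closure_minimal subsetI)
    fix w assume "w \<in> {w. moll r (p - w) \<noteq> 0}"
    then have "\<not> r \<le> norm (p - w)" using moll_eq_0[OF r] by blast
    then show "w \<in> cball p r" by (simp add: dist_norm)
  qed simp
  then have "bounded (closure {w. moll r (p - w) \<noteq> 0})" using bounded_subset bounded_cball by blast
  then show ?thesis using c sub
    by (auto simp: test_function_def compact_eq_bounded_closed intro!: smooth_fn_Ck smooth_fn_moll_shift)
qed

lemma DERIV_partial_deriv_line:
  assumes "u differentiable (at (x + s *\<^sub>R axis i 1))"
  shows "((\<lambda>s. u (x + s *\<^sub>R axis i 1)) has_field_derivative partial_deriv i u (x + s *\<^sub>R axis i 1)) (at s)"
proof -
  have "((\<lambda>s. x + s *\<^sub>R axis i 1) has_derivative (\<lambda>h. h *\<^sub>R axis i (1::real))) (at s)"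
    by (auto intro!: derivative_eq_intros)
  moreover have D: "(u has_derivative frechet_derivative u (at (x + s *\<^sub>R axis i 1))) (at (x + s *\<^sub>R axis i 1))"
    using assms by (simp add: frechet_derivative_works)
  ultimately have "((\<lambda>s. u (x + s *\<^sub>R axis i 1)) has_derivative
      (\<lambda>h. frechet_derivative u (at (x + s *\<^sub>R axis i 1)) (h *\<^sub>R axis i 1))) (at s)"
    by (rule has_derivative_compose)
  then show ?thesis
    using linear_scale[OF has_derivative_linear[OF D]]
    by (simp add: has_field_derivative_def partial_deriv_def mult.commute[of _ "partial_deriv i u _"] mult_commute_abs)
qed

text \<open>Difference quotients of \<open>u\<close> have integral 0 by translation invariance. They
  converge to the partial derivative and, by the mean value theorem, are bounded by its maximum, so
  dominated convergence applies. The integrations by parts against test functions and mollifiers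
  rest on this fact.\<close>

lemma integral_partial_deriv_eq_0:
  fixes u :: "real^'n::finite \<Rightarrow> real"
  assumes d: "\<And>x. u differentiable (at x)" and c: "continuous_on UNIV (partial_deriv i u)"
    and s: "\<And>x. x \<notin> cball 0 R \<Longrightarrow> u x = 0"
  shows "(LINT x|lborel. partial_deriv i u x) = 0"
proof -
  let ?e = "axis i 1 :: real^'n"
  have uc: "continuous_on UNIV u"
    using d by (auto intro!: continuous_at_imp_continuous_on differentiable_imp_continuous_within)
  have um: "u \<in> borel_measurable borel" by (rule borel_measurable_continuous_onI[OF uc])
  have zero: "partial_deriv i u x = 0" if "x \<notin> cball 0 R" for x
  proof -
    have op: "open (- cball (0::real^'n) R)" by (intro open_Compl) auto
    have "((\<lambda>x. 0) has_derivative (\<lambda>h. 0)) (at x)" by (rule has_derivative_const)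
    then have "(u has_derivative (\<lambda>h. 0)) (at x)"
      by (rule has_derivative_transform_within_open[OF _ op]) (use that s in auto)
    then show ?thesis by (simp add: partial_deriv_eq)
  qed
  obtain L where L: "\<And>x. \<bar>partial_deriv i u x\<bar> \<le> L"
  proof -
    have "bounded (partial_deriv i u ` cball 0 R)"
      by (intro compact_imp_bounded compact_continuous_image continuous_on_subset[OF c]) auto
    then obtain L where L: "\<And>x. x \<in> cball 0 R \<Longrightarrow> norm (partial_deriv i u x) \<le> L"
      unfolding bounded_iff by blast
    show thesis
    proof (rule that[of "max 0 L"])
      fix x show "\<bar>partial_deriv i u x\<bar> \<le> max 0 L"
        using L[of x] zero[of x] by (cases "x \<in> cball 0 R") auto
    qed
  qed
  obtain U where U: "\<And>x. \<bar>u x\<bar> \<le> U"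
  proof -
    have "bounded (u ` cball 0 R)"
      by (intro compact_imp_bounded compact_continuous_image continuous_on_subset[OF uc]) auto
    then obtain L where L: "\<And>x. x \<in> cball 0 R \<Longrightarrow> norm (u x) \<le> L"
      unfolding bounded_iff by blast
    show thesis
    proof (rule that[of "max 0 L"])
      fix x show "\<bar>u x\<bar> \<le> max 0 L"
        using L[of x] s[of x] by (cases "x \<in> cball 0 R") auto
    qed
  qed
  have ui: "integrable lborel u"
    by (rule integrable_bounded_support[OF um, of U 0 R]) (use U s in auto)
  \<comment> \<open>Steps of size at most 1 keep all difference quotients supported in the ball of
    radius \<open>R + 1\<close>.\<close>
  define t where "t k = 1 / (real k + 1)" for k :: nat
  have t: "0 < t k" "t k \<le> 1" for k by (auto simp: t_def)
  have t0: "t \<longlonglongrightarrow> 0" unfolding t_def using LIMSEQ_inverse_real_of_nat by (simp add: inverse_eq_divide add.commute)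
  define q where "q k x = (u (x + t k *\<^sub>R ?e) - u x) / t k" for k x
  have shm: "(\<lambda>x. u (x + t k *\<^sub>R ?e)) \<in> borel_measurable borel" for k
    by (intro borel_measurable_continuous_onI continuous_on_compose2[OF uc] continuous_intros) auto
  have "(\<lambda>k. LINT x|lborel. q k x) \<longlonglongrightarrow> (LINT x|lborel. partial_deriv i u x)"
  proof (rule integral_dominated_convergence[where w="\<lambda>x. indicator (cball 0 (R + 1)) x * L"])
    show "integrable lborel (\<lambda>x::real^'n. indicator (cball 0 (R + 1)) x * L)"
      by (intro integrable_mult_left integrable_real_indicator) (auto simp: emeasure_lborel_cball_finite[simplified])
    show "AE x in lborel. (\<lambda>k. q k x) \<longlonglongrightarrow> partial_deriv i u x"
    proof (intro AE_I2)
      fix x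
      have "((\<lambda>s. u (x + s *\<^sub>R ?e)) has_field_derivative partial_deriv i u x) (at 0)"
        using DERIV_partial_deriv_line[of u x 0 i] d by simp
      then have "((\<lambda>h. (u (x + h *\<^sub>R ?e) - u x) / h) \<longlongrightarrow> partial_deriv i u x) (at 0)"
        by (simp add: has_field_derivative_iff)
      moreover have "filterlim t (at 0) sequentially"
        using t0 t by (auto simp: filterlim_at less_imp_neq[symmetric])
      ultimately show "(\<lambda>k. q k x) \<longlonglongrightarrow> partial_deriv i u x"
        unfolding q_def by (rule filterlim_compose)
    qed
    show "AE x in lborel. norm (q k x) \<le> indicator (cball 0 (R + 1)) x * L" for k
    proof (intro AE_I2)
      fix x
      show "norm (q k x) \<le> indicator (cball 0 (R + 1)) x * L"
      proof (cases "x \<in> cball 0 (R + 1)")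
        case True
        have "\<exists>z. 0 < z \<and> z < t k \<and> u (x + t k *\<^sub>R ?e) - u (x + 0 *\<^sub>R ?e) = (t k - 0) * partial_deriv i u (x + z *\<^sub>R ?e)"
          by (rule MVT2) (use t d in \<open>auto intro: DERIV_partial_deriv_line\<close>)
        then obtain z where "u (x + t k *\<^sub>R ?e) - u x = t k * partial_deriv i u (x + z *\<^sub>R ?e)" by auto
        then have "q k x = partial_deriv i u (x + z *\<^sub>R ?e)" using t(1)[of k] by (simp add: q_def)
        then show ?thesis using True L by simp
      next
        case False
        have "norm x \<le> norm (x + t k *\<^sub>R ?e) + norm (t k *\<^sub>R ?e)"
          using norm_triangle_ineq4[of "x + t k *\<^sub>R ?e" "t k *\<^sub>R ?e"] by simp
        then have "norm x \<le> norm (x + t k *\<^sub>R ?e) + 1" using t[of k] by (simp add: norm_axis_1)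
        then have "u (x + t k *\<^sub>R ?e) = 0" "u x = 0" using False by (auto intro!: s)
        then show ?thesis using False by (simp add: q_def)
      qed
    qed
  qed (use um shm c in \<open>auto simp: q_def[abs_def] intro: borel_measurable_continuous_onI\<close>)
  moreover have "(LINT x|lborel. q k x) = 0" for k
  proof -
    have "(LINT x|lborel. u (x + t k *\<^sub>R ?e)) = (LINT x|lborel. u x)"
      using integral_lborel_affine[OF um, of 1 "t k *\<^sub>R ?e"] by (simp add: add.commute)
    moreover have "integrable lborel (\<lambda>x. u (x + t k *\<^sub>R ?e))"
    proof (rule integrable_bounded_support[of _ U 0 "R + 1"])
      fix x :: "real^'n" assume "x \<notin> cball 0 (R + 1)"
      moreover have "norm x \<le> norm (x + t k *\<^sub>R ?e) + norm (t k *\<^sub>R ?e)"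
        using norm_triangle_ineq4[of "x + t k *\<^sub>R ?e" "t k *\<^sub>R ?e"] by simp
      ultimately show "u (x + t k *\<^sub>R ?e) = 0" using t[of k] by (intro s) (simp add: norm_axis_1)
    qed (use U shm in auto)
    ultimately show ?thesis using ui by (simp add: q_def)
  qed
  ultimately show ?thesis by (simp add: LIMSEQ_const_iff)
qed

lemma borel_measurable_moll_shift: "(\<lambda>w. moll r (p - w)) \<in> borel_measurable borel"
  by (intro borel_measurable_continuous_onI continuous_on_compose2[OF continuous_on_moll[of UNIV]] continuous_intros) auto

lemma borel_measurable_grad_moll_shift: "(\<lambda>w. grad_moll r (p - w)) \<in> borel_measurable borel"
  by (intro borel_measurable_continuous_onI continuous_on_compose2[OF continuous_on_grad_moll[of UNIV]] continuous_intros) auto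

lemma integral_moll_shift:
  assumes "0 < r"
  shows "(LINT w|lborel. moll r (p - w :: real^'n::finite)) = 1"
proof -
  have "(LINT w|lborel. moll r (p - w)) = \<bar>-1::real\<bar> ^ DIM(real^'n) * (LINT w|lborel. moll r (p - (p + (-1) *\<^sub>R w)))"
    by (rule integral_lborel_affine[OF borel_measurable_moll_shift]) simp
  then show ?thesis using integral_moll[OF assms, where 'n='n] by simp
qed

lemma integrable_moll_shift:
  assumes "0 < r"
  shows "integrable lborel (\<lambda>w. moll r (p - w :: real^'n::finite))"
  using integral_moll_shift[OF assms, of p] not_integrable_integral_eq by fastforce

section \<open>Convolution with the mollifiers\<close>

definition conv_moll :: "(real^'n::finite \<Rightarrow> real) \<Rightarrow> real \<Rightarrow> real^'n \<Rightarrow> real" where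
  "conv_moll f r p = (LINT w|lebesgue. moll r (p - w) * f w)"

text \<open>The gradient of \<open>conv_moll f r\<close>: the derivative falls on the mollifier, so
  integrability of \<open>f\<close> is enough.\<close>

definition conv_grad_moll :: "(real^'n::finite \<Rightarrow> real) \<Rightarrow> real \<Rightarrow> real^'n \<Rightarrow> real^'n" where
  "conv_grad_moll f r p = (LINT w|lebesgue. f w *\<^sub>R grad_moll r (p - w))"

lemma integrable_mult_moll:
  fixes f :: "real^'n::finite \<Rightarrow> 'b::euclidean_space"
  assumes f: "integrable lebesgue f" and r: "0 < r"
  shows "integrable lebesgue (\<lambda>w. moll r (p - w) *\<^sub>R f w)"
proof (rule Bochner_Integration.integrable_bound)
  show "integrable lebesgue (\<lambda>w. 1 / (r ^ CARD('n) * bump_mass TYPE('n)) * norm (f w))"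
    using f by simp
  show "(\<lambda>w. moll r (p - w) *\<^sub>R f w) \<in> borel_measurable lebesgue"
    by (rule borel_measurable_scaleR[OF borel_measurable_lebesgueI[OF borel_measurable_moll_shift] borel_measurable_integrable[OF f]])
  show "AE w in lebesgue. norm (moll r (p - w) *\<^sub>R f w) \<le> norm (1 / (r ^ CARD('n) * bump_mass TYPE('n)) * norm (f w))"
  proof (intro AE_I2)
    fix w
    have "moll r (p - w) * norm (f w) \<le> 1 / (r ^ CARD('n) * bump_mass TYPE('n)) * norm (f w)"
      by (intro mult_right_mono moll_le r) auto
    also have "\<dots> \<le> \<bar>1 / (r ^ CARD('n) * bump_mass TYPE('n)) * norm (f w)\<bar>" by (rule abs_ge_self)
    finally show "norm (moll r (p - w) *\<^sub>R f w) \<le> norm (1 / (r ^ CARD('n) * bump_mass TYPE('n)) * norm (f w))"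
      using moll_nonneg[OF r, of "p - w"] by simp
  qed
qed

lemma integrable_mult_grad_moll:
  fixes f :: "real^'n::finite \<Rightarrow> real"
  assumes f: "integrable lebesgue f" and r: "0 < r"
  shows "integrable lebesgue (\<lambda>w. f w *\<^sub>R grad_moll r (p - w))"
proof (rule Bochner_Integration.integrable_bound)
  show "integrable lebesgue (\<lambda>w. 4 / (r ^ (CARD('n) + 1) * bump_mass TYPE('n)) * norm (f w))"
    using f by simp
  show "(\<lambda>w. f w *\<^sub>R grad_moll r (p - w)) \<in> borel_measurable lebesgue"
    by (rule borel_measurable_scaleR[OF borel_measurable_integrable[OF f] borel_measurable_lebesgueI[OF borel_measurable_grad_moll_shift]])
  show "AE w in lebesgue. norm (f w *\<^sub>R grad_moll r (p - w)) \<le> norm (4 / (r ^ (CARD('n) + 1) * bump_mass TYPE('n)) * norm (f w))"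
  proof (intro AE_I2)
    fix w
    have "norm (grad_moll r (p - w)) * \<bar>f w\<bar> \<le> 4 / (r ^ (CARD('n) + 1) * bump_mass TYPE('n)) * \<bar>f w\<bar>"
      by (intro mult_right_mono norm_grad_moll_le r) auto
    also have "\<dots> \<le> \<bar>4 / (r ^ (CARD('n) + 1) * bump_mass TYPE('n)) * \<bar>f w\<bar>\<bar>" by (rule abs_ge_self)
    finally show "norm (f w *\<^sub>R grad_moll r (p - w)) \<le> norm (4 / (r ^ (CARD('n) + 1) * bump_mass TYPE('n)) * norm (f w))"
      by (simp add: mult.commute)
  qed
qed

lemma isCont_moll_shift: "isCont (\<lambda>p. moll r (p - w)) a"
proof -
  have "continuous_on UNIV (\<lambda>p. moll r (p - w))"
    by (intro continuous_on_compose2[OF continuous_on_moll[of UNIV]] continuous_intros) auto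
  then show ?thesis by (simp add: continuous_on_eq_continuous_at)
qed

lemma isCont_grad_moll_shift: "isCont (\<lambda>p. grad_moll r (p - w)) a"
proof -
  have "continuous_on UNIV (\<lambda>p. grad_moll r (p - w))"
    by (intro continuous_on_compose2[OF continuous_on_grad_moll[of UNIV]] continuous_intros) auto
  then show ?thesis by (simp add: continuous_on_eq_continuous_at)
qed

lemma isCont_conv_moll:
  fixes f :: "real^'n::finite \<Rightarrow> real"
  assumes f: "integrable lebesgue f" and r: "0 < r"
  shows "isCont (conv_moll f r) a"
  unfolding conv_moll_def
proof (rule isCont_integral[of 1])
  show "(\<lambda>w. moll r (p - w) * f w) \<in> borel_measurable lebesgue" for p
    using integrable_mult_moll[OF f r, of p] by auto
  show "AE w in lebesgue. isCont (\<lambda>p. moll r (p - w) * f w) a"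
    by (intro AE_I2 isCont_mult isCont_moll_shift continuous_const)
  show "integrable lebesgue (\<lambda>w. 1 / (r ^ CARD('n) * bump_mass TYPE('n)) * norm (f w))"
    using f by simp
  show "AE w in lebesgue. norm (moll r (p - w) * f w) \<le> 1 / (r ^ CARD('n) * bump_mass TYPE('n)) * norm (f w)" for p
  proof (intro AE_I2)
    fix w
    have "moll r (p - w) * norm (f w) \<le> 1 / (r ^ CARD('n) * bump_mass TYPE('n)) * norm (f w)"
      by (intro mult_right_mono moll_le r) auto
    then show "norm (moll r (p - w) * f w) \<le> 1 / (r ^ CARD('n) * bump_mass TYPE('n)) * norm (f w)"
      using moll_nonneg[OF r, of "p - w"] by (simp add: abs_mult)
  qed
qed simp

lemma isCont_conv_grad_moll:
  fixes f :: "real^'n::finite \<Rightarrow> real"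
  assumes f: "integrable lebesgue f" and r: "0 < r"
  shows "isCont (conv_grad_moll f r) a"
  unfolding conv_grad_moll_def
proof (rule isCont_integral[of 1])
  show "(\<lambda>w. f w *\<^sub>R grad_moll r (p - w)) \<in> borel_measurable lebesgue" for p
    using integrable_mult_grad_moll[OF f r, of p] by auto
  show "AE w in lebesgue. isCont (\<lambda>p. f w *\<^sub>R grad_moll r (p - w)) a"
    by (intro AE_I2 continuous_scaleR isCont_grad_moll_shift continuous_const)
  show "integrable lebesgue (\<lambda>w. 4 / (r ^ (CARD('n) + 1) * bump_mass TYPE('n)) * norm (f w))"
    using f by simp
  show "AE w in lebesgue. norm (f w *\<^sub>R grad_moll r (p - w)) \<le> 4 / (r ^ (CARD('n) + 1) * bump_mass TYPE('n)) * norm (f w)" for p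
  proof (intro AE_I2)
    fix w
    have "norm (grad_moll r (p - w)) * \<bar>f w\<bar> \<le> 4 / (r ^ (CARD('n) + 1) * bump_mass TYPE('n)) * \<bar>f w\<bar>"
      by (intro mult_right_mono norm_grad_moll_le r) auto
    then show "norm (f w *\<^sub>R grad_moll r (p - w)) \<le> 4 / (r ^ (CARD('n) + 1) * bump_mass TYPE('n)) * norm (f w)"
      by (simp add: mult.commute)
  qed
qed simp

text \<open>The fundamental theorem of calculus is applied to the kernel along the segment from
  \<open>z\<close> to \<open>y\<close>, and Fubini moves the integral over \<open>w\<close> inside.
  In this way differentiability of \<open>conv_moll f r\<close> itself is never discussed.\<close>

lemma conv_moll_diff:
  fixes f :: "real^'n::finite \<Rightarrow> real"
  assumes f: "integrable lebesgue f" and r: "0 < r"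
  shows "conv_moll f r y - conv_moll f r z =
    (LINT t|lborel. indicator {0..1} t * (conv_grad_moll f r (z + t *\<^sub>R (y - z)) \<bullet> (y - z)))"
proof -
  let ?L = "4 / (r ^ (CARD('n) + 1) * bump_mass TYPE('n))"
  define k where "k p = indicator {0..1} (fst p) * (grad_moll r (z + fst p *\<^sub>R (y - z) - snd p) \<bullet> (y - z))"
    for p :: "real \<times> (real^'n)"
  have "(\<lambda>p::real \<times> (real^'n). grad_moll r (z + fst p *\<^sub>R (y - z) - snd p)) \<in> borel_measurable borel"
    by (intro borel_measurable_continuous_onI continuous_on_compose2[OF continuous_on_grad_moll[of UNIV]] continuous_intros) auto
  moreover have "(\<lambda>p::real \<times> (real^'n). indicator {0..1} (fst p) :: real) \<in> borel_measurable borel"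
  proof -
    have "(fst :: real \<times> (real^'n) \<Rightarrow> real) \<in> borel_measurable borel"
      by (intro borel_measurable_continuous_onI continuous_intros)
    from measurable_compose[OF this, of "indicator {0..1}" borel] show ?thesis by simp
  qed
  ultimately have km: "k \<in> borel_measurable borel"
    unfolding k_def[abs_def] by (intro borel_measurable_times borel_measurable_inner) auto
  have bound: "\<bar>k (t, w)\<bar> \<le> indicator {0..1} t * (?L * norm (y - z))" for t w
  proof -
    have "\<bar>grad_moll r (z + t *\<^sub>R (y - z) - w) \<bullet> (y - z)\<bar> \<le> norm (grad_moll r (z + t *\<^sub>R (y - z) - w)) * norm (y - z)"
      by (rule Cauchy_Schwarz_ineq2)
    also have "\<dots> \<le> ?L * norm (y - z)" by (intro mult_right_mono norm_grad_moll_le r) simp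
    finally show ?thesis by (simp add: k_def indicator_def)
  qed
  have ui: "integrable lborel (\<lambda>t::real. indicator {0..1} t * (?L * norm (y - z)))"
    by (intro integrable_mult_left integrable_real_indicator) auto
  have inner: "(LINT t|lborel. k (t, w)) = moll r (y - w) - moll r (z - w)" for w
  proof -
    have der: "((\<lambda>t. moll r (z + t *\<^sub>R (y - z) - w)) has_vector_derivative
        (grad_moll r (z + t *\<^sub>R (y - z) - w) \<bullet> (y - z))) (at t within {0..1})" for t
    proof -
      have "((\<lambda>t. z + t *\<^sub>R (y - z) - w) has_derivative (\<lambda>h. h *\<^sub>R (y - z))) (at t within {0..1})"
        by (auto intro!: derivative_eq_intros)
      from has_derivative_compose[OF this has_derivative_moll[OF r]]
      show ?thesis by (simp add: has_vector_derivative_def mult.commute)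
    qed
    have cont: "continuous_on {0..1} (\<lambda>t. grad_moll r (z + t *\<^sub>R (y - z) - w) \<bullet> (y - z))"
      by (intro continuous_intros continuous_on_compose2[OF continuous_on_grad_moll[of UNIV]]) auto
    have "(LINT t|lborel. indicator {0..1} t *\<^sub>R (grad_moll r (z + t *\<^sub>R (y - z) - w) \<bullet> (y - z))) =
        moll r (z + 1 *\<^sub>R (y - z) - w) - moll r (z + 0 *\<^sub>R (y - z) - w)"
      by (rule integral_FTC_atLeastAtMost[OF _ der cont]) simp
    then show ?thesis by (simp add: k_def)
  qed
  have "conv_moll f r y - conv_moll f r z = (LINT w|lebesgue. (moll r (y - w) - moll r (z - w)) * f w)"
    unfolding conv_moll_def using integrable_mult_moll[OF f r, of y] integrable_mult_moll[OF f r, of z]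
    by (simp add: left_diff_distrib)
  also have "\<dots> = (LINT w|lebesgue. (LINT t|lborel. k (t, w)) * f w)" by (simp add: inner)
  also have "\<dots> = (LINT t|lborel. LINT w|lebesgue. k (t, w) * f w)"
    by (rule integral_swap_kernel[OF km f ui bound, symmetric])
  also have "\<dots> = (LINT t|lborel. indicator {0..1} t * (conv_grad_moll f r (z + t *\<^sub>R (y - z)) \<bullet> (y - z)))"
  proof (rule Bochner_Integration.integral_cong[OF refl])
    fix t :: real
    have "(LINT w|lebesgue. k (t, w) * f w) =
        indicator {0..1} t * (LINT w|lebesgue. (f w *\<^sub>R grad_moll r (z + t *\<^sub>R (y - z) - w)) \<bullet> (y - z))"
      unfolding k_def by (subst integral_mult_right_zero[symmetric]) (simp add: mult_ac)
    also have "(LINT w|lebesgue. (f w *\<^sub>R grad_moll r (z + t *\<^sub>R (y - z) - w)) \<bullet> (y - z)) =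
        conv_grad_moll f r (z + t *\<^sub>R (y - z)) \<bullet> (y - z)"
      unfolding conv_grad_moll_def by (rule integral_inner_left) (rule integrable_mult_grad_moll[OF f r])
    finally show "(LINT w|lebesgue. k (t, w) * f w) =
        indicator {0..1} t * (conv_grad_moll f r (z + t *\<^sub>R (y - z)) \<bullet> (y - z))" .
  qed
  finally show ?thesis .
qed

text \<open>The mollifier has integral 1, so the error is an integral of f(w) - f(p) against it. Its
  size is at most \<open>C\<close> divided by the volume of \<open>ball p r\<close>: the powers of
  \<open>r\<close> cancel, and the error is at most \<open>C\<close> times the mean oscillation at
  \<open>p\<close>.\<close>

lemma conv_moll_tendsto:
  fixes f :: "real^'n::finite \<Rightarrow> real"
  assumes f: "integrable lebesgue f"
    and p: "((\<lambda>r. avg (ball p r) (\<lambda>y. norm (f y - f p))) \<longlongrightarrow> 0) (at_right 0)"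
  shows "((\<lambda>r. conv_moll f r p) \<longlongrightarrow> f p) (at_right 0)"
proof -
  define C where "C = measure lebesgue (ball (0::real^'n) 1) / bump_mass TYPE('n)"
  have "((\<lambda>r. conv_moll f r p - f p) \<longlongrightarrow> 0) (at_right 0)"
  proof (rule Lim_null_comparison)
    show "((\<lambda>r. C * avg (ball p r) (\<lambda>y. norm (f y - f p))) \<longlongrightarrow> 0) (at_right 0)"
      using tendsto_mult[OF tendsto_const[of C] p] by simp
    show "\<forall>\<^sub>F r in at_right 0. norm (conv_moll f r p - f p) \<le> C * avg (ball p r) (\<lambda>y. norm (f y - f p))"
    proof (rule eventually_at_rightI[of 0 1])
      fix r :: real assume "r \<in> {0<..<1}"
      then have r: "0 < r" by simp
      let ?c = "1 / (r ^ CARD('n) * bump_mass TYPE('n))"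
      have i1: "integrable lebesgue (\<lambda>w. moll r (p - w))"
        using integrable_moll_shift[OF r, of p] by (simp add: integrable_completion borel_measurable_integrable)
      have one: "(LINT w|lebesgue. moll r (p - w)) = 1"
        using integral_moll_shift[OF r, of p] borel_measurable_moll_shift[of r p] by (simp add: integral_completion)
      have i2: "integrable lebesgue (\<lambda>w. moll r (p - w) * (f w - f p))"
        using integrable_mult_moll[OF f r, of p] i1 by (simp add: right_diff_distrib)
      have i3: "integrable lebesgue (\<lambda>w. indicator (ball p r) w *\<^sub>R norm (f w - f p))"
      proof -
        have "integrable lebesgue (\<lambda>w. indicator (ball p r) w *\<^sub>R f w)"
          using f by (intro integrable_mult_indicator) auto
        moreover have "integrable lebesgue (\<lambda>w. indicator (ball p r) w *\<^sub>R f p)"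
          by (intro integrable_scaleR_left integrable_real_indicator) (auto simp: emeasure_lborel_ball_finite[simplified])
        ultimately have "integrable lebesgue (\<lambda>w. norm (indicator (ball p r) w *\<^sub>R f w - indicator (ball p r) w *\<^sub>R f p))"
          by (intro integrable_norm Bochner_Integration.integrable_diff)
        then show ?thesis
          by (rule Bochner_Integration.integrable_cong[THEN iffD1, rotated 2]) (auto simp: indicator_def)
      qed
      have "conv_moll f r p - f p = (LINT w|lebesgue. moll r (p - w) * (f w - f p))"
        unfolding conv_moll_def using integrable_mult_moll[OF f r, of p] i1 one
        by (simp add: right_diff_distrib)
      then have "norm (conv_moll f r p - f p) \<le> (LINT w|lebesgue. norm (moll r (p - w) * (f w - f p)))"
        using integral_norm_bound by metis
      also have "\<dots> \<le> (LINT w|lebesgue. ?c * (indicator (ball p r) w *\<^sub>R norm (f w - f p)))"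
      proof (rule integral_mono)
        fix w
        show "norm (moll r (p - w) * (f w - f p)) \<le> ?c * (indicator (ball p r) w *\<^sub>R norm (f w - f p))"
        proof (cases "w \<in> ball p r")
          case True
          then show ?thesis using moll_nonneg[OF r, of "p - w"]
              mult_right_mono[OF moll_le[OF r, of "p - w"], of "\<bar>f w - f p\<bar>"]
            by (simp add: abs_mult)
        next
          case False
          then show ?thesis using moll_eq_0[OF r, of "p - w"] by (simp add: dist_norm)
        qed
      qed (use i2 i3 in \<open>auto intro: integrable_mult_right\<close>)
      also have "\<dots> = ?c * (measure lebesgue (ball p r) * avg (ball p r) (\<lambda>y. norm (f y - f p)))"
        using r content_ball_pos[OF r, of p] by (simp add: avg_def set_lebesgue_integral_def)
      also have "\<dots> = C * avg (ball p r) (\<lambda>y. norm (f y - f p))"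
        using r content_ball_conv_unit_ball[of r p] by (simp add: C_def)
      finally show "norm (conv_moll f r p - f p) \<le> C * avg (ball p r) (\<lambda>y. norm (f y - f p))" .
    qed simp
  qed
  then show ?thesis by (simp add: LIM_zero_iff)
qed

section \<open>The Poincare inequality on balls\<close>

text \<open>For \<open>t \<ge> 1/2\<close> substitute in the far end point, for \<open>t \<le> 1/2\<close> in the near one.\<close>

lemma nn_integral_segments_le:
  fixes g :: "'a::euclidean_space \<Rightarrow> ennreal"
  assumes [measurable]: "g \<in> borel_measurable borel" "B \<in> sets borel" and B: "convex B"
  shows "(\<integral>\<^sup>+z\<in>B. \<integral>\<^sup>+y\<in>B. \<integral>\<^sup>+t\<in>{0..1}. g (z + t *\<^sub>R (y - z)) \<partial>lborel \<partial>lborel \<partial>lborel)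
     \<le> 2 ^ DIM('a) * emeasure lborel B * (\<integral>\<^sup>+u\<in>B. g u \<partial>lborel)"
proof -
  let ?I = "\<integral>\<^sup>+u\<in>B. g u \<partial>lborel"
  let ?h = "\<lambda>z y t::real. g (z + t *\<^sub>R (y - z)) * indicator B y * indicator B z * indicator {0..1} t"
  have aff: "(\<integral>\<^sup>+y\<in>B. g (z + t *\<^sub>R (y - z)) \<partial>lborel) \<le> 2 ^ DIM('a) * ?I"
    if t: "1 / 2 \<le> t" "t \<le> 1" and z: "z \<in> B" for z t
  proof -
    have [measurable]: "(\<lambda>u. g u * indicator B u) \<in> borel_measurable borel" by measurable
    have sub: "z + t *\<^sub>R (y - z) \<in> B" if "y \<in> B" for y
    proof -
      have "z + t *\<^sub>R (y - z) = (1 - t) *\<^sub>R z + t *\<^sub>R y" by (simp add: algebra_simps)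
      then show ?thesis using convexD[OF B z that, of "1 - t" t] t by auto
    qed
    have "(\<integral>\<^sup>+y\<in>B. g (z + t *\<^sub>R (y - z)) \<partial>lborel) \<le>
        (\<integral>\<^sup>+y. g (z + t *\<^sub>R (y - z)) * indicator B (z + t *\<^sub>R (y - z)) \<partial>lborel)"
      using sub by (intro nn_integral_mono) (auto simp: indicator_def)
    also have "\<dots> = (\<integral>\<^sup>+y. g ((z - t *\<^sub>R z) + t *\<^sub>R y) * indicator B ((z - t *\<^sub>R z) + t *\<^sub>R y) \<partial>lborel)"
      by (simp add: algebra_simps)
    also have "\<dots> = 1 * \<dots>" by simp
    also have "\<dots> \<le> (ennreal (2 ^ DIM('a)) * ennreal (\<bar>t\<bar> ^ DIM('a))) *
        (\<integral>\<^sup>+y. g ((z - t *\<^sub>R z) + t *\<^sub>R y) * indicator B ((z - t *\<^sub>R z) + t *\<^sub>R y) \<partial>lborel)"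
    proof (rule mult_right_mono)
      have "1 \<le> (2 * \<bar>t\<bar>) ^ DIM('a)" using t by (intro one_le_power) auto
      then have "1 \<le> (2::real) ^ DIM('a) * \<bar>t\<bar> ^ DIM('a)" by (simp add: power_mult_distrib)
      then show "1 \<le> ennreal (2 ^ DIM('a)) * ennreal (\<bar>t\<bar> ^ DIM('a))"
        by (simp add: ennreal_mult[symmetric])
    qed simp
    also have "\<dots> = ennreal (2 ^ DIM('a)) * ?I"
      using t nn_integral_lborel_affine[of "\<lambda>u. g u * indicator B u" t "z - t *\<^sub>R z"]
      by (simp add: mult.assoc)
    finally show ?thesis by (simp add: ennreal_power[symmetric])
  qed
  \<comment> \<open>The estimate for one fixed \<open>t\<close>. The integral over \<open>t\<close>
    is made the outermost one below, because the end point to substitute is chosen according to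
    \<open>t\<close> alone.\<close>
  have t1: "(\<integral>\<^sup>+z. \<integral>\<^sup>+y. ?h z y t \<partial>lborel \<partial>lborel) \<le> 2 ^ DIM('a) * emeasure lborel B * ?I * indicator {0..1} t" for t
  proof -
    have half: "(\<integral>\<^sup>+z. \<integral>\<^sup>+y. ?h z y t \<partial>lborel \<partial>lborel) \<le> 2 ^ DIM('a) * emeasure lborel B * ?I"
      if t: "1 / 2 \<le> t" "t \<le> 1" for t
    proof -
      have "(\<integral>\<^sup>+z. \<integral>\<^sup>+y. ?h z y t \<partial>lborel \<partial>lborel) \<le> (\<integral>\<^sup>+z. (2 ^ DIM('a) * ?I) * indicator B z \<partial>lborel)"
      proof (rule nn_integral_mono)
        fix z show "(\<integral>\<^sup>+y. ?h z y t \<partial>lborel) \<le> 2 ^ DIM('a) * ?I * indicator B z"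
          using aff[OF t, of z] t by (cases "z \<in> B") auto
      qed
      also have "\<dots> = 2 ^ DIM('a) * emeasure lborel B * ?I"
        by (subst nn_integral_cmult_indicator) (simp_all add: mult_ac)
      finally show ?thesis .
    qed
    consider "t < 0 \<or> 1 < t" | "1 / 2 \<le> t" "t \<le> 1" | "0 \<le> t" "t < 1 / 2" by linarith
    then show ?thesis
    proof cases
      case 3
      have "(\<integral>\<^sup>+z. \<integral>\<^sup>+y. ?h z y t \<partial>lborel \<partial>lborel) = (\<integral>\<^sup>+y. \<integral>\<^sup>+z. ?h z y t \<partial>lborel \<partial>lborel)"
        by (rule lborel_pair.Fubini') measurable
      also have "\<dots> = (\<integral>\<^sup>+y. \<integral>\<^sup>+z. ?h y z (1 - t) \<partial>lborel \<partial>lborel)"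
      proof (rule nn_integral_cong, rule nn_integral_cong)
        fix y z :: 'a
        have "z + t *\<^sub>R (y - z) = y + (1 - t) *\<^sub>R (z - y)" by (simp add: algebra_simps)
        then show "?h z y t = ?h y z (1 - t)" using 3 by (simp add: mult_ac)
      qed
      also have "\<dots> \<le> 2 ^ DIM('a) * emeasure lborel B * ?I" by (rule half) (use 3 in auto)
      finally show ?thesis using 3 by simp
    qed (use half in auto)
  qed
  have "(\<integral>\<^sup>+z\<in>B. \<integral>\<^sup>+y\<in>B. \<integral>\<^sup>+t\<in>{0..1}. g (z + t *\<^sub>R (y - z)) \<partial>lborel \<partial>lborel \<partial>lborel) =
      (\<integral>\<^sup>+z. \<integral>\<^sup>+y. \<integral>\<^sup>+t. ?h z y t \<partial>lborel \<partial>lborel \<partial>lborel)"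
  proof (rule nn_integral_cong)
    fix z
    have "(\<integral>\<^sup>+t. ?h z y t \<partial>lborel) =
        (\<integral>\<^sup>+t\<in>{0..1}. g (z + t *\<^sub>R (y - z)) \<partial>lborel) * indicator B y * indicator B z" for y
    proof -
      have "(\<integral>\<^sup>+t. ?h z y t \<partial>lborel) =
          (\<integral>\<^sup>+t. (g (z + t *\<^sub>R (y - z)) * indicator {0..1} t) * (indicator B y * indicator B z) \<partial>lborel)"
        by (intro nn_integral_cong) (simp add: mult_ac)
      also have "\<dots> = (\<integral>\<^sup>+t\<in>{0..1}. g (z + t *\<^sub>R (y - z)) \<partial>lborel) * (indicator B y * indicator B z)"
        by (rule nn_integral_multc) measurable
      finally show ?thesis by (simp add: mult_ac)
    qed
    then show "(\<integral>\<^sup>+y\<in>B. \<integral>\<^sup>+t\<in>{0..1}. g (z + t *\<^sub>R (y - z)) \<partial>lborel \<partial>lborel) * indicator B z =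
        (\<integral>\<^sup>+y. \<integral>\<^sup>+t. ?h z y t \<partial>lborel \<partial>lborel)"
      by (simp only:) (rule nn_integral_multc[symmetric], measurable)
  qed
  also have "\<dots> = (\<integral>\<^sup>+z. \<integral>\<^sup>+t. \<integral>\<^sup>+y. ?h z y t \<partial>lborel \<partial>lborel \<partial>lborel)"
    by (rule nn_integral_cong, rule lborel_pair.Fubini'[symmetric]) measurable
  also have "\<dots> = (\<integral>\<^sup>+t. \<integral>\<^sup>+z. \<integral>\<^sup>+y. ?h z y t \<partial>lborel \<partial>lborel \<partial>lborel)"
    by (rule lborel_pair.Fubini'[symmetric]) measurable
  also have "\<dots> \<le> (\<integral>\<^sup>+t. 2 ^ DIM('a) * emeasure lborel B * ?I * indicator {0..1} t \<partial>(lborel :: real measure))"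
    by (rule nn_integral_mono) (rule t1)
  also have "\<dots> = 2 ^ DIM('a) * emeasure lborel B * ?I"
    by (subst nn_integral_cmult_indicator) auto
  finally show ?thesis .
qed

text \<open>Compactness puts an e-neighbourhood of the closed ball into \<Omega>; a point at
  distance between r and r + e from the centre is within e of its radial projection onto the
  sphere.\<close>

lemma cball_enlarge:
  fixes x :: "'a::euclidean_space"
  assumes "open \<Omega>" "cball x r \<subseteq> \<Omega>" "0 < r"
  obtains r' where "r < r'" "cball x r' \<subseteq> \<Omega>"
proof -
  obtain e where e: "e > 0" "(\<Union>y\<in>cball x r. cball y e) \<subseteq> \<Omega>"
    using compact_subset_open_imp_cball_epsilon_subset[of "cball x r" \<Omega>] assms by auto
  have "y \<in> \<Omega>" if y: "dist x y \<le> r + e" for y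
  proof (cases "dist x y \<le> r")
    case True
    then show ?thesis using assms by auto
  next
    case False
    define z where "z = x + (r / dist x y) *\<^sub>R (y - x)"
    have d: "0 < dist x y" using False assms(3) by linarith
    have "dist x z = r" using d assms(3) by (simp add: z_def dist_norm norm_minus_commute)
    moreover have "dist z y \<le> e"
    proof -
      have "y - z = (1 - r / dist x y) *\<^sub>R (y - x)" by (simp add: z_def algebra_simps)
      then have "dist z y = \<bar>1 - r / dist x y\<bar> * dist x y"
        by (simp add: dist_norm norm_minus_commute)
      also have "\<dots> = dist x y - r" using False d by (simp add: field_simps abs_if)
      finally show ?thesis using y by simp
    qed
    ultimately have "y \<in> (\<Union>y\<in>cball x r. cball y e)" by auto
    then show ?thesis using e by blast
  qed
  then have "cball x (r + e) \<subseteq> \<Omega>" by auto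
  then show thesis using that[of "r + e"] e(1) by simp
qed

lemma locally_integrable_on_compact:
  "f locally_integrable_on \<Omega> \<Longrightarrow> compact K \<Longrightarrow> K \<subseteq> \<Omega> \<Longrightarrow> integrable lebesgue (\<lambda>x. indicator K x *\<^sub>R f x)"
  unfolding locally_integrable_on_def set_integrable_def by blast

lemma integrable_imp_locally_integrable_on:
  "integrable lebesgue f \<Longrightarrow> f locally_integrable_on \<Omega>"
  unfolding locally_integrable_on_def set_integrable_def
  by (auto intro!: integrable_mult_indicator lmeasurable_compact fmeasurableD)

text \<open>The weak gradient is tested with the mollifier centred at \<open>p\<close>. Its
  derivative in \<open>w\<close> is minus \<open>grad_moll\<close>, and the two minus signs cancel.
  The cut-off at \<open>K\<close> provides global integrability and is harmless, since the kernel
  vanishes outside \<open>cball p \<delta>\<close>.\<close>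

lemma conv_grad_moll_weak_gradient:
  fixes f :: "real^'n::finite \<Rightarrow> real"
  assumes f: "f locally_integrable_on \<Omega>" and G: "weak_gradient \<Omega> f G"
    and K: "compact K" "K \<subseteq> \<Omega>" and \<delta>: "0 < \<delta>" "cball p \<delta> \<subseteq> K"
  shows "conv_grad_moll (\<lambda>w. indicator K w *\<^sub>R f w) \<delta> p =
    (LINT w|lebesgue. moll \<delta> (p - w) *\<^sub>R (indicator K w *\<^sub>R G w))"
proof -
  have Gl: "G locally_integrable_on \<Omega>" using G by (simp add: weak_gradient_def)
  have Fi: "integrable lebesgue (\<lambda>w. indicator K w *\<^sub>R f w)" by (rule locally_integrable_on_compact[OF f K])
  have Hi: "integrable lebesgue (\<lambda>w. indicator K w *\<^sub>R G w)" by (rule locally_integrable_on_compact[OF Gl K])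
  let ?\<eta> = "\<lambda>w. moll \<delta> (p - w)"
  have t: "test_function \<Omega> ?\<eta>" by (rule test_function_moll_shift) (use \<delta> K in auto)
  have out: "grad_moll \<delta> (p - w) = 0" "moll \<delta> (p - w) = 0" if "w \<notin> K" for w
  proof -
    have "\<delta> \<le> norm (p - w)" using that \<delta> by (force simp: dist_norm)
    then show "grad_moll \<delta> (p - w) = 0" "moll \<delta> (p - w) = 0" using grad_moll_eq_0 moll_eq_0 \<delta> by auto
  qed
  have "conv_grad_moll (\<lambda>w. indicator K w *\<^sub>R f w) \<delta> p $ i =
    (LINT w|lebesgue. moll \<delta> (p - w) *\<^sub>R (indicator K w *\<^sub>R G w)) $ i" for i
  proof -
    have "conv_grad_moll (\<lambda>w. indicator K w *\<^sub>R f w) \<delta> p $ i =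
        (LINT w|lebesgue. ((indicator K w *\<^sub>R f w) *\<^sub>R grad_moll \<delta> (p - w)) $ i)"
      unfolding conv_grad_moll_def
      by (rule integral_bounded_linear[OF bounded_linear_vec_nth integrable_mult_grad_moll[OF Fi \<delta>(1)], symmetric])
    also have "\<dots> = (LINT w|lebesgue. - (indicator \<Omega> w *\<^sub>R (f w * partial_deriv i ?\<eta> w)))"
    proof (rule Bochner_Integration.integral_cong[OF refl])
      fix w show "((indicator K w *\<^sub>R f w) *\<^sub>R grad_moll \<delta> (p - w)) $ i = - (indicator \<Omega> w *\<^sub>R (f w * partial_deriv i ?\<eta> w))"
        using K(2) out[of w] partial_deriv_moll_shift[OF \<delta>(1), of i p w] by (auto simp: indicator_def)
    qed
    also have "\<dots> = - (LINT w:\<Omega>|lebesgue. f w * partial_deriv i ?\<eta> w)"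
      by (simp add: set_lebesgue_integral_def)
    also have "\<dots> = (LINT w:\<Omega>|lebesgue. G w $ i * ?\<eta> w)"
      using G t by (simp add: weak_gradient_def)
    also have "\<dots> = (LINT w|lebesgue. (moll \<delta> (p - w) *\<^sub>R (indicator K w *\<^sub>R G w)) $ i)"
      unfolding set_lebesgue_integral_def
    proof (rule Bochner_Integration.integral_cong[OF refl])
      fix w show "indicator \<Omega> w *\<^sub>R (G w $ i * ?\<eta> w) = (moll \<delta> (p - w) *\<^sub>R (indicator K w *\<^sub>R G w)) $ i"
        using K(2) out[of w] by (auto simp: indicator_def)
    qed
    also have "\<dots> = (LINT w|lebesgue. moll \<delta> (p - w) *\<^sub>R (indicator K w *\<^sub>R G w)) $ i"
      by (rule integral_bounded_linear[OF bounded_linear_vec_nth integrable_mult_moll[OF Hi \<delta>(1)]])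
    finally show ?thesis .
  qed
  then show ?thesis by (simp add: vec_eq_iff)
qed

lemma nn_integral_moll_shift:
  assumes "0 < r"
  shows "(\<integral>\<^sup>+p. ennreal (moll r (p - w :: real^'n::finite)) \<partial>lborel) = 1"
proof -
  note [measurable] = borel_measurable_moll_shift[of r 0]
  have "(\<lambda>p. ennreal (moll r (0 - p))) \<in> borel_measurable borel" by measurable
  from nn_integral_lborel_reflect[OF this, of w]
  have "(\<integral>\<^sup>+p. ennreal (moll r (p - w)) \<partial>lborel) = (\<integral>\<^sup>+p. ennreal (moll r (0 - p :: real^'n)) \<partial>lborel)"
    by simp
  also have "\<dots> = ennreal (LINT p|lborel. moll r (0 - p :: real^'n))"
    by (rule nn_integral_eq_integral[OF integrable_moll_shift[OF assms]]) (use moll_nonneg[OF assms] in auto)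
  finally show ?thesis using integral_moll_shift[OF assms, of "0 :: real^'n"] by simp
qed

text \<open>By Tonelli each \<open>w\<close> is counted with the mollifier mass seen from
  \<open>ball x r\<close>. This mass is at most 1, and it is 0 when \<open>w\<close> is further than
  r + \<delta> from \<open>x\<close>.\<close>

lemma nn_integral_norm_conv_le:
  fixes H :: "real^'n::finite \<Rightarrow> real^'n"
  assumes H: "integrable lebesgue H" and \<delta>: "0 < \<delta>"
    and D: "\<And>p. p \<in> ball x r \<Longrightarrow> D p = (LINT w|lebesgue. moll \<delta> (p - w) *\<^sub>R H w)"
  shows "(\<integral>\<^sup>+p\<in>ball x r. ennreal (norm (D p)) \<partial>lborel) \<le>
     (\<integral>\<^sup>+w\<in>ball x (r + \<delta>). ennreal (norm (H w)) \<partial>lebesgue)"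
proof -
  define k where "k q = indicator (ball x r) (fst q) * ennreal (moll \<delta> (fst q - snd q))" for q :: "(real^'n) \<times> (real^'n)"
  have "(\<lambda>q::(real^'n) \<times> (real^'n). moll \<delta> (fst q - snd q)) \<in> borel_measurable borel"
    by (intro borel_measurable_continuous_onI continuous_on_compose2[OF continuous_on_moll[of UNIV]] continuous_intros) auto
  moreover have "(\<lambda>q::(real^'n) \<times> (real^'n). indicator (ball x r) (fst q) :: ennreal) \<in> borel_measurable borel"
  proof -
    have f: "(fst :: (real^'n) \<times> (real^'n) \<Rightarrow> real^'n) \<in> borel_measurable borel"
      by (intro borel_measurable_continuous_onI continuous_intros)
    have "(indicator (ball x r) :: _ \<Rightarrow> ennreal) \<in> borel_measurable borel"
      by (intro borel_measurable_indicator borel_open) auto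
    from measurable_compose[OF f this] show ?thesis .
  qed
  ultimately have km: "k \<in> borel_measurable borel"
    unfolding k_def[abs_def] by (intro borel_measurable_times_ennreal) auto
  have Hm: "(\<lambda>w. ennreal (norm (H w))) \<in> borel_measurable lebesgue" using H by measurable
  have kle: "(\<integral>\<^sup>+p. k (p, w) \<partial>lebesgue) \<le> indicator (ball x (r + \<delta>)) w" for w
  proof (cases "w \<in> ball x (r + \<delta>)")
    case True
    have "(\<integral>\<^sup>+p. k (p, w) \<partial>lebesgue) \<le> (\<integral>\<^sup>+p. ennreal (moll \<delta> (p - w)) \<partial>lebesgue)"
      by (intro nn_integral_mono) (auto simp: k_def indicator_def)
    then show ?thesis using True by (simp add: nn_integral_completion nn_integral_moll_shift[OF \<delta>])
  next
    case False
    have "k (p, w) = 0" for p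
    proof (cases "p \<in> ball x r")
      case True
      then have "\<delta> \<le> norm (p - w)" using False dist_triangle[of x w p] by (simp add: dist_norm[symmetric])
      then have "moll \<delta> (p - w) = 0" by (rule moll_eq_0[OF \<delta>])
      then show ?thesis by (simp add: k_def)
    qed (simp add: k_def)
    then show ?thesis by simp
  qed
  have "(\<integral>\<^sup>+p\<in>ball x r. ennreal (norm (D p)) \<partial>lborel) \<le> (\<integral>\<^sup>+p. \<integral>\<^sup>+w. k (p, w) * ennreal (norm (H w)) \<partial>lebesgue \<partial>lborel)"
  proof (rule nn_integral_mono)
    fix p
    show "ennreal (norm (D p)) * indicator (ball x r) p \<le> (\<integral>\<^sup>+w. k (p, w) * ennreal (norm (H w)) \<partial>lebesgue)"
    proof (cases "p \<in> ball x r")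
      case True
      have "ennreal (norm (D p)) \<le> (\<integral>\<^sup>+w. ennreal (norm (moll \<delta> (p - w) *\<^sub>R H w)) \<partial>lebesgue)"
        unfolding D[OF True] by (rule integral_norm_bound_ennreal[OF integrable_mult_moll[OF H \<delta>]])
      also have "\<dots> = (\<integral>\<^sup>+w. k (p, w) * ennreal (norm (H w)) \<partial>lebesgue)"
        using True by (intro nn_integral_cong) (simp add: k_def ennreal_mult moll_nonneg[OF \<delta>])
      finally show ?thesis using True by simp
    qed simp
  qed
  also have "\<dots> = (\<integral>\<^sup>+w. (\<integral>\<^sup>+p. k (p, w) \<partial>lebesgue) * ennreal (norm (H w)) \<partial>lebesgue)"
    using nn_integral_swap_kernel[OF km Hm] by (simp add: nn_integral_completion)
  also have "\<dots> \<le> (\<integral>\<^sup>+w\<in>ball x (r + \<delta>). ennreal (norm (H w)) \<partial>lebesgue)"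
    by (rule nn_integral_mono) (subst mult.commute, intro mult_left_mono kle, simp)
  finally show ?thesis .
qed

text \<open>Write the difference as an integral of the gradient along the segment, use |y - z| \<le>
  2r, and average over all segments in the ball.\<close>

lemma nn_integral_differences_le:
  fixes F :: "real^'n::finite \<Rightarrow> real"
  assumes F: "integrable lebesgue F" and \<delta>: "0 < \<delta>" and r: "0 < r"
  shows "(\<integral>\<^sup>+z\<in>ball x r. \<integral>\<^sup>+y\<in>ball x r. ennreal \<bar>conv_moll F \<delta> y - conv_moll F \<delta> z\<bar> \<partial>lborel \<partial>lborel)
    \<le> ennreal (2 * r) * (2 ^ CARD('n) * emeasure lborel (ball x r) *
       (\<integral>\<^sup>+p\<in>ball x r. ennreal (norm (conv_grad_moll F \<delta> p)) \<partial>lborel))"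
proof -
  let ?B = "ball x r" and ?D = "conv_grad_moll F \<delta>"
  have [measurable]: "?D \<in> borel_measurable borel"
    by (intro borel_measurable_continuous_onI continuous_at_imp_continuous_on ballI isCont_conv_grad_moll F \<delta>)
  have [measurable]: "?B \<in> sets borel" by simp
  let ?g = "\<lambda>p. ennreal (norm (?D p))"
  have pt: "ennreal \<bar>conv_moll F \<delta> y - conv_moll F \<delta> z\<bar> * indicator ?B y * indicator ?B z \<le>
     ennreal (2 * r) * ((\<integral>\<^sup>+t\<in>{0..1}. ?g (z + t *\<^sub>R (y - z)) \<partial>lborel) * indicator ?B y * indicator ?B z)" for y z
  proof (cases "y \<in> ?B \<and> z \<in> ?B")
    case True
    then have yz: "norm (y - z) \<le> 2 * r"
      using dist_triangle[of y z x] by (simp add: dist_norm[symmetric] dist_commute)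
    let ?u = "\<lambda>t::real. indicator {0..1} t * (?D (z + t *\<^sub>R (y - z)) \<bullet> (y - z))"
    have "ennreal \<bar>LINT t|lborel. ?u t\<bar> \<le> (\<integral>\<^sup>+t. ennreal \<bar>?u t\<bar> \<partial>lborel)"
      using integral_norm_bound_ennreal[of lborel ?u]
      by (cases "integrable lborel ?u") (auto simp: not_integrable_integral_eq)
    also have "\<dots> \<le> (\<integral>\<^sup>+t. ennreal (2 * r) * (?g (z + t *\<^sub>R (y - z)) * indicator {0..1} t) \<partial>lborel)"
    proof (rule nn_integral_mono)
      fix t
      have "\<bar>?D (z + t *\<^sub>R (y - z)) \<bullet> (y - z)\<bar> \<le> norm (?D (z + t *\<^sub>R (y - z))) * norm (y - z)"
        by (rule Cauchy_Schwarz_ineq2)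
      also have "\<dots> \<le> norm (?D (z + t *\<^sub>R (y - z))) * (2 * r)" by (intro mult_left_mono yz) simp
      finally have "ennreal \<bar>?D (z + t *\<^sub>R (y - z)) \<bullet> (y - z)\<bar> \<le> ennreal (2 * r) * ?g (z + t *\<^sub>R (y - z))"
        using r by (simp add: ennreal_mult[symmetric] mult.commute ennreal_leI)
      then show "ennreal \<bar>?u t\<bar> \<le> ennreal (2 * r) * (?g (z + t *\<^sub>R (y - z)) * indicator {0..1} t)"
        by (simp add: indicator_def)
    qed
    also have "\<dots> = ennreal (2 * r) * (\<integral>\<^sup>+t\<in>{0..1}. ?g (z + t *\<^sub>R (y - z)) \<partial>lborel)"
      by (rule nn_integral_cmult) measurable
    finally show ?thesis using True by (simp add: conv_moll_diff[OF F \<delta>])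
  qed auto
  have "(\<integral>\<^sup>+z\<in>?B. \<integral>\<^sup>+y\<in>?B. ennreal \<bar>conv_moll F \<delta> y - conv_moll F \<delta> z\<bar> \<partial>lborel \<partial>lborel) \<le>
     (\<integral>\<^sup>+z. ennreal (2 * r) * ((\<integral>\<^sup>+y\<in>?B. \<integral>\<^sup>+t\<in>{0..1}. ?g (z + t *\<^sub>R (y - z)) \<partial>lborel \<partial>lborel) * indicator ?B z) \<partial>lborel)"
  proof (rule nn_integral_mono)
    fix z
    show "(\<integral>\<^sup>+y\<in>?B. ennreal \<bar>conv_moll F \<delta> y - conv_moll F \<delta> z\<bar> \<partial>lborel) * indicator ?B z \<le>
      ennreal (2 * r) * ((\<integral>\<^sup>+y\<in>?B. \<integral>\<^sup>+t\<in>{0..1}. ?g (z + t *\<^sub>R (y - z)) \<partial>lborel \<partial>lborel) * indicator ?B z)"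
    proof (cases "z \<in> ?B")
      case True
      have "(\<integral>\<^sup>+y\<in>?B. ennreal \<bar>conv_moll F \<delta> y - conv_moll F \<delta> z\<bar> \<partial>lborel) \<le>
        (\<integral>\<^sup>+y. ennreal (2 * r) * ((\<integral>\<^sup>+t\<in>{0..1}. ?g (z + t *\<^sub>R (y - z)) \<partial>lborel) * indicator ?B y) \<partial>lborel)"
        using pt[of _ z] True by (intro nn_integral_mono) simp
      also have "\<dots> = ennreal (2 * r) * (\<integral>\<^sup>+y\<in>?B. \<integral>\<^sup>+t\<in>{0..1}. ?g (z + t *\<^sub>R (y - z)) \<partial>lborel \<partial>lborel)"
        by (rule nn_integral_cmult) measurable
      finally show ?thesis using True by simp
    qed simp
  qed
  also have "\<dots> = ennreal (2 * r) * (\<integral>\<^sup>+z\<in>?B. \<integral>\<^sup>+y\<in>?B. \<integral>\<^sup>+t\<in>{0..1}. ?g (z + t *\<^sub>R (y - z)) \<partial>lborel \<partial>lborel \<partial>lborel)"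
    by (rule nn_integral_cmult) measurable
  also have "\<dots> \<le> ennreal (2 * r) * (2 ^ CARD('n) * emeasure lborel ?B * (\<integral>\<^sup>+p\<in>?B. ?g p \<partial>lborel))"
    using nn_integral_segments_le[of ?g ?B] by (intro mult_left_mono) auto
  finally show ?thesis .
qed

text \<open>The inequality for mollified functions is passed to the limit. On the left the
  mollifications converge only almost everywhere, so Fatou is used in \<open>y\<close> for each good
  \<open>z\<close> and then in \<open>z\<close>. On the right the balls of radius r + \<delta>
  shrink to the closed ball, whose boundary sphere is a null set.\<close>

lemma nn_integral_differences_weak_gradient:
  fixes f :: "real^'n::finite \<Rightarrow> real"
  assumes \<Omega>: "open \<Omega>" and f: "f locally_integrable_on \<Omega>" and G: "weak_gradient \<Omega> f G"
    and r: "0 < r" and sub: "cball x r \<subseteq> \<Omega>"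
  shows "(\<integral>\<^sup>+z\<in>ball x r. \<integral>\<^sup>+y\<in>ball x r. ennreal \<bar>f y - f z\<bar> \<partial>lebesgue \<partial>lebesgue)
    \<le> ennreal (2 * r) * (2 ^ CARD('n) * emeasure lborel (ball x r) *
       (\<integral>\<^sup>+p\<in>ball x r. ennreal (norm (G p)) \<partial>lebesgue))"
proof -
  obtain r' where r': "r < r'" "cball x r' \<subseteq> \<Omega>" using cball_enlarge[OF \<Omega> sub r] by blast
  let ?B = "ball x r"
  define K where "K = cball x r'"
  have K: "compact K" "K \<subseteq> \<Omega>" using r' by (auto simp: K_def)
  have Gl: "G locally_integrable_on \<Omega>" using G by (simp add: weak_gradient_def)
  define F where "F = (\<lambda>w. indicator K w *\<^sub>R f w)"
  define H where "H = (\<lambda>w. indicator K w *\<^sub>R G w)"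
  have Fi: "integrable lebesgue F" unfolding F_def by (rule locally_integrable_on_compact[OF f K])
  have Hi: "integrable lebesgue H" unfolding H_def by (rule locally_integrable_on_compact[OF Gl K])
  have BK: "?B \<subseteq> K" using r' by (auto simp: K_def)
  define \<delta> where "\<delta> j = (r' - r) / (real j + 2)" for j :: nat
  have \<delta>: "0 < \<delta> j" "r + \<delta> j \<le> r'" for j
  proof -
    show "0 < \<delta> j" using r' by (simp add: \<delta>_def)
    have "(r' - r) / (real j + 2) \<le> (r' - r) / 1" using r' by (intro divide_left_mono) auto
    then show "r + \<delta> j \<le> r'" by (simp add: \<delta>_def)
  qed
  have \<delta>0: "\<delta> \<longlonglongrightarrow> 0"
  proof -
    have "(\<lambda>j. inverse (real (Suc (Suc j)))) \<longlonglongrightarrow> 0"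
      using LIMSEQ_inverse_real_of_nat by (rule LIMSEQ_Suc)
    from tendsto_mult[OF tendsto_const[of "r' - r"] this]
    show ?thesis unfolding \<delta>_def by (simp add: divide_inverse add.commute)
  qed
  then have \<delta>r: "filterlim \<delta> (at_right 0) sequentially"
    using \<delta>(1) less_imp_neq[OF \<delta>(1), symmetric] by (auto simp: filterlim_at intro!: always_eventually)
  let ?C = "ennreal (2 * r) * (2 ^ CARD('n) * emeasure lborel ?B)"
  have Cfin: "?C < top"
    using emeasure_lborel_ball_finite[of x r]
    by (auto simp: ennreal_mult_less_top power_less_top_ennreal)
  define T where "T j = (\<integral>\<^sup>+w\<in>ball x (r + \<delta> j). ennreal (norm (H w)) \<partial>lebesgue)" for j
  have Hm[measurable]: "H \<in> borel_measurable lebesgue" using Hi by auto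
  have Tlim: "T \<longlonglongrightarrow> (\<integral>\<^sup>+w\<in>cball x r. ennreal (norm (H w)) \<partial>lebesgue)"
    unfolding T_def
  proof (rule nn_integral_dominated_convergence[where w="\<lambda>w. ennreal (norm (H w))"])
    show "AE w in lebesgue. (\<lambda>j. ennreal (norm (H w)) * indicator (ball x (r + \<delta> j)) w)
        \<longlonglongrightarrow> ennreal (norm (H w)) * indicator (cball x r) w"
    proof (intro AE_I2)
      fix w
      have "\<forall>\<^sub>F j in sequentially. indicator (ball x (r + \<delta> j)) w = (indicator (cball x r) w :: ennreal)"
      proof (cases "dist x w \<le> r")
        case True
        then have "w \<in> ball x (r + \<delta> j)" for j using \<delta>(1)[of j] by simp
        then show ?thesis using True by simp
      next
        case False
        then have "\<forall>\<^sub>F j in sequentially. \<delta> j < dist x w - r"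
          using order_tendstoD(2)[OF \<delta>0] by simp
        then show ?thesis by eventually_elim (use False in \<open>simp add: indicator_def\<close>)
      qed
      then have "\<forall>\<^sub>F j in sequentially. ennreal (norm (H w)) * indicator (ball x (r + \<delta> j)) w =
          ennreal (norm (H w)) * indicator (cball x r) w"
        by eventually_elim simp
      then show "(\<lambda>j. ennreal (norm (H w)) * indicator (ball x (r + \<delta> j)) w)
        \<longlonglongrightarrow> ennreal (norm (H w)) * indicator (cball x r) w"
        by (rule tendsto_eventually)
    qed
    show "(\<integral>\<^sup>+w. ennreal (norm (H w)) \<partial>lebesgue) < \<infinity>"
      using Hi by (simp add: integrable_iff_bounded)
    show "AE w in lebesgue. ennreal (norm (H w)) * indicator (ball x (r + \<delta> j)) w \<le> ennreal (norm (H w))" for j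
      by (auto simp: indicator_def)
  qed (auto intro!: borel_measurable_times_ennreal borel_measurable_indicator measurable_compose[OF Hm])
  have Tinf: "(\<integral>\<^sup>+w\<in>cball x r. ennreal (norm (H w)) \<partial>lebesgue) = (\<integral>\<^sup>+p\<in>?B. ennreal (norm (G p)) \<partial>lebesgue)"
  proof (rule nn_integral_cong_AE)
    show "AE w in lebesgue. ennreal (norm (H w)) * indicator (cball x r) w = ennreal (norm (G w)) * indicator ?B w"
      using AE_not_sphere[of x r]
    proof eventually_elim
      case (elim w)
      then show ?case using BK by (auto simp: H_def indicator_def)
    qed
  qed
  define Fj where "Fj j = conv_moll F (\<delta> j)" for j
  have Fjm[measurable]: "Fj j \<in> borel_measurable borel" for j
    unfolding Fj_def
    by (intro borel_measurable_continuous_onI continuous_at_imp_continuous_on ballI isCont_conv_moll Fi \<delta>)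
  have main: "(\<integral>\<^sup>+z\<in>?B. \<integral>\<^sup>+y\<in>?B. ennreal \<bar>Fj j y - Fj j z\<bar> \<partial>lborel \<partial>lborel) \<le> ?C * T j" for j
  proof -
    have "(\<integral>\<^sup>+p\<in>?B. ennreal (norm (conv_grad_moll F (\<delta> j) p)) \<partial>lborel) \<le> T j"
      unfolding T_def
    proof (rule nn_integral_norm_conv_le[OF Hi \<delta>(1)])
      fix p assume p: "p \<in> ?B"
      have "cball p (\<delta> j) \<subseteq> K"
      proof
        fix w assume "w \<in> cball p (\<delta> j)"
        then show "w \<in> K" using p \<delta>(2)[of j] dist_triangle[of x w p] by (simp add: K_def)
      qed
      then show "conv_grad_moll F (\<delta> j) p = (LINT w|lebesgue. moll (\<delta> j) (p - w) *\<^sub>R H w)"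
        unfolding F_def H_def by (rule conv_grad_moll_weak_gradient[OF f G K \<delta>(1)])
    qed
    then have "ennreal (2 * r) * (2 ^ CARD('n) * emeasure lborel ?B *
       (\<integral>\<^sup>+p\<in>?B. ennreal (norm (conv_grad_moll F (\<delta> j) p)) \<partial>lborel)) \<le> ?C * T j"
      unfolding mult.assoc by (intro mult_left_mono) auto
    then show ?thesis
      using nn_integral_differences_le[OF Fi \<delta>(1)[of j] r, of x] unfolding Fj_def by (rule order_trans[rotated])
  qed
  have good: "AE z in lebesgue. (\<lambda>j. Fj j z) \<longlonglongrightarrow> F z"
    using AE_lebesgue_point[OF open_UNIV integrable_imp_locally_integrable_on[OF Fi]]
  proof eventually_elim
    case (elim z)
    then have "((\<lambda>r. conv_moll F r z) \<longlongrightarrow> F z) (at_right 0)" by (intro conv_moll_tendsto[OF Fi]) simp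
    then show ?case unfolding Fj_def by (rule filterlim_compose[OF _ \<delta>r])
  qed
  have inner: "(\<integral>\<^sup>+y\<in>?B. ennreal \<bar>F y - F z\<bar> \<partial>lebesgue) \<le>
      liminf (\<lambda>j. \<integral>\<^sup>+y\<in>?B. ennreal \<bar>Fj j y - Fj j z\<bar> \<partial>lborel)" if z: "(\<lambda>j. Fj j z) \<longlonglongrightarrow> F z" for z
  proof -
    have "(\<integral>\<^sup>+y\<in>?B. ennreal \<bar>F y - F z\<bar> \<partial>lebesgue) \<le>
        (\<integral>\<^sup>+y. liminf (\<lambda>j. ennreal \<bar>Fj j y - Fj j z\<bar> * indicator ?B y) \<partial>lebesgue)"
    proof (rule nn_integral_mono_AE)
      show "AE y in lebesgue. ennreal \<bar>F y - F z\<bar> * indicator ?B y \<le> liminf (\<lambda>j. ennreal \<bar>Fj j y - Fj j z\<bar> * indicator ?B y)"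
        using good
      proof eventually_elim
        case (elim y)
        have "(\<lambda>j. ennreal \<bar>Fj j y - Fj j z\<bar>) \<longlonglongrightarrow> ennreal \<bar>F y - F z\<bar>"
          by (intro tendsto_ennrealI tendsto_intros elim z)
        then have "(\<lambda>j. ennreal \<bar>Fj j y - Fj j z\<bar> * indicator ?B y) \<longlonglongrightarrow> ennreal \<bar>F y - F z\<bar> * indicator ?B y"
          by (cases "y \<in> ?B") auto
        from lim_imp_Liminf[OF _ this] show ?case by simp
      qed
    qed
    also have "\<dots> \<le> liminf (\<lambda>j. \<integral>\<^sup>+y\<in>?B. ennreal \<bar>Fj j y - Fj j z\<bar> \<partial>lebesgue)"
      by (rule nn_integral_liminf, rule borel_measurable_lebesgueI, rule borel_measurable_times_ennreal)
        (auto intro!: borel_measurable_indicator borel_open)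
    finally show ?thesis by (simp add: nn_integral_completion)
  qed
  have [measurable]: "?B \<in> sets borel" by simp
  have FjB: "(\<lambda>z. \<integral>\<^sup>+y\<in>?B. ennreal \<bar>Fj j y - Fj j z\<bar> \<partial>lborel) \<in> borel_measurable borel" for j
  proof -
    have "(\<lambda>z. \<integral>\<^sup>+y\<in>?B. ennreal \<bar>Fj j y - Fj j z\<bar> \<partial>lborel) \<in> borel_measurable lborel"
      by measurable
    then show ?thesis by simp
  qed
  have FjBm: "(\<lambda>z. (\<integral>\<^sup>+y\<in>?B. ennreal \<bar>Fj j y - Fj j z\<bar> \<partial>lborel) * indicator ?B z) \<in> borel_measurable lebesgue" for j
    by (intro borel_measurable_lebesgueI borel_measurable_times_ennreal FjB borel_measurable_indicator) simp
  have "(\<integral>\<^sup>+z\<in>?B. \<integral>\<^sup>+y\<in>?B. ennreal \<bar>f y - f z\<bar> \<partial>lebesgue \<partial>lebesgue) =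
      (\<integral>\<^sup>+z\<in>?B. \<integral>\<^sup>+y\<in>?B. ennreal \<bar>F y - F z\<bar> \<partial>lebesgue \<partial>lebesgue)"
  proof (rule nn_integral_cong)
    fix z
    show "(\<integral>\<^sup>+y\<in>?B. ennreal \<bar>f y - f z\<bar> \<partial>lebesgue) * indicator ?B z = (\<integral>\<^sup>+y\<in>?B. ennreal \<bar>F y - F z\<bar> \<partial>lebesgue) * indicator ?B z"
    proof (cases "z \<in> ?B")
      case True
      have "(\<integral>\<^sup>+y\<in>?B. ennreal \<bar>f y - f z\<bar> \<partial>lebesgue) = (\<integral>\<^sup>+y\<in>?B. ennreal \<bar>F y - F z\<bar> \<partial>lebesgue)"
        using BK True by (intro nn_integral_cong) (auto simp: F_def indicator_def)
      then show ?thesis by simp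
    qed simp
  qed
  also have "\<dots> \<le> (\<integral>\<^sup>+z. liminf (\<lambda>j. (\<integral>\<^sup>+y\<in>?B. ennreal \<bar>Fj j y - Fj j z\<bar> \<partial>lborel) * indicator ?B z) \<partial>lebesgue)"
  proof (rule nn_integral_mono_AE)
    show "AE z in lebesgue. (\<integral>\<^sup>+y\<in>?B. ennreal \<bar>F y - F z\<bar> \<partial>lebesgue) * indicator ?B z \<le>
        liminf (\<lambda>j. (\<integral>\<^sup>+y\<in>?B. ennreal \<bar>Fj j y - Fj j z\<bar> \<partial>lborel) * indicator ?B z)"
      using good
    proof eventually_elim
      case (elim z)
      show ?case using inner[OF elim] by (cases "z \<in> ?B") auto
    qed
  qed
  also have "\<dots> \<le> liminf (\<lambda>j. \<integral>\<^sup>+z\<in>?B. \<integral>\<^sup>+y\<in>?B. ennreal \<bar>Fj j y - Fj j z\<bar> \<partial>lborel \<partial>lebesgue)"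
    by (rule nn_integral_liminf) (rule FjBm)
  also have "\<dots> \<le> liminf (\<lambda>j. ?C * T j)"
    using main by (intro Liminf_mono always_eventually allI) (simp add: nn_integral_completion)
  also have "\<dots> = ?C * (\<integral>\<^sup>+p\<in>?B. ennreal (norm (G p)) \<partial>lebesgue)"
    using ennreal_tendsto_cmult[OF Cfin Tlim] unfolding Tinf by (intro lim_imp_Liminf) simp_all
  finally show ?thesis by (simp only: mult.assoc)
qed

lemma avg_nonneg: "(\<And>y. y \<in> B \<Longrightarrow> 0 \<le> u y) \<Longrightarrow> 0 \<le> avg B u"
  unfolding avg_def set_lebesgue_integral_def
  by (intro divide_nonneg_nonneg integral_nonneg_AE) (auto simp: indicator_def)

lemma sharp_mean_nonneg: "0 \<le> sharp_mean B f"
  unfolding sharp_mean_def by (rule avg_nonneg) simp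

lemma integrable_const_ball: "integrable lebesgue (\<lambda>y. indicator (ball x r) y *\<^sub>R (c::'b::euclidean_space))"
  for x :: "'a::euclidean_space"
  by (intro integrable_scaleR_left integrable_real_indicator) (auto simp: emeasure_lborel_ball_finite[simplified])

text \<open>The deviation of f(z) from the mean is the average of f(y) - f(z) over \<open>y\<close>,
  up to sign. Multiplying by the squared volume avoids divisions in \<open>ennreal\<close>.\<close>

lemma sharp_mean_le_double_integral:
  fixes f :: "'a::euclidean_space \<Rightarrow> real"
  assumes f: "set_integrable lebesgue (ball x r) f" and r: "0 < r"
  shows "ennreal (sharp_mean (ball x r) f * (measure lebesgue (ball x r))\<^sup>2) \<le>
    (\<integral>\<^sup>+z\<in>ball x r. \<integral>\<^sup>+y\<in>ball x r. ennreal \<bar>f y - f z\<bar> \<partial>lebesgue \<partial>lebesgue)"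
proof -
  let ?B = "ball x r"
  define m where "m = measure lebesgue ?B"
  have m: "0 < m" using r by (simp add: m_def)
  define c where "c = avg ?B f"
  have fi: "integrable lebesgue (\<lambda>y. indicator ?B y *\<^sub>R f y)" using f by (simp add: set_integrable_def)
  have di: "integrable lebesgue (\<lambda>y. indicator ?B y *\<^sub>R (f y - d))" for d
    using Bochner_Integration.integrable_diff[OF fi integrable_const_ball[of x r d]] by (simp add: right_diff_distrib)
  have pt: "ennreal (m * \<bar>f z - c\<bar>) \<le> (\<integral>\<^sup>+y\<in>?B. ennreal \<bar>f y - f z\<bar> \<partial>lebesgue)" for z
  proof -
    have "(LINT y|lebesgue. indicator ?B y *\<^sub>R (f y - f z)) = m * c - m * f z"
      using fi integrable_const_ball[of x r "f z"] m
      by (simp add: right_diff_distrib c_def avg_def set_lebesgue_integral_def m_def)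
    then have "m * \<bar>f z - c\<bar> = norm (LINT y|lebesgue. indicator ?B y *\<^sub>R (f y - f z))"
      using m by (simp add: right_diff_distrib[symmetric] abs_mult)
    also have "ennreal \<dots> \<le> (\<integral>\<^sup>+y. ennreal (norm (indicator ?B y *\<^sub>R (f y - f z))) \<partial>lebesgue)"
      by (rule integral_norm_bound_ennreal[OF di])
    also have "\<dots> = (\<integral>\<^sup>+y\<in>?B. ennreal \<bar>f y - f z\<bar> \<partial>lebesgue)"
      by (intro nn_integral_cong) (auto simp: indicator_def)
    finally show ?thesis .
  qed
  have "sharp_mean ?B f * m\<^sup>2 = (LINT z|lebesgue. m * (indicator ?B z *\<^sub>R \<bar>f z - c\<bar>))"
    using m by (simp add: sharp_mean_def avg_def[of _ "\<lambda>y. \<bar>f y - _\<bar>"] set_lebesgue_integral_def m_def[symmetric]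
        c_def[symmetric] power2_eq_square)
  also have "ennreal \<dots> = (\<integral>\<^sup>+z. ennreal (m * (indicator ?B z *\<^sub>R \<bar>f z - c\<bar>)) \<partial>lebesgue)"
  proof (rule nn_integral_eq_integral[symmetric])
    have "integrable lebesgue (\<lambda>z. indicator ?B z *\<^sub>R \<bar>f z - c\<bar>)"
      using integrable_abs[OF di[of c]]
      by (rule Bochner_Integration.integrable_cong[THEN iffD1, rotated 2]) (auto simp: abs_mult)
    then show "integrable lebesgue (\<lambda>z. m * (indicator ?B z *\<^sub>R \<bar>f z - c\<bar>))" by (rule integrable_mult_right)
  qed (use m in auto)
  also have "\<dots> \<le> (\<integral>\<^sup>+z\<in>?B. \<integral>\<^sup>+y\<in>?B. ennreal \<bar>f y - f z\<bar> \<partial>lebesgue \<partial>lebesgue)"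
  proof (rule nn_integral_mono)
    fix z
    show "ennreal (m * (indicator ?B z *\<^sub>R \<bar>f z - c\<bar>)) \<le>
        (\<integral>\<^sup>+y\<in>?B. ennreal \<bar>f y - f z\<bar> \<partial>lebesgue) * indicator ?B z"
      using pt[of z] by (cases "z \<in> ?B") auto
  qed
  finally show ?thesis by (simp only: m_def)
qed

text \<open>The factor \<open>2 * r\<close> is the bound for |y - z| and \<open>2 ^ CARD('n)\<close>
  the price of the substitution on segments. What matters is that the constant is the same for all
  balls and the dependence on the radius is linear.\<close>

theorem poincare_ball:
  fixes f :: "real^'n::finite \<Rightarrow> real"
  assumes \<Omega>: "open \<Omega>" and f: "f locally_integrable_on \<Omega>" and G: "weak_gradient \<Omega> f G"
    and r: "0 < r" and sub: "cball x r \<subseteq> \<Omega>"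
  shows "sharp_mean (ball x r) f \<le> 2 ^ (CARD('n) + 1) * r * avg (ball x r) (\<lambda>y. norm (G y))"
proof -
  let ?B = "ball x r"
  define m where "m = measure lebesgue ?B"
  have m: "0 < m" using r by (simp add: m_def)
  have em: "emeasure lborel ?B = ennreal m"
    using emeasure_lebesgue_ball[of x r] by (simp add: m_def)
  have Gl: "G locally_integrable_on \<Omega>" using G by (simp add: weak_gradient_def)
  have i: "set_integrable lebesgue ?B h" if "h locally_integrable_on \<Omega>" for h :: "real^'n \<Rightarrow> 'b::euclidean_space"
  proof -
    have "set_integrable lebesgue (cball x r) h"
      using that sub compact_cball unfolding locally_integrable_on_def by blast
    then show ?thesis by (rule set_integrable_subset) auto
  qed
  have gi: "integrable lebesgue (\<lambda>y. indicator ?B y *\<^sub>R norm (G y))"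
    using integrable_norm[OF i[OF Gl, unfolded set_integrable_def]]
    by (rule Bochner_Integration.integrable_cong[THEN iffD1, rotated 2]) auto
  define g where "g = avg ?B (\<lambda>y. norm (G y))"
  have g0: "0 \<le> g" unfolding g_def by (rule avg_nonneg) simp
  have "(\<integral>\<^sup>+p\<in>?B. ennreal (norm (G p)) \<partial>lebesgue) = (\<integral>\<^sup>+p. ennreal (indicator ?B p *\<^sub>R norm (G p)) \<partial>lebesgue)"
    by (intro nn_integral_cong) (auto simp: indicator_def)
  also have "\<dots> = ennreal (m * g)"
    using m by (subst nn_integral_eq_integral[OF gi]) (auto simp: g_def avg_def m_def set_lebesgue_integral_def)
  finally have gI: "(\<integral>\<^sup>+p\<in>?B. ennreal (norm (G p)) \<partial>lebesgue) = ennreal (m * g)" .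
  have "ennreal (sharp_mean ?B f * m\<^sup>2) \<le> ennreal (2 * r) * (2 ^ CARD('n) * ennreal m * ennreal (m * g))"
    using order_trans[OF sharp_mean_le_double_integral[OF i[OF f] r]
        nn_integral_differences_weak_gradient[OF \<Omega> f G r sub]]
    by (simp only: gI em m_def)
  also have "\<dots> = ennreal (2 * r * (2 ^ CARD('n) * m * (m * g)))"
    using r m g0 by (simp add: ennreal_mult ennreal_power[symmetric])
  finally have "sharp_mean ?B f * m\<^sup>2 \<le> 2 * r * (2 ^ CARD('n) * m * (m * g))"
    using r m g0 by (subst (asm) ennreal_le_iff) auto
  also have "\<dots> = (2 ^ (CARD('n) + 1) * r * g) * m\<^sup>2" by (simp add: power2_eq_square)
  finally show ?thesis using zero_less_power[OF m, of 2] unfolding g_def[symmetric] by (rule mult_right_le_imp_le)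
qed

section \<open>The key estimate\<close>

lemma AE_lebesgue_on_iff:
  "S \<in> sets lebesgue \<Longrightarrow> (AE x in lebesgue_on S. Q x) \<longleftrightarrow> (AE x in lebesgue. x \<in> S \<longrightarrow> Q x)"
  by (subst AE_restrict_space_iff) auto

text \<open>A finite convex function is continuous in the open half-line; at 0 continuity is the
  right limit required of a \<Phi>-function.\<close>

lemma Phi_function_real:
  assumes p: "Phi_function p" and fin: "\<And>t. 0 \<le> t \<Longrightarrow> p t < top"
  defines "P \<equiv> \<lambda>t. enn2real (p t)"
  shows "\<And>t. 0 \<le> t \<Longrightarrow> p t = ennreal (P t)" "convex_on {0..} P" "mono_on {0..} P" "P 0 = 0"
    "\<And>t. 0 \<le> P t" "continuous_on {0..} P"
proof -
  show pP: "p t = ennreal (P t)" if "0 \<le> t" for t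
    using fin[OF that] by (simp add: P_def less_top)
  show P0: "\<And>t. 0 \<le> P t" by (simp add: P_def)
  show conv: "convex_on {0..} P"
  proof (rule convex_onI)
    fix t x y :: real assume t: "0 < t" "t < 1" and x: "x \<in> {0..}" and y: "y \<in> {0..}"
    have nn: "0 \<le> (1 - t) * x + t * y" using t x y by auto
    have "p ((1 - t) * x + t * y) \<le> ennreal (1 - t) * p x + ennreal t * p y"
      using p t x y unfolding Phi_function_def by auto
    then have "ennreal (P ((1 - t) * x + t * y)) \<le> ennreal ((1 - t) * P x + t * P y)"
      using t x y nn P0 by (simp add: pP ennreal_mult)
    then show "P ((1 - t) *\<^sub>R x + t *\<^sub>R y) \<le> (1 - t) * P x + t * P y"
      using t P0 by (subst (asm) ennreal_le_iff) auto
  qed auto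
  show "mono_on {0..} P"
  proof (rule mono_onI)
    fix s t :: real assume "s \<in> {0..}" "t \<in> {0..}" "s \<le> t"
    then show "P s \<le> P t" using p fin[of t] mono_onD[of "{0..}" p s t] unfolding Phi_function_def P_def
      by (auto intro!: enn2real_mono)
  qed
  show P00: "P 0 = 0" using p by (simp add: Phi_function_def P_def)
  have "convex_on {0<..} P" by (rule convex_on_subset[OF conv]) auto
  then have c: "continuous_on {0<..} P" by (intro convex_on_continuous) auto
  have "(p \<longlongrightarrow> 0) (at_right 0)" using p by (simp add: Phi_function_def)
  then have "((\<lambda>t. enn2real (p t)) \<longlongrightarrow> 0) (at_right 0)"
    by (intro tendsto_enn2real) auto
  then have r: "(P \<longlongrightarrow> P 0) (at_right 0)" unfolding P_def using P00 P_def by simp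
  show "continuous_on {0..} P"
    unfolding continuous_on_def
  proof
    fix x :: real assume x: "x \<in> {0..}"
    show "(P \<longlongrightarrow> P x) (at x within {0..})"
    proof (cases "x = 0")
      case True
      have "at (0::real) within {0..} = at_right 0" by (rule at_within_Ici_at_right)
      then show ?thesis using r True by simp
    next
      case False
      then have "isCont P x" using c x by (simp add: continuous_on_eq_continuous_at)
      then show ?thesis unfolding isCont_def by (rule tendsto_within_subset) simp
    qed
  qed
qed

lemma convex_0_scale:
  assumes "convex_on {0..} P" "P 0 = 0" "0 \<le> c" "c \<le> 1" "0 \<le> (t::real)"
  shows "P (c * t) \<le> c * P t"
  using convex_onD[OF assms(1), of c 0 t] assms by simp

lemma convex_supporting_line:
  assumes P: "convex_on {0..} P" "P 0 = 0" "\<And>t. 0 \<le> P t" and u: "0 < (u::real)"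
  obtains k where "0 \<le> k" "P u \<le> k * u" "\<And>v. 0 \<le> v \<Longrightarrow> P u + k * (v - u) \<le> P v"
proof -
  \<comment> \<open>The right derivative of \<open>P\<close> at \<open>u\<close>, as the infimum of
    the difference quotients to the right. The supporting line evaluated at v = 0 gives
    \<open>P u \<le> k * u\<close>, hence k \<ge> 0.\<close>
  define k where "k = Inf ((\<lambda>t. (P u - P t) / (u - t)) ` ({u<..} \<inter> {0..}))"
  have tang: "P u + k * (v - u) \<le> P v" if "0 \<le> v" for v
    using convex_le_Inf_differential[OF P(1), of u v] u that unfolding k_def by simp
  have "P u \<le> k * u" using tang[of 0] P by simp
  moreover have "0 \<le> k" using calculation P(3)[of u] u by (smt (verit) mult_neg_pos)
  ultimately show thesis using that tang by blast
qed

text \<open>(A1) is only available for \<open>t\<close> with \<open>Q t < L\<close>.  Larger \<open>t\<close> are split as \<open>s * \<theta>\<close> with \<open>s\<close> in the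
  admissible range and a weight \<open>\<theta>\<close> controlled by \<open>Q t / L\<close>; in \<open>weighted_jensen\<close> the average of these
  weights is at most \<open>2 + C0\<close>, since \<open>L\<close> is the reciprocal volume of the ball.\<close>

lemma weighted_comparison:
  fixes P Q :: "real \<Rightarrow> real"
  assumes Q: "convex_on {0..} Q" "mono_on {0..} Q" "Q 0 = 0" "\<And>t. 0 \<le> Q t" "continuous_on {0..} Q"
    and P: "\<And>t. 0 \<le> P t"
    and \<beta>: "0 < \<beta>" and \<sigma>: "0 < \<sigma>" and L: "0 < L" and e: "0 \<le> e" and C0: "0 \<le> C0"
    and A0: "P (\<beta> * \<sigma>) \<le> 1" "1 \<le> Q \<sigma>" "Q \<sigma> \<le> C0"
    and A1: "\<And>t. \<sigma> \<le> t \<Longrightarrow> (\<And>u. 0 \<le> u \<Longrightarrow> L \<le> Q u \<Longrightarrow> t \<le> u) \<Longrightarrow> P (\<beta> * t) \<le> Q t"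
    and A2: "\<And>t. 0 \<le> t \<Longrightarrow> t \<le> \<sigma> \<Longrightarrow> P (\<beta> * t) \<le> Q t + e"
    and t: "0 \<le> t"
  shows "\<exists>s \<theta>. 0 \<le> s \<and> 0 \<le> \<theta> \<and> t \<le> s * \<theta> \<and> \<theta> \<le> 1 + (1 + C0) * (Q t / L) \<and> \<theta> * P (\<beta> * s) \<le> Q t + e"
proof -
  have QL: "0 \<le> Q t / L" "0 \<le> C0 * (Q t / L)" using Q(4) L C0 by auto
  have w1: "1 \<le> 1 + (1 + C0) * (Q t / L)" and w2: "Q t / L \<le> 1 + (1 + C0) * (Q t / L)"
    using QL by (simp_all only: distrib_right mult_1_left)
  have fin: ?thesis if "0 \<le> s" "0 \<le> \<theta>" "t \<le> s * \<theta>" "\<theta> \<le> 1 + (1 + C0) * (Q t / L)"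
      "\<theta> * P (\<beta> * s) \<le> Q t + e" for s \<theta>
    using that by blast
  consider "t \<le> \<sigma>" | "\<sigma> < t" "Q t < L" | "\<sigma> < t" "L \<le> Q t" "Q \<sigma> < L" | "\<sigma> < t" "L \<le> Q \<sigma>" by linarith
  then show ?thesis
  proof cases
    case 1
    show ?thesis by (rule fin[of t 1, OF _ _ _ w1]) (use A2[OF t 1] t in simp_all)
  next
    case 2
    have "t \<le> u" if "0 \<le> u" "L \<le> Q u" for u
    proof (rule ccontr)
      assume "\<not> t \<le> u"
      then have "Q u \<le> Q t" using Q(2) that t by (intro mono_onD[OF Q(2)]) auto
      then show False using that 2 by linarith
    qed
    then have "P (\<beta> * t) \<le> Q t" using 2 by (intro A1) auto
    then show ?thesis by (intro fin[of t 1, OF _ _ _ w1]) (use t e in simp_all)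
  next
    case 3
    \<comment> \<open>The height is cut where \<open>Q s = L\<close>, the last one that (A1) admits,
      and the weight is Q(t)/L. Convexity with \<open>Q 0 = 0\<close> gives Q(s)/s \<le> Q(t)/t,
      which says t \<le> s \<theta>; and \<open>P (\<beta> * s) \<le> L\<close> makes the weighted
      value at most Q(t).\<close>
    have "continuous_on {\<sigma>..t} Q" by (rule continuous_on_subset[OF Q(5)]) (use \<sigma> in auto)
    then obtain s where s: "\<sigma> \<le> s" "s \<le> t" "Q s = L"
      using IVT'[of Q \<sigma> L t] 3 by auto
    have sp: "0 < s" using s \<sigma> by linarith
    have "s \<le> u" if "0 \<le> u" "L \<le> Q u" for u
    proof (rule ccontr)
      assume "\<not> s \<le> u"
      then have us: "u / s < 1" using sp by simp
      have "Q u \<le> u / s * Q s" using convex_0_scale[OF Q(1,3), of "u / s" s] that us sp by simp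
      also have "\<dots> < 1 * Q s" by (rule mult_strict_right_mono[OF us]) (use L s in simp)
      finally show False using that s by simp
    qed
    then have PL: "P (\<beta> * s) \<le> L" using A1[of s] s by auto
    have "Q s \<le> s / t * Q t" using convex_0_scale[OF Q(1,3), of "s / t" t] s sp 3 t by simp
    then have ts: "t \<le> s * (Q t / L)" using s L sp 3 t by (simp add: field_simps)
    have "Q t / L * P (\<beta> * s) \<le> Q t / L * L" by (intro mult_left_mono PL QL)
    then show ?thesis by (intro fin[of s "Q t / L", OF _ _ ts w2]) (use sp QL e L in simp_all)
  next
    case 4
    \<comment> \<open>The level \<open>L\<close> is already reached at \<sigma>, so only (A0) is
      left: height \<sigma> and weight Q(t). Convexity and \<open>1 \<le> Q \<sigma>\<close> give t
      \<le> \<sigma> Q(t), while L \<le> Q(\<sigma>) \<le> C0 bounds the weight by C0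
      Q(t)/L.\<close>
    have tp: "0 < t" using 4 \<sigma> by linarith
    have "Q \<sigma> \<le> \<sigma> / t * Q t" using convex_0_scale[OF Q(1,3), of "\<sigma> / t" t] \<sigma> 4 tp by simp
    then have "1 \<le> \<sigma> / t * Q t" using A0 by linarith
    then have ts: "t \<le> \<sigma> * Q t" using tp by (simp add: field_simps)
    have "L \<le> C0" using A0 4 by linarith
    then have "Q t * L \<le> Q t * C0" by (intro mult_left_mono Q(4))
    then have "Q t \<le> C0 * (Q t / L)" using L by (simp add: field_simps)
    then have "Q t \<le> 1 + (1 + C0) * (Q t / L)" using QL by (simp only: distrib_right mult_1_left)
    moreover have "Q t * P (\<beta> * \<sigma>) \<le> Q t * 1" by (intro mult_left_mono A0 Q(4))
    ultimately show ?thesis by (intro fin[of \<sigma> "Q t", OF _ _ ts]) (use \<sigma> e Q(4)[of t] in simp_all)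
  qed
qed

text \<open>Multiply the supporting line of \<open>P\<close> at u by the weight \<theta>, evaluate
  at \<beta> s and integrate over the ball. Since \<open>q\<close> has integral at most 1, the
  weights have average at most 1 + (1 + C0) = 2 + C0. With u equal to \<beta>/(2 + C0) times the
  average of \<open>g\<close>, the slope terms cancel and (2 + C0) P(u) remains on the left.\<close>

lemma weighted_jensen:
  fixes g q e :: "'a::euclidean_space \<Rightarrow> real"
  assumes P: "convex_on {0..} P" "P 0 = 0" "\<And>t. 0 \<le> P t"
    and \<beta>: "0 < \<beta>" and C0: "0 \<le> C0" and r: "0 < r"
    and g: "set_integrable lebesgue (ball x r) g" "\<And>y. 0 \<le> g y"
    and q: "set_integrable lebesgue (ball x r) q" "\<And>y. 0 \<le> q y" "(LINT y:ball x r|lebesgue. q y) \<le> 1"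
    and e: "set_integrable lebesgue (ball x r) e" "\<And>y. 0 \<le> e y"
    and w: "AE y in lebesgue. y \<in> ball x r \<longrightarrow> (\<exists>s \<theta>. 0 \<le> s \<and> 0 \<le> \<theta> \<and> g y \<le> s * \<theta> \<and>
      \<theta> \<le> 1 + (1 + C0) * (q y * measure lebesgue (ball x r)) \<and> \<theta> * P (\<beta> * s) \<le> q y + e y)"
  shows "P (\<beta> / (2 + C0) * avg (ball x r) g) \<le> avg (ball x r) q + avg (ball x r) e"
proof -
  let ?B = "ball x r"
  define m where "m = measure lebesgue ?B"
  have m: "0 < m" using r by (simp add: m_def)
  define u where "u = \<beta> / (2 + C0) * avg ?B g"
  have u0: "0 \<le> u" unfolding u_def using \<beta> C0 avg_nonneg[of ?B g] g(2) by auto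
  have av0: "0 \<le> avg ?B q + avg ?B e" using avg_nonneg[of ?B q] avg_nonneg[of ?B e] q(2) e(2) by auto
  show ?thesis
  proof (cases "u = 0")
    case True
    then show ?thesis using P(2) av0 unfolding u_def[symmetric] by simp
  next
    case False
    then have up: "0 < u" using u0 by simp
    obtain k where k: "0 \<le> k" "P u \<le> k * u" "\<And>v. 0 \<le> v \<Longrightarrow> P u + k * (v - u) \<le> P v"
      using convex_supporting_line[OF P up] by metis
    \<comment> \<open>Minus the intercept of the supporting line. Because it is nonnegative, the
      weights may be replaced by their upper bound.\<close>
    define K where "K = k * u - P u"
    have K: "0 \<le> K" using k by (simp add: K_def)
    have gi: "integrable lebesgue (\<lambda>y. indicator ?B y *\<^sub>R g y)" and qi: "integrable lebesgue (\<lambda>y. indicator ?B y *\<^sub>R q y)"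
      and ei: "integrable lebesgue (\<lambda>y. indicator ?B y *\<^sub>R e y)"
      using g q e by (simp_all add: set_integrable_def)
    have ai: "\<And>c f. set_integrable lebesgue ?B f \<Longrightarrow> (LINT y|lebesgue. indicator ?B y *\<^sub>R f y) = m * avg ?B f"
      using m by (simp add: avg_def set_lebesgue_integral_def m_def)
    have "(LINT y|lebesgue. k * \<beta> * (indicator ?B y *\<^sub>R g y) - K * (indicator ?B y *\<^sub>R 1) -
            K * (1 + C0) * m * (indicator ?B y *\<^sub>R q y))
        \<le> (LINT y|lebesgue. indicator ?B y *\<^sub>R q y + indicator ?B y *\<^sub>R e y)"
    proof (rule integral_mono_AE)
      show "AE y in lebesgue. k * \<beta> * (indicator ?B y *\<^sub>R g y) - K * (indicator ?B y *\<^sub>R 1) -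
            K * (1 + C0) * m * (indicator ?B y *\<^sub>R q y) \<le> indicator ?B y *\<^sub>R q y + indicator ?B y *\<^sub>R e y"
        using w
      proof eventually_elim
        case (elim y)
        show ?case
        proof (cases "y \<in> ?B")
          case True
          then obtain s \<theta> where s: "0 \<le> s" "0 \<le> \<theta>" "g y \<le> s * \<theta>" "\<theta> \<le> 1 + (1 + C0) * (q y * m)"
              "\<theta> * P (\<beta> * s) \<le> q y + e y"
            using elim unfolding m_def by blast
          have "k * \<beta> * g y \<le> k * \<beta> * (s * \<theta>)" using k \<beta> s by (intro mult_left_mono) auto
          moreover have "\<theta> * K \<le> (1 + (1 + C0) * (q y * m)) * K" using K s by (intro mult_right_mono) auto
          moreover have "\<theta> * (P u + k * (\<beta> * s - u)) \<le> \<theta> * P (\<beta> * s)"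
            using k(3)[of "\<beta> * s"] \<beta> s by (intro mult_left_mono) auto
          ultimately have "k * \<beta> * g y - K - K * (1 + C0) * m * q y \<le> q y + e y"
            using s(5) by (simp add: K_def algebra_simps)
          then show ?thesis using True by simp
        qed simp
      qed
      show "integrable lebesgue (\<lambda>y. k * \<beta> * (indicator ?B y *\<^sub>R g y) - K * (indicator ?B y *\<^sub>R 1) -
            K * (1 + C0) * m * (indicator ?B y *\<^sub>R q y))"
        using gi qi integrable_const_ball[of x r "1::real"]
        by (intro Bochner_Integration.integrable_diff integrable_mult_right) auto
    qed (use qi ei in auto)
    also have "\<dots> = m * (avg ?B q + avg ?B e)"
      using qi ei ai[OF q(1)] ai[OF e(1)] by (simp add: distrib_left)
    also have "(LINT y|lebesgue. k * \<beta> * (indicator ?B y *\<^sub>R g y) - K * (indicator ?B y *\<^sub>R 1) -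
            K * (1 + C0) * m * (indicator ?B y *\<^sub>R q y)) = k * \<beta> * (m * avg ?B g) - K * m - K * (1 + C0) * m * (m * avg ?B q)"
    proof -
      let ?g = "\<lambda>y. k * \<beta> * (indicator ?B y *\<^sub>R g y)" and ?o = "\<lambda>y. K * (indicator ?B y *\<^sub>R (1::real))"
        and ?q = "\<lambda>y. K * (1 + C0) * m * (indicator ?B y *\<^sub>R q y)"
      have i: "integrable lebesgue ?g" "integrable lebesgue ?o" "integrable lebesgue ?q"
        by (intro integrable_mult_right gi qi integrable_const_ball)+
      have "(LINT y|lebesgue. ?g y - ?o y - ?q y) = integral\<^sup>L lebesgue ?g - integral\<^sup>L lebesgue ?o - integral\<^sup>L lebesgue ?q"
        using Bochner_Integration.integral_diff[OF Bochner_Integration.integrable_diff[OF i(1,2)] i(3)]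
          Bochner_Integration.integral_diff[OF i(1,2)] by simp
      also have "integral\<^sup>L lebesgue ?g = k * \<beta> * (m * avg ?B g)" by (simp only: integral_mult_right_zero ai[OF g(1)])
      also have "integral\<^sup>L lebesgue ?q = K * (1 + C0) * m * (m * avg ?B q)" by (simp only: integral_mult_right_zero ai[OF q(1)])
      also have "integral\<^sup>L lebesgue ?o = K * m" by (simp add: m_def)
      finally show ?thesis .
    qed
    finally have main: "k * \<beta> * (m * avg ?B g) - K * m - K * (1 + C0) * m * (m * avg ?B q) \<le> m * (avg ?B q + avg ?B e)" .
    have "m * avg ?B q \<le> 1" using q(3) m by (simp add: avg_def m_def)
    then have "K * (1 + C0) * m * (m * avg ?B q) \<le> K * (1 + C0) * m * 1"
      using K C0 m by (intro mult_left_mono) auto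
    then have "k * \<beta> * (m * avg ?B g) - K * m - K * (1 + C0) * m \<le> m * (avg ?B q + avg ?B e)" using main by linarith
    moreover have "\<beta> * avg ?B g = (2 + C0) * u" unfolding u_def using C0 by simp
    then have "k * \<beta> * (m * avg ?B g) = m * (k * ((2 + C0) * u))" by (metis mult.assoc mult.left_commute)
    ultimately have "m * ((2 + C0) * P u) \<le> m * (avg ?B q + avg ?B e)"
      by (simp add: K_def algebra_simps)
    then have "(2 + C0) * P u \<le> avg ?B q + avg ?B e" using m by simp
    moreover have "P u \<le> (2 + C0) * P u" using P(3)[of u] C0 mult_right_mono[of 1 "2 + C0" "P u"] by simp
    ultimately show ?thesis unfolding u_def by linarith
  qed
qed

text \<open>Measurability of \<phi> is given only for each fixed \<open>t\<close>. By monotonicity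
  and left-continuity the composition is the supremum of \<phi>(x, q) over rationals q < u(x), a
  countable supremum of measurable functions; at u(x) = 0 all terms are 0, as is \<phi>(x,
  0).\<close>

lemma borel_measurable_Phi_compose:
  assumes gp: "generalized_Phi_function \<Omega> \<phi>" and u: "u \<in> borel_measurable (lebesgue_on \<Omega>)" and u0: "\<And>x. 0 \<le> u x"
  shows "(\<lambda>x. \<phi> x (u x)) \<in> borel_measurable (lebesgue_on \<Omega>)"
proof -
  have "(\<lambda>x. SUP q\<in>\<rat> \<inter> {0..}. (if q < u x then \<phi> x q else 0)) \<in> borel_measurable (lebesgue_on \<Omega>)"
  proof (rule borel_measurable_SUP)
    show "countable (\<rat> \<inter> {0..} :: real set)" using countable_rat by blast
    fix q :: real assume q: "q \<in> \<rat> \<inter> {0..}"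
    then have [measurable]: "(\<lambda>x. \<phi> x q) \<in> borel_measurable (lebesgue_on \<Omega>)"
      using gp by (auto simp: generalized_Phi_function_def)
    note [measurable] = u
    show "(\<lambda>x. if q < u x then \<phi> x q else 0) \<in> borel_measurable (lebesgue_on \<Omega>)" by measurable
  qed
  also have "?this \<longleftrightarrow> (\<lambda>x. \<phi> x (u x)) \<in> borel_measurable (lebesgue_on \<Omega>)"
  proof (rule measurable_cong)
    fix x assume "x \<in> space (lebesgue_on \<Omega>)"
    then have p: "Phi_function (\<phi> x)" using gp by (auto simp: generalized_Phi_function_def)
    have mono: "\<phi> x s \<le> \<phi> x t" if "0 \<le> s" "s \<le> t" for s t
      using p that mono_onD[of "{0..}" "\<phi> x" s t] unfolding Phi_function_def by auto
    show "(SUP q\<in>\<rat> \<inter> {0..}. (if q < u x then \<phi> x q else 0)) = \<phi> x (u x)"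
    proof (rule antisym)
      show "(SUP q\<in>\<rat> \<inter> {0..}. (if q < u x then \<phi> x q else 0)) \<le> \<phi> x (u x)"
        by (rule SUP_least) (auto intro: mono)
      show "\<phi> x (u x) \<le> (SUP q\<in>\<rat> \<inter> {0..}. (if q < u x then \<phi> x q else 0))"
      proof (cases "u x = 0")
        case True
        then show ?thesis using p by (simp add: Phi_function_def)
      next
        case False
        then have up: "0 < u x" using u0[of x] by simp
        have lim: "(\<phi> x \<longlongrightarrow> \<phi> x (u x)) (at_left (u x))"
          using p up unfolding Phi_function_def continuous_within by blast
        show ?thesis
        proof (rule tendsto_upperbound[OF lim])
          show "\<forall>\<^sub>F t in at_left (u x). \<phi> x t \<le> (SUP q\<in>\<rat> \<inter> {0..}. (if q < u x then \<phi> x q else 0))"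
          proof (rule eventually_at_leftI[OF _ up])
            fix t assume t: "t \<in> {0<..<u x}"
            then obtain q where q: "q \<in> \<rat>" "t < q" "q < u x" using Rats_dense_in_real[of t "u x"] by auto
            have "\<phi> x t \<le> \<phi> x q" using q t by (intro mono) auto
            also have "\<dots> = (if q < u x then \<phi> x q else 0)" using q by simp
            also have "\<dots> \<le> (SUP q\<in>\<rat> \<inter> {0..}. (if q < u x then \<phi> x q else 0))"
              using q t by (intro SUP_upper) auto
            finally show "\<phi> x t \<le> (SUP q\<in>\<rat> \<inter> {0..}. (if q < u x then \<phi> x q else 0))" .
          qed
        qed simp
      qed
    qed
  qed
  finally show ?thesis .
qed

section \<open>The standing assumptions with their witnesses fixed, and their consequences at almost
  every point\<close>

locale phi_setting =
  fixes \<Omega> :: "(real^'n::finite) set" and \<phi> :: "real^'n \<Rightarrow> real \<Rightarrow> ennreal"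
    and \<beta> \<sigma> :: real and h :: "real^'n \<Rightarrow> real" and a ca b cb :: real
  assumes open_Omega: "open \<Omega>" and gen_Phi: "generalized_Phi_function \<Omega> \<phi>"
    and \<beta>: "0 < \<beta>" and \<sigma>: "0 < \<sigma>" and A0: "condA0 \<Omega> \<phi> \<beta> \<sigma>" and A1: "condA1 \<Omega> \<phi> \<beta> \<sigma>"
    and h: "integrable (lebesgue_on \<Omega>) h"
    and A2: "AE x in lebesgue_on \<Omega>. AE y in lebesgue_on \<Omega>. \<forall>t\<in>{0..\<sigma>}.
           enn2ereal (\<phi> x (\<beta> * t)) \<le> enn2ereal (\<phi> y t) + ereal (h x + h y)"
    and a: "1 < a" and ca: "0 < ca"
    and inc: "AE x in lebesgue_on \<Omega>. almost_increasing_on {0<..} ca (\<lambda>s. ennreal (s powr (- a)) * \<phi> x s)"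
    and b: "1 < b" and cb: "0 < cb"
    and dec: "AE x in lebesgue_on \<Omega>. almost_decreasing_on {0<..} cb (\<lambda>s. ennreal (s powr (- b)) * \<phi> x s)"
begin

text \<open>Bundles the almost everywhere hypotheses into one property of a point, true almost
  everywhere in \<Omega>, so that later arguments can be carried out point by point.\<close>

definition good :: "real^'n \<Rightarrow> bool" where
  "good x \<longleftrightarrow> x \<in> \<Omega> \<and> almost_increasing_on {0<..} ca (\<lambda>s. ennreal (s powr (- a)) * \<phi> x s) \<and>
     almost_decreasing_on {0<..} cb (\<lambda>s. ennreal (s powr (- b)) * \<phi> x s) \<and>
     (AE y in lebesgue_on \<Omega>. \<forall>t\<in>{0..\<sigma>}.
           enn2ereal (\<phi> x (\<beta> * t)) \<le> enn2ereal (\<phi> y t) + ereal (h x + h y))"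

text \<open>\<open>enn2real\<close> sends infinity to 0, so this is faithful only where \<phi> is
  finite, which \<open>phi_finite\<close> shows at good points.\<close>

definition P :: "real^'n \<Rightarrow> real \<Rightarrow> real" where
  "P x t = enn2real (\<phi> x t)"

text \<open>The bound for \<open>P x \<sigma>\<close> obtained by doubling from
  \<open>\<beta> * \<sigma>\<close>, where (A0) gives at most 1. The maximum with 1 is there because
  doubling needs a factor of at least 1.\<close>

definition C0 :: real where
  "C0 = max 1 (1 / \<beta>) powr b / cb"

definition \<kappa> :: real where
  "\<kappa> = \<beta> / (2 + C0)"

lemma C0_nonneg: "0 \<le> C0" using cb by (simp add: C0_def)

lemma kappa_pos: "0 < \<kappa>" using \<beta> C0_nonneg by (simp add: \<kappa>_def add_pos_nonneg)

lemma sets_Omega [measurable, simp]: "\<Omega> \<in> sets lebesgue"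
  using open_Omega by simp

lemma AE_good: "AE x in lebesgue. x \<in> \<Omega> \<longrightarrow> good x"
  using inc[unfolded AE_lebesgue_on_iff[OF sets_Omega]] dec[unfolded AE_lebesgue_on_iff[OF sets_Omega]]
    A2[unfolded AE_lebesgue_on_iff[OF sets_Omega, of "\<lambda>x. AE y in lebesgue_on \<Omega>. Q x y" for Q]]
  by eventually_elim (auto simp: good_def)

lemma Phi: "x \<in> \<Omega> \<Longrightarrow> Phi_function (\<phi> x)"
  using gen_Phi by (simp add: generalized_Phi_function_def)

lemma phi_mono: "x \<in> \<Omega> \<Longrightarrow> 0 \<le> s \<Longrightarrow> s \<le> t \<Longrightarrow> \<phi> x s \<le> \<phi> x t"
  using Phi[of x] mono_onD[of "{0..}" "\<phi> x" s t] by (simp add: Phi_function_def)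

lemma phi_0: "x \<in> \<Omega> \<Longrightarrow> \<phi> x 0 = 0"
  using Phi[of x] by (simp add: Phi_function_def)

text \<open>(aDec) compared at the points \<open>t\<close> and \<open>K * t\<close> and solved for
  the value at \<open>K * t\<close>. The case t = 0 is separate because the quotient in (aDec) lives
  on positive arguments.\<close>

lemma phi_doubling:
  assumes x: "good x" and t: "0 \<le> t" and K: "1 \<le> K"
  shows "\<phi> x (K * t) \<le> ennreal (K powr b / cb) * \<phi> x t"
proof (cases "t = 0")
  case True
  then show ?thesis using x phi_0[of x] by (simp add: good_def)
next
  case False
  then have tp: "0 < t" using t by simp
  have "t \<le> K * t" using mult_right_mono[OF K t] by simp
  then have le: "ennreal cb * (ennreal ((K * t) powr (- b)) * \<phi> x (K * t)) \<le> ennreal (t powr (- b)) * \<phi> x t"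
    using x tp K unfolding good_def almost_decreasing_on_def by auto
  define c where "c = cb * (K * t) powr (- b)"
  have c: "0 < c" using cb tp K by (simp add: c_def)
  have "ennreal c * \<phi> x (K * t) \<le> ennreal (t powr (- b)) * \<phi> x t"
    using le cb by (simp add: c_def ennreal_mult mult.assoc)
  then have "ennreal (1 / c) * (ennreal c * \<phi> x (K * t)) \<le> ennreal (1 / c) * (ennreal (t powr (- b)) * \<phi> x t)"
    by (rule mult_left_mono) simp
  also have "ennreal (1 / c) * (ennreal c * \<phi> x (K * t)) = \<phi> x (K * t)"
    using c by (simp add: mult.assoc[symmetric] ennreal_mult[symmetric])
  also have "ennreal (1 / c) * (ennreal (t powr (- b)) * \<phi> x t) = ennreal (1 / c * t powr (- b)) * \<phi> x t"
    using c by (simp add: mult.assoc[symmetric] ennreal_mult[symmetric])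
  also have "1 / c * t powr (- b) = K powr b / cb"
    using tp K cb by (simp add: c_def powr_minus powr_mult field_simps)
  finally show ?thesis .
qed

text \<open>(A0) makes \<phi> finite at \<open>\<beta> * \<sigma>\<close>, and doubling carries
  finiteness to every \<open>t\<close>.\<close>

lemma phi_finite:
  assumes x: "good x" and t: "0 \<le> t"
  shows "\<phi> x t < top"
proof -
  define K where "K = max 1 (t / (\<beta> * \<sigma>))"
  have bs: "0 < \<beta> * \<sigma>" using \<beta> \<sigma> by simp
  have xO: "x \<in> \<Omega>" using x by (simp add: good_def)
  have "t = t / (\<beta> * \<sigma>) * (\<beta> * \<sigma>)" using \<beta> \<sigma> by simp
  also have "\<dots> \<le> K * (\<beta> * \<sigma>)" unfolding K_def using bs by (intro mult_right_mono) auto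
  finally have "\<phi> x t \<le> \<phi> x (K * (\<beta> * \<sigma>))" by (intro phi_mono xO t)
  also have "\<dots> \<le> ennreal (K powr b / cb) * \<phi> x (\<beta> * \<sigma>)"
    by (rule phi_doubling[OF x]) (use bs in \<open>auto simp: K_def\<close>)
  also have "\<dots> \<le> ennreal (K powr b / cb) * 1"
    using A0 xO by (intro mult_left_mono) (auto simp: condA0_def)
  also have "\<dots> < top" by simp
  finally show ?thesis .
qed

lemma P_facts:
  assumes "good x"
  shows phi_eq_P: "\<And>t. 0 \<le> t \<Longrightarrow> \<phi> x t = ennreal (P x t)" and P_convex: "convex_on {0..} (P x)"
    and P_mono: "mono_on {0..} (P x)" and P_0: "P x 0 = 0" and P_cont: "continuous_on {0..} (P x)"
proof -
  have p: "Phi_function (\<phi> x)" using assms Phi by (simp add: good_def)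
  note r = Phi_function_real[OF p phi_finite[OF assms]]
  have P: "P x = (\<lambda>t. enn2real (\<phi> x t))" by (rule ext) (simp add: P_def)
  show "\<And>t. 0 \<le> t \<Longrightarrow> \<phi> x t = ennreal (P x t)" "convex_on {0..} (P x)"
    "mono_on {0..} (P x)" "P x 0 = 0" "continuous_on {0..} (P x)"
    unfolding P using r by auto
qed

lemma P_nonneg: "0 \<le> P x t" by (simp add: P_def)

lemma P_le_iff: "good x \<Longrightarrow> 0 \<le> t \<Longrightarrow> 0 \<le> c \<Longrightarrow> \<phi> x t \<le> ennreal c \<longleftrightarrow> P x t \<le> c"
  by (simp add: phi_eq_P P_nonneg)

lemma P_beta_sigma: "good x \<Longrightarrow> P x (\<beta> * \<sigma>) \<le> 1"
  using A0 P_le_iff[of x "\<beta> * \<sigma>" 1] \<beta> \<sigma> by (auto simp: condA0_def good_def)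

lemma P_sigma_ge: 
  assumes x: "good x"
  shows "1 \<le> P x \<sigma>"
proof -
  have "1 \<le> \<phi> x \<sigma>" using A0 x by (auto simp: condA0_def good_def)
  then have "ennreal 1 \<le> ennreal (P x \<sigma>)" using phi_eq_P[OF x, of \<sigma>] \<sigma> by simp
  then show ?thesis by (subst (asm) ennreal_le_iff) (auto simp: P_nonneg)
qed

lemma P_doubling:
  assumes x: "good x" and t: "0 \<le> t" and K: "1 \<le> K"
  shows "P x (K * t) \<le> K powr b / cb * P x t"
proof -
  have "\<phi> x (K * t) \<le> ennreal (K powr b / cb * P x t)"
    using phi_doubling[OF x t K] phi_eq_P[OF x t] cb by (simp add: ennreal_mult[symmetric] P_nonneg)
  then show ?thesis using t K cb by (subst (asm) P_le_iff[OF x]) (auto simp: P_nonneg)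
qed

lemma P_sigma_le:
  assumes x: "good x"
  shows "P x \<sigma> \<le> C0"
proof -
  define K where "K = max 1 (1 / \<beta>)"
  have K: "1 \<le> K" by (simp add: K_def)
  have "\<sigma> = 1 / \<beta> * (\<beta> * \<sigma>)" using \<beta> by simp
  also have "\<dots> \<le> K * (\<beta> * \<sigma>)" unfolding K_def using \<beta> \<sigma> by (intro mult_right_mono) auto
  finally have "P x \<sigma> \<le> P x (K * (\<beta> * \<sigma>))" using \<sigma> \<beta> K by (intro mono_onD[OF P_mono[OF x]]) auto
  also have "\<dots> \<le> K powr b / cb * P x (\<beta> * \<sigma>)" using \<beta> \<sigma> by (intro P_doubling x K) auto
  also have "\<dots> \<le> K powr b / cb * 1" using P_beta_sigma[OF x] cb by (intro mult_left_mono) auto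
  finally show ?thesis by (simp add: C0_def K_def)
qed

text \<open>Convexity and \<open>1 \<le> P x \<sigma>\<close> give P(t) \<ge> t/\<sigma> beyond
  \<sigma>. Hence a finite modular controls the integral over sets of finite measure, uniformly in
  the behaviour of \<phi>.\<close>

lemma le_sigma_P:
  assumes x: "good x" and t: "0 \<le> t"
  shows "t \<le> \<sigma> + \<sigma> * P x t"
proof (cases "t \<le> \<sigma>")
  case True
  then show ?thesis using \<sigma> P_nonneg[of x t] by (simp add: add_increasing2)
next
  case False
  then have tp: "0 < t" using \<sigma> by linarith
  have "P x \<sigma> \<le> \<sigma> / t * P x t"
    using convex_0_scale[OF P_convex[OF x] P_0[OF x], of "\<sigma> / t" t] \<sigma> False tp by simp
  then have "1 \<le> \<sigma> / t * P x t" using P_sigma_ge[OF x] by linarith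
  then have "t \<le> \<sigma> * P x t" using tp by (simp add: field_simps)
  then show ?thesis using \<sigma> by linarith
qed

text \<open>(aInc) started at \<sigma>, where \<open>P x\<close> is at least 1: growth of order
  \<open>a\<close> > 1 with a constant independent of \<open>x\<close>. Uniform integrability of
  families with bounded modular comes from here.\<close>

lemma powr_le_P:
  assumes x: "good x" and t: "\<sigma> \<le> t"
  shows "t powr a \<le> ca * \<sigma> powr a * P x t"
proof -
  have tp: "0 < t" using t \<sigma> by linarith
  have "ennreal (\<sigma> powr (- a)) * \<phi> x \<sigma> \<le> ennreal ca * (ennreal (t powr (- a)) * \<phi> x t)"
    using x t tp \<sigma> unfolding good_def almost_increasing_on_def by auto
  then have "ennreal (\<sigma> powr (- a) * P x \<sigma>) \<le> ennreal (ca * (t powr (- a) * P x t))"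
    using phi_eq_P[OF x] tp \<sigma> ca by (simp add: ennreal_mult P_nonneg)
  then have "\<sigma> powr (- a) * P x \<sigma> \<le> ca * (t powr (- a) * P x t)"
    using ca by (subst (asm) ennreal_le_iff) (auto simp: P_nonneg)
  moreover have "\<sigma> powr (- a) * 1 \<le> \<sigma> powr (- a) * P x \<sigma>" by (intro mult_left_mono P_sigma_ge x) simp
  ultimately have "\<sigma> powr (- a) \<le> ca * (t powr (- a) * P x t)" by linarith
  then show ?thesis using tp \<sigma> by (simp add: powr_minus field_simps)
qed

text \<open>The hypothesis on \<open>u\<close> says that \<open>t\<close> is a lower bound of the
  set whose infimum defines \<open>phi_inverse\<close>; this is the form in which the comparison of
  heights delivers it.\<close>

lemma A1_real:
  assumes x: "good x" "x \<in> ball z r" and y: "good y" "y \<in> ball z r" and r: "0 < r" "ball z r \<subseteq> \<Omega>"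
    and t: "\<sigma> \<le> t" and u: "\<And>u. 0 \<le> u \<Longrightarrow> 1 / measure lebesgue (ball z r) \<le> P y u \<Longrightarrow> t \<le> u"
  shows "P x (\<beta> * t) \<le> P y t"
proof -
  let ?m = "measure lebesgue (ball z r)"
  have m: "0 < ?m" using r by simp
  have e: "1 / emeasure lebesgue (ball z r) = ennreal (1 / ?m)"
    using divide_ennreal[of 1 ?m] m by (simp add: emeasure_lebesgue_ball del: emeasure_completion)
  have "ennreal t \<le> phi_inverse \<phi> y (1 / emeasure lebesgue (ball z r))"
    unfolding phi_inverse_def e
  proof (rule INF_greatest)
    fix v assume "v \<in> {t. 0 \<le> t \<and> ennreal (1 / ?m) \<le> \<phi> y t}"
    then have v: "0 \<le> v" "ennreal (1 / ?m) \<le> ennreal (P y v)" using phi_eq_P[OF y(1)] by auto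
    then have "1 / ?m \<le> P y v" by (subst (asm) ennreal_le_iff) (auto simp: P_nonneg)
    then show "ennreal t \<le> ennreal v" using u[of v] v by (intro ennreal_leI) auto
  qed
  then have "\<phi> x (\<beta> * t) \<le> \<phi> y t"
    using A1 x y r t unfolding condA1_def by blast
  then have "\<phi> x (\<beta> * t) \<le> ennreal (P y t)" using phi_eq_P[OF y(1), of t] t \<sigma> by simp
  then show ?thesis using t \<sigma> \<beta> by (subst (asm) P_le_iff[OF x(1)]) (auto simp: P_nonneg)
qed

text \<open>Absolute values turn the error into a nonnegative one, which may then be enlarged,
  integrated and averaged without sign conditions.\<close>

lemma A2_real:
  assumes x: "good x"
  shows "AE y in lebesgue. y \<in> \<Omega> \<longrightarrow> (\<forall>t. 0 \<le> t \<longrightarrow> t \<le> \<sigma> \<longrightarrow> P x (\<beta> * t) \<le> P y t + (\<bar>h x\<bar> + \<bar>h y\<bar>))"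
proof -
  have "AE y in lebesgue. y \<in> \<Omega> \<longrightarrow> (\<forall>t\<in>{0..\<sigma>}.
           enn2ereal (\<phi> x (\<beta> * t)) \<le> enn2ereal (\<phi> y t) + ereal (h x + h y))"
    using x by (simp add: good_def AE_lebesgue_on_iff)
  then show ?thesis using AE_good
  proof eventually_elim
    case (elim y)
    show ?case
    proof (intro impI allI)
      fix t assume y: "y \<in> \<Omega>" and t: "0 \<le> t" "t \<le> \<sigma>"
      have gy: "good y" using elim y by simp
      have "enn2ereal (\<phi> x (\<beta> * t)) \<le> enn2ereal (\<phi> y t) + ereal (h x + h y)" using elim y t by simp
      then have "P x (\<beta> * t) \<le> P y t + (h x + h y)"
        using phi_eq_P[OF x, of "\<beta> * t"] phi_eq_P[OF gy, of t] t \<beta> by (simp add: enn2ereal_ennreal P_nonneg)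
      then show "P x (\<beta> * t) \<le> P y t + (\<bar>h x\<bar> + \<bar>h y\<bar>)" by linarith
    qed
  qed
qed

lemma borel_measurable_lebesgue_on_extend:
  fixes u :: "real^'n \<Rightarrow> 'c::euclidean_space"
  assumes "u \<in> borel_measurable (lebesgue_on \<Omega>)"
  shows "(\<lambda>x. indicator \<Omega> x *\<^sub>R u x) \<in> borel_measurable lebesgue"
  using assms by (subst (asm) borel_measurable_restrict_space_iff) auto

text \<open>The extension by zero allows averages over balls and integrals over the whole space;
  \<open>Pg\<close> is extended for the same reason.\<close>

definition habs :: "real^'n \<Rightarrow> real" where
  "habs y = indicator \<Omega> y *\<^sub>R \<bar>h y\<bar>"

lemma integrable_habs: "integrable lebesgue habs"
  unfolding habs_def using integrable_abs[OF h] by (subst (asm) integrable_restrict_space) auto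

lemma habs_nonneg: "0 \<le> habs y" by (simp add: habs_def)

definition Pg :: "(real^'n \<Rightarrow> real) \<Rightarrow> real^'n \<Rightarrow> real" where
  "Pg g y = indicator \<Omega> y *\<^sub>R P y (g y)"

lemma Pg_nonneg: "0 \<le> Pg g y" by (simp add: Pg_def P_nonneg)

lemma borel_measurable_phi_compose:
  "u \<in> borel_measurable (lebesgue_on \<Omega>) \<Longrightarrow> (\<And>x. 0 \<le> u x) \<Longrightarrow> (\<lambda>x. \<phi> x (u x)) \<in> borel_measurable (lebesgue_on \<Omega>)"
  by (rule borel_measurable_Phi_compose[OF gen_Phi])

lemma borel_measurable_Pg:
  assumes "u \<in> borel_measurable (lebesgue_on \<Omega>)" "\<And>x. 0 \<le> u x"
  shows "Pg u \<in> borel_measurable lebesgue"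
  unfolding Pg_def P_def
  using borel_measurable_phi_compose[OF assms] by (intro borel_measurable_lebesgue_on_extend) measurable

lemma nn_integral_Pg:
  assumes "\<And>x. 0 \<le> u x"
  shows "(\<integral>\<^sup>+y. ennreal (Pg u y) \<partial>lebesgue) = (\<integral>\<^sup>+y\<in>\<Omega>. \<phi> y (u y) \<partial>lebesgue)"
proof (rule nn_integral_cong_AE)
  show "AE y in lebesgue. ennreal (Pg u y) = \<phi> y (u y) * indicator \<Omega> y"
    using AE_good
  proof eventually_elim
    case (elim y)
    show ?case
    proof (cases "y \<in> \<Omega>")
      case True
      then show ?thesis using elim phi_eq_P[of y "u y"] assms by (simp add: Pg_def)
    qed (simp add: Pg_def)
  qed
qed

lemma integrable_Pg:
  assumes u: "u \<in> borel_measurable (lebesgue_on \<Omega>)" "\<And>x. 0 \<le> u x"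
    and fin: "(\<integral>\<^sup>+y\<in>\<Omega>. \<phi> y (u y) \<partial>lebesgue) < \<infinity>"
  shows "integrable lebesgue (Pg u)"
  using fin nn_integral_Pg[of u] u borel_measurable_Pg[OF u] Pg_nonneg[of u]
  by (intro integrableI_nonneg) auto

text \<open>By \<open>le_sigma_P\<close> the function is dominated on \<open>K\<close> by \<sigma>
  plus \<sigma> times \<open>Pg u\<close>.\<close>

lemma integrable_of_modular:
  assumes u: "u \<in> borel_measurable (lebesgue_on \<Omega>)" "\<And>x. 0 \<le> u x"
    and fin: "(\<integral>\<^sup>+y\<in>\<Omega>. \<phi> y (u y) \<partial>lebesgue) < \<infinity>"
    and K: "K \<subseteq> \<Omega>" "K \<in> lmeasurable"
  shows "integrable lebesgue (\<lambda>y. indicator K y *\<^sub>R u y)"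
proof (rule Bochner_Integration.integrable_bound)
  show "integrable lebesgue (\<lambda>y. \<sigma> * indicator K y + \<sigma> * Pg u y)"
    using K integrable_Pg[OF u fin] by (intro Bochner_Integration.integrable_add integrable_mult_right integrable_real_indicator)
      (auto simp: fmeasurable_def)
  have "(\<lambda>y. indicator K y *\<^sub>R (indicator \<Omega> y *\<^sub>R u y)) \<in> borel_measurable lebesgue"
    using K by (intro borel_measurable_scaleR borel_measurable_indicator borel_measurable_lebesgue_on_extend u) auto
  moreover have "(\<lambda>y. indicator K y *\<^sub>R (indicator \<Omega> y *\<^sub>R u y)) = (\<lambda>y. indicator K y *\<^sub>R u y)"
    using K by (auto simp: indicator_def fun_eq_iff)
  ultimately show "(\<lambda>y. indicator K y *\<^sub>R u y) \<in> borel_measurable lebesgue" by simp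
  show "AE y in lebesgue. norm (indicator K y *\<^sub>R u y) \<le> norm (\<sigma> * indicator K y + \<sigma> * Pg u y)"
    using AE_good
  proof eventually_elim
    case (elim y)
    show ?case
    proof (cases "y \<in> K")
      case True
      then have "good y" "y \<in> \<Omega>" using elim K by auto
      then show ?thesis using True le_sigma_P[of y "u y"] u(2)[of y] \<sigma> P_nonneg[of y "u y"] by (simp add: Pg_def)
    qed simp
  qed
qed

text \<open>A normalised modular bounds the integral of \<open>Pg g\<close> over the ball by 1,
  which is exactly what keeps the weights of \<open>weighted_jensen\<close> under control. The error
  of (A2) splits into its value at the centre and its average over the ball; both are integrable in
  \<open>x\<close>, with an integral independent of \<open>r\<close>.\<close>

theorem key_estimate:
  assumes g: "g \<in> borel_measurable (lebesgue_on \<Omega>)" "\<And>y. 0 \<le> g y"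
    and mod: "(\<integral>\<^sup>+y\<in>\<Omega>. \<phi> y (g y) \<partial>lebesgue) \<le> 1"
    and x: "good x" and r: "0 < r" "ball x r \<subseteq> \<Omega>"
  shows "P x (\<kappa> * avg (ball x r) g) \<le> avg (ball x r) (Pg g) + habs x + avg (ball x r) habs"
proof -
  let ?B = "ball x r"
  let ?m = "measure lebesgue ?B"
  have m: "0 < ?m" using r by simp
  have xO: "x \<in> \<Omega>" "x \<in> ?B" using x r by (auto simp: good_def)
  have fin: "(\<integral>\<^sup>+y\<in>\<Omega>. \<phi> y (g y) \<partial>lebesgue) < \<infinity>" using mod by (auto intro: le_less_trans)
  have gi: "set_integrable lebesgue ?B g"
    unfolding set_integrable_def by (rule integrable_of_modular[OF g fin r(2)]) simp
  have qi: "set_integrable lebesgue ?B (Pg g)"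
    unfolding set_integrable_def by (intro integrable_mult_indicator integrable_Pg[OF g fin]) simp
  have q1: "(LINT y:?B|lebesgue. Pg g y) \<le> 1"
  proof -
    have "ennreal (LINT y:?B|lebesgue. Pg g y) = (\<integral>\<^sup>+y. ennreal (indicator ?B y *\<^sub>R Pg g y) \<partial>lebesgue)"
      using qi unfolding set_lebesgue_integral_def set_integrable_def
      by (intro nn_integral_eq_integral[symmetric]) (auto simp: Pg_nonneg)
    also have "\<dots> \<le> (\<integral>\<^sup>+y. ennreal (Pg g y) \<partial>lebesgue)"
      by (intro nn_integral_mono) (auto simp: indicator_def Pg_nonneg)
    also have "\<dots> \<le> ennreal 1" using mod nn_integral_Pg[of g] g(2) by simp
    finally show ?thesis by (subst (asm) ennreal_le_iff) auto
  qed
  have ei: "set_integrable lebesgue ?B (\<lambda>y. habs x + habs y)"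
    using integrable_const_ball[of x r "habs x"] integrable_mult_indicator[OF _ integrable_habs, of ?B]
    by (simp add: set_integrable_def distrib_left)
  have w: "AE y in lebesgue. y \<in> ?B \<longrightarrow> (\<exists>s \<theta>. 0 \<le> s \<and> 0 \<le> \<theta> \<and> g y \<le> s * \<theta> \<and>
      \<theta> \<le> 1 + (1 + C0) * (Pg g y * ?m) \<and> \<theta> * P x (\<beta> * s) \<le> Pg g y + (habs x + habs y))"
    using AE_good A2_real[OF x]
  proof eventually_elim
    case (elim y)
    show ?case
    proof
      assume yB: "y \<in> ?B"
      then have yO: "y \<in> \<Omega>" using r by auto
      have gy: "good y" using elim yO by simp
      \<comment> \<open>Here \<open>Q\<close> is \<open>P y\<close> and the level is the reciprocal
        volume of the ball, the bound up to which (A1) holds for \<open>x\<close> and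
        \<open>y\<close> in it.\<close>
      have "\<exists>s \<theta>. 0 \<le> s \<and> 0 \<le> \<theta> \<and> g y \<le> s * \<theta> \<and> \<theta> \<le> 1 + (1 + C0) * (P y (g y) / (1 / ?m)) \<and>
          \<theta> * P x (\<beta> * s) \<le> P y (g y) + (\<bar>h x\<bar> + \<bar>h y\<bar>)"
      proof (rule weighted_comparison[where \<sigma>=\<sigma>])
        show "P x (\<beta> * t) \<le> P y t" if "\<sigma> \<le> t" "\<And>u. 0 \<le> u \<Longrightarrow> 1 / ?m \<le> P y u \<Longrightarrow> t \<le> u" for t
          by (rule A1_real[OF x xO(2) gy yB r that])
        show "P x (\<beta> * t) \<le> P y t + (\<bar>h x\<bar> + \<bar>h y\<bar>)" if "0 \<le> t" "t \<le> \<sigma>" for t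
          using elim yO that by simp
      qed (use P_convex[OF gy] P_mono[OF gy] P_0[OF gy] P_cont[OF gy] P_nonneg \<beta> \<sigma> m C0_nonneg
          P_beta_sigma[OF x] P_sigma_ge[OF gy] P_sigma_le[OF gy] g(2) in auto)
      then show "\<exists>s \<theta>. 0 \<le> s \<and> 0 \<le> \<theta> \<and> g y \<le> s * \<theta> \<and>
          \<theta> \<le> 1 + (1 + C0) * (Pg g y * ?m) \<and> \<theta> * P x (\<beta> * s) \<le> Pg g y + (habs x + habs y)"
        using yO xO by (simp add: Pg_def habs_def)
    qed
  qed
  have "P x (\<kappa> * avg ?B g) \<le> avg ?B (Pg g) + avg ?B (\<lambda>y. habs x + habs y)"
    unfolding \<kappa>_def
    by (rule weighted_jensen[OF P_convex[OF x] P_0[OF x] P_nonneg \<beta> C0_nonneg r(1) gi g(2) qi Pg_nonneg q1 ei _ w])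
      (simp add: habs_nonneg)
  also have "avg ?B (\<lambda>y. habs x + habs y) = habs x + avg ?B habs"
  proof -
    have "(LINT y|lebesgue. indicator ?B y *\<^sub>R (habs x + habs y)) =
        (LINT y|lebesgue. indicator ?B y *\<^sub>R habs x) + (LINT y|lebesgue. indicator ?B y *\<^sub>R habs y)"
      using Bochner_Integration.integral_add[OF integrable_const_ball[of x r "habs x"]
          integrable_mult_indicator[OF _ integrable_habs, of ?B]]
      by (simp add: distrib_left)
    then show ?thesis using m by (simp add: avg_def set_lebesgue_integral_def add_divide_distrib)
  qed
  finally show ?thesis by simp
qed

end

section \<open>Pointwise limits of sharp means\<close>

text \<open>A closed ball around a point of \<Omega> that left \<Omega> would, being connected, meet
  the frontier, at distance at most \<open>r\<close> from the centre.\<close>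

lemma inner_partD:
  assumes "x \<in> inner_part \<Omega> r" "0 < r"
  shows "x \<in> \<Omega>" "cball x r \<subseteq> \<Omega>"
proof -
  show x: "x \<in> \<Omega>" using assms by (auto simp: inner_part_def split: if_splits)
  show "cball x r \<subseteq> \<Omega>"
  proof (rule ccontr)
    assume n: "\<not> cball x r \<subseteq> \<Omega>"
    have "x \<in> cball x r \<inter> \<Omega>" using x assms(2) by simp
    then have "cball x r \<inter> \<Omega> \<noteq> {}" by blast
    moreover have "cball x r - \<Omega> \<noteq> {}" using n by blast
    ultimately obtain z where z: "z \<in> cball x r" "z \<in> frontier \<Omega>"
      using connected_Int_frontier[OF connected_cball] by blast
    have "infdist x (frontier \<Omega>) \<le> dist x z" by (rule infdist_le[OF z(2)])
    moreover have "\<Omega> \<noteq> UNIV" using n by auto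
    ultimately show False using assms z by (auto simp: inner_part_def)
  qed
qed

lemma open_inner_part: "open \<Omega> \<Longrightarrow> open (inner_part \<Omega> r)"
proof (cases "\<Omega> = UNIV")
  case False
  assume "open \<Omega>"
  moreover have "open {x. r < infdist x (frontier \<Omega>)}"
    by (intro open_Collect_less continuous_intros)
  ultimately have "open (\<Omega> \<inter> {x. r < infdist x (frontier \<Omega>)})" by (rule open_Int)
  moreover have "inner_part \<Omega> r = \<Omega> \<inter> {x. r < infdist x (frontier \<Omega>)}" using False by (auto simp: inner_part_def)
  ultimately show ?thesis by simp
qed (simp add: inner_part_def)

lemma inner_partI:
  assumes "x \<in> \<Omega>" "\<Omega> \<noteq> UNIV \<Longrightarrow> r < infdist x (frontier \<Omega>)"
  shows "x \<in> inner_part \<Omega> r"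
  using assms by (auto simp: inner_part_def)

lemma inner_part_radius:
  fixes x :: "'a::euclidean_space"
  assumes "open \<Omega>" "x \<in> \<Omega>"
  obtains d where "0 < d" "\<And>r. r < d \<Longrightarrow> x \<in> inner_part \<Omega> r"
proof (cases "\<Omega> = UNIV")
  case True
  show thesis by (rule that[of 1]) (use True in \<open>auto simp: inner_part_def\<close>)
next
  case False
  have "frontier \<Omega> \<noteq> {}"
    using False assms frontier_eq_empty[of \<Omega>] by auto
  moreover have "x \<notin> frontier \<Omega>" using assms by (simp add: frontier_def interior_open)
  ultimately have "0 < infdist x (frontier \<Omega>)"
    using in_closed_iff_infdist_zero[of "frontier \<Omega>" x] infdist_nonneg[of x "frontier \<Omega>"] by auto
  then show thesis by (rule that) (use assms in \<open>auto intro: inner_partI\<close>)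
qed

text \<open>The distance to the frontier has a positive minimum on a nonempty compact
  \<open>K\<close>. If \<Omega> is the whole space the frontier is empty and
  \<open>inner_part\<close> is everything, so this case is split off.\<close>

lemma inner_part_compact:
  fixes K :: "'a::euclidean_space set"
  assumes "open \<Omega>" "compact K" "K \<subseteq> \<Omega>"
  obtains d where "0 < d" "\<And>r. r < d \<Longrightarrow> K \<subseteq> inner_part \<Omega> r"
proof (cases "\<Omega> = UNIV \<or> K = {}")
  case True
  show thesis by (rule that[of 1]) (use True in \<open>auto simp: inner_part_def\<close>)
next
  case False
  then have ne: "K \<noteq> {}" "frontier \<Omega> \<noteq> {}"
    using assms frontier_eq_empty[of \<Omega>] by auto
  have "continuous_on K (\<lambda>x. infdist x (frontier \<Omega>))" by (intro continuous_intros)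
  from continuous_attains_inf[OF assms(2) ne(1) this]
  obtain x where x: "x \<in> K" "\<And>y. y \<in> K \<Longrightarrow> infdist x (frontier \<Omega>) \<le> infdist y (frontier \<Omega>)" by blast
  have "x \<notin> frontier \<Omega>" using x assms by (auto simp: frontier_def interior_open)
  then have "0 < infdist x (frontier \<Omega>)"
    using in_closed_iff_infdist_zero[of "frontier \<Omega>" x] infdist_nonneg[of x "frontier \<Omega>"] ne by auto
  then show thesis
    by (rule that) (use assms x in \<open>auto intro!: inner_partI dest: less_le_trans\<close>)
qed

lemma lebesgue_integral_borel:
  "u \<in> borel_measurable borel \<Longrightarrow> integral\<^sup>L lebesgue u = (integral\<^sup>L lborel u :: 'b::euclidean_space)"
  by (simp add: integral_completion)

section \<open>Averages of linear functions over balls and the origin of the constant\<close>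

lemma avg_ball_affine:
  fixes u :: "'a::euclidean_space \<Rightarrow> real"
  assumes u: "u \<in> borel_measurable borel" and r: "0 < r"
  shows "avg (ball x r) u = avg (ball 0 1) (\<lambda>z. u (x + r *\<^sub>R z))"
proof -
  have [measurable]: "u \<in> borel_measurable borel" by fact
  have [measurable]: "ball x r \<in> sets borel" "ball (0::'a) 1 \<in> sets borel" by simp_all
  have "(LINT y:ball x r|lebesgue. u y) = (LINT y|lborel. indicator (ball x r) y *\<^sub>R u y)"
    unfolding set_lebesgue_integral_def by (rule lebesgue_integral_borel) measurable
  also have "\<dots> = \<bar>r\<bar> ^ DIM('a) * (LINT z|lborel. indicator (ball x r) (x + r *\<^sub>R z) *\<^sub>R u (x + r *\<^sub>R z))"
    using r by (intro integral_lborel_affine) auto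
  also have "(\<lambda>z. indicator (ball x r) (x + r *\<^sub>R z) *\<^sub>R u (x + r *\<^sub>R z)) = (\<lambda>z. indicator (ball 0 1) z *\<^sub>R u (x + r *\<^sub>R z))"
    using r by (auto simp: indicator_def dist_norm fun_eq_iff)
  also have "(LINT z|lborel. indicator (ball 0 1) z *\<^sub>R u (x + r *\<^sub>R z)) = (LINT z:ball 0 1|lebesgue. u (x + r *\<^sub>R z))"
    unfolding set_lebesgue_integral_def by (rule lebesgue_integral_borel[symmetric]) measurable
  finally show ?thesis
    using r content_ball_conv_unit_ball[of r x] unfolding avg_def by simp
qed

lemma avg_unit_ball_linear: "avg (ball 0 1) (\<lambda>z::'a::euclidean_space. v \<bullet> z) = 0"
proof -
  let ?F = "\<lambda>z::'a. indicator (ball 0 1) z *\<^sub>R (v \<bullet> z)"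
  have [measurable]: "ball (0::'a) 1 \<in> sets borel" by simp
  have m: "?F \<in> borel_measurable borel" by measurable
  have "(LINT z|lborel. ?F z) = (LINT z|lborel. ?F (- z))"
    using integral_lborel_affine[OF m, of "-1" 0] by simp
  also have "\<dots> = (LINT z|lborel. - ?F z)"
    by (intro Bochner_Integration.integral_cong) (auto simp: indicator_def)
  also have "\<dots> = - (LINT z|lborel. ?F z)" by simp
  finally have "(LINT z|lborel. ?F z) = 0" by simp
  then show ?thesis
    unfolding avg_def set_lebesgue_integral_def using lebesgue_integral_borel[OF m] by simp
qed

text \<open>An orthogonal map carrying \<open>norm v\<close> times a coordinate vector to
  \<open>v\<close> preserves the unit ball and the integral, so only the length of \<open>v\<close>
  enters.\<close>

lemma avg_unit_ball_abs_linear: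
  fixes v :: "real^'n::finite" and k :: 'n
  shows "avg (ball 0 1) (\<lambda>z. \<bar>v \<bullet> z\<bar>) = c_const k * norm v"
proof -
  let ?e = "axis k 1 :: real^'n"
  have [measurable]: "ball (0::real^'n) 1 \<in> sets borel" by simp
  have m: "(\<lambda>z::real^'n. indicator (ball 0 1) z *\<^sub>R \<bar>w \<bullet> z\<bar>) \<in> borel_measurable borel" for w by measurable
  have i: "integrable lborel (\<lambda>z::real^'n. indicator (ball 0 1) z *\<^sub>R \<bar>w \<bullet> z\<bar>)" for w
  proof (rule integrable_bounded_support[OF m, of _ "norm w" 0 1])
    show "norm (indicator (ball 0 1) z *\<^sub>R \<bar>w \<bullet> z\<bar>) \<le> norm w" for z
    proof (cases "z \<in> ball 0 1")
      case True
      have "\<bar>w \<bullet> z\<bar> \<le> norm w * norm z" by (rule Cauchy_Schwarz_ineq2)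
      also have "\<dots> \<le> norm w * 1" using True by (intro mult_left_mono) auto
      finally show ?thesis using True by simp
    qed simp
  qed auto
  obtain T where T: "orthogonal_transformation T" "T (norm v *\<^sub>R ?e) = v"
    using orthogonal_transformation_exists[of "norm v *\<^sub>R ?e" v] by (auto simp: norm_axis_1)
  have "ennreal (LINT z|lborel. indicator (ball 0 1) z *\<^sub>R \<bar>v \<bullet> z\<bar>) =
      (\<integral>\<^sup>+z. ennreal (indicator (ball 0 1) z *\<^sub>R \<bar>v \<bullet> z\<bar>) \<partial>lborel)"
    by (rule nn_integral_eq_integral[OF i, symmetric]) auto
  also have "\<dots> = (\<integral>\<^sup>+z. ennreal (indicator (ball 0 1) (T z) *\<^sub>R \<bar>v \<bullet> T z\<bar>) \<partial>lborel)"
    by (rule nn_integral_orthogonal_transformation[OF _ T(1), symmetric]) measurable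
  also have "\<dots> = (\<integral>\<^sup>+z. ennreal (norm v * (indicator (ball 0 1) z *\<^sub>R \<bar>?e \<bullet> z\<bar>)) \<partial>lborel)"
  proof (rule nn_integral_cong)
    fix z
    have "v \<bullet> T z = (norm v *\<^sub>R ?e) \<bullet> z"
      using T unfolding orthogonal_transformation_def by metis
    then show "ennreal (indicator (ball 0 1) (T z) *\<^sub>R \<bar>v \<bullet> T z\<bar>) = ennreal (norm v * (indicator (ball 0 1) z *\<^sub>R \<bar>?e \<bullet> z\<bar>))"
      using orthogonal_transformation_norm[OF T(1), of z] by (simp add: indicator_def abs_mult)
  qed
  also have "\<dots> = ennreal (LINT z|lborel. norm v * (indicator (ball 0 1) z *\<^sub>R \<bar>?e \<bullet> z\<bar>))"
    by (rule nn_integral_eq_integral[OF integrable_mult_right[OF i]]) auto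
  also have "(LINT z|lborel. norm v * (indicator (ball 0 1) z *\<^sub>R \<bar>?e \<bullet> z\<bar>)) = norm v * (LINT z|lborel. indicator (ball 0 1) z *\<^sub>R \<bar>?e \<bullet> z\<bar>)"
    by (rule integral_mult_right_zero)
  finally have "(LINT z|lborel. indicator (ball 0 1) z *\<^sub>R \<bar>v \<bullet> z\<bar>) = norm v * (LINT z|lborel. indicator (ball 0 1) z *\<^sub>R \<bar>?e \<bullet> z\<bar>)"
    by (subst (asm) ennreal_inj) (auto intro!: mult_nonneg_nonneg integral_nonneg_AE)
  then show ?thesis
    unfolding c_const_def avg_def set_lebesgue_integral_def using lebesgue_integral_borel[OF m, of v] lebesgue_integral_borel[OF m, of ?e]
    by (simp add: inner_commute mult.commute)
qed

text \<open>By oddness the mean of y \<mapsto> v \<bullet> y is its value at the centre, and after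
  rescaling the deviation is r |v \<bullet> z|. That this is an equality, and not just a bound,
  identifies the constant in the limit.\<close>

lemma sharp_mean_linear:
  fixes v :: "real^'n::finite" and k :: 'n
  assumes r: "0 < r"
  shows "sharp_mean (ball x r) (\<lambda>y. v \<bullet> y) = r * (c_const k * norm v)"
proof -
  have "avg (ball x r) (\<lambda>y. v \<bullet> y) = avg (ball 0 1) (\<lambda>z. v \<bullet> x + r * (v \<bullet> z))"
    using r by (subst avg_ball_affine) (auto simp: inner_add_right)
  also have "\<dots> = v \<bullet> x"
  proof -
    let ?m = "measure lebesgue (ball (0::real^'n) 1)"
    have m: "0 < ?m" by simp
    have i: "integrable lebesgue (\<lambda>z::real^'n. indicator (ball 0 1) z *\<^sub>R (v \<bullet> z))"
    proof (rule Bochner_Integration.integrable_bound[OF integrable_const_ball[of 0 1 "norm v"]])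
      have [measurable]: "ball (0::real^'n) 1 \<in> sets borel" by simp
      show "(\<lambda>z::real^'n. indicator (ball 0 1) z *\<^sub>R (v \<bullet> z)) \<in> borel_measurable lebesgue"
        by (rule borel_measurable_lebesgueI) measurable
      show "AE z in lebesgue. norm (indicator (ball 0 1) z *\<^sub>R (v \<bullet> z)) \<le> norm (indicator (ball (0::real^'n) 1) z *\<^sub>R norm v)"
      proof (intro AE_I2)
        fix z :: "real^'n"
        show "norm (indicator (ball 0 1) z *\<^sub>R (v \<bullet> z)) \<le> norm (indicator (ball (0::real^'n) 1) z *\<^sub>R norm v)"
        proof (cases "z \<in> ball 0 1")
          case True
          have "\<bar>v \<bullet> z\<bar> \<le> norm v * norm z" by (rule Cauchy_Schwarz_ineq2)
          also have "\<dots> \<le> norm v * 1" using True by (intro mult_left_mono) auto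
          finally show ?thesis using True by simp
        qed simp
      qed
    qed
    have "(LINT z|lebesgue. indicator (ball (0::real^'n) 1) z *\<^sub>R (v \<bullet> x + r * (v \<bullet> z))) =
        (LINT z|lebesgue. indicator (ball (0::real^'n) 1) z *\<^sub>R (v \<bullet> x)) + (LINT z|lebesgue. r * (indicator (ball 0 1) z *\<^sub>R (v \<bullet> z)))"
      using Bochner_Integration.integral_add[OF integrable_const_ball[of 0 1 "v \<bullet> x"] integrable_mult_right[OF i, of r]]
      by (simp add: algebra_simps)
    also have "(LINT z|lebesgue. r * (indicator (ball 0 1) z *\<^sub>R (v \<bullet> z))) = 0"
      using avg_unit_ball_linear[of v] m by (simp add: avg_def set_lebesgue_integral_def)
    finally show ?thesis using m by (simp add: avg_def set_lebesgue_integral_def)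
  qed
  finally have c: "avg (ball x r) (\<lambda>y. v \<bullet> y) = v \<bullet> x" .
  have "sharp_mean (ball x r) (\<lambda>y. v \<bullet> y) = avg (ball 0 1) (\<lambda>z. r * \<bar>v \<bullet> z\<bar>)"
    unfolding sharp_mean_def c using r by (subst avg_ball_affine) (auto simp: inner_add_right abs_mult)
  also have "\<dots> = r * avg (ball 0 1) (\<lambda>z. \<bar>v \<bullet> z\<bar>)"
    by (simp add: avg_def set_lebesgue_integral_def)
  finally show ?thesis by (simp add: avg_unit_ball_abs_linear[of v k])
qed

lemma avg_add:
  assumes "set_integrable lebesgue B u" "set_integrable lebesgue B v"
  shows "avg B (\<lambda>y. u y + v y) = avg B u + avg B v"
  using set_integral_add(2)[OF assms] by (simp add: avg_def add_divide_distrib)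

lemma set_integrable_minus_const_ball:
  fixes u :: "'a::euclidean_space \<Rightarrow> real"
  assumes "set_integrable lebesgue (ball x r) u"
  shows "set_integrable lebesgue (ball x r) (\<lambda>y. \<bar>u y - c\<bar>)"
proof -
  have "integrable lebesgue (\<lambda>y. \<bar>indicator (ball x r) y *\<^sub>R u y - indicator (ball x r) y *\<^sub>R c\<bar>)"
    using assms integrable_const_ball[of x r c] unfolding set_integrable_def
    by (intro integrable_abs Bochner_Integration.integrable_diff)
  then show ?thesis unfolding set_integrable_def
    by (rule Bochner_Integration.integrable_cong[THEN iffD1, rotated 2]) (auto simp: indicator_def)
qed

lemma sharp_mean_triangle:
  fixes u v :: "'a::euclidean_space \<Rightarrow> real"
  assumes u: "set_integrable lebesgue (ball x r) u" and v: "set_integrable lebesgue (ball x r) v"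
  shows "sharp_mean (ball x r) (\<lambda>y. u y + v y) \<le> sharp_mean (ball x r) u + sharp_mean (ball x r) v"
proof -
  let ?B = "ball x r"
  have au: "set_integrable lebesgue ?B (\<lambda>y. \<bar>u y - c\<bar>)" for c by (rule set_integrable_minus_const_ball[OF u])
  have av: "set_integrable lebesgue ?B (\<lambda>y. \<bar>v y - c\<bar>)" for c by (rule set_integrable_minus_const_ball[OF v])
  have "sharp_mean ?B (\<lambda>y. u y + v y) \<le> avg ?B (\<lambda>y. \<bar>u y - avg ?B u\<bar> + \<bar>v y - avg ?B v\<bar>)"
    unfolding sharp_mean_def avg_add[OF u v] unfolding avg_def[of ?B "\<lambda>y. \<bar>u y + v y - _\<bar>"] avg_def[of ?B "\<lambda>y. \<bar>u y - _\<bar> + _ y"]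
  proof (rule divide_right_mono)
    show "(LINT y:?B|lebesgue. \<bar>u y + v y - (avg ?B u + avg ?B v)\<bar>) \<le>
        (LINT y:?B|lebesgue. \<bar>u y - avg ?B u\<bar> + \<bar>v y - avg ?B v\<bar>)"
      by (rule set_integral_mono[OF set_integrable_minus_const_ball[OF set_integral_add(1)[OF u v]] set_integral_add(1)[OF au av]]) auto
  qed simp
  also have "\<dots> = sharp_mean ?B u + sharp_mean ?B v" unfolding sharp_mean_def by (rule avg_add[OF au av])
  finally show ?thesis .
qed

lemma sharp_mean_uminus: "sharp_mean B (\<lambda>y. - u y) = sharp_mean B u"
proof -
  have "avg B (\<lambda>y. - u y) = - avg B u" by (simp add: avg_def set_lebesgue_integral_def)
  then show ?thesis by (simp add: sharp_mean_def abs_minus_commute)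
qed

lemma sharp_mean_divide: "0 < l \<Longrightarrow> sharp_mean B (\<lambda>y. u y / l) = sharp_mean B u / l"
proof -
  assume l: "0 < l"
  have "avg B (\<lambda>y. w y / l) = avg B w / l" for w
    by (simp add: avg_def set_lebesgue_integral_def)
  moreover have "\<bar>u y / l - avg B u / l\<bar> = \<bar>u y - avg B u\<bar> / l" for y
    using l by (simp add: diff_divide_distrib[symmetric])
  ultimately show ?thesis by (simp add: sharp_mean_def)
qed

section \<open>Test functions, differences of weak gradients and linear functions\<close>

lemma test_functionD:
  fixes \<eta> :: "real^'n::finite \<Rightarrow> real"
  assumes "test_function \<Omega> \<eta>"
  obtains K where "compact K" "K \<subseteq> \<Omega>" "\<And>x. x \<notin> K \<Longrightarrow> \<eta> x = 0" "\<And>i x. x \<notin> K \<Longrightarrow> partial_deriv i \<eta> x = 0"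
    "\<And>x. \<eta> differentiable (at x)" "continuous_on UNIV \<eta>" "\<And>i. continuous_on UNIV (partial_deriv i \<eta>)"
proof -
  have Ck: "Ck k \<eta>" for k using assms by (simp add: test_function_def)
  have d: "\<eta> differentiable (at x)" for x using Ck[of 1] by simp
  have c: "continuous_on UNIV (partial_deriv i \<eta>)" for i using Ck[of 1] by simp
  have c0: "continuous_on UNIV \<eta>" using Ck[of 0] by simp
  let ?K = "closure {x. \<eta> x \<noteq> 0}"
  have z: "\<eta> x = 0" if "x \<notin> ?K" for x using that closure_subset[of "{x. \<eta> x \<noteq> 0}"] by auto
  have pz: "partial_deriv i \<eta> x = 0" if "x \<notin> ?K" for i x
  proof -
    have op: "open (- ?K)" by (intro open_Compl) auto
    have "((\<lambda>x. 0) has_derivative (\<lambda>h. 0)) (at x)" by (rule has_derivative_const)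
    then have "(\<eta> has_derivative (\<lambda>h. 0)) (at x)"
    proof (rule has_derivative_transform_within_open[OF _ op])
      show "x \<in> - ?K" using that by simp
      show "0 = \<eta> y" if "y \<in> - ?K" for y using z[of y] that by simp
    qed
    then show ?thesis by (simp add: partial_deriv_eq)
  qed
  show thesis
    by (rule that[OF _ _ z pz d c0 c]) (use assms in \<open>simp_all add: test_function_def\<close>)
qed

lemma compact_support_bounded:
  fixes u :: "'a::euclidean_space \<Rightarrow> real"
  assumes "continuous_on UNIV u" "compact K" "\<And>x. x \<notin> K \<Longrightarrow> u x = 0"
  obtains C where "0 \<le> C" "\<And>x. \<bar>u x\<bar> \<le> C"
proof -
  have "bounded (u ` K)" by (intro compact_imp_bounded compact_continuous_image continuous_on_subset[OF assms(1)] assms) auto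
  then obtain L where L: "\<And>x. x \<in> K \<Longrightarrow> norm (u x) \<le> L" unfolding bounded_iff by blast
  show thesis
  proof (rule that[of "max 0 L"])
    fix x show "\<bar>u x\<bar> \<le> max 0 L" using L[of x] assms(3)[of x] by (cases "x \<in> K") auto
  qed simp
qed

lemma integrable_mult_compact_support:
  fixes f :: "'a::euclidean_space \<Rightarrow> 'b::euclidean_space" and u :: "'a \<Rightarrow> real"
  assumes f: "f locally_integrable_on \<Omega>" and u: "continuous_on UNIV u"
    and K: "compact K" "K \<subseteq> \<Omega>" "\<And>x. x \<notin> K \<Longrightarrow> u x = 0"
  shows "integrable lebesgue (\<lambda>x. indicator \<Omega> x *\<^sub>R (u x *\<^sub>R f x))"
proof -
  obtain C where C: "0 \<le> C" "\<And>x. \<bar>u x\<bar> \<le> C" using compact_support_bounded[OF u K(1,3)] by blast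
  have fi: "integrable lebesgue (\<lambda>x. indicator K x *\<^sub>R f x)" by (rule locally_integrable_on_compact[OF f K(1,2)])
  have um: "u \<in> borel_measurable lebesgue"
    by (intro borel_measurable_lebesgueI borel_measurable_continuous_onI u)
  have "integrable lebesgue (\<lambda>x. u x *\<^sub>R (indicator K x *\<^sub>R f x))"
  proof (rule Bochner_Integration.integrable_bound[OF integrable_mult_right[OF integrable_norm[OF fi], of C]])
    show "(\<lambda>x. u x *\<^sub>R (indicator K x *\<^sub>R f x)) \<in> borel_measurable lebesgue"
      by (intro borel_measurable_scaleR[OF um borel_measurable_integrable[OF fi]])
    show "AE x in lebesgue. norm (u x *\<^sub>R (indicator K x *\<^sub>R f x)) \<le> norm (C * norm (indicator K x *\<^sub>R f x))"
    proof (intro AE_I2)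
      fix x
      have "\<bar>u x\<bar> * (indicator K x * norm (f x)) \<le> C * (indicator K x * norm (f x))"
        by (intro mult_right_mono C) simp
      then show "norm (u x *\<^sub>R (indicator K x *\<^sub>R f x)) \<le> norm (C * norm (indicator K x *\<^sub>R f x))"
        using C(1) by (simp add: abs_mult mult.assoc)
    qed
  qed
  also have "?this \<longleftrightarrow> ?thesis"
    by (rule Bochner_Integration.integrable_cong) (use K in \<open>auto simp: indicator_def\<close>)
  finally show ?thesis .
qed

lemma locally_integrable_on_diff:
  "f locally_integrable_on \<Omega> \<Longrightarrow> g locally_integrable_on \<Omega> \<Longrightarrow> (\<lambda>x. f x - g x) locally_integrable_on \<Omega>"
  unfolding locally_integrable_on_def by (simp add: set_integral_diff(1))

lemma locally_integrable_on_continuous: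
  fixes u :: "'a::euclidean_space \<Rightarrow> 'b::euclidean_space"
  assumes "continuous_on UNIV u"
  shows "u locally_integrable_on \<Omega>"
  unfolding locally_integrable_on_def
proof (intro allI impI)
  fix K assume "compact K \<and> K \<subseteq> \<Omega>"
  then have K: "compact K" by simp
  have "set_integrable lborel K u" unfolding set_integrable_def
    by (rule borel_integrable_compact[OF K continuous_on_subset[OF assms]]) simp
  then show "set_integrable lebesgue K u"
    unfolding set_integrable_def by (simp add: integrable_completion borel_measurable_integrable)
qed

lemma weak_gradient_diff:
  fixes f g :: "real^'n::finite \<Rightarrow> real"
  assumes f: "f locally_integrable_on \<Omega>" and g: "g locally_integrable_on \<Omega>"
    and F: "weak_gradient \<Omega> f F" and G: "weak_gradient \<Omega> g G"
  shows "weak_gradient \<Omega> (\<lambda>x. f x - g x) (\<lambda>x. F x - G x)"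
  unfolding weak_gradient_def
proof (intro conjI allI impI)
  have Fl: "F locally_integrable_on \<Omega>" and Gl: "G locally_integrable_on \<Omega>" using F G by (auto simp: weak_gradient_def)
  show "(\<lambda>x. F x - G x) locally_integrable_on \<Omega>" by (rule locally_integrable_on_diff[OF Fl Gl])
  fix \<eta> i assume \<eta>: "test_function \<Omega> \<eta>"
  obtain K where K: "compact K" "K \<subseteq> \<Omega>" "\<And>x. x \<notin> K \<Longrightarrow> \<eta> x = 0" "\<And>i x. x \<notin> K \<Longrightarrow> partial_deriv i \<eta> x = 0"
    "\<And>x. \<eta> differentiable (at x)" "continuous_on UNIV \<eta>" "\<And>i. continuous_on UNIV (partial_deriv i \<eta>)"
    using test_functionD[OF \<eta>] by blast
  have i1: "integrable lebesgue (\<lambda>x. indicator \<Omega> x *\<^sub>R (u x * partial_deriv i \<eta> x))" if "u locally_integrable_on \<Omega>" for u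
    using integrable_mult_compact_support[OF that K(7) K(1,2,4)] by (simp add: mult.commute)
  have i2: "integrable lebesgue (\<lambda>x. indicator \<Omega> x *\<^sub>R (H x $ i * \<eta> x))" if "H locally_integrable_on \<Omega>" for H :: "real^'n \<Rightarrow> real^'n"
  proof -
    have "integrable lebesgue (\<lambda>x. (indicator \<Omega> x *\<^sub>R (\<eta> x *\<^sub>R H x)) $ i)"
      by (rule integrable_bounded_linear[OF bounded_linear_vec_nth integrable_mult_compact_support[OF that K(6) K(1,2,3)]])
    then show ?thesis by (simp add: mult_ac)
  qed
  have "(LINT x:\<Omega>|lebesgue. (f x - g x) * partial_deriv i \<eta> x) =
      (LINT x:\<Omega>|lebesgue. f x * partial_deriv i \<eta> x) - (LINT x:\<Omega>|lebesgue. g x * partial_deriv i \<eta> x)"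
    unfolding set_lebesgue_integral_def
    using Bochner_Integration.integral_diff[OF i1[OF f] i1[OF g]] by (simp only: left_diff_distrib scaleR_diff_right)
  also have "\<dots> = - ((LINT x:\<Omega>|lebesgue. F x $ i * \<eta> x) - (LINT x:\<Omega>|lebesgue. G x $ i * \<eta> x))"
    using F G \<eta> by (simp add: weak_gradient_def)
  also have "(LINT x:\<Omega>|lebesgue. F x $ i * \<eta> x) - (LINT x:\<Omega>|lebesgue. G x $ i * \<eta> x) = (LINT x:\<Omega>|lebesgue. (F x - G x) $ i * \<eta> x)"
    unfolding set_lebesgue_integral_def
    using Bochner_Integration.integral_diff[OF i2[OF Fl] i2[OF Gl]]
    by (simp only: left_diff_distrib scaleR_diff_right vector_minus_component)
  finally show "(LINT x:\<Omega>|lebesgue. (f x - g x) * partial_deriv i \<eta> x) = - (LINT x:\<Omega>|lebesgue. (F x - G x) $ i * \<eta> x)" .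
qed

text \<open>The product of the linear function and the test function has compact support, so its
  partial derivative integrates to 0; the product rule turns this into the defining
  identity.\<close>

lemma weak_gradient_linear:
  fixes v :: "real^'n::finite"
  shows "weak_gradient \<Omega> (\<lambda>y. v \<bullet> y) (\<lambda>y. v)"
  unfolding weak_gradient_def
proof (intro conjI allI impI)
  show "(\<lambda>y. v) locally_integrable_on \<Omega>" by (intro locally_integrable_on_continuous continuous_intros)
  fix \<eta> i assume \<eta>: "test_function \<Omega> \<eta>"
  obtain K where K: "compact K" "K \<subseteq> \<Omega>" "\<And>x. x \<notin> K \<Longrightarrow> \<eta> x = 0" "\<And>i x. x \<notin> K \<Longrightarrow> partial_deriv i \<eta> x = 0"
    "\<And>x. \<eta> differentiable (at x)" "continuous_on UNIV \<eta>" "\<And>i. continuous_on UNIV (partial_deriv i \<eta>)"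
    using test_functionD[OF \<eta>] by blast
  obtain R where "\<forall>x\<in>K. norm x \<le> R" using compact_imp_bounded[OF K(1)] unfolding bounded_iff by blast
  then have R: "K \<subseteq> cball 0 R" by auto
  have D: "((\<lambda>x. (v \<bullet> x) * \<eta> x) has_derivative (\<lambda>h. (v \<bullet> x) * frechet_derivative \<eta> (at x) h + (v \<bullet> h) * \<eta> x)) (at x)" for x
    by (rule has_derivative_mult[OF has_derivative_inner_right[OF has_derivative_ident]
          frechet_derivative_works[THEN iffD1, OF K(5)]])
  have pd: "partial_deriv i (\<lambda>x. (v \<bullet> x) * \<eta> x) = (\<lambda>x. (v \<bullet> x) * partial_deriv i \<eta> x + v $ i * \<eta> x)"
    by (rule ext, subst partial_deriv_eq[OF D]) (simp add: partial_deriv_def inner_axis)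
  have "(LINT x|lborel. partial_deriv i (\<lambda>x. (v \<bullet> x) * \<eta> x) x) = 0"
  proof (rule integral_partial_deriv_eq_0)
    show "(\<lambda>x. (v \<bullet> x) * \<eta> x) differentiable (at x)" for x using D by (rule differentiableI)
    show "continuous_on UNIV (partial_deriv i (\<lambda>x. (v \<bullet> x) * \<eta> x))" unfolding pd by (intro continuous_intros K(6,7))
    show "(v \<bullet> x) * \<eta> x = 0" if "x \<notin> cball 0 R" for x using K(3)[of x] R that by (simp add: subset_iff) metis
  qed
  then have "0 = (LINT x|lebesgue. (v \<bullet> x) * partial_deriv i \<eta> x + v $ i * \<eta> x)"
    unfolding pd by (subst lebesgue_integral_borel) (intro borel_measurable_continuous_onI continuous_intros K(6,7), simp)
  also have "\<dots> = (LINT x|lebesgue. indicator \<Omega> x *\<^sub>R (partial_deriv i \<eta> x *\<^sub>R (v \<bullet> x)) + indicator \<Omega> x *\<^sub>R (\<eta> x *\<^sub>R v $ i))"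
  proof (rule Bochner_Integration.integral_cong[OF refl])
    fix x
    show "(v \<bullet> x) * partial_deriv i \<eta> x + v $ i * \<eta> x =
        indicator \<Omega> x *\<^sub>R (partial_deriv i \<eta> x *\<^sub>R (v \<bullet> x)) + indicator \<Omega> x *\<^sub>R (\<eta> x *\<^sub>R v $ i)"
      using K(2) K(3)[of x] K(4)[of x i] by (cases "x \<in> K") (auto simp: subset_iff mult.commute)
  qed
  also have "\<dots> = (LINT x|lebesgue. indicator \<Omega> x *\<^sub>R (partial_deriv i \<eta> x *\<^sub>R (v \<bullet> x))) + (LINT x|lebesgue. indicator \<Omega> x *\<^sub>R (\<eta> x *\<^sub>R v $ i))"
  proof (rule Bochner_Integration.integral_add)
    show "integrable lebesgue (\<lambda>x. indicator \<Omega> x *\<^sub>R (partial_deriv i \<eta> x *\<^sub>R (v \<bullet> x)))"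
      by (rule integrable_mult_compact_support[OF _ K(7) K(1,2,4)])
        (intro locally_integrable_on_continuous continuous_intros)
    show "integrable lebesgue (\<lambda>x. indicator \<Omega> x *\<^sub>R (\<eta> x *\<^sub>R v $ i))"
      by (rule integrable_mult_compact_support[OF _ K(6) K(1,2,3)])
        (intro locally_integrable_on_continuous continuous_intros)
  qed
  also have "(LINT x|lebesgue. indicator \<Omega> x *\<^sub>R (partial_deriv i \<eta> x *\<^sub>R (v \<bullet> x))) = (LINT x:\<Omega>|lebesgue. (v \<bullet> x) * partial_deriv i \<eta> x)"
    unfolding set_lebesgue_integral_def by (intro Bochner_Integration.integral_cong refl) simp
  also have "(LINT x|lebesgue. indicator \<Omega> x *\<^sub>R (\<eta> x *\<^sub>R v $ i)) = (LINT x:\<Omega>|lebesgue. v $ i * \<eta> x)"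
    unfolding set_lebesgue_integral_def by (intro Bochner_Integration.integral_cong refl) simp
  finally show "(LINT x:\<Omega>|lebesgue. (v \<bullet> x) * partial_deriv i \<eta> x) = - (LINT x:\<Omega>|lebesgue. v $ i * \<eta> x)"
    by linarith
qed

lemma locally_integrable_on_set_integrable_ball:
  "f locally_integrable_on \<Omega> \<Longrightarrow> cball x r \<subseteq> \<Omega> \<Longrightarrow> set_integrable lebesgue (ball x r) f"
  for x :: "'a::euclidean_space"
  by (rule set_integrable_subset[of lebesgue "cball x r"]) (auto simp: locally_integrable_on_def)

lemma AE_sharp_mean_limit:
  fixes f :: "real^'n::finite \<Rightarrow> real" and k :: 'n
  assumes \<Omega>: "open \<Omega>" and f: "f locally_integrable_on \<Omega>" and G: "weak_gradient \<Omega> f G"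
  shows "AE x in lebesgue. x \<in> \<Omega> \<longrightarrow>
    ((\<lambda>r. 1 / r * sharp_mean (ball x r) f) \<longlongrightarrow> c_const k * norm (G x)) (at_right 0)"
proof -
  have Gl: "G locally_integrable_on \<Omega>" using G by (simp add: weak_gradient_def)
  show ?thesis
    using AE_lebesgue_point[OF \<Omega> Gl]
  proof eventually_elim
    case (elim x)
    show ?case
    proof
      assume x: "x \<in> \<Omega>"
      define C where "C = (2::real) ^ (CARD('n) + 1)"
      \<comment> \<open>Only the linear part of the Taylor polynomial is subtracted: sharp means do
        not see additive constants.\<close>
      let ?l = "\<lambda>y. G x \<bullet> y"
      have ll: "?l locally_integrable_on \<Omega>" by (intro locally_integrable_on_continuous continuous_intros)
      have dl: "(\<lambda>y. f y - ?l y) locally_integrable_on \<Omega>" by (rule locally_integrable_on_diff[OF f ll])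
      have wd: "weak_gradient \<Omega> (\<lambda>y. f y - ?l y) (\<lambda>y. G y - G x)"
        by (rule weak_gradient_diff[OF f ll G weak_gradient_linear])
      obtain e where e: "0 < e" "cball x e \<subseteq> \<Omega>" using x \<Omega> open_contains_cball by blast
      have "((\<lambda>r. 1 / r * sharp_mean (ball x r) f - c_const k * norm (G x)) \<longlongrightarrow> 0) (at_right 0)"
      proof (rule Lim_null_comparison)
        show "((\<lambda>r. C * avg (ball x r) (\<lambda>y. norm (G y - G x))) \<longlongrightarrow> 0) (at_right 0)"
          using tendsto_mult[OF tendsto_const[of C]] elim x by fastforce
        show "\<forall>\<^sub>F r in at_right 0. norm (1 / r * sharp_mean (ball x r) f - c_const k * norm (G x)) \<le>
            C * avg (ball x r) (\<lambda>y. norm (G y - G x))"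
        proof (rule eventually_at_rightI[of 0 e])
          fix r assume "r \<in> {0<..<e}"
          then have r: "0 < r" "cball x r \<subseteq> \<Omega>" using e by auto
          let ?B = "ball x r" and ?d = "\<lambda>y. f y - ?l y"
          have pb: "sharp_mean ?B ?d \<le> C * r * avg ?B (\<lambda>y. norm (G y - G x))"
            unfolding C_def by (rule poincare_ball[OF \<Omega> dl wd r])
          note si = locally_integrable_on_set_integrable_ball[OF f r(2)]
            locally_integrable_on_set_integrable_ball[OF ll r(2)] locally_integrable_on_set_integrable_ball[OF dl r(2)]
          have "sharp_mean ?B f \<le> sharp_mean ?B ?d + sharp_mean ?B ?l"
            using sharp_mean_triangle[OF si(3) si(2)] by simp
          \<comment> \<open>The reverse triangle inequality, written as \<open>?l\<close> = f -
            \<open>?d\<close>; it needs that sharp means ignore the sign.\<close>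
          moreover have "sharp_mean ?B ?l \<le> sharp_mean ?B f + sharp_mean ?B ?d"
          proof -
            have "set_integrable lebesgue ?B (\<lambda>y. - ?d y)"
              using Bochner_Integration.integrable_minus[OF si(3)[unfolded set_integrable_def]]
              by (simp add: set_integrable_def algebra_simps)
            from sharp_mean_triangle[OF si(1) this] show ?thesis by (simp add: sharp_mean_uminus[of ?B ?d, simplified])
          qed
          moreover have "sharp_mean ?B ?l = r * (c_const k * norm (G x))" by (rule sharp_mean_linear[OF r(1)])
          ultimately have "\<bar>sharp_mean ?B f - r * (c_const k * norm (G x))\<bar> \<le> C * r * avg ?B (\<lambda>y. norm (G y - G x))"
            using pb by (simp add: abs_le_iff)
          then have "\<bar>sharp_mean ?B f - r * (c_const k * norm (G x))\<bar> / r \<le> C * avg ?B (\<lambda>y. norm (G y - G x))"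
            using r by (simp add: field_simps)
          moreover have "\<bar>sharp_mean ?B f - r * (c_const k * norm (G x))\<bar> / r = \<bar>1 / r * sharp_mean ?B f - c_const k * norm (G x)\<bar>"
          proof -
            have "1 / r * sharp_mean ?B f - c_const k * norm (G x) = (sharp_mean ?B f - r * (c_const k * norm (G x))) / r"
              using r by (simp add: diff_divide_distrib)
            then show ?thesis using r by simp
          qed
          ultimately show "norm (1 / r * sharp_mean ?B f - c_const k * norm (G x)) \<le> C * avg ?B (\<lambda>y. norm (G y - G x))"
            by simp
        qed (use e in simp)
      qed
      then show "((\<lambda>r. 1 / r * sharp_mean (ball x r) f) \<longlongrightarrow> c_const k * norm (G x)) (at_right 0)"
        by (simp only: LIM_zero_iff)
    qed
  qed
qed

section \<open>Limits of the modulars and norms\<close>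

text \<open>Dominated convergence with moving majorants. Fatou for \<open>H\<close> gives the lower
  bound; Fatou for \<open>K - H\<close>, whose integrals are \<open>c\<close> minus those of
  \<open>H\<close>, gives the upper one. The integrals of the majorants must not lose mass in the
  limit, which here means that they all equal \<open>c\<close>.\<close>

lemma nn_integral_tendsto_dominated_const:
  fixes H K :: "nat \<Rightarrow> 'a \<Rightarrow> ennreal"
  assumes Hm[measurable]: "\<And>j. H j \<in> borel_measurable M" and Km[measurable]: "\<And>j. K j \<in> borel_measurable M"
    and H0m[measurable]: "Hlim \<in> borel_measurable M" and K0m[measurable]: "Klim \<in> borel_measurable M"
    and le: "\<And>j. AE x in M. H j x \<le> K j x"
    and Hl: "AE x in M. (\<lambda>j. H j x) \<longlonglongrightarrow> Hlim x" and Kl: "AE x in M. (\<lambda>j. K j x) \<longlonglongrightarrow> Klim x"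
    and Ki: "\<And>j. integral\<^sup>N M (K j) = c" and K0i: "integral\<^sup>N M Klim = c" and c: "c < top"
  shows "(\<lambda>j. integral\<^sup>N M (H j)) \<longlonglongrightarrow> integral\<^sup>N M Hlim"
proof -
  have leA: "AE x in M. \<forall>j. H j x \<le> K j x" using le by (simp add: AE_all_countable)
  have le0: "AE x in M. Hlim x \<le> Klim x"
    using leA Hl Kl
  proof eventually_elim
    case (elim x)
    show ?case by (rule LIMSEQ_le[OF elim(2,3)]) (use elim(1) in auto)
  qed
  have Hc: "integral\<^sup>N M (H j) \<le> c" for j using nn_integral_mono_AE[OF le[of j]] Ki by simp
  have H0c: "integral\<^sup>N M Hlim \<le> c" using nn_integral_mono_AE[OF le0] K0i by simp
  have "integral\<^sup>N M Hlim \<le> (\<integral>\<^sup>+x. liminf (\<lambda>j. H j x) \<partial>M)"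
  proof (rule nn_integral_mono_AE)
    show "AE x in M. Hlim x \<le> liminf (\<lambda>j. H j x)"
      using Hl by eventually_elim (simp add: lim_imp_Liminf)
  qed
  also have "\<dots> \<le> liminf (\<lambda>j. integral\<^sup>N M (H j))" by (rule nn_integral_liminf) measurable
  finally have lower: "integral\<^sup>N M Hlim \<le> liminf (\<lambda>j. integral\<^sup>N M (H j))" .
  \<comment> \<open>Finiteness of \<open>c\<close> makes the subtraction in \<open>ennreal\<close>
    cancel correctly, here and when the inequality is inverted again.\<close>
  have "c - integral\<^sup>N M Hlim = (\<integral>\<^sup>+x. Klim x - Hlim x \<partial>M)"
    using H0c c le0 K0i by (subst nn_integral_diff) (auto simp: top_unique less_top[symmetric])
  also have "\<dots> \<le> (\<integral>\<^sup>+x. liminf (\<lambda>j. K j x - H j x) \<partial>M)"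
  proof (rule nn_integral_mono_AE)
    have "AE x in M. Klim x \<noteq> \<infinity>" using K0i c by (intro nn_integral_PInf_AE) auto
    then show "AE x in M. Klim x - Hlim x \<le> liminf (\<lambda>j. K j x - H j x)"
      using Hl Kl le0
    proof eventually_elim
      case (elim x)
      have "(\<lambda>j. K j x - H j x) \<longlonglongrightarrow> Klim x - Hlim x"
        using elim by (intro tendsto_diff_ennreal) (auto simp: top_unique)
      then show ?case by (simp add: lim_imp_Liminf)
    qed
  qed
  also have "\<dots> \<le> liminf (\<lambda>j. \<integral>\<^sup>+x. K j x - H j x \<partial>M)" by (rule nn_integral_liminf) measurable
  also have "(\<lambda>j. \<integral>\<^sup>+x. K j x - H j x \<partial>M) = (\<lambda>j. c - integral\<^sup>N M (H j))"
  proof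
    fix j
    have "integral\<^sup>N M (H j) \<noteq> \<infinity>" using Hc[of j] c by (auto simp: top_unique)
    then show "(\<integral>\<^sup>+x. K j x - H j x \<partial>M) = c - integral\<^sup>N M (H j)"
      using le[of j] Ki by (subst nn_integral_diff) auto
  qed
  also have "liminf (\<lambda>j. c - integral\<^sup>N M (H j)) = c - limsup (\<lambda>j. integral\<^sup>N M (H j))"
    by (rule ennreal_liminf_minus) (rule Hc)
  finally have 1: "c - integral\<^sup>N M Hlim \<le> c - limsup (\<lambda>j. integral\<^sup>N M (H j))" .
  have "limsup (\<lambda>j. integral\<^sup>N M (H j)) \<le> c" using Hc by (intro Limsup_bounded) auto
  then have "limsup (\<lambda>j. integral\<^sup>N M (H j)) = c - (c - limsup (\<lambda>j. integral\<^sup>N M (H j)))"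
    using c by (intro diff_diff_ennreal[symmetric]) auto
  also have "\<dots> \<le> c - (c - integral\<^sup>N M Hlim)" by (rule ennreal_minus_mono[OF order_refl 1])
  also have "\<dots> = integral\<^sup>N M Hlim" using c H0c by (intro diff_diff_ennreal) auto
  finally have upper: "limsup (\<lambda>j. integral\<^sup>N M (H j)) \<le> integral\<^sup>N M Hlim" .
  have "liminf (\<lambda>j. integral\<^sup>N M (H j)) \<le> limsup (\<lambda>j. integral\<^sup>N M (H j))" by (rule Liminf_le_Limsup) simp
  then show ?thesis using lower upper by (subst tendsto_iff_Liminf_eq_Limsup) auto
qed

section \<open>Averages and sharp means as functions of the centre\<close>

lemma measure_ball_translate: "measure lebesgue (ball (x::'a) r) = measure lebesgue (ball (0::'a::euclidean_space) r)"
  by (cases "0 \<le> r") (auto simp: content_ball ball_empty)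

lemma isCont_avg_ball:
  fixes u :: "'a::euclidean_space \<Rightarrow> real"
  assumes "integrable lebesgue u" "0 < r"
  shows "isCont (\<lambda>x. avg (ball x r) u) a"
proof -
  have "(\<lambda>x. avg (ball x r) u) = (\<lambda>x. (LINT y:ball x r|lebesgue. u y) / measure lebesgue (ball (0::'a) r))"
    by (rule ext, unfold avg_def, subst measure_ball_translate, rule refl)
  then show ?thesis
    using isCont_set_integral_ball[OF assms(1), where r=r and a=a] assms(2) by simp
qed

lemma borel_measurable_avg_ball:
  fixes u :: "'a::euclidean_space \<Rightarrow> real"
  assumes "integrable lebesgue u" "0 < r"
  shows "(\<lambda>x. avg (ball x r) u) \<in> borel_measurable borel"
  by (intro borel_measurable_continuous_onI continuous_at_imp_continuous_on ballI isCont_avg_ball assms)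

lemma AE_avg_ball_tendsto:
  fixes u :: "'a::euclidean_space \<Rightarrow> real"
  assumes u: "integrable lebesgue u"
  shows "AE x in lebesgue. ((\<lambda>r. avg (ball x r) u) \<longlongrightarrow> u x) (at_right 0)"
  using AE_lebesgue_point[OF open_UNIV integrable_imp_locally_integrable_on[OF u]]
proof eventually_elim
  case (elim x)
  have "((\<lambda>r. avg (ball x r) u - u x) \<longlongrightarrow> 0) (at_right 0)"
  proof (rule Lim_null_comparison)
    show "((\<lambda>r. avg (ball x r) (\<lambda>y. norm (u y - u x))) \<longlongrightarrow> 0) (at_right 0)" using elim by simp
    show "\<forall>\<^sub>F r in at_right 0. norm (avg (ball x r) u - u x) \<le> avg (ball x r) (\<lambda>y. norm (u y - u x))"
    proof (rule eventually_at_rightI[of 0 1])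
      fix r :: real assume "r \<in> {0<..<1}"
      then have r: "0 < r" by simp
      let ?m = "measure lebesgue (ball x r)"
      have m: "0 < ?m" using r by simp
      have ui: "integrable lebesgue (\<lambda>y. indicator (ball x r) y *\<^sub>R u y)" using u by (intro integrable_mult_indicator) auto
      have "?m * (avg (ball x r) u - u x) = (LINT y|lebesgue. indicator (ball x r) y *\<^sub>R u y) - ?m * u x"
        using m by (simp add: avg_def set_lebesgue_integral_def right_diff_distrib)
      also have "\<dots> = (LINT y|lebesgue. indicator (ball x r) y *\<^sub>R (u y - u x))"
        using Bochner_Integration.integral_diff[OF ui integrable_const_ball[of x r "u x"]]
        by (simp add: right_diff_distrib)
      finally have "norm (LINT y|lebesgue. indicator (ball x r) y *\<^sub>R (u y - u x)) = \<bar>?m * (avg (ball x r) u - u x)\<bar>"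
        unfolding real_norm_def by (rule arg_cong[OF sym])
      then have "?m * \<bar>avg (ball x r) u - u x\<bar> = norm (LINT y|lebesgue. indicator (ball x r) y *\<^sub>R (u y - u x))"
        using m by (simp only: abs_mult abs_of_pos)
      also have "\<dots> \<le> (LINT y|lebesgue. norm (indicator (ball x r) y *\<^sub>R (u y - u x)))" by (rule integral_norm_bound)
      also have "\<dots> = (LINT y|lebesgue. indicator (ball x r) y *\<^sub>R norm (u y - u x))"
        by (simp add: abs_mult)
      also have "\<dots> = ?m * avg (ball x r) (\<lambda>y. norm (u y - u x))"
        using m by (simp add: avg_def set_lebesgue_integral_def)
      finally show "norm (avg (ball x r) u - u x) \<le> avg (ball x r) (\<lambda>y. norm (u y - u x))"
        using m by simp
    qed simp
  qed
  then show ?case by (simp only: LIM_zero_iff)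
qed

text \<open>By Tonelli a point \<open>y\<close> is counted once for every centre in
  \<open>ball y r\<close>, with the reciprocal volume as weight, so its total weight is 1. Because
  of this the majorants for different radii have the same integral.\<close>

lemma nn_integral_avg_ball:
  fixes u :: "'a::euclidean_space \<Rightarrow> real"
  assumes u: "integrable lebesgue u" "\<And>y. 0 \<le> u y" and r: "0 < r"
  shows "(\<integral>\<^sup>+x. ennreal (avg (ball x r) u) \<partial>lebesgue) = (\<integral>\<^sup>+y. ennreal (u y) \<partial>lebesgue)"
proof -
  define m where "m = measure lebesgue (ball (0::'a) r)"
  have m: "0 < m" using r by (simp add: m_def)
  have mx: "measure lebesgue (ball x r) = m" for x :: 'a by (simp only: m_def measure_ball_translate[of x])
  define k where "k p = ennreal (1 / m) * indicator (ball 0 r) (fst p - snd p)" for p :: "'a \<times> 'a"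
  have d: "(\<lambda>p::'a \<times> 'a. fst p - snd p) \<in> borel_measurable borel"
    by (intro borel_measurable_continuous_onI continuous_intros)
  have "(indicator (ball 0 r) :: 'a \<Rightarrow> ennreal) \<in> borel_measurable borel"
    by (intro borel_measurable_indicator borel_open) auto
  from measurable_compose[OF d this] have km: "k \<in> borel_measurable borel"
    unfolding k_def[abs_def] by (intro borel_measurable_times_ennreal) auto
  have um: "(\<lambda>y. ennreal (u y)) \<in> borel_measurable lebesgue" using u by measurable
  have "(\<integral>\<^sup>+x. ennreal (avg (ball x r) u) \<partial>lebesgue) = (\<integral>\<^sup>+x. \<integral>\<^sup>+y. k (x, y) * ennreal (u y) \<partial>lebesgue \<partial>lebesgue)"
  proof (rule nn_integral_cong)
    fix x :: 'a
    have ui: "integrable lebesgue (\<lambda>y. 1 / m * (indicator (ball x r) y *\<^sub>R u y))"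
      using u by (intro integrable_mult_right integrable_mult_indicator) auto
    have "avg (ball x r) u = (LINT y|lebesgue. 1 / m * (indicator (ball x r) y *\<^sub>R u y))"
      unfolding integral_mult_right_zero by (simp add: avg_def mx set_lebesgue_integral_def)
    also have "ennreal \<dots> = (\<integral>\<^sup>+y. ennreal (1 / m * (indicator (ball x r) y *\<^sub>R u y)) \<partial>lebesgue)"
      using m u by (intro nn_integral_eq_integral[symmetric] ui) auto
    also have "\<dots> = (\<integral>\<^sup>+y. k (x, y) * ennreal (u y) \<partial>lebesgue)"
    proof (rule nn_integral_cong)
      fix y
      show "ennreal (1 / m * (indicator (ball x r) y *\<^sub>R u y)) = k (x, y) * ennreal (u y)"
        using m u(2)[of y] by (auto simp: k_def indicator_def dist_norm norm_minus_commute[of x y] ennreal_mult[symmetric])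
    qed
    finally show "ennreal (avg (ball x r) u) = (\<integral>\<^sup>+y. k (x, y) * ennreal (u y) \<partial>lebesgue)" .
  qed
  also have "\<dots> = (\<integral>\<^sup>+y. (\<integral>\<^sup>+x. k (x, y) \<partial>lebesgue) * ennreal (u y) \<partial>lebesgue)"
    by (rule nn_integral_swap_kernel[OF km um])
  also have "(\<lambda>y. \<integral>\<^sup>+x. k (x, y) \<partial>lebesgue) = (\<lambda>y. 1)"
  proof
    fix y
    have "(\<integral>\<^sup>+x. k (x, y) \<partial>lebesgue) = (\<integral>\<^sup>+x. ennreal (1 / m) * indicator (ball y r) x \<partial>lebesgue)"
      by (intro nn_integral_cong) (auto simp: k_def indicator_def dist_norm norm_minus_commute)
    also have "\<dots> = ennreal (1 / m) * emeasure lebesgue (ball y r)" by (rule nn_integral_cmult_indicator) simp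
    also have "\<dots> = 1" unfolding emeasure_lebesgue_ball mx using m by (simp add: ennreal_mult[symmetric])
    finally show "(\<integral>\<^sup>+x. k (x, y) \<partial>lebesgue) = 1" .
  qed
  finally show ?thesis by simp
qed

text \<open>The mean is continuous in the centre first; then dominated convergence applies to the
  integral of the deviation. Its purpose is measurability of the integrand of the sharp modular in
  \<open>x\<close>.\<close>

lemma isCont_sharp_mean:
  fixes f :: "'a::euclidean_space \<Rightarrow> real"
  assumes \<Omega>: "open \<Omega>" and f: "f locally_integrable_on \<Omega>" and r: "0 < r" and a: "cball a r \<subseteq> \<Omega>"
  shows "isCont (\<lambda>x. sharp_mean (ball x r) f) a"
proof -
  obtain r' where r': "r < r'" "cball a r' \<subseteq> \<Omega>" using cball_enlarge[OF \<Omega> a r] by blast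
  define K where "K = cball a r'"
  define F where "F = (\<lambda>y. indicator K y *\<^sub>R f y)"
  have Fi: "integrable lebesgue F" unfolding F_def by (rule locally_integrable_on_compact[OF f]) (use r' in \<open>auto simp: K_def\<close>)
  define c where "c x = avg (ball x r) F" for x
  have cc: "isCont c a" unfolding c_def[abs_def] by (rule isCont_avg_ball[OF Fi r])
  have "\<exists>d>0. \<forall>x. x \<noteq> a \<and> dist x a < d \<longrightarrow> dist (c x) (c a) < 1"
    using cc[unfolded isCont_def tendsto_iff eventually_at, rule_format, of 1] by simp
  then obtain d where d0: "0 < d" "\<And>x. x \<noteq> a \<Longrightarrow> dist x a < d \<Longrightarrow> dist (c x) (c a) < 1" by blast
  have d: "0 < d" "\<And>x. dist x a < d \<Longrightarrow> dist (c x) (c a) < 1"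
  proof -
    show "dist (c x) (c a) < 1" if "dist x a < d" for x using d0(2)[of x] that by (cases "x = a") auto
  qed (rule d0)
  \<comment> \<open>Within this distance of \<open>a\<close> the balls stay in \<open>K\<close> and
    their means differ by less than 1 from the mean at \<open>a\<close>; both facts enter the
    majorant.\<close>
  define e where "e = min d (r' - r)"
  have e: "0 < e" using d r' by (simp add: e_def)
  have sub: "ball x r \<subseteq> K" if "dist x a < e" for x
  proof
    fix y assume "y \<in> ball x r"
    then show "y \<in> K" using that dist_triangle[of a y x] by (simp add: K_def e_def dist_commute)
  qed
  have FK: "(\<lambda>y. indicator (ball x r) y *\<^sub>R F y) = (\<lambda>y. indicator (ball x r) y *\<^sub>R f y)" if "dist x a < e" for x
    using sub[OF that] by (auto simp: F_def indicator_def fun_eq_iff)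
  have cx: "avg (ball x r) f = c x" if "dist x a < e" for x
    unfolding c_def avg_def set_lebesgue_integral_def FK[OF that] by simp
  define S where "S x = (LINT y|lebesgue. indicator (ball x r) y *\<^sub>R \<bar>F y - c x\<bar>)" for x
  have Sc: "isCont S a"
    unfolding S_def[abs_def]
  proof (rule isCont_integral[OF e])
    show "(\<lambda>y. indicator (ball x r) y *\<^sub>R \<bar>F y - c x\<bar>) \<in> borel_measurable lebesgue" for x
      using Fi by (intro borel_measurable_scaleR borel_measurable_indicator borel_measurable_abs borel_measurable_diff) auto
    show "AE y in lebesgue. isCont (\<lambda>x. indicator (ball x r) y *\<^sub>R \<bar>F y - c x\<bar>) a"
      using AE_not_sphere[of a r] by eventually_elim (intro continuous_intros isCont_indicator_ball cc)
    show "integrable lebesgue (\<lambda>y. \<bar>F y\<bar> + indicator K y * (\<bar>c a\<bar> + 1))"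
      using Fi by (intro Bochner_Integration.integrable_add integrable_abs integrable_mult_left integrable_real_indicator)
        (auto simp: K_def emeasure_lborel_cball_finite[simplified])
    show "AE y in lebesgue. norm (indicator (ball x r) y *\<^sub>R \<bar>F y - c x\<bar>) \<le> \<bar>F y\<bar> + indicator K y * (\<bar>c a\<bar> + 1)"
      if x: "dist x a < e" for x
    proof (intro AE_I2)
      fix y
      show "norm (indicator (ball x r) y *\<^sub>R \<bar>F y - c x\<bar>) \<le> \<bar>F y\<bar> + indicator K y * (\<bar>c a\<bar> + 1)"
      proof (cases "y \<in> ball x r")
        case True
        then have "y \<in> K" using sub[OF x] by blast
        moreover have "\<bar>c x - c a\<bar> < 1" using d(2)[of x] x by (simp add: e_def dist_real_def)
        ultimately show ?thesis using True by simp
      qed simp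
    qed
  qed
  have eq: "sharp_mean (ball x r) f = S x / measure lebesgue (ball (0::'a) r)" if "dist x a < e" for x
  proof -
    have "(LINT y|lebesgue. indicator (ball x r) y *\<^sub>R \<bar>f y - c x\<bar>) = S x"
      unfolding S_def
      by (intro Bochner_Integration.integral_cong) (use sub[OF that] in \<open>auto simp: F_def indicator_def\<close>)
    then show ?thesis
      unfolding sharp_mean_def cx[OF that] avg_def[of _ "\<lambda>y. \<bar>f y - c x\<bar>"] set_lebesgue_integral_def
      by (simp only: measure_ball_translate[of x])
  qed
  have "isCont (\<lambda>x. S x / measure lebesgue (ball (0::'a) r)) a" using Sc r by (intro continuous_intros) auto
  moreover have "\<forall>\<^sub>F x in nhds a. sharp_mean (ball x r) f = S x / measure lebesgue (ball (0::'a) r)"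
    using eq e by (auto simp: eventually_nhds_metric)
  ultimately show ?thesis by (simp only: isCont_cong)
qed

lemma borel_measurable_sharp_mean:
  fixes f :: "'a::euclidean_space \<Rightarrow> real"
  assumes \<Omega>: "open \<Omega>" and f: "f locally_integrable_on \<Omega>" and r: "0 < r"
  shows "(\<lambda>x. indicator (inner_part \<Omega> r) x *\<^sub>R (1 / r * sharp_mean (ball x r) f)) \<in> borel_measurable lebesgue"
proof (rule borel_measurable_lebesgueI, rule borel_measurable_continuous_on_indicator)
  show "inner_part \<Omega> r \<in> sets borel" by (intro borel_open open_inner_part \<Omega>)
  show "continuous_on (inner_part \<Omega> r) (\<lambda>x. 1 / r * sharp_mean (ball x r) f)"
  proof (intro continuous_at_imp_continuous_on ballI)
    fix x assume x: "x \<in> inner_part \<Omega> r"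
    show "isCont (\<lambda>x. 1 / r * sharp_mean (ball x r) f) x"
      by (intro continuous_mult continuous_const isCont_sharp_mean[OF \<Omega> f r inner_partD(2)[OF x r]])
  qed
qed

text \<open>Almost all mass of the weights ends up below any \<gamma>, where \<open>I\<close> is
  close to \<open>L\<close>, while beyond \<gamma> the values are at most \<open>C\<close> and the
  mass tends to 0. The proof compares integrands only with multiples of the weights, so
  measurability of \<open>I\<close> in \<open>r\<close> never has to be established.\<close>

lemma weighted_average:
  fixes I :: "real \<Rightarrow> ennreal" and \<psi> :: "real \<Rightarrow> real \<Rightarrow> real"
  assumes \<psi>i: "\<And>\<epsilon>. 0 < \<epsilon> \<Longrightarrow> set_integrable lebesgue {0<..} (\<psi> \<epsilon>)"
    and \<psi>0: "\<And>\<epsilon> r. 0 < \<epsilon> \<Longrightarrow> 0 < r \<Longrightarrow> 0 \<le> \<psi> \<epsilon> r"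
    and \<psi>1: "\<And>\<epsilon>. 0 < \<epsilon> \<Longrightarrow> (LINT r:{0<..}|lebesgue. \<psi> \<epsilon> r) = 1"
    and \<psi>t: "\<And>\<gamma>. 0 < \<gamma> \<Longrightarrow> ((\<lambda>\<epsilon>. LINT r:{\<gamma><..}|lebesgue. \<psi> \<epsilon> r) \<longlongrightarrow> 0) (at_right 0)"
  shows weighted_average_head: "\<And>\<gamma>. 0 < \<gamma> \<Longrightarrow> ((\<lambda>\<epsilon>. \<integral>\<^sup>+r\<in>{0<..\<gamma>}. ennreal (\<psi> \<epsilon> r) \<partial>lebesgue) \<longlongrightarrow> 1) (at_right 0)"
    and weighted_average_tendsto: "(I \<longlongrightarrow> L) (at_right 0) \<Longrightarrow> (\<And>r. 0 < r \<Longrightarrow> I r \<le> C) \<Longrightarrow> C < top \<Longrightarrow>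
      ((\<lambda>\<epsilon>. \<integral>\<^sup>+r\<in>{0<..}. I r * ennreal (\<psi> \<epsilon> r) \<partial>lebesgue) \<longlongrightarrow> L) (at_right 0)"
proof -
  have nn: "(\<integral>\<^sup>+r\<in>A. ennreal (\<psi> \<epsilon> r) \<partial>lebesgue) = ennreal (LINT r:A|lebesgue. \<psi> \<epsilon> r)"
    and Ai: "set_integrable lebesgue A (\<psi> \<epsilon>)" and Am: "(\<lambda>r. ennreal (\<psi> \<epsilon> r) * indicator A r) \<in> borel_measurable lebesgue"
    if \<epsilon>: "0 < \<epsilon>" and A: "A \<subseteq> {0<..}" "A \<in> sets lebesgue" for \<epsilon> and A :: "real set"
  proof -
    show i: "set_integrable lebesgue A (\<psi> \<epsilon>)" by (rule set_integrable_subset[OF \<psi>i[OF \<epsilon>] A(2,1)])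
    have eq: "(\<lambda>r. ennreal (\<psi> \<epsilon> r) * indicator A r) = (\<lambda>r. ennreal (indicator A r *\<^sub>R \<psi> \<epsilon> r))"
      by (auto simp: indicator_def fun_eq_iff)
    show "(\<integral>\<^sup>+r\<in>A. ennreal (\<psi> \<epsilon> r) \<partial>lebesgue) = ennreal (LINT r:A|lebesgue. \<psi> \<epsilon> r)"
      unfolding eq set_lebesgue_integral_def
      by (rule nn_integral_eq_integral[OF i[unfolded set_integrable_def]]) (use A \<psi>0[OF \<epsilon>] in \<open>auto simp: indicator_def subset_iff\<close>)
    show "(\<lambda>r. ennreal (\<psi> \<epsilon> r) * indicator A r) \<in> borel_measurable lebesgue"
      unfolding eq using i unfolding set_integrable_def by measurable
  qed
  have pos: "\<forall>\<^sub>F \<epsilon> in at_right 0. (0::real) < \<epsilon>" by (rule eventually_at_right_less)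
  have tail: "((\<lambda>\<epsilon>. \<integral>\<^sup>+r\<in>{\<gamma><..}. ennreal (\<psi> \<epsilon> r) \<partial>lebesgue) \<longlongrightarrow> 0) (at_right 0)" if \<gamma>: "0 < \<gamma>" for \<gamma>
  proof (rule Lim_transform_eventually)
    show "((\<lambda>\<epsilon>. ennreal (LINT r:{\<gamma><..}|lebesgue. \<psi> \<epsilon> r)) \<longlongrightarrow> 0) (at_right 0)"
      using tendsto_ennrealI[OF \<psi>t[OF \<gamma>]] by simp
    show "\<forall>\<^sub>F \<epsilon> in at_right 0. ennreal (LINT r:{\<gamma><..}|lebesgue. \<psi> \<epsilon> r) = (\<integral>\<^sup>+r\<in>{\<gamma><..}. ennreal (\<psi> \<epsilon> r) \<partial>lebesgue)"
      using pos by eventually_elim (subst nn, use \<gamma> in auto)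
  qed
  show head: "((\<lambda>\<epsilon>. \<integral>\<^sup>+r\<in>{0<..\<gamma>}. ennreal (\<psi> \<epsilon> r) \<partial>lebesgue) \<longlongrightarrow> 1) (at_right 0)" if \<gamma>: "0 < \<gamma>" for \<gamma>
  proof (rule Lim_transform_eventually)
    show "((\<lambda>\<epsilon>. ennreal (1 - (LINT r:{\<gamma><..}|lebesgue. \<psi> \<epsilon> r))) \<longlongrightarrow> 1) (at_right 0)"
      using tendsto_ennrealI[OF tendsto_diff[OF tendsto_const[of 1] \<psi>t[OF \<gamma>]]] by simp
    show "\<forall>\<^sub>F \<epsilon> in at_right 0. ennreal (1 - (LINT r:{\<gamma><..}|lebesgue. \<psi> \<epsilon> r)) = (\<integral>\<^sup>+r\<in>{0<..\<gamma>}. ennreal (\<psi> \<epsilon> r) \<partial>lebesgue)"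
      using pos
    proof eventually_elim
      case (elim \<epsilon>)
      have un: "{0<..\<gamma>} \<union> {\<gamma><..} = {0<..}" using \<gamma> by auto
      have "(LINT r:{0<..\<gamma>} \<union> {\<gamma><..}|lebesgue. \<psi> \<epsilon> r) = (LINT r:{0<..\<gamma>}|lebesgue. \<psi> \<epsilon> r) + (LINT r:{\<gamma><..}|lebesgue. \<psi> \<epsilon> r)"
        by (rule set_integral_Un[OF _ Ai[OF elim] Ai[OF elim]]) (use \<gamma> in auto)
      then have "(LINT r:{0<..\<gamma>}|lebesgue. \<psi> \<epsilon> r) = 1 - (LINT r:{\<gamma><..}|lebesgue. \<psi> \<epsilon> r)"
        unfolding un \<psi>1[OF elim] by simp
      then show ?case by (subst nn[OF elim]) auto
    qed
  qed
  assume IL: "(I \<longlongrightarrow> L) (at_right 0)" and IC: "\<And>r. 0 < r \<Longrightarrow> I r \<le> C" and C: "C < top"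
  let ?R = "\<lambda>\<epsilon>. \<integral>\<^sup>+r\<in>{0<..}. I r * ennreal (\<psi> \<epsilon> r) \<partial>lebesgue"
  show "(?R \<longlongrightarrow> L) (at_right 0)"
  proof (rule order_tendstoI)
    fix l assume "l < L"
    then obtain l' where l': "l < l'" "l' < L" using dense by blast
    obtain \<gamma> where \<gamma>: "0 < \<gamma>" "\<And>r. 0 < r \<Longrightarrow> r < \<gamma> \<Longrightarrow> l' < I r"
      using order_tendstoD(1)[OF IL l'(2)] unfolding eventually_at_right_field by auto
    \<comment> \<open>Halving \<gamma> makes the closed right end of the interval fall into the
      range where the strict bound on \<open>I\<close> holds.\<close>
    have "((\<lambda>\<epsilon>. l' * (\<integral>\<^sup>+r\<in>{0<..\<gamma>/2}. ennreal (\<psi> \<epsilon> r) \<partial>lebesgue)) \<longlongrightarrow> l' * 1) (at_right 0)"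
      using l' \<gamma> by (intro ennreal_tendsto_cmult head) (auto simp: less_top[symmetric] dest: order.strict_trans2)
    then have "\<forall>\<^sub>F \<epsilon> in at_right 0. l < l' * (\<integral>\<^sup>+r\<in>{0<..\<gamma>/2}. ennreal (\<psi> \<epsilon> r) \<partial>lebesgue)"
      using l' by (intro order_tendstoD(1)) auto
    then show "\<forall>\<^sub>F \<epsilon> in at_right 0. l < ?R \<epsilon>"
      using pos
    proof eventually_elim
      case (elim \<epsilon>)
      have "l' * (\<integral>\<^sup>+r\<in>{0<..\<gamma>/2}. ennreal (\<psi> \<epsilon> r) \<partial>lebesgue) = (\<integral>\<^sup>+r. l' * (ennreal (\<psi> \<epsilon> r) * indicator {0<..\<gamma>/2} r) \<partial>lebesgue)"
        by (rule nn_integral_cmult[symmetric]) (rule Am[OF elim(2)], auto)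
      also have "\<dots> \<le> ?R \<epsilon>"
      proof (rule nn_integral_mono)
        fix r
        show "l' * (ennreal (\<psi> \<epsilon> r) * indicator {0<..\<gamma>/2} r) \<le> I r * ennreal (\<psi> \<epsilon> r) * indicator {0<..} r"
          using \<gamma>(2)[of r] \<gamma>(1) by (auto simp: indicator_def intro!: mult_right_mono)
      qed
      finally show ?case using elim by (auto intro: less_le_trans)
    qed
  next
    fix l assume "L < l"
    then obtain l' where l': "L < l'" "l' < l" using dense by blast
    obtain \<gamma> where \<gamma>: "0 < \<gamma>" "\<And>r. 0 < r \<Longrightarrow> r < \<gamma> \<Longrightarrow> I r < l'"
      using order_tendstoD(2)[OF IL l'(1)] unfolding eventually_at_right_field by auto
    \<comment> \<open>Near 0 the total mass 1 gives at most \<open>l'\<close>; the remainder is at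
      most \<open>C\<close> times a vanishing tail.\<close>
    have "((\<lambda>\<epsilon>. l' + C * (\<integral>\<^sup>+r\<in>{\<gamma>/2<..}. ennreal (\<psi> \<epsilon> r) \<partial>lebesgue)) \<longlongrightarrow> l' + C * 0) (at_right 0)"
      using \<gamma> by (intro tendsto_add tendsto_const ennreal_tendsto_cmult C tail) auto
    then have "\<forall>\<^sub>F \<epsilon> in at_right 0. l' + C * (\<integral>\<^sup>+r\<in>{\<gamma>/2<..}. ennreal (\<psi> \<epsilon> r) \<partial>lebesgue) < l"
      using l' by (intro order_tendstoD(2)) auto
    then show "\<forall>\<^sub>F \<epsilon> in at_right 0. ?R \<epsilon> < l"
      using pos
    proof eventually_elim
      case (elim \<epsilon>)
      have m1: "(\<lambda>r. ennreal (\<psi> \<epsilon> r) * indicator {0<..} r) \<in> borel_measurable lebesgue"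
        and m2: "(\<lambda>r. ennreal (\<psi> \<epsilon> r) * indicator {\<gamma>/2<..} r) \<in> borel_measurable lebesgue"
        using \<gamma> by (auto intro!: Am[OF elim(2)])
      have "?R \<epsilon> \<le> (\<integral>\<^sup>+r. l' * (ennreal (\<psi> \<epsilon> r) * indicator {0<..} r) + C * (ennreal (\<psi> \<epsilon> r) * indicator {\<gamma>/2<..} r) \<partial>lebesgue)"
      proof (rule nn_integral_mono)
        fix r
        show "I r * ennreal (\<psi> \<epsilon> r) * indicator {0<..} r \<le>
            l' * (ennreal (\<psi> \<epsilon> r) * indicator {0<..} r) + C * (ennreal (\<psi> \<epsilon> r) * indicator {\<gamma>/2<..} r)"
        proof (cases "0 < r \<and> r \<le> \<gamma> / 2")
          case True
          then have "I r * ennreal (\<psi> \<epsilon> r) \<le> l' * ennreal (\<psi> \<epsilon> r)" using \<gamma>(2)[of r] \<gamma>(1) by (intro mult_right_mono) auto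
          then show ?thesis using True by simp
        next
          case False
          then have "0 < r \<Longrightarrow> I r * ennreal (\<psi> \<epsilon> r) \<le> C * ennreal (\<psi> \<epsilon> r)" using IC[of r] by (intro mult_right_mono) auto
          then show ?thesis using False by (cases "0 < r") (auto simp: add_increasing)
        qed
      qed
      also have "\<dots> = l' * (\<integral>\<^sup>+r\<in>{0<..}. ennreal (\<psi> \<epsilon> r) \<partial>lebesgue) + C * (\<integral>\<^sup>+r\<in>{\<gamma>/2<..}. ennreal (\<psi> \<epsilon> r) \<partial>lebesgue)"
        using m1 m2 by (subst nn_integral_add) (auto simp: nn_integral_cmult)
      also have "(\<integral>\<^sup>+r\<in>{0<..}. ennreal (\<psi> \<epsilon> r) \<partial>lebesgue) = 1"
        by (subst nn[OF elim(2)]) (auto simp: \<psi>1[OF elim(2)])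
      finally show ?case using elim by (auto intro: le_less_trans)
    qed
  qed
qed

lemma weak_gradient_divide:
  fixes f :: "real^'n::finite \<Rightarrow> real"
  assumes G: "weak_gradient \<Omega> f G"
  shows "weak_gradient \<Omega> (\<lambda>x. f x / l) (\<lambda>x. G x /\<^sub>R l)"
  unfolding weak_gradient_def
proof (intro conjI allI impI)
  show "(\<lambda>x. G x /\<^sub>R l) locally_integrable_on \<Omega>"
    using G unfolding weak_gradient_def locally_integrable_on_def by (auto intro: set_integrable_scaleR_right)
  fix \<eta> i assume \<eta>: "test_function \<Omega> \<eta>"
  have "(LINT x:\<Omega>|lebesgue. f x / l * partial_deriv i \<eta> x) = (LINT x:\<Omega>|lebesgue. f x * partial_deriv i \<eta> x) / l"
    unfolding set_lebesgue_integral_def by (subst integral_divide_zero[symmetric]) simp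
  also have "\<dots> = - ((LINT x:\<Omega>|lebesgue. G x $ i * \<eta> x) / l)" using G \<eta> by (simp add: weak_gradient_def)
  also have "(LINT x:\<Omega>|lebesgue. G x $ i * \<eta> x) / l = (LINT x:\<Omega>|lebesgue. (G x /\<^sub>R l) $ i * \<eta> x)"
    unfolding set_lebesgue_integral_def by (subst integral_divide_zero[symmetric]) (simp add: divide_inverse mult_ac)
  finally show "(LINT x:\<Omega>|lebesgue. f x / l * partial_deriv i \<eta> x) = - (LINT x:\<Omega>|lebesgue. (G x /\<^sub>R l) $ i * \<eta> x)" .
qed

lemma locally_integrable_on_divide:
  fixes f :: "'a::euclidean_space \<Rightarrow> real"
  assumes "f locally_integrable_on \<Omega>"
  shows "(\<lambda>x. f x / l) locally_integrable_on \<Omega>"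
  using assms unfolding locally_integrable_on_def divide_inverse by (auto intro: set_integrable_mult_left)

lemma c_const_nonneg: "0 \<le> c_const k"
  unfolding c_const_def by (rule avg_nonneg) simp

section \<open>Modulars under scaling, and the limits for functions with gradient in the
  space\<close>

context phi_setting
begin

lemma phi_scale:
  assumes x: "x \<in> \<Omega>" and c: "0 \<le> c" "c \<le> 1" and t: "0 \<le> t"
  shows "\<phi> x (c * t) \<le> ennreal c * \<phi> x t"
proof -
  have "\<phi> x ((1 - c) * 0 + c * t) \<le> ennreal (1 - c) * \<phi> x 0 + ennreal c * \<phi> x t"
    using Phi[OF x] c t unfolding Phi_function_def by auto
  then show ?thesis using phi_0[OF x] by simp
qed

lemma borel_measurable_phi_indicator:
  assumes "u \<in> borel_measurable (lebesgue_on \<Omega>)" "\<And>x. 0 \<le> u x"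
  shows "(\<lambda>x. \<phi> x (u x) * indicator \<Omega> x) \<in> borel_measurable lebesgue"
  using borel_measurable_phi_compose[OF assms] by (subst (asm) borel_measurable_restrict_space_iff_ennreal) auto

lemma nn_integral_phi_scale:
  assumes u: "u \<in> borel_measurable (lebesgue_on \<Omega>)" "\<And>x. 0 \<le> u x" and c: "0 \<le> c" "c \<le> 1"
  shows "(\<integral>\<^sup>+x\<in>\<Omega>. \<phi> x (c * u x) \<partial>lebesgue) \<le> ennreal c * (\<integral>\<^sup>+x\<in>\<Omega>. \<phi> x (u x) \<partial>lebesgue)"
proof -
  have "(\<integral>\<^sup>+x\<in>\<Omega>. \<phi> x (c * u x) \<partial>lebesgue) \<le> (\<integral>\<^sup>+x. ennreal c * (\<phi> x (u x) * indicator \<Omega> x) \<partial>lebesgue)"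
    using phi_scale[OF _ c u(2)] by (intro nn_integral_mono) (auto simp: indicator_def)
  also have "\<dots> = ennreal c * (\<integral>\<^sup>+x\<in>\<Omega>. \<phi> x (u x) \<partial>lebesgue)"
    by (rule nn_integral_cmult[OF borel_measurable_phi_indicator[OF u]])
  finally show ?thesis .
qed

lemma nn_integral_phi_doubling:
  assumes u: "u \<in> borel_measurable (lebesgue_on \<Omega>)" "\<And>x. 0 \<le> u x" and K: "1 \<le> K"
  shows "(\<integral>\<^sup>+x\<in>\<Omega>. \<phi> x (K * u x) \<partial>lebesgue) \<le> ennreal (K powr b / cb) * (\<integral>\<^sup>+x\<in>\<Omega>. \<phi> x (u x) \<partial>lebesgue)"
proof -
  have "(\<integral>\<^sup>+x\<in>\<Omega>. \<phi> x (K * u x) \<partial>lebesgue) \<le> (\<integral>\<^sup>+x. ennreal (K powr b / cb) * (\<phi> x (u x) * indicator \<Omega> x) \<partial>lebesgue)"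
  proof (rule nn_integral_mono_AE)
    show "AE x in lebesgue. \<phi> x (K * u x) * indicator \<Omega> x \<le> ennreal (K powr b / cb) * (\<phi> x (u x) * indicator \<Omega> x)"
      using AE_good
    proof eventually_elim
      case (elim x)
      then show ?case using phi_doubling[OF _ u(2) K, of x] by (cases "x \<in> \<Omega>") auto
    qed
  qed
  also have "\<dots> = ennreal (K powr b / cb) * (\<integral>\<^sup>+x\<in>\<Omega>. \<phi> x (u x) \<partial>lebesgue)"
    by (rule nn_integral_cmult[OF borel_measurable_phi_indicator[OF u]])
  finally show ?thesis .
qed

text \<open>Convexity with \<phi>(x, 0) = 0 lets the factor 1/(1 + m) bring a finite modular m down
  to m/(1 + m), which is at most 1, the normalisation that the key estimate asks for.\<close>

lemma LphiD:
  fixes G :: "real^'n \<Rightarrow> 'c::euclidean_space"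
  assumes G: "G \<in> Lphi \<phi> \<Omega>"
  obtains \<mu> where "0 < \<mu>" "(\<integral>\<^sup>+x\<in>\<Omega>. \<phi> x (\<mu> * norm (G x)) \<partial>lebesgue) \<le> 1"
    "(\<lambda>x. norm (G x)) \<in> borel_measurable (lebesgue_on \<Omega>)"
proof -
  have Gm[measurable]: "G \<in> borel_measurable (lebesgue_on \<Omega>)" using G by (simp add: Lphi_def)
  then have nm: "(\<lambda>x. norm (G x)) \<in> borel_measurable (lebesgue_on \<Omega>)" by measurable
  obtain l where l: "0 < l" "modular \<phi> \<Omega> (\<lambda>x. l *\<^sub>R G x) < \<infinity>" using G by (auto simp: Lphi_def)
  let ?M = "\<integral>\<^sup>+x\<in>\<Omega>. \<phi> x (l * norm (G x)) \<partial>lebesgue"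
  have M: "?M < top" using l by (simp add: modular_def)
  define m where "m = enn2real ?M"
  have Mm: "?M = ennreal m" using M by (simp add: m_def)
  have m: "0 \<le> m" by (simp add: m_def)
  have um: "(\<lambda>x. l * norm (G x)) \<in> borel_measurable (lebesgue_on \<Omega>)" by measurable
  have "(\<integral>\<^sup>+x\<in>\<Omega>. \<phi> x (1 / (1 + m) * (l * norm (G x))) \<partial>lebesgue) \<le> ennreal (1 / (1 + m)) * ?M"
    by (rule nn_integral_phi_scale[OF um]) (use l m in auto)
  also have "\<dots> = ennreal (m / (1 + m))" unfolding Mm using m by (simp add: ennreal_mult[symmetric])
  also have "\<dots> \<le> ennreal 1" using m by (intro ennreal_leI) simp
  finally have "(\<integral>\<^sup>+x\<in>\<Omega>. \<phi> x (l / (1 + m) * norm (G x)) \<partial>lebesgue) \<le> 1" by simp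
  then show thesis using that[of "l / (1 + m)"] l m nm by simp
qed

text \<open>One multiple with finite modular is enough: doubling reaches every other multiple, in
  particular the one with the factor \<open>c_const k\<close>.\<close>

lemma nn_integral_phi_mult_finite:
  assumes u: "u \<in> borel_measurable (lebesgue_on \<Omega>)" "\<And>x. 0 \<le> u x" and l: "0 < l" "0 \<le> c"
    and fin: "(\<integral>\<^sup>+x\<in>\<Omega>. \<phi> x (l * u x) \<partial>lebesgue) < top"
  shows "(\<integral>\<^sup>+x\<in>\<Omega>. \<phi> x (c * u x) \<partial>lebesgue) < top"
proof -
  define K where "K = max 1 (c / l)"
  have [measurable]: "u \<in> borel_measurable (lebesgue_on \<Omega>)" by fact
  have um: "(\<lambda>x. l * u x) \<in> borel_measurable (lebesgue_on \<Omega>)" by measurable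
  have "(\<integral>\<^sup>+x\<in>\<Omega>. \<phi> x (c * u x) \<partial>lebesgue) \<le> (\<integral>\<^sup>+x\<in>\<Omega>. \<phi> x (K * (l * u x)) \<partial>lebesgue)"
  proof (rule nn_integral_mono)
    fix x
    have "c * u x = c / l * (l * u x)" using l by simp
    also have "\<dots> \<le> K * (l * u x)" unfolding K_def using l u(2)[of x] by (intro mult_right_mono) auto
    finally show "\<phi> x (c * u x) * indicator \<Omega> x \<le> \<phi> x (K * (l * u x)) * indicator \<Omega> x"
      using l u(2)[of x] phi_mono[of x "c * u x" "K * (l * u x)"] by (auto simp: indicator_def)
  qed
  also have "\<dots> \<le> ennreal (K powr b / cb) * (\<integral>\<^sup>+x\<in>\<Omega>. \<phi> x (l * u x) \<partial>lebesgue)"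
    by (rule nn_integral_phi_doubling[OF um]) (use l u(2) in \<open>auto simp: K_def\<close>)
  also have "\<dots> < top" using fin by (auto simp: ennreal_mult_less_top)
  finally show ?thesis .
qed

definition sharp_integral :: "(real^'n \<Rightarrow> real) \<Rightarrow> real \<Rightarrow> ennreal" where
  "sharp_integral f r = (\<integral>\<^sup>+x\<in>inner_part \<Omega> r. \<phi> x (1 / r * sharp_mean (ball x r) f) \<partial>lebesgue)"

lemma sharp_modular_eq:
  "sharp_modular \<phi> \<Omega> w f = (\<integral>\<^sup>+r\<in>{0<..}. sharp_integral f r * ennreal (w r) \<partial>lebesgue)"
  by (simp add: sharp_modular_def sharp_integral_def)

text \<open>The Poincare inequality, doubling and the key estimate give the majorants
  \<open>Q r\<close>. These converge almost everywhere to \<open>Q0\<close> by Lebesgue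
  differentiation and all have integral \<open>q\<close>, so the limit follows from dominated
  convergence with moving majorants, and \<open>q\<close> is the bound for all radii.\<close>

theorem sharp_integral_limit:
  fixes k :: 'n
  assumes f: "f locally_integrable_on \<Omega>" and G: "weak_gradient \<Omega> f G" and GL: "G \<in> Lphi \<phi> \<Omega>"
  shows "(sharp_integral f \<longlongrightarrow> modular \<phi> \<Omega> (\<lambda>x. c_const k * norm (G x))) (at_right 0)"
    and "\<exists>C<top. \<forall>r>0. sharp_integral f r \<le> C"
    and "modular \<phi> \<Omega> (\<lambda>x. c_const k * norm (G x)) < top"
proof -
  let ?c = "c_const k"
  have c: "0 \<le> ?c" by (rule c_const_nonneg)
  obtain \<mu> where \<mu>: "0 < \<mu>" "(\<integral>\<^sup>+x\<in>\<Omega>. \<phi> x (\<mu> * norm (G x)) \<partial>lebesgue) \<le> 1"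
    and nm[measurable]: "(\<lambda>x. norm (G x)) \<in> borel_measurable (lebesgue_on \<Omega>)"
    using LphiD[OF GL] by blast
  define g where "g x = \<mu> * norm (G x)" for x
  have g: "g \<in> borel_measurable (lebesgue_on \<Omega>)" "\<And>x. 0 \<le> g x" unfolding g_def[abs_def] using \<mu> by (measurable, simp)
  have gmod: "(\<integral>\<^sup>+x\<in>\<Omega>. \<phi> x (g x) \<partial>lebesgue) \<le> 1" using \<mu> by (simp add: g_def)
  then have gfin: "(\<integral>\<^sup>+x\<in>\<Omega>. \<phi> x (g x) \<partial>lebesgue) < \<infinity>" by (auto intro: le_less_trans)
  have modc: "modular \<phi> \<Omega> (\<lambda>x. ?c * norm (G x)) = (\<integral>\<^sup>+x\<in>\<Omega>. \<phi> x (?c * norm (G x)) \<partial>lebesgue)"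
    using c by (simp add: modular_def abs_mult)
  show "modular \<phi> \<Omega> (\<lambda>x. ?c * norm (G x)) < top"
    unfolding modc using gfin by (intro nn_integral_phi_mult_finite[OF nm _ \<mu>(1) c]) (auto simp: g_def)
  have Pi: "integrable lebesgue (Pg g)" by (rule integrable_Pg[OF g gfin])
  define Cp where "Cp = (2::real) ^ (CARD('n) + 1)"
  \<comment> \<open>The factor by which the argument allowed in the key estimate must be enlarged:
    \<open>Cp\<close> from the Poincare inequality, \<mu> from the normalisation and \<kappa> from
    the key estimate. Doubling pays for it with the constant \<open>D\<close>.\<close>
  define K where "K = max 1 (Cp / (\<mu> * \<kappa>))"
  define D where "D = K powr b / cb"
  have D: "0 \<le> D" using cb by (simp add: D_def)
  \<comment> \<open>The summands are kept as separate \<open>ennreal\<close> terms so that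
    additivity and \<open>nn_integral_avg_ball\<close> apply to each.\<close>
  define Q where "Q r x = ennreal D * (ennreal (avg (ball x r) (Pg g)) + ennreal (habs x) + ennreal (avg (ball x r) habs))" for r x
  define Q0 where "Q0 x = ennreal D * (ennreal (Pg g x) + ennreal (habs x) + ennreal (habs x))" for x
  define H where "H r x = \<phi> x (1 / r * sharp_mean (ball x r) f) * indicator (inner_part \<Omega> r) x" for r x
  have Hle: "AE x in lebesgue. \<forall>r>0. H r x \<le> Q r x"
    using AE_good
  proof eventually_elim
    case (elim x)
    show ?case
    proof (intro allI impI)
      fix r :: real assume r: "0 < r"
      show "H r x \<le> Q r x"
      proof (cases "x \<in> inner_part \<Omega> r")
        case True
        note ip = inner_partD[OF True r]
        have gx: "good x" using elim ip by simp
        let ?B = "ball x r"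
        have sub: "?B \<subseteq> \<Omega>" using ip by (meson ball_subset_cball order_trans)
        have "1 / r * sharp_mean ?B f \<le> Cp * avg ?B (\<lambda>y. norm (G y))"
          using poincare_ball[OF open_Omega f G r ip(2)] r by (simp add: Cp_def field_simps)
        also have "\<dots> = Cp / (\<mu> * \<kappa>) * (\<kappa> * avg ?B g)"
          using \<mu> kappa_pos by (simp add: g_def avg_def set_lebesgue_integral_def)
        also have "\<dots> \<le> K * (\<kappa> * avg ?B g)"
          unfolding K_def using kappa_pos avg_nonneg[of ?B g] g(2) by (intro mult_right_mono) auto
        finally have "\<phi> x (1 / r * sharp_mean ?B f) \<le> \<phi> x (K * (\<kappa> * avg ?B g))"
          using ip r sharp_mean_nonneg[of ?B f] by (intro phi_mono) auto
        also have "\<dots> \<le> ennreal (K powr b / cb) * \<phi> x (\<kappa> * avg ?B g)"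
          using kappa_pos avg_nonneg[of ?B g] g(2) by (intro phi_doubling gx) (auto simp: K_def)
        also have "\<phi> x (\<kappa> * avg ?B g) = ennreal (P x (\<kappa> * avg ?B g))"
          using kappa_pos avg_nonneg[of ?B g] g(2) by (intro phi_eq_P gx) auto
        also have "ennreal (K powr b / cb) * ennreal (P x (\<kappa> * avg ?B g)) \<le>
            ennreal D * ennreal (avg ?B (Pg g) + habs x + avg ?B habs)"
          unfolding D_def by (intro mult_left_mono ennreal_leI key_estimate[OF g gmod gx r sub]) simp
        also have "\<dots> = Q r x"
          unfolding Q_def using avg_nonneg[of ?B "Pg g"] avg_nonneg[of ?B habs] Pg_nonneg habs_nonneg
          by (simp add: ennreal_plus[symmetric] del: ennreal_plus)
        finally show ?thesis using True by (simp add: H_def)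
      qed (simp add: H_def)
    qed
  qed
  have Hm: "H r \<in> borel_measurable lebesgue" if r: "0 < r" for r
  proof -
    define u where "u x = indicator (inner_part \<Omega> r) x *\<^sub>R (1 / r * sharp_mean (ball x r) f)" for x
    have "u \<in> borel_measurable lebesgue" unfolding u_def[abs_def] by (rule borel_measurable_sharp_mean[OF open_Omega f r])
    then have "u \<in> borel_measurable (lebesgue_on \<Omega>)" by (rule measurable_restrict_space1)
    moreover have "0 \<le> u x" for x using r sharp_mean_nonneg[of "ball x r" f] by (simp add: u_def)
    ultimately have "(\<lambda>x. \<phi> x (u x) * indicator \<Omega> x) \<in> borel_measurable lebesgue" by (rule borel_measurable_phi_indicator)
    moreover have "inner_part \<Omega> r \<in> sets lebesgue" using open_inner_part[OF open_Omega] by simp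
    ultimately have "(\<lambda>x. \<phi> x (u x) * indicator \<Omega> x * indicator (inner_part \<Omega> r) x) \<in> borel_measurable lebesgue"
      by (rule borel_measurable_times_ennreal[OF _ borel_measurable_indicator])
    moreover have "(\<lambda>x. \<phi> x (u x) * indicator \<Omega> x * indicator (inner_part \<Omega> r) x) = H r"
      using inner_partD(1)[OF _ r] by (auto simp: H_def u_def fun_eq_iff indicator_def)
    ultimately show ?thesis by simp
  qed
  have hm: "(\<lambda>x. ennreal (habs x)) \<in> borel_measurable lebesgue"
    using borel_measurable_integrable[OF integrable_habs] by measurable
  have pm: "(\<lambda>x. ennreal (Pg g x)) \<in> borel_measurable lebesgue"
    using borel_measurable_integrable[OF Pi] by measurable
  have am: "(\<lambda>x. ennreal (avg (ball x r) u)) \<in> borel_measurable lebesgue" if "integrable lebesgue u" "0 < r" for u :: "real^'n \<Rightarrow> real" and r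
    using borel_measurable_lebesgueI[OF borel_measurable_avg_ball[OF that]] by measurable
  have Qm: "Q r \<in> borel_measurable lebesgue" if r: "0 < r" for r
    unfolding Q_def[abs_def] by (intro borel_measurable_times_ennreal borel_measurable_add borel_measurable_const am hm Pi integrable_habs r)
  have Q0m: "Q0 \<in> borel_measurable lebesgue"
    unfolding Q0_def[abs_def] by (intro borel_measurable_times_ennreal borel_measurable_add borel_measurable_const hm pm)
  define q where "q = (\<integral>\<^sup>+x. Q0 x \<partial>lebesgue)"
  have q0: "q = ennreal D * ((\<integral>\<^sup>+x. ennreal (Pg g x) \<partial>lebesgue) + (\<integral>\<^sup>+x. ennreal (habs x) \<partial>lebesgue) + (\<integral>\<^sup>+x. ennreal (habs x) \<partial>lebesgue))"
    unfolding q_def Q0_def using hm pm by (subst nn_integral_cmult) (auto simp: nn_integral_add)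
  have Qi: "(\<integral>\<^sup>+x. Q r x \<partial>lebesgue) = q" if r: "0 < r" for r
  proof -
    have "(\<integral>\<^sup>+x. Q r x \<partial>lebesgue) = ennreal D * ((\<integral>\<^sup>+x. ennreal (avg (ball x r) (Pg g)) \<partial>lebesgue) +
        (\<integral>\<^sup>+x. ennreal (habs x) \<partial>lebesgue) + (\<integral>\<^sup>+x. ennreal (avg (ball x r) habs) \<partial>lebesgue))"
      unfolding Q_def using hm am[OF Pi r] am[OF integrable_habs r]
      by (subst nn_integral_cmult) (auto simp: nn_integral_add)
    then show ?thesis
      unfolding nn_integral_avg_ball[OF Pi Pg_nonneg r] nn_integral_avg_ball[OF integrable_habs habs_nonneg r] q0 .
  qed
  have qfin: "q < top"
    unfolding q0 using Pi integrable_habs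
    by (auto simp: ennreal_mult_less_top nn_integral_eq_integral Pg_nonneg habs_nonneg)
  have IH: "sharp_integral f r = (\<integral>\<^sup>+x. H r x \<partial>lebesgue)" for r
    by (simp add: sharp_integral_def H_def)
  show "\<exists>C<top. \<forall>r>0. sharp_integral f r \<le> C"
  proof (intro exI conjI allI impI)
    fix r :: real assume r: "0 < r"
    have "AE x in lebesgue. H r x \<le> Q r x" using Hle by eventually_elim (use r in auto)
    from nn_integral_mono_AE[OF this] show "sharp_integral f r \<le> q" using Qi[OF r] by (simp add: IH)
  qed (rule qfin)
  define H0 where "H0 x = \<phi> x (?c * norm (G x)) * indicator \<Omega> x" for x
  have H0m: "H0 \<in> borel_measurable lebesgue"
    unfolding H0_def[abs_def] by (rule borel_measurable_phi_indicator) (use c in auto)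
  have Hlim: "AE x in lebesgue. ((\<lambda>r. H r x) \<longlongrightarrow> H0 x) (at_right 0)"
    using AE_good AE_sharp_mean_limit[OF open_Omega f G, of k]
  proof eventually_elim
    case (elim x)
    show ?case
    proof (cases "x \<in> \<Omega>")
      case True
      then have gx: "good x" and lim: "((\<lambda>r. 1 / r * sharp_mean (ball x r) f) \<longlongrightarrow> ?c * norm (G x)) (at_right 0)"
        using elim by auto
      have pos: "\<forall>\<^sub>F r in at_right 0. (0::real) < r" by (rule eventually_at_right_less)
      have "((\<lambda>r. P x (1 / r * sharp_mean (ball x r) f)) \<longlongrightarrow> P x (?c * norm (G x))) (at_right 0)"
      proof (rule continuous_on_tendsto_compose[OF P_cont[OF gx] lim])
        show "\<forall>\<^sub>F r in at_right 0. 1 / r * sharp_mean (ball x r) f \<in> {0..}"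
          using pos by eventually_elim (simp add: sharp_mean_nonneg)
      qed (use c in simp)
      then have l2: "((\<lambda>r. ennreal (P x (1 / r * sharp_mean (ball x r) f))) \<longlongrightarrow> ennreal (P x (?c * norm (G x)))) (at_right 0)"
        by (rule tendsto_ennrealI)
      obtain d where d: "0 < d" "\<And>r. r < d \<Longrightarrow> x \<in> inner_part \<Omega> r"
        using inner_part_radius[OF open_Omega True] by blast
      have H0x: "H0 x = ennreal (P x (?c * norm (G x)))"
        using True c phi_eq_P[OF gx, of "?c * norm (G x)"] by (simp add: H0_def)
      show ?thesis unfolding H0x
      proof (rule Lim_transform_eventually[OF l2])
        show "\<forall>\<^sub>F r in at_right 0. ennreal (P x (1 / r * sharp_mean (ball x r) f)) = H r x"
        proof (rule eventually_at_rightI[of 0 d])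
          fix r assume r: "r \<in> {0<..<d}"
          then show "ennreal (P x (1 / r * sharp_mean (ball x r) f)) = H r x"
            using d(2)[of r] phi_eq_P[OF gx, of "1 / r * sharp_mean (ball x r) f"] sharp_mean_nonneg[of "ball x r" f]
            by (simp add: H_def)
        qed (rule d)
      qed
    next
      case False
      show ?thesis
      proof (rule Lim_transform_eventually[OF tendsto_const])
        show "\<forall>\<^sub>F r in at_right 0. H0 x = H r x"
          by (rule eventually_at_rightI[of 0 1]) (use False inner_partD(1)[of x \<Omega>] in \<open>auto simp: H0_def H_def indicator_def\<close>)
      qed
    qed
  qed
  have Qlim: "AE x in lebesgue. ((\<lambda>r. Q r x) \<longlongrightarrow> Q0 x) (at_right 0)"
    using AE_avg_ball_tendsto[OF Pi] AE_avg_ball_tendsto[OF integrable_habs]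
  proof eventually_elim
    case (elim x)
    show ?case unfolding Q_def Q0_def
      by (intro ennreal_tendsto_cmult tendsto_add tendsto_ennrealI elim tendsto_const) simp
  qed
  have mod0: "modular \<phi> \<Omega> (\<lambda>x. ?c * norm (G x)) = (\<integral>\<^sup>+x. H0 x \<partial>lebesgue)" by (simp add: modc H0_def)
  show "(sharp_integral f \<longlongrightarrow> modular \<phi> \<Omega> (\<lambda>x. ?c * norm (G x))) (at_right 0)"
    unfolding tendsto_at_iff_sequentially comp_def
  proof (intro allI impI)
    fix X :: "nat \<Rightarrow> real" assume "\<forall>i. X i \<in> {0<..} - {0}" and X0: "X \<longlonglongrightarrow> 0"
    then have Xp: "0 < X i" for i by auto
    have Xr: "filterlim X (at_right 0) sequentially"
      using X0 Xp less_imp_neq[OF Xp, symmetric] by (auto simp: filterlim_at intro!: always_eventually)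
    show "(\<lambda>i. sharp_integral f (X i)) \<longlonglongrightarrow> modular \<phi> \<Omega> (\<lambda>x. ?c * norm (G x))"
      unfolding IH mod0
    proof (rule nn_integral_tendsto_dominated_const[where K="\<lambda>i. Q (X i)" and Klim=Q0 and c=q])
      show "AE x in lebesgue. H (X j) x \<le> Q (X j) x" for j using Hle by eventually_elim (use Xp in auto)
      show "AE x in lebesgue. (\<lambda>j. H (X j) x) \<longlonglongrightarrow> H0 x"
        using Hlim by eventually_elim (rule filterlim_compose[OF _ Xr])
      show "AE x in lebesgue. (\<lambda>j. Q (X j) x) \<longlonglongrightarrow> Q0 x"
        using Qlim by eventually_elim (rule filterlim_compose[OF _ Xr])
    qed (use Hm Qm H0m Q0m Xp Qi qfin in \<open>auto simp: q_def\<close>)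
  qed
qed


lemma Lphi_divide:
  assumes G: "G \<in> Lphi \<phi> \<Omega>" and l: "0 < l"
  shows "(\<lambda>x. G x /\<^sub>R l) \<in> Lphi \<phi> \<Omega>"
proof -
  have Gm: "G \<in> borel_measurable (lebesgue_on \<Omega>)" using G by (simp add: Lphi_def)
  obtain m where m: "0 < m" "modular \<phi> \<Omega> (\<lambda>x. m *\<^sub>R G x) < \<infinity>" using G by (auto simp: Lphi_def)
  have "(\<lambda>x. G x /\<^sub>R l) \<in> borel_measurable (lebesgue_on \<Omega>)" using Gm by measurable
  moreover have "modular \<phi> \<Omega> (\<lambda>x. (m * l) *\<^sub>R (G x /\<^sub>R l)) < \<infinity>" using m l by (simp add: mult.assoc)
  ultimately show ?thesis using m l by (auto simp: Lphi_def intro!: exI[of _ "m * l"])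
qed

lemma sharp_modular_antimono:
  assumes l: "0 < l" "l \<le> l'"
  shows "sharp_modular \<phi> \<Omega> w (\<lambda>x. f x / l') \<le> sharp_modular \<phi> \<Omega> w (\<lambda>x. f x / l)"
  unfolding sharp_modular_eq
proof (rule nn_integral_mono)
  fix r :: real
  show "sharp_integral (\<lambda>x. f x / l') r * ennreal (w r) * indicator {0<..} r \<le>
      sharp_integral (\<lambda>x. f x / l) r * ennreal (w r) * indicator {0<..} r"
  proof (cases "0 < r")
    case True
    have "sharp_integral (\<lambda>x. f x / l') r \<le> sharp_integral (\<lambda>x. f x / l) r"
      unfolding sharp_integral_def
    proof (rule nn_integral_mono)
      fix x
      have "sharp_mean (ball x r) f / l' \<le> sharp_mean (ball x r) f / l"
        using l by (intro divide_left_mono sharp_mean_nonneg) auto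
      then have "1 / r * sharp_mean (ball x r) (\<lambda>x. f x / l') \<le> 1 / r * sharp_mean (ball x r) (\<lambda>x. f x / l)"
        using True l by (intro mult_left_mono) (auto simp: sharp_mean_divide)
      then show "\<phi> x (1 / r * sharp_mean (ball x r) (\<lambda>x. f x / l')) * indicator (inner_part \<Omega> r) x \<le>
          \<phi> x (1 / r * sharp_mean (ball x r) (\<lambda>x. f x / l)) * indicator (inner_part \<Omega> r) x"
        using True inner_partD(1)[of x \<Omega> r] sharp_mean_nonneg[of "ball x r" "\<lambda>x. f x / l'"]
        by (cases "x \<in> inner_part \<Omega> r") (auto intro!: phi_mono)
    qed
    then show ?thesis by (intro mult_right_mono) auto
  qed simp
qed

text \<open>For the norms, the modular limit is applied to \<open>f / l\<close> for each l > 0. If l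
  lies below the claimed limit, the limiting modular exceeds 1, so eventually the sharp norm is at
  least l; if l lies above it, the limiting modular is below 1, so eventually the sharp norm is at
  most l.\<close>

theorem sharp_limits:
  fixes k :: 'n and \<psi> :: "real \<Rightarrow> real \<Rightarrow> real"
  assumes \<psi>: "\<And>\<epsilon>. 0 < \<epsilon> \<Longrightarrow> set_integrable lebesgue {0<..} (\<psi> \<epsilon>)"
     "\<And>\<epsilon> r. 0 < \<epsilon> \<Longrightarrow> 0 < r \<Longrightarrow> 0 \<le> \<psi> \<epsilon> r"
     "\<And>\<epsilon>. 0 < \<epsilon> \<Longrightarrow> (LINT r:{0<..}|lebesgue. \<psi> \<epsilon> r) = 1"
     "\<And>\<gamma>. 0 < \<gamma> \<Longrightarrow> ((\<lambda>\<epsilon>. LINT r:{\<gamma><..}|lebesgue. \<psi> \<epsilon> r) \<longlongrightarrow> 0) (at_right 0)"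
    and f: "f locally_integrable_on \<Omega>" and G: "weak_gradient \<Omega> f G" and GL: "G \<in> Lphi \<phi> \<Omega>"
  shows sharp_modular_limit: "((\<lambda>\<epsilon>. sharp_modular \<phi> \<Omega> (\<psi> \<epsilon>) f) \<longlongrightarrow> modular \<phi> \<Omega> (\<lambda>x. c_const k * norm (G x))) (at_right 0)"
    and sharp_norm_limit: "((\<lambda>\<epsilon>. sharp_norm \<phi> \<Omega> (\<psi> \<epsilon>) f) \<longlongrightarrow> ennreal (c_const k) * phi_norm \<phi> \<Omega> G) (at_right 0)"
proof -
  have lim: "((\<lambda>\<epsilon>. sharp_modular \<phi> \<Omega> (\<psi> \<epsilon>) u) \<longlongrightarrow> modular \<phi> \<Omega> (\<lambda>x. c_const k * norm (H x))) (at_right 0)"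
    if u: "u locally_integrable_on \<Omega>" "weak_gradient \<Omega> u H" "H \<in> Lphi \<phi> \<Omega>" for u H
  proof -
    obtain C where "C < top" "\<forall>r>0. sharp_integral u r \<le> C" using sharp_integral_limit(2)[OF u] by blast
    then show ?thesis unfolding sharp_modular_eq
      by (intro weighted_average_tendsto[OF \<psi> sharp_integral_limit(1)[OF u]]) auto
  qed
  show "((\<lambda>\<epsilon>. sharp_modular \<phi> \<Omega> (\<psi> \<epsilon>) f) \<longlongrightarrow> modular \<phi> \<Omega> (\<lambda>x. c_const k * norm (G x))) (at_right 0)"
    by (rule lim[OF f G GL])
  let ?c = "c_const k"
  let ?N = "phi_norm \<phi> \<Omega> G"
  have c: "0 \<le> ?c" by (rule c_const_nonneg)
  obtain \<mu> where \<mu>: "0 < \<mu>" "(\<integral>\<^sup>+x\<in>\<Omega>. \<phi> x (\<mu> * norm (G x)) \<partial>lebesgue) \<le> 1"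
    and nm[measurable]: "(\<lambda>x. norm (G x)) \<in> borel_measurable (lebesgue_on \<Omega>)"
    using LphiD[OF GL] by blast
  have mod_eq: "modular \<phi> \<Omega> (\<lambda>x. G x /\<^sub>R l) = (\<integral>\<^sup>+x\<in>\<Omega>. \<phi> x (norm (G x) / l) \<partial>lebesgue)" if "0 < l" for l
    using that by (simp add: modular_def divide_inverse mult.commute)
  have lim_l: "((\<lambda>\<epsilon>. sharp_modular \<phi> \<Omega> (\<psi> \<epsilon>) (\<lambda>x. f x / l)) \<longlongrightarrow> (\<integral>\<^sup>+x\<in>\<Omega>. \<phi> x (?c * (norm (G x) / l)) \<partial>lebesgue)) (at_right 0)"
    if l: "0 < l" for l
  proof -
    have "modular \<phi> \<Omega> (\<lambda>x. ?c * norm (G x /\<^sub>R l)) = (\<integral>\<^sup>+x\<in>\<Omega>. \<phi> x (?c * (norm (G x) / l)) \<partial>lebesgue)"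
      using l c by (simp add: modular_def abs_mult divide_inverse mult_ac)
    then show ?thesis
      using lim[OF locally_integrable_on_divide[OF f] weak_gradient_divide[OF G] Lphi_divide[OF GL l]] by simp
  qed
  have ne: "\<exists>l>0. modular \<phi> \<Omega> (\<lambda>x. G x /\<^sub>R l) \<le> 1"
    using \<mu> mod_eq[of "1 / \<mu>"] by (intro exI[of _ "1 / \<mu>"]) (simp add: mult.commute)
  show "((\<lambda>\<epsilon>. sharp_norm \<phi> \<Omega> (\<psi> \<epsilon>) f) \<longlongrightarrow> ennreal ?c * ?N) (at_right 0)"
  proof (rule order_tendstoI)
    fix y assume "y < ennreal ?c * ?N"
    then obtain z where z: "y < z" "z < ennreal ?c * ?N" using dense by blast
    then have "z < top" using less_top order.strict_trans2[OF z(2) top_greatest] by blast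
    then obtain l where l: "z = ennreal l" "0 \<le> l" by (cases z) auto
    have lp: "0 < l" using z l by (cases "l = 0") auto
    have cp: "0 < ?c" using z c by (cases "?c = 0") auto
    have "\<not> modular \<phi> \<Omega> (\<lambda>x. G x /\<^sub>R (l / ?c)) \<le> 1"
    proof
      assume "modular \<phi> \<Omega> (\<lambda>x. G x /\<^sub>R (l / ?c)) \<le> 1"
      then have "?N \<le> ennreal (l / ?c)" unfolding phi_norm_def using lp cp by (intro INF_lower) auto
      then have "ennreal ?c * ?N \<le> ennreal ?c * ennreal (l / ?c)" by (rule mult_left_mono) simp
      also have "\<dots> = ennreal l" using lp cp by (simp add: ennreal_mult[symmetric])
      finally show False using z l by simp
    qed
    then have "1 < (\<integral>\<^sup>+x\<in>\<Omega>. \<phi> x (?c * (norm (G x) / l)) \<partial>lebesgue)"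
      using lp cp mod_eq[of "l / ?c"] by (simp add: not_le mult.commute)
    from order_tendstoD(1)[OF lim_l[OF lp] this]
    show "\<forall>\<^sub>F \<epsilon> in at_right 0. y < sharp_norm \<phi> \<Omega> (\<psi> \<epsilon>) f"
    proof eventually_elim
      case (elim \<epsilon>)
      have "ennreal l \<le> sharp_norm \<phi> \<Omega> (\<psi> \<epsilon>) f"
        unfolding sharp_norm_def
      proof (rule INF_greatest)
        fix m assume "m \<in> {l. 0 < l \<and> sharp_modular \<phi> \<Omega> (\<psi> \<epsilon>) (\<lambda>x. f x / l) \<le> 1}"
        then have m: "0 < m" "sharp_modular \<phi> \<Omega> (\<psi> \<epsilon>) (\<lambda>x. f x / m) \<le> 1" by auto
        have "\<not> m \<le> l" using sharp_modular_antimono[OF m(1), of l "\<psi> \<epsilon>" f] m(2) elim by auto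
        then show "ennreal l \<le> ennreal m" by (intro ennreal_leI) simp
      qed
      then show ?case using z l by auto
    qed
  next
    fix y assume "ennreal ?c * ?N < y"
    then obtain z where z: "ennreal ?c * ?N < z" "z < y" using dense by blast
    then have "z < top" using order.strict_trans2[OF z(2) top_greatest] by blast
    then obtain l where l: "z = ennreal l" "0 \<le> l" by (cases z) auto
    have lp: "0 < l" using z l by (cases "l = 0") auto
    have "\<exists>m>0. modular \<phi> \<Omega> (\<lambda>x. G x /\<^sub>R m) \<le> 1 \<and> ?c * m < l"
    proof (rule ccontr)
      assume "\<not> ?thesis"
      then have n: "\<And>m. 0 < m \<Longrightarrow> modular \<phi> \<Omega> (\<lambda>x. G x /\<^sub>R m) \<le> 1 \<Longrightarrow> l \<le> ?c * m" by force
      \<comment> \<open>If the constant were 0, any admissible m would force l \<le> 0; hence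
        division by it is legitimate.\<close>
      have cp: "0 < ?c" using ne n c lp by (cases "?c = 0") fastforce+
      have "ennreal (l / ?c) \<le> ?N"
        unfolding phi_norm_def
      proof (rule INF_greatest)
        fix m assume "m \<in> {l. 0 < l \<and> modular \<phi> \<Omega> (\<lambda>x. G x /\<^sub>R l) \<le> 1}"
        then have "l \<le> ?c * m" using n by auto
        then show "ennreal (l / ?c) \<le> ennreal m" using cp by (intro ennreal_leI) (simp add: field_simps)
      qed
      then have "ennreal ?c * ennreal (l / ?c) \<le> ennreal ?c * ?N" by (rule mult_left_mono) simp
      moreover have "ennreal ?c * ennreal (l / ?c) = ennreal l" using lp cp by (simp add: ennreal_mult[symmetric])
      ultimately show False using z l by simp
    qed
    then obtain m where m: "0 < m" "modular \<phi> \<Omega> (\<lambda>x. G x /\<^sub>R m) \<le> 1" "?c * m < l" by blast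
    have um: "(\<lambda>x. norm (G x) / m) \<in> borel_measurable (lebesgue_on \<Omega>)" by measurable
    have "(\<integral>\<^sup>+x\<in>\<Omega>. \<phi> x (?c * (norm (G x) / l)) \<partial>lebesgue) = (\<integral>\<^sup>+x\<in>\<Omega>. \<phi> x (?c * m / l * (norm (G x) / m)) \<partial>lebesgue)"
      using m by simp
    also have "\<dots> \<le> ennreal (?c * m / l) * (\<integral>\<^sup>+x\<in>\<Omega>. \<phi> x (norm (G x) / m) \<partial>lebesgue)"
      by (rule nn_integral_phi_scale[OF um]) (use m c lp in auto)
    also have "\<dots> \<le> ennreal (?c * m / l) * 1" using m mod_eq[OF m(1)] by (intro mult_left_mono) auto
    \<comment> \<open>Strictness matters: only a limit strictly below 1 forces the sharp modulars
      below 1 for small \<epsilon>. It comes from convexity and the room between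
      \<open>?c * m\<close> and \<open>l\<close>.\<close>
    also have "\<dots> < 1" using m lp c by (simp add: ennreal_less_one_iff)
    finally have "(\<integral>\<^sup>+x\<in>\<Omega>. \<phi> x (?c * (norm (G x) / l)) \<partial>lebesgue) < 1" .
    from order_tendstoD(2)[OF lim_l[OF lp] this]
    show "\<forall>\<^sub>F \<epsilon> in at_right 0. sharp_norm \<phi> \<Omega> (\<psi> \<epsilon>) f < y"
    proof eventually_elim
      case (elim \<epsilon>)
      have "sharp_norm \<phi> \<Omega> (\<psi> \<epsilon>) f \<le> ennreal l"
        unfolding sharp_norm_def using elim lp by (intro INF_lower) auto
      then show ?case using z l by auto
    qed
  qed
qed

end

section \<open>Almost everywhere convergent midpoints\<close>

text \<open>The Euclidean length of the vector (1, v): strictly convex, unlike the norm, and still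
  of linear growth, so that first-moment bounds control it.\<close>

definition bracket :: "'b::real_inner \<Rightarrow> real" where
  "bracket v = sqrt (1 + v \<bullet> v)"

lemma bracket_ge_1: "1 \<le> bracket v" and norm_le_bracket: "norm v \<le> bracket v"
  and bracket_power2: "(bracket v)\<^sup>2 = 1 + v \<bullet> v"
  by (auto simp: bracket_def norm_eq_sqrt_inner)

text \<open>Strict convexity in quantitative form. With p the product of the brackets and q = 1 + a
  \<bullet> b, the Cauchy-Schwarz inequality gives |a - b|^2 \<le> p^2 - q^2, and direct expansion
  gives S^2 - 4m^2 = 2(p - q). Hence a small convexity gap S - 2m forces \<open>a\<close> and
  \<open>b\<close> together.\<close>

lemma bracket_midpoint:
  fixes a b :: "'b::real_inner"
  defines "m \<equiv> bracket ((1 / 2) *\<^sub>R (a + b))" and "S \<equiv> bracket a + bracket b"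
  shows "2 * m \<le> S" and "(norm (a - b))\<^sup>2 \<le> 2 * S ^ 3 * (S - 2 * m)"
proof -
  let ?p = "bracket a * bracket b" and ?q = "1 + a \<bullet> b"
  have aux: "n \<le> 2 * s ^ 3 * (s - 2 * t)"
    if "n \<le> p\<^sup>2 - q\<^sup>2" "s\<^sup>2 - (2 * t)\<^sup>2 = 2 * (p - q)" "\<bar>q\<bar> \<le> p" "2 * t \<le> s" "0 \<le> t" "p \<le> s * s"
    for n p q s t :: real
  proof -
    have st: "(s - 2 * t) * (s + 2 * t) = 2 * (p - q)"
      using that(2) by (simp add: power2_eq_square algebra_simps)
    have "n \<le> (p - q) * (p + q)" using that(1) by (simp add: power2_eq_square algebra_simps)
    also have "\<dots> \<le> (p - q) * (2 * p)" using that(3) by (intro mult_left_mono) auto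
    also have "\<dots> = p * ((s - 2 * t) * (s + 2 * t))" unfolding st by (simp add: mult_ac)
    also have "\<dots> \<le> (s * s) * ((s - 2 * t) * (2 * s))" using that by (intro mult_mono) auto
    also have "\<dots> = 2 * s ^ 3 * (s - 2 * t)" by (simp add: power3_eq_cube algebra_simps)
    finally show ?thesis .
  qed
  have b1: "1 \<le> bracket a" "1 \<le> bracket b" "1 \<le> m" by (simp_all add: bracket_ge_1 m_def)
  have p0: "0 < ?p" using b1 by (simp add: mult_pos_pos)
  have "?p\<^sup>2 = (1 + a \<bullet> a) * (1 + b \<bullet> b)" by (simp add: power_mult_distrib bracket_power2)
  moreover have "(norm (a - b))\<^sup>2 = a \<bullet> a - 2 * (a \<bullet> b) + b \<bullet> b"
    by (simp add: power2_norm_eq_inner inner_diff inner_commute)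
  moreover have "(a \<bullet> b)\<^sup>2 \<le> (a \<bullet> a) * (b \<bullet> b)" by (rule Cauchy_Schwarz_ineq)
  ultimately have d: "(norm (a - b))\<^sup>2 \<le> ?p\<^sup>2 - ?q\<^sup>2" by (simp add: power2_eq_square algebra_simps)
  then have "?q\<^sup>2 \<le> ?p\<^sup>2" using zero_le_power2[of "norm (a - b)"] by linarith
  then have qp: "\<bar>?q\<bar> \<le> ?p" using p0 by (metis abs_le_square_iff abs_of_pos)
  have "4 * m\<^sup>2 = 4 + (a + b) \<bullet> (a + b)" by (simp add: m_def bracket_power2)
  then have e: "S\<^sup>2 - (2 * m)\<^sup>2 = 2 * (?p - ?q)"
    by (simp add: S_def power2_sum bracket_power2 power_mult_distrib inner_add inner_commute algebra_simps)
  have "0 \<le> S\<^sup>2 - (2 * m)\<^sup>2" unfolding e using order_trans[OF abs_ge_self qp] by simp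
  then have "(2 * m)\<^sup>2 \<le> S\<^sup>2" by (simp only: diff_ge_0_iff_ge)
  moreover have "0 \<le> S" using b1 unfolding S_def by linarith
  ultimately show mS: "2 * m \<le> S" by (rule power2_le_imp_le)
  have pS: "?p \<le> S * S" unfolding S_def using b1 by (intro mult_mono) auto
  have m0: "0 \<le> m" using b1 by linarith
  show "(norm (a - b))\<^sup>2 \<le> 2 * S ^ 3 * (S - 2 * m)" by (rule aux[OF d e qp mS m0 pS])
qed

text \<open>If the gap is at most \<delta>^4 S/2, the midpoint estimate yields |a - b|^2 \<le>
  (\<delta> S)^4; otherwise S itself is at most 2/\<delta>^4 times the gap. The square root is what
  makes both terms linear in brackets, hence integrable.\<close>

lemma sqrt_dist_le:
  fixes a b :: "'b::real_inner"
  defines "m \<equiv> bracket ((1 / 2) *\<^sub>R (a + b))" and "S \<equiv> bracket a + bracket b"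
  assumes \<delta>: "0 < \<delta>"
  shows "sqrt (norm (a - b)) \<le> \<delta> * S + 2 / \<delta> ^ 4 * (S - 2 * m)"
proof -
  have S2: "2 \<le> S" using bracket_ge_1[of a] bracket_ge_1[of b] by (simp add: S_def)
  have g: "0 \<le> S - 2 * m" using bracket_midpoint(1)[of a b] by (simp add: S_def m_def)
  show ?thesis
  proof (cases "S - 2 * m \<le> \<delta> ^ 4 / 2 * S")
    case True
    have "(norm (a - b))\<^sup>2 \<le> 2 * S ^ 3 * (S - 2 * m)" using bracket_midpoint(2)[of a b] by (simp add: S_def m_def)
    also have "\<dots> \<le> 2 * S ^ 3 * (\<delta> ^ 4 / 2 * S)" using S2 True by (intro mult_left_mono) auto
    also have "\<dots> = ((\<delta> * S)\<^sup>2)\<^sup>2" by (simp add: power_mult_distrib eval_nat_numeral algebra_simps)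
    finally have "norm (a - b) \<le> (\<delta> * S)\<^sup>2" by (rule power2_le_imp_le) simp
    then have "sqrt (norm (a - b)) \<le> \<delta> * S" using \<delta> S2 by (intro real_le_lsqrt) auto
    moreover have "0 \<le> 2 / \<delta> ^ 4 * (S - 2 * m)" using g \<delta> by simp
    ultimately show ?thesis by linarith
  next
    case False
    have "norm (a - b) \<le> norm a + norm b" by (rule norm_triangle_ineq4)
    also have "\<dots> \<le> S" unfolding S_def by (intro add_mono norm_le_bracket)
    also have "\<dots> \<le> S\<^sup>2" using S2 by (simp add: power2_eq_square)
    finally have "sqrt (norm (a - b)) \<le> S" using S2 by (intro real_le_lsqrt) auto
    also have "\<dots> = 2 / \<delta> ^ 4 * (\<delta> ^ 4 / 2 * S)" using \<delta> by simp
    also have "\<dots> \<le> 2 / \<delta> ^ 4 * (S - 2 * m)" using False \<delta> by (intro mult_left_mono) auto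
    finally show ?thesis using \<delta> S2 by (simp add: add_increasing)
  qed
qed

lemma borel_measurable_bracket: "bracket \<in> borel_measurable (borel :: 'b::euclidean_space measure)"
  unfolding bracket_def[abs_def] by (intro borel_measurable_continuous_onI continuous_intros)

text \<open>Komlos-type compactness: almost minimising the strictly convex functional
  \<open>\<integral> sqrt(1 + |g|\<^sup>2)\<close> over shrinking midpoint-convex sets produces a sequence that is Cauchy
  for \<open>\<integral> sqrt |g - g'|\<close>.\<close>

theorem midpoint_convex_AE_convergent:
  fixes S :: "nat \<Rightarrow> ('a \<Rightarrow> 'b::euclidean_space) set"
  assumes ne: "\<And>j. S j \<noteq> {}" and dec: "\<And>i j. i \<le> j \<Longrightarrow> S j \<subseteq> S i"
    and mid: "\<And>j u v. u \<in> S j \<Longrightarrow> v \<in> S j \<Longrightarrow> (\<lambda>x. (1 / 2) *\<^sub>R (u x + v x)) \<in> S j"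
    and meas: "\<And>u. u \<in> S 0 \<Longrightarrow> u \<in> borel_measurable M"
    and bound: "\<And>u. u \<in> S 0 \<Longrightarrow> (\<integral>\<^sup>+x. ennreal (bracket (u x)) \<partial>M) \<le> ennreal C"
    and C: "0 \<le> C"
  shows "\<exists>g G. (\<forall>j. g j \<in> S j) \<and> G \<in> borel_measurable M \<and> (AE x in M. (\<lambda>j. g j x) \<longlonglongrightarrow> G x)"
proof -
  have S0: "u \<in> S 0" if "u \<in> S j" for u j using dec[of 0 j] that by auto
  have bm: "(\<lambda>x. bracket (u x)) \<in> borel_measurable M" if "u \<in> S 0" for u
    by (rule measurable_compose[OF meas[OF that] borel_measurable_bracket])
  have b0: "0 \<le> bracket v" for v :: 'b using bracket_ge_1[of v] by linarith
  have bi: "integrable M (\<lambda>x. bracket (u x))" if "u \<in> S 0" for u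
    using bm[OF that] bound[OF that] b0 by (intro integrableI_nonneg) (auto intro: le_less_trans)
  define J where "J u = (LINT x|M. bracket (u x))" for u :: "'a \<Rightarrow> 'b"
  have J0: "0 \<le> J u" for u unfolding J_def by (intro integral_nonneg_AE) (simp add: b0)
  have JC: "J u \<le> C" if "u \<in> S 0" for u
  proof -
    have "ennreal (J u) \<le> ennreal C"
      using bound[OF that] nn_integral_eq_integral[OF bi[OF that]] b0 by (simp add: J_def)
    then show ?thesis using C by simp
  qed
  define m where "m j = Inf (J ` S j)" for j
  have bb: "bdd_below (J ` S j)" for j by (rule bdd_belowI[of _ 0]) (use J0 in auto)
  have m_le: "m j \<le> J u" if "u \<in> S j" for u j unfolding m_def using that bb by (intro cInf_lower) auto
  have m_mono: "m i \<le> m j" if "i \<le> j" for i j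
    unfolding m_def using ne bb dec[OF that] by (intro cInf_superset_mono) auto
  have m_C: "m j \<le> C" for j
  proof -
    obtain u where "u \<in> S j" using ne[of j] by auto
    then show ?thesis using m_le[of u j] JC[OF S0] by force
  qed
  obtain L where L: "m \<longlonglongrightarrow> L" and m_L: "\<And>j. m j \<le> L"
    using incseq_convergent[of m C] m_mono m_C by (auto simp: incseq_def)
  define e where "e j = 1 / (real j + 1)" for j :: nat
  have e: "0 < e j" "i \<le> j \<Longrightarrow> e j \<le> e i" for i j by (auto simp: e_def frac_le)
  have e0: "e \<longlonglongrightarrow> 0" unfolding e_def using LIMSEQ_inverse_real_of_nat by (simp add: inverse_eq_divide add.commute)
  have "\<exists>u\<in>S j. J u < m j + e j" for j
    using cInf_lessD[of "J ` S j" "m j + e j"] ne[of j] e(1)[of j] by (auto simp: m_def)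
  then obtain h where h: "\<And>j. h j \<in> S j" "\<And>j. J (h j) < m j + e j" by metis
  \<comment> \<open>Bounds the convexity gap of \<open>h j\<close> and \<open>h k\<close> for k
    \<ge> j: their values are below m(j) + e(j) and L + e(j), while the midpoint lies in
    \<open>S j\<close> and has value at least m(j).\<close>
  define t where "t j = L - m j + 2 * e j" for j
  have t0: "t \<longlonglongrightarrow> 0"
    using tendsto_add[OF tendsto_diff[OF tendsto_const[of L] L] tendsto_mult[OF tendsto_const[of 2] e0]]
    unfolding t_def by simp
  let ?md = "\<lambda>j k x. (1 / 2) *\<^sub>R (h j x + h k x)"
  have hm: "h j \<in> borel_measurable M" for j by (rule meas[OF S0[OF h(1)]])
  have step: "(\<integral>\<^sup>+x. ennreal (sqrt (norm (h j x - h k x))) \<partial>M) \<le> ennreal (\<delta> * (2 * C) + 2 / \<delta> ^ 4 * t j)"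
    if jk: "j \<le> k" and \<delta>: "0 < \<delta>" for j k \<delta>
  proof -
    have hk: "h k \<in> S j" using h(1)[of k] dec[OF jk] by auto
    have mS: "?md j k \<in> S j" by (rule mid[OF h(1) hk])
    let ?B = "\<lambda>x. \<delta> * (bracket (h j x) + bracket (h k x)) + 2 / \<delta> ^ 4 * ((bracket (h j x) + bracket (h k x)) - 2 * bracket (?md j k x))"
    note i = bi[OF S0[OF h(1)[of j]]] bi[OF S0[OF h(1)[of k]]] bi[OF S0[OF mS]]
    have Bi: "integrable M ?B"
      by (intro Bochner_Integration.integrable_add Bochner_Integration.integrable_diff integrable_mult_right i)
    have "(\<integral>\<^sup>+x. ennreal (sqrt (norm (h j x - h k x))) \<partial>M) \<le> (\<integral>\<^sup>+x. ennreal (?B x) \<partial>M)"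
      by (intro nn_integral_mono ennreal_leI sqrt_dist_le \<delta>)
    also have "\<dots> = ennreal (LINT x|M. ?B x)"
    proof (rule nn_integral_eq_integral[OF Bi])
      have "0 \<le> ?B x" for x using sqrt_dist_le[OF \<delta>, of "h j x" "h k x"] real_sqrt_ge_zero[OF norm_ge_zero[of "h j x - h k x"]] by linarith
      then show "AE x in M. 0 \<le> ?B x" by simp
    qed
    also have "(LINT x|M. ?B x) = \<delta> * (J (h j) + J (h k)) + 2 / \<delta> ^ 4 * ((J (h j) + J (h k)) - 2 * J (?md j k))"
      unfolding J_def using i by (simp add: Bochner_Integration.integrable_add Bochner_Integration.integrable_diff)
    also have "ennreal \<dots> \<le> ennreal (\<delta> * (2 * C) + 2 / \<delta> ^ 4 * t j)"
    proof (intro ennreal_leI add_mono mult_left_mono)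
      show "J (h j) + J (h k) \<le> 2 * C" using JC[OF S0[OF h(1)[of j]]] JC[OF S0[OF h(1)[of k]]] by simp
      show "J (h j) + J (h k) - 2 * J (?md j k) \<le> t j"
        using m_le[OF mS] h(2)[of j] h(2)[of k] m_L[of k] e(2)[OF jk] by (simp add: t_def)
    qed (use \<delta> in auto)
    finally show ?thesis .
  qed
  have "\<exists>N. \<forall>j\<ge>N. \<forall>k\<ge>j. (\<integral>\<^sup>+x. ennreal (sqrt (norm (h j x - h k x))) \<partial>M) \<le> ennreal ((1 / 2) ^ i)" for i
  proof -
    \<comment> \<open>Chosen so that the term with \<delta> takes at most half of the target; the
      added 1 covers C = 0.\<close>
    define \<delta> where "\<delta> = (1 / 2) ^ i / (4 * C + 1)"
    have \<delta>: "0 < \<delta>" using C by (simp add: \<delta>_def)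
    have d1: "\<delta> * (2 * C) \<le> (1 / 2) ^ i / 2"
    proof -
      have "\<delta> * (2 * C) = (1 / 2) ^ i * (2 * C / (4 * C + 1))" by (simp add: \<delta>_def)
      also have "\<dots> \<le> (1 / 2) ^ i * (1 / 2)" using C by (intro mult_left_mono) (auto simp: field_simps)
      finally show ?thesis by simp
    qed
    have "(\<lambda>j. 2 / \<delta> ^ 4 * t j) \<longlonglongrightarrow> 2 / \<delta> ^ 4 * 0" by (intro tendsto_intros t0)
    then have "\<forall>\<^sub>F j in sequentially. 2 / \<delta> ^ 4 * t j < (1 / 2) ^ i / 2" by (rule order_tendstoD(2)) simp
    then obtain N where N: "\<And>j. j \<ge> N \<Longrightarrow> 2 / \<delta> ^ 4 * t j < (1 / 2) ^ i / 2" by (auto simp: eventually_sequentially)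
    show ?thesis
    proof (intro exI allI impI)
      fix j k assume "N \<le> j" "j \<le> k"
      then show "(\<integral>\<^sup>+x. ennreal (sqrt (norm (h j x - h k x))) \<partial>M) \<le> ennreal ((1 / 2) ^ i)"
        using order_trans[OF step[of j k, OF _ \<delta>] ennreal_leI[of _ "(1 / 2) ^ i"]] N[of j] d1 by fastforce
    qed
  qed
  then obtain N where N: "\<And>i j k. N i \<le> j \<Longrightarrow> j \<le> k \<Longrightarrow>
      (\<integral>\<^sup>+x. ennreal (sqrt (norm (h j x - h k x))) \<partial>M) \<le> ennreal ((1 / 2) ^ i)" by metis
  \<comment> \<open>A nondecreasing choice of indices above \<open>N i\<close>; the summand
    \<open>i\<close> ensures that \<open>g i\<close> still belongs to \<open>S i\<close>.\<close>
  define n where "n i = (\<Sum>l\<le>i. N l) + i" for i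
  have n: "N i \<le> n i" "i \<le> n i" "n i \<le> n (Suc i)" for i
  proof -
    have "N i \<le> (\<Sum>l\<le>i. N l)" by (rule member_le_sum) auto
    then show "N i \<le> n i" by (simp add: n_def)
  qed (auto simp: n_def)
  define g where "g i = h (n i)" for i
  have gS: "g i \<in> S i" for i using h(1)[of "n i"] dec[OF n(2)[of i]] by (auto simp: g_def)
  have gm[measurable]: "g i \<in> borel_measurable M" for i unfolding g_def by (rule hm)
  have gi: "(\<integral>\<^sup>+x. ennreal (sqrt (norm (g i x - g (Suc i) x))) \<partial>M) \<le> ennreal ((1 / 2) ^ i)" for i
    unfolding g_def by (rule N[OF n(1) n(3)])
  have "(\<integral>\<^sup>+x. (\<Sum>i. ennreal (sqrt (norm (g i x - g (Suc i) x)))) \<partial>M) =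
      (\<Sum>i. \<integral>\<^sup>+x. ennreal (sqrt (norm (g i x - g (Suc i) x))) \<partial>M)"
    by (rule nn_integral_suminf) measurable
  also have "\<dots> \<le> (\<Sum>i. ennreal ((1 / 2) ^ i))" by (intro suminf_le gi) auto
  also have "\<dots> = ennreal (\<Sum>i. (1 / 2) ^ i)" by (rule suminf_ennreal2) (auto intro: summable_geometric)
  also have "\<dots> < \<infinity>" by simp
  finally have "AE x in M. (\<Sum>i. ennreal (sqrt (norm (g i x - g (Suc i) x)))) \<noteq> \<infinity>"
    by (intro nn_integral_PInf_AE) auto
  then have conv: "AE x in M. convergent (\<lambda>i. g i x)"
  proof eventually_elim
    case (elim x)
    then have sq: "summable (\<lambda>i. sqrt (norm (g i x - g (Suc i) x)))"
      by (intro summable_suminf_not_top) auto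
    have "\<forall>\<^sub>F i in sequentially. sqrt (norm (g i x - g (Suc i) x)) < 1"
      by (rule order_tendstoD(2)[OF summable_LIMSEQ_zero[OF sq]]) simp
    \<comment> \<open>Summable roots are eventually below 1, where a number is bounded by its root;
      so the increments themselves are summable.\<close>
    then have ev: "\<forall>\<^sub>F i in sequentially. norm (g (Suc i) x - g i x) \<le> sqrt (norm (g i x - g (Suc i) x))"
    proof eventually_elim
      case (elim i)
      let ?s = "sqrt (norm (g i x - g (Suc i) x))"
      have "?s * ?s \<le> ?s * 1" using elim by (intro mult_left_mono) auto
      then show ?case by (simp add: norm_minus_commute)
    qed
    have "summable (\<lambda>i. g (Suc i) x - g i x)" by (rule summable_comparison_test_ev[OF ev sq])
    then have "convergent (\<lambda>n. g n x - g 0 x)"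
      using sum_lessThan_telescope[of "\<lambda>i. g i x"] by (simp add: summable_iff_convergent)
    from convergent_add[OF this convergent_const[of "g 0 x"]] show ?case by simp
  qed
  show ?thesis
  proof (intro exI conjI allI)
    show "(\<lambda>x. lim (\<lambda>i. g i x)) \<in> borel_measurable M" by measurable
    show "AE x in M. (\<lambda>j. g j x) \<longlonglongrightarrow> lim (\<lambda>i. g i x)"
      using conv by eventually_elim (simp add: convergent_LIMSEQ_iff)
  qed (rule gS)
qed

text \<open>All iterated midpoints of the tail from index \<open>j\<close> on. They are finite
  constructions, so whatever is stable under midpoints passes to the hull by induction:
  measurability, modular bounds, closeness of a linear functional to its limit.\<close>

inductive_set midpoint_hull :: "(nat \<Rightarrow> 'a \<Rightarrow> 'b::real_vector) \<Rightarrow> nat \<Rightarrow> ('a \<Rightarrow> 'b) set"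
  for D :: "nat \<Rightarrow> 'a \<Rightarrow> 'b" and j :: nat where
  base: "j \<le> k \<Longrightarrow> D k \<in> midpoint_hull D j"
| mid: "u \<in> midpoint_hull D j \<Longrightarrow> v \<in> midpoint_hull D j \<Longrightarrow> (\<lambda>x. (1 / 2) *\<^sub>R (u x + v x)) \<in> midpoint_hull D j"

lemma midpoint_hull_antimono: "i \<le> j \<Longrightarrow> midpoint_hull D j \<subseteq> midpoint_hull D i"
proof
  fix u assume ij: "i \<le> j" and "u \<in> midpoint_hull D j"
  from this(2) show "u \<in> midpoint_hull D i"
    by induction (use ij in \<open>auto intro: midpoint_hull.intros\<close>)
qed

section \<open>Mollified gradients\<close>

lemma grad_moll_cutoff:
  assumes "0 < r" "cball p r \<subseteq> K"
  shows "(indicator K w *\<^sub>R f w) *\<^sub>R grad_moll r (p - w) = (indicator (cball p r) w *\<^sub>R f w) *\<^sub>R grad_moll r (p - w)"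
proof (cases "w \<in> cball p r")
  case False
  then have "grad_moll r (p - w) = 0" using assms by (intro grad_moll_eq_0) (auto simp: dist_norm)
  then show ?thesis by simp
qed (use assms in auto)

lemma conv_grad_moll_cutoff:
  assumes "0 < r" "cball p r \<subseteq> K"
  shows "conv_grad_moll (\<lambda>w. indicator K w *\<^sub>R f w) r p = conv_grad_moll (\<lambda>w. indicator (cball p r) w *\<^sub>R f w) r p"
  unfolding conv_grad_moll_def using grad_moll_cutoff[OF assms] by (intro Bochner_Integration.integral_cong) auto

text \<open>Up to sign each component is a partial derivative of a compactly supported function. The
  vanishing mean is what allows a constant to be subtracted from \<open>f\<close> under the
  convolution.\<close>

lemma integral_grad_moll:
  fixes p :: "real^'n::finite"
  assumes r: "0 < r"
  shows "(LINT w|lebesgue. grad_moll r (p - w)) = 0"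
proof -
  have gi: "integrable lebesgue (\<lambda>w. grad_moll r (p - w))"
  proof -
    have "integrable lborel (\<lambda>w. grad_moll r (p - w))"
      by (rule integrable_bounded_support[OF borel_measurable_grad_moll_shift norm_grad_moll_le[OF r], of p r])
        (use grad_moll_eq_0[OF r] in \<open>auto simp: dist_norm not_le intro: grad_moll_eq_0[OF r] less_imp_le\<close>)
    then show ?thesis using borel_measurable_grad_moll_shift by (simp add: integrable_completion)
  qed
  have "(LINT w|lebesgue. grad_moll r (p - w)) $ i = 0" for i
  proof -
    have pd: "partial_deriv i (\<lambda>w. moll r (p - w)) = (\<lambda>w. - (grad_moll r (p - w) $ i))"
      by (rule ext) (rule partial_deriv_moll_shift[OF r])
    have gc: "continuous_on UNIV (\<lambda>w. grad_moll r (p - w))"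
      by (intro continuous_on_compose2[OF continuous_on_grad_moll[of UNIV]] continuous_intros) auto
    have "(LINT w|lborel. partial_deriv i (\<lambda>w. moll r (p - w)) w) = 0"
    proof (rule integral_partial_deriv_eq_0)
      show "(\<lambda>w. moll r (p - w)) differentiable (at w)" for w
        using has_derivative_moll_shift[OF r] by (rule differentiableI)
      show "continuous_on UNIV (partial_deriv i (\<lambda>w. moll r (p - w)))"
        unfolding pd by (intro continuous_intros gc)
      show "moll r (p - w) = 0" if "w \<notin> cball 0 (norm p + r)" for w
      proof -
        have "r \<le> norm (p - w)" using that norm_triangle_ineq2[of w p] by (simp add: norm_minus_commute)
        then show ?thesis by (rule moll_eq_0[OF r])
      qed
    qed
    moreover have "(\<lambda>w. grad_moll r (p - w) $ i) \<in> borel_measurable borel"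
      by (intro borel_measurable_continuous_onI continuous_intros gc)
    ultimately have "(LINT w|lebesgue. grad_moll r (p - w) $ i) = 0"
      unfolding pd by (subst lebesgue_integral_borel) auto
    then show ?thesis
      using integral_bounded_linear[OF bounded_linear_vec_nth gi, of i] by simp
  qed
  then show ?thesis by (simp add: vec_eq_iff)
qed

text \<open>Since the kernel has mean 0, \<open>f\<close> may be replaced by its deviation from the
  mean over the ball. The kernel is at most 4 divided by r^(n+1) times the bump mass, and the volume
  of the ball is r^n times that of the unit ball, so a single 1/r is left.\<close>

lemma norm_conv_grad_moll_le:
  fixes f :: "real^'n::finite \<Rightarrow> real"
  assumes f: "set_integrable lebesgue (cball x r) f" and r: "0 < r"
  shows "norm (conv_grad_moll (\<lambda>w. indicator (cball x r) w *\<^sub>R f w) r x) \<le>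
    4 * measure lebesgue (ball (0::real^'n) 1) / bump_mass TYPE('n) * (1 / r * sharp_mean (ball x r) f)"
proof -
  let ?B = "ball x r"
  define c where "c = avg ?B f"
  define F where "F = (\<lambda>w. indicator (cball x r) w *\<^sub>R f w)"
  let ?L = "4 / (r ^ (CARD('n) + 1) * bump_mass TYPE('n))"
  have Fi: "integrable lebesgue F" using f by (simp add: F_def set_integrable_def)
  have fB: "set_integrable lebesgue ?B f" by (rule set_integrable_subset[OF f]) auto
  have gi: "integrable lebesgue (\<lambda>w. c *\<^sub>R grad_moll r (x - w))"
  proof (rule integrable_scaleR_right)
    have "integrable lborel (\<lambda>w. grad_moll r (x - w))"
      by (rule integrable_bounded_support[OF borel_measurable_grad_moll_shift norm_grad_moll_le[OF r], of x r])
        (auto simp: dist_norm not_le intro: grad_moll_eq_0[OF r] less_imp_le)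
    then show "integrable lebesgue (\<lambda>w. grad_moll r (x - w))" using borel_measurable_grad_moll_shift by (simp add: integrable_completion)
  qed
  have "conv_grad_moll F r x = (LINT w|lebesgue. F w *\<^sub>R grad_moll r (x - w)) - (LINT w|lebesgue. c *\<^sub>R grad_moll r (x - w))"
    unfolding conv_grad_moll_def by (simp add: integral_grad_moll[OF r])
  also have "\<dots> = (LINT w|lebesgue. F w *\<^sub>R grad_moll r (x - w) - c *\<^sub>R grad_moll r (x - w))"
    by (rule Bochner_Integration.integral_diff[OF integrable_mult_grad_moll[OF Fi r] gi, symmetric])
  finally have diff: "conv_grad_moll F r x = (LINT w|lebesgue. F w *\<^sub>R grad_moll r (x - w) - c *\<^sub>R grad_moll r (x - w))" .
  have "norm (conv_grad_moll F r x) \<le> (LINT w|lebesgue. norm (F w *\<^sub>R grad_moll r (x - w) - c *\<^sub>R grad_moll r (x - w)))"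
    unfolding diff by (rule integral_norm_bound)
  also have "\<dots> \<le> (LINT w|lebesgue. ?L * (indicator ?B w *\<^sub>R \<bar>f w - c\<bar>))"
  proof (rule integral_mono)
    show "integrable lebesgue (\<lambda>w. norm (F w *\<^sub>R grad_moll r (x - w) - c *\<^sub>R grad_moll r (x - w)))"
      by (intro integrable_norm Bochner_Integration.integrable_diff integrable_mult_grad_moll Fi r gi)
    show "integrable lebesgue (\<lambda>w. ?L * (indicator ?B w *\<^sub>R \<bar>f w - c\<bar>))"
      using set_integrable_minus_const_ball[OF fB] unfolding set_integrable_def by (rule integrable_mult_right)
    fix w
    show "norm (F w *\<^sub>R grad_moll r (x - w) - c *\<^sub>R grad_moll r (x - w)) \<le> ?L * (indicator ?B w *\<^sub>R \<bar>f w - c\<bar>)"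
    proof (cases "w \<in> ?B")
      case True
      then have "F w = f w" by (simp add: F_def)
      then have "norm (F w *\<^sub>R grad_moll r (x - w) - c *\<^sub>R grad_moll r (x - w)) = norm (grad_moll r (x - w)) * \<bar>f w - c\<bar>"
        by (simp add: scaleR_diff_left[symmetric] mult.commute)
      also have "\<dots> \<le> ?L * \<bar>f w - c\<bar>" by (intro mult_right_mono norm_grad_moll_le r) simp
      finally show ?thesis using True by simp
    next
      case False
      then have "grad_moll r (x - w) = 0" by (intro grad_moll_eq_0 r) (simp add: dist_norm)
      then show ?thesis using False by simp
    qed
  qed
  also have "\<dots> = ?L * (measure lebesgue ?B * sharp_mean ?B f)"
    using r unfolding integral_mult_right_zero
    by (simp add: sharp_mean_def avg_def[of _ "\<lambda>y. \<bar>f y - _\<bar>"] c_def[symmetric] set_lebesgue_integral_def)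
  also have "\<dots> = 4 * measure lebesgue (ball (0::real^'n) 1) / bump_mass TYPE('n) * (1 / r * sharp_mean ?B f)"
    using r content_ball_conv_unit_ball[of r x] by (simp add: field_simps)
  finally show ?thesis by (simp only: F_def)
qed

lemma moll_minus: "moll r (- x) = moll r x"
  by (simp add: moll_def bump_def)

context phi_setting
begin

text \<open>Vitali's convergence theorem in this setting. The part below a level R tends to 0 by
  dominated convergence on the compact set; the part above is at most R^(1-a) times a constant times
  the modular, which is small for large R because a > 1.\<close>

lemma L1_tendsto_0:
  fixes y :: "nat \<Rightarrow> real^'n \<Rightarrow> real"
  assumes ym: "\<And>j. y j \<in> borel_measurable (lebesgue_on \<Omega>)" and y0: "\<And>j x. 0 \<le> y j x"
    and mod: "\<And>j. (\<integral>\<^sup>+x\<in>\<Omega>. \<phi> x (y j x) \<partial>lebesgue) \<le> ennreal C" and C: "0 \<le> C"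
    and lim: "AE x in lebesgue. x \<in> \<Omega> \<longrightarrow> (\<lambda>j. y j x) \<longlonglongrightarrow> 0"
    and K: "compact K" "K \<subseteq> \<Omega>"
  shows "(\<lambda>j. LINT x|lebesgue. indicator K x *\<^sub>R y j x) \<longlonglongrightarrow> 0"
proof -
  define A where "A = ca * \<sigma> powr a"
  have A: "0 < A" using ca \<sigma> by (simp add: A_def)
  have Km: "K \<in> lmeasurable" using K by (intro lmeasurable_compact)
  have fin: "(\<integral>\<^sup>+x\<in>\<Omega>. \<phi> x (y j x) \<partial>lebesgue) < \<infinity>" for j using mod[of j] by (auto intro: le_less_trans)
  have Pi: "integrable lebesgue (Pg (y j))" for j by (rule integrable_Pg[OF ym y0 fin])
  have PC: "(LINT x|lebesgue. Pg (y j) x) \<le> C" for j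
  proof -
    have "ennreal (LINT x|lebesgue. Pg (y j) x) = (\<integral>\<^sup>+x. ennreal (Pg (y j) x) \<partial>lebesgue)"
      by (rule nn_integral_eq_integral[OF Pi, symmetric]) (simp add: Pg_nonneg)
    also have "\<dots> \<le> ennreal C" using mod[of j] nn_integral_Pg[of "y j"] y0 by simp
    finally show ?thesis using C by simp
  qed
  have yi: "integrable lebesgue (\<lambda>x. indicator K x *\<^sub>R y j x)" for j by (rule integrable_of_modular[OF ym y0 fin K(2) Km])
  have nn: "0 \<le> (LINT x|lebesgue. indicator K x *\<^sub>R y j x)" for j
    by (intro integral_nonneg_AE) (simp add: y0)
  show ?thesis
  proof (rule order_tendstoI)
    fix e :: real assume "0 < e"
    have "((\<lambda>R. A * C * R powr (1 - a)) \<longlongrightarrow> A * C * 0) at_top"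
      using a by (intro tendsto_intros tendsto_neg_powr filterlim_ident) auto
    then have "\<forall>\<^sub>F R in at_top. A * C * R powr (1 - a) < e / 2" using \<open>0 < e\<close> by (intro order_tendstoD(2)) auto
    \<comment> \<open>R \<ge> \<sigma> is needed for the growth bound \<open>powr_le_P\<close>; the
      second condition makes the tail smaller than half of \<open>e\<close>.\<close>
    then obtain R where R: "\<sigma> \<le> R" "A * C * R powr (1 - a) < e / 2"
      using eventually_ge_at_top[of \<sigma>] by (metis (mono_tags, lifting) eventually_conj eventually_happens trivial_limit_at_top_linorder)
    have Rp: "0 < R" using R \<sigma> by linarith
    have pt: "AE x in lebesgue. indicator K x *\<^sub>R y j x \<le> indicator K x * min (y j x) R + R powr (1 - a) * A * Pg (y j) x" for j
      using AE_good
    proof eventually_elim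
      case (elim x)
      show ?case
      proof (cases "x \<in> K")
        case True
        then have gx: "good x" and xO: "x \<in> \<Omega>" using elim K by auto
        have nonneg: "0 \<le> R powr (1 - a) * A * P x (y j x)" using A P_nonneg by simp
        show ?thesis
        proof (cases "y j x \<le> R")
          case True
          then show ?thesis using \<open>x \<in> K\<close> xO nonneg by (simp add: Pg_def)
        next
          case False
          then have yR: "R < y j x" by simp
          have "y j x = y j x powr (1 - a) * y j x powr a" using yR Rp by (simp add: powr_add[symmetric])
          also have "\<dots> \<le> R powr (1 - a) * (A * P x (y j x))"
          proof (rule mult_mono)
            show "y j x powr (1 - a) \<le> R powr (1 - a)" using yR Rp a by (intro powr_mono2') auto
            show "y j x powr a \<le> A * P x (y j x)" unfolding A_def using R yR by (intro powr_le_P gx) auto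
          qed auto
          finally have "y j x \<le> R powr (1 - a) * A * P x (y j x)" by (simp add: mult.assoc)
          then show ?thesis using \<open>x \<in> K\<close> xO yR Rp by (simp add: Pg_def)
        qed
      next
        case False
        then show ?thesis using A Pg_nonneg[of "y j" x] by simp
      qed
    qed
    have mm: "(\<lambda>x. indicator K x * min (y j x) R) \<in> borel_measurable lebesgue" for j
    proof -
      have "(\<lambda>x. min (indicator K x *\<^sub>R y j x) R) \<in> borel_measurable lebesgue"
        using borel_measurable_integrable[OF yi[of j]] by measurable
      moreover have "(\<lambda>x. indicator K x * min (y j x) R) = (\<lambda>x. min (indicator K x *\<^sub>R y j x) R)"
        using Rp by (auto simp: fun_eq_iff indicator_def)
      ultimately show ?thesis by simp
    qed
    have Ki: "integrable lebesgue (\<lambda>x. indicator K x * R)"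
      using Km by (intro integrable_mult_left integrable_real_indicator) (auto simp: fmeasurable_def)
    have mb: "norm (indicator K x * min (y j x) R) \<le> indicator K x * R" for j x
      using y0[of j x] Rp by (auto simp: indicator_def)
    have mi: "integrable lebesgue (\<lambda>x. indicator K x * min (y j x) R)" for j
      by (rule Bochner_Integration.integrable_bound[OF Ki mm]) (use mb Rp in \<open>auto simp: indicator_def\<close>)
    have "(\<lambda>j. LINT x|lebesgue. indicator K x * min (y j x) R) \<longlonglongrightarrow> (LINT x|(lebesgue :: (real^'n) measure). 0)"
    proof (rule integral_dominated_convergence[OF _ mm Ki])
      show "AE x in lebesgue. (\<lambda>j. indicator K x * min (y j x) R) \<longlonglongrightarrow> 0"
        using lim
      proof eventually_elim
        case (elim x)
        show ?case
        proof (cases "x \<in> K")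
          case True
          then have "(\<lambda>j. min (y j x) R) \<longlonglongrightarrow> min 0 R" using elim K by (intro tendsto_min tendsto_const) auto
          then show ?thesis using True Rp by simp
        qed simp
      qed
    qed (use mb in auto)
    then have "\<forall>\<^sub>F j in sequentially. (LINT x|lebesgue. indicator K x * min (y j x) R) < e / 2"
      using \<open>0 < e\<close> by (intro order_tendstoD(2)) auto
    then show "\<forall>\<^sub>F j in sequentially. (LINT x|lebesgue. indicator K x *\<^sub>R y j x) < e"
    proof eventually_elim
      case (elim j)
      have "(LINT x|lebesgue. indicator K x *\<^sub>R y j x) \<le>
          (LINT x|lebesgue. indicator K x * min (y j x) R + R powr (1 - a) * A * Pg (y j) x)"
        by (rule integral_mono_AE[OF yi _ pt]) (intro Bochner_Integration.integrable_add mi integrable_mult_right Pi)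
      also have "\<dots> = (LINT x|lebesgue. indicator K x * min (y j x) R) + R powr (1 - a) * A * (LINT x|lebesgue. Pg (y j) x)"
        using Bochner_Integration.integral_add[OF mi integrable_mult_right[OF Pi]] by simp
      also have "\<dots> \<le> (LINT x|lebesgue. indicator K x * min (y j x) R) + R powr (1 - a) * A * C"
        using PC[of j] A by (intro add_left_mono mult_left_mono) auto
      also have "\<dots> < e" using elim R by (simp add: mult_ac)
      finally show ?case .
    qed
  next
    fix e :: real assume "e < 0"
    then show "\<forall>\<^sub>F j in sequentially. e < (LINT x|lebesgue. indicator K x *\<^sub>R y j x)"
      using nn by (auto intro!: always_eventually dest: less_le_trans)
  qed
qed

lemma phi_midpoint:
  fixes u v :: "'c::real_normed_vector"
  assumes x: "x \<in> \<Omega>" and L: "0 < L"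
  shows "\<phi> x (norm ((1 / 2) *\<^sub>R (u + v)) / L) \<le> ennreal (1 / 2) * \<phi> x (norm u / L) + ennreal (1 / 2) * \<phi> x (norm v / L)"
proof -
  have "norm ((1 / 2) *\<^sub>R (u + v)) / L \<le> (1 - 1 / 2) * (norm u / L) + 1 / 2 * (norm v / L)"
  proof -
    have e: "norm ((1 / 2) *\<^sub>R (u + v)) = 1 / 2 * norm (u + v)" unfolding norm_scaleR by simp
    show ?thesis unfolding e using L norm_triangle_ineq[of u v] by (simp add: field_simps)
  qed
  then have "\<phi> x (norm ((1 / 2) *\<^sub>R (u + v)) / L) \<le> \<phi> x ((1 - 1 / 2) * (norm u / L) + 1 / 2 * (norm v / L))"
    using L by (intro phi_mono x) auto
  also have "\<dots> \<le> ennreal (1 - 1 / 2) * \<phi> x (norm u / L) + ennreal (1 / 2) * \<phi> x (norm v / L)"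
  proof -
    have cv: "\<forall>s\<ge>0. \<forall>t\<ge>0. \<forall>\<theta>\<in>{0..1}. \<phi> x ((1 - \<theta>) * s + \<theta> * t) \<le> ennreal (1 - \<theta>) * \<phi> x s + ennreal \<theta> * \<phi> x t"
      using Phi[OF x] by (simp add: Phi_function_def)
    have "0 \<le> norm u / L" "0 \<le> norm v / L" "(1 / 2 :: real) \<in> {0..1}" using L by auto
    with cv show ?thesis by blast
  qed
  finally show ?thesis by simp
qed

text \<open>Convexity of the modular along midpoints: they stay under a common bound C, which lets
  the whole midpoint hull inherit the bound of its generators.\<close>

lemma nn_integral_phi_midpoint:
  fixes u v :: "real^'n \<Rightarrow> real^'n"
  assumes um: "u \<in> borel_measurable (lebesgue_on \<Omega>)" and vm: "v \<in> borel_measurable (lebesgue_on \<Omega>)" and L: "0 < L"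
    and uC: "(\<integral>\<^sup>+x\<in>\<Omega>. \<phi> x (norm (u x) / L) \<partial>lebesgue) \<le> ennreal C" and vC: "(\<integral>\<^sup>+x\<in>\<Omega>. \<phi> x (norm (v x) / L) \<partial>lebesgue) \<le> ennreal C"
    and C: "0 \<le> C"
  shows "(\<integral>\<^sup>+x\<in>\<Omega>. \<phi> x (norm ((1 / 2) *\<^sub>R (u x + v x)) / L) \<partial>lebesgue) \<le> ennreal C"
proof -
  have m: "(\<lambda>x. \<phi> x (norm (w x) / L) * indicator \<Omega> x) \<in> borel_measurable lebesgue"
    if [measurable]: "w \<in> borel_measurable (lebesgue_on \<Omega>)" for w :: "real^'n \<Rightarrow> real^'n"
    by (rule borel_measurable_phi_indicator) (measurable, use L in simp)
  have "(\<integral>\<^sup>+x\<in>\<Omega>. \<phi> x (norm ((1 / 2) *\<^sub>R (u x + v x)) / L) \<partial>lebesgue) \<le>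
      (\<integral>\<^sup>+x. ennreal (1 / 2) * (\<phi> x (norm (u x) / L) * indicator \<Omega> x) + ennreal (1 / 2) * (\<phi> x (norm (v x) / L) * indicator \<Omega> x) \<partial>lebesgue)"
  proof (rule nn_integral_mono)
    fix x
    show "\<phi> x (norm ((1 / 2) *\<^sub>R (u x + v x)) / L) * indicator \<Omega> x \<le>
      ennreal (1 / 2) * (\<phi> x (norm (u x) / L) * indicator \<Omega> x) + ennreal (1 / 2) * (\<phi> x (norm (v x) / L) * indicator \<Omega> x)"
      using phi_midpoint[OF _ L, of x "u x" "v x"] by (cases "x \<in> \<Omega>") auto
  qed
  also have "\<dots> = ennreal (1 / 2) * (\<integral>\<^sup>+x\<in>\<Omega>. \<phi> x (norm (u x) / L) \<partial>lebesgue) + ennreal (1 / 2) * (\<integral>\<^sup>+x\<in>\<Omega>. \<phi> x (norm (v x) / L) \<partial>lebesgue)"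
    using m[OF um] m[OF vm] by (subst nn_integral_add) (auto simp: nn_integral_cmult)
  also have "\<dots> \<le> ennreal (1 / 2) * ennreal C + ennreal (1 / 2) * ennreal C"
    by (intro add_mono mult_left_mono uC vC) auto
  also have "\<dots> = ennreal (1 / 2 * C) + ennreal (1 / 2 * C)"
    using C ennreal_mult[of "1 / 2" C] by (simp only: zero_le_divide_1_iff zero_le_numeral)
  also have "\<dots> = ennreal (1 / 2 * C + 1 / 2 * C)" using C by (intro ennreal_plus[symmetric]) auto
  also have "\<dots> = ennreal C" by simp
  finally show ?thesis .
qed

end

text \<open>After Fubini the inner integral in \<open>x\<close> is integrated by parts: the
  derivative of \<eta> times the shifted mollifier integrates to 0, which moves the derivative onto
  \<eta>. The mollifier is even, so the result is again a convolution.\<close>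

lemma integral_conv_grad_moll_test:
  fixes F :: "real^'n::finite \<Rightarrow> real"
  assumes F: "integrable lebesgue F" and r: "0 < r"
    and \<eta>: "\<And>x. \<eta> differentiable (at x)" "continuous_on UNIV \<eta>" "continuous_on UNIV (partial_deriv i \<eta>)"
    and K: "compact K" "\<And>x. x \<notin> K \<Longrightarrow> \<eta> x = 0" "\<And>x. x \<notin> K \<Longrightarrow> partial_deriv i \<eta> x = 0"
  shows "(LINT x|lebesgue. conv_grad_moll F r x $ i * \<eta> x) = - (LINT w|lebesgue. conv_moll (partial_deriv i \<eta>) r w * F w)"
proof -
  let ?L = "4 / (r ^ (CARD('n) + 1) * bump_mass TYPE('n))"
  obtain R where "\<forall>x\<in>K. norm x \<le> R" using compact_imp_bounded[OF K(1)] unfolding bounded_iff by blast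
  then have R: "K \<subseteq> cball 0 R" by auto
  have gc: "continuous_on UNIV (\<lambda>w. grad_moll r (w - p))" "continuous_on UNIV (\<lambda>w. moll r (w - p))" for p :: "real^'n"
    by (intro continuous_on_compose2[OF continuous_on_grad_moll[of UNIV]]
        continuous_on_compose2[OF continuous_on_moll[of UNIV]] continuous_intros; simp)+
  define k where "k p = \<eta> (fst p) * (grad_moll r (fst p - snd p) $ i)" for p :: "(real^'n) \<times> (real^'n)"
  have km: "k \<in> borel_measurable borel"
  proof -
    have "continuous_on UNIV (\<lambda>p::(real^'n) \<times> (real^'n). grad_moll r (fst p - snd p))"
      by (intro continuous_on_compose2[OF continuous_on_grad_moll[of UNIV]] continuous_intros) auto
    moreover have "continuous_on UNIV (\<lambda>p::(real^'n) \<times> (real^'n). \<eta> (fst p))"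
      by (intro continuous_on_compose2[OF \<eta>(2)] continuous_intros) auto
    ultimately show ?thesis unfolding k_def[abs_def] by (intro borel_measurable_continuous_onI continuous_intros)
  qed
  have \<eta>m: "\<eta> \<in> borel_measurable borel" by (rule borel_measurable_continuous_onI[OF \<eta>(2)])
  obtain B where B: "0 \<le> B" "\<And>x. \<bar>\<eta> x\<bar> \<le> B" using compact_support_bounded[OF \<eta>(2) K(1,2)] by blast
  have \<eta>i: "integrable lborel \<eta>"
  proof (rule integrable_bounded_support[OF \<eta>m, of B 0 R])
    show "\<eta> x = 0" if "x \<notin> cball 0 R" for x using K(2)[of x] R that by blast
  qed (use B in simp)
  have ui: "integrable lborel (\<lambda>x. \<bar>\<eta> x\<bar> * ?L)" by (intro integrable_mult_left integrable_abs \<eta>i)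
  have kb: "\<bar>k (x, w)\<bar> \<le> \<bar>\<eta> x\<bar> * ?L" for x w
  proof -
    have "\<bar>grad_moll r (x - w) $ i\<bar> \<le> norm (grad_moll r (x - w))" by (rule component_le_norm_cart)
    also have "\<dots> \<le> ?L" by (rule norm_grad_moll_le[OF r])
    finally have "\<bar>\<eta> x\<bar> * \<bar>grad_moll r (x - w) $ i\<bar> \<le> \<bar>\<eta> x\<bar> * ?L" by (rule mult_left_mono) simp
    then show ?thesis by (simp add: k_def abs_mult)
  qed
  have cm: "(\<lambda>x. conv_grad_moll F r x $ i * \<eta> x) \<in> borel_measurable borel"
    by (intro borel_measurable_continuous_onI continuous_intros \<eta>(2) continuous_at_imp_continuous_on ballI
        isCont_conv_grad_moll F r)
  have "(LINT x|lebesgue. conv_grad_moll F r x $ i * \<eta> x) = (LINT x|lborel. conv_grad_moll F r x $ i * \<eta> x)"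
    by (rule lebesgue_integral_borel[OF cm])
  also have "\<dots> = (LINT x|lborel. LINT w|lebesgue. k (x, w) * F w)"
  proof (rule Bochner_Integration.integral_cong[OF refl])
    fix x
    have "conv_grad_moll F r x $ i = (LINT w|lebesgue. (F w *\<^sub>R grad_moll r (x - w)) $ i)"
      unfolding conv_grad_moll_def
      by (rule integral_bounded_linear[OF bounded_linear_vec_nth integrable_mult_grad_moll[OF F r], symmetric])
    then have "conv_grad_moll F r x $ i * \<eta> x = (LINT w|lebesgue. \<eta> x * (F w *\<^sub>R grad_moll r (x - w)) $ i)"
      by (simp only: integral_mult_right_zero mult.commute)
    also have "\<dots> = (LINT w|lebesgue. k (x, w) * F w)"
      by (intro Bochner_Integration.integral_cong refl) (simp add: k_def)
    finally show "conv_grad_moll F r x $ i * \<eta> x = (LINT w|lebesgue. k (x, w) * F w)" .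
  qed
  also have "\<dots> = (LINT w|lebesgue. (LINT x|lborel. k (x, w)) * F w)"
    by (rule integral_swap_kernel[OF km F ui kb])
  also have "\<dots> = (LINT w|lebesgue. - (conv_moll (partial_deriv i \<eta>) r w * F w))"
  proof (rule Bochner_Integration.integral_cong[OF refl])
    fix w
    let ?u = "\<lambda>x. \<eta> x * moll r (x - w)"
    have Dm: "((\<lambda>x. moll r (x - w)) has_derivative (\<lambda>h. grad_moll r (x - w) \<bullet> h)) (at x)" for x
    proof -
      have "((\<lambda>x. x - w) has_derivative (\<lambda>h. h)) (at x)" by (auto intro!: derivative_eq_intros)
      from has_derivative_compose[OF this has_derivative_moll[OF r]] show ?thesis by simp
    qed
    have D: "(?u has_derivative (\<lambda>h. \<eta> x * (grad_moll r (x - w) \<bullet> h) + frechet_derivative \<eta> (at x) h * moll r (x - w))) (at x)" for x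
      by (rule has_derivative_mult[OF frechet_derivative_works[THEN iffD1, OF \<eta>(1)] Dm])
    have pd: "partial_deriv i ?u = (\<lambda>x. \<eta> x * (grad_moll r (x - w) $ i) + partial_deriv i \<eta> x * moll r (x - w))"
      by (rule ext, subst partial_deriv_eq[OF D]) (simp add: partial_deriv_def inner_axis)
    have "(LINT x|lborel. partial_deriv i ?u x) = 0"
    proof (rule integral_partial_deriv_eq_0)
      show "?u differentiable (at x)" for x using D by (rule differentiableI)
      show "continuous_on UNIV (partial_deriv i ?u)" unfolding pd by (intro continuous_intros gc \<eta>(2,3))
      show "?u x = 0" if "x \<notin> cball 0 R" for x
      proof -
        have "x \<notin> K" using R that by blast
        then show ?thesis by (simp add: K(2))
      qed
    qed
    moreover have m1: "(\<lambda>x. k (x, w)) \<in> borel_measurable borel" "(\<lambda>x. partial_deriv i \<eta> x * moll r (x - w)) \<in> borel_measurable borel"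
      unfolding k_def by (auto intro!: borel_measurable_continuous_onI continuous_intros gc \<eta>(2,3))
    have i1: "integrable lborel (\<lambda>x. k (x, w))"
      by (rule Bochner_Integration.integrable_bound[OF ui]) (use m1 kb order_trans[OF kb abs_ge_self] in auto)
    obtain B' where B': "0 \<le> B'" "\<And>x. \<bar>partial_deriv i \<eta> x\<bar> \<le> B'" using compact_support_bounded[OF \<eta>(3) K(1,3)] by blast
    have i2: "integrable lborel (\<lambda>x. partial_deriv i \<eta> x * moll r (x - w))"
    proof (rule integrable_bounded_support[OF m1(2), of "B' * (1 / (r ^ CARD('n) * bump_mass TYPE('n)))" 0 R])
      show "norm (partial_deriv i \<eta> x * moll r (x - w)) \<le> B' * (1 / (r ^ CARD('n) * bump_mass TYPE('n)))" for x
        unfolding norm_mult using B' moll_le[OF r, of "x - w"] moll_nonneg[OF r, of "x - w"]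
        by (intro mult_mono) auto
      show "partial_deriv i \<eta> x * moll r (x - w) = 0" if "x \<notin> cball 0 R" for x
      proof -
        have "x \<notin> K" using R that by blast
        then show ?thesis by (simp add: K(3))
      qed
    qed
    have "(LINT x|lborel. partial_deriv i ?u x) = (LINT x|lborel. k (x, w)) + (LINT x|lborel. partial_deriv i \<eta> x * moll r (x - w))"
      unfolding pd using Bochner_Integration.integral_add[OF i1 i2] by (simp add: k_def)
    moreover have "(LINT x|lborel. partial_deriv i \<eta> x * moll r (x - w)) = conv_moll (partial_deriv i \<eta>) r w"
    proof -
      have "conv_moll (partial_deriv i \<eta>) r w = (LINT x|lebesgue. partial_deriv i \<eta> x * moll r (x - w))"
        unfolding conv_moll_def
      proof (intro Bochner_Integration.integral_cong refl)
        fix x show "moll r (w - x) * partial_deriv i \<eta> x = partial_deriv i \<eta> x * moll r (x - w)"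
          using moll_minus[of r "x - w"] by simp
      qed
      then show ?thesis using lebesgue_integral_borel[OF m1(2)] by simp
    qed
    ultimately have "(LINT x|lborel. k (x, w)) = - conv_moll (partial_deriv i \<eta>) r w" by linarith
    then show "(LINT x|lborel. k (x, w)) * F w = - (conv_moll (partial_deriv i \<eta>) r w * F w)" by simp
  qed
  finally show ?thesis by simp
qed

lemma conv_moll_bounded:
  fixes u :: "real^'n::finite \<Rightarrow> real"
  assumes u: "integrable lebesgue u" "\<And>x. \<bar>u x\<bar> \<le> B" and r: "0 < r"
  shows "\<bar>conv_moll u r p\<bar> \<le> B"
proof -
  have i: "integrable lebesgue (\<lambda>w. moll r (p - w))"
    using integrable_moll_shift[OF r, of p] borel_measurable_moll_shift by (simp add: integrable_completion)
  have "\<bar>conv_moll u r p\<bar> \<le> (LINT w|lebesgue. norm (moll r (p - w) * u w))"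
    unfolding conv_moll_def using integral_norm_bound[of lebesgue "\<lambda>w. moll r (p - w) * u w"] by simp
  also have "\<dots> \<le> (LINT w|lebesgue. moll r (p - w) * B)"
  proof (rule integral_mono)
    show "norm (moll r (p - w) * u w) \<le> moll r (p - w) * B" for w
      using moll_nonneg[OF r, of "p - w"] u(2)[of w] by (simp add: abs_mult mult_left_mono)
  qed (use integrable_mult_moll[OF u(1) r, of p] i in auto)
  also have "\<dots> = (LINT w|lebesgue. moll r (p - w)) * B" by (rule integral_mult_left_zero)
  also have "(LINT w|lebesgue. moll r (p - w)) = 1"
    using integral_moll_shift[OF r, of p] lebesgue_integral_borel[OF borel_measurable_moll_shift[of r p]] by simp
  finally show ?thesis by simp
qed

section \<open>Mollified gradients on the inner parts and the construction of the weak
  gradient\<close>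

context phi_setting
begin

definition sharp_bound :: real where
  "sharp_bound = 4 * measure lebesgue (ball (0::real^'n) 1) / bump_mass TYPE('n)"

lemma sharp_bound_pos: "0 < sharp_bound"
  using bump_mass_pos[where 'n='n] by (simp add: sharp_bound_def)

text \<open>The inner cut-off gives the convolution a meaning for functions that are only locally
  integrable; the outer one keeps to centres whose balls lie in \<Omega>. The value 0 elsewhere adds
  nothing to the modular.\<close>

definition discrete_grad :: "(real^'n \<Rightarrow> real) \<Rightarrow> real \<Rightarrow> real^'n \<Rightarrow> real^'n" where
  "discrete_grad f r x = indicator (inner_part \<Omega> r) x *\<^sub>R conv_grad_moll (\<lambda>w. indicator (cball x r) w *\<^sub>R f w) r x"

text \<open>The cut-off moves with \<open>x\<close>, but near a given point it may be replaced by
  one fixed larger ball, because the kernel only sees \<open>cball x r\<close>; then continuity of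
  \<open>conv_grad_moll\<close> applies.\<close>

lemma borel_measurable_discrete_grad:
  assumes f: "f locally_integrable_on \<Omega>" and r: "0 < r"
  shows "discrete_grad f r \<in> borel_measurable lebesgue"
  unfolding discrete_grad_def[abs_def]
proof (rule borel_measurable_lebesgueI, rule borel_measurable_continuous_on_indicator)
  show "inner_part \<Omega> r \<in> sets borel" by (intro borel_open open_inner_part open_Omega)
  show "continuous_on (inner_part \<Omega> r) (\<lambda>x. conv_grad_moll (\<lambda>w. indicator (cball x r) w *\<^sub>R f w) r x)"
  proof (intro continuous_at_imp_continuous_on ballI)
    fix p assume "p \<in> inner_part \<Omega> r"
    then have "cball p r \<subseteq> \<Omega>" using inner_partD(2) r by blast
    then obtain r' where r': "r < r'" "cball p r' \<subseteq> \<Omega>" using cball_enlarge[OF open_Omega _ r] by blast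
    have i: "integrable lebesgue (\<lambda>w. indicator (cball p r') w *\<^sub>R f w)"
      by (rule locally_integrable_on_compact[OF f _ r'(2)]) simp
    have c: "isCont (conv_grad_moll (\<lambda>w. indicator (cball p r') w *\<^sub>R f w) r) p" by (rule isCont_conv_grad_moll[OF i r])
    have "\<forall>\<^sub>F x in nhds p. conv_grad_moll (\<lambda>w. indicator (cball x r) w *\<^sub>R f w) r x = conv_grad_moll (\<lambda>w. indicator (cball p r') w *\<^sub>R f w) r x"
      unfolding eventually_nhds_metric
    proof (intro exI[of _ "r' - r"] conjI allI impI)
      fix x assume x: "dist x p < r' - r"
      have "cball x r \<subseteq> cball p r'"
      proof
        fix y assume "y \<in> cball x r"
        then show "y \<in> cball p r'" using x dist_triangle[of p y x] by (simp add: dist_commute)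
      qed
      then show "conv_grad_moll (\<lambda>w. indicator (cball x r) w *\<^sub>R f w) r x = conv_grad_moll (\<lambda>w. indicator (cball p r') w *\<^sub>R f w) r x"
        using conv_grad_moll_cutoff[OF r, of x "cball p r'" f] by simp
    qed (use r' in simp)
    then show "isCont (\<lambda>x. conv_grad_moll (\<lambda>w. indicator (cball x r) w *\<^sub>R f w) r x) p"
      using c by (simp only: isCont_cong)
  qed
qed

lemma nn_integral_phi_discrete_grad:
  assumes f: "f locally_integrable_on \<Omega>" and r: "0 < r"
  shows "(\<integral>\<^sup>+x\<in>\<Omega>. \<phi> x (norm (discrete_grad f r x) / sharp_bound) \<partial>lebesgue) \<le> sharp_integral f r"
  unfolding sharp_integral_def
proof (rule nn_integral_mono)
  fix x
  show "\<phi> x (norm (discrete_grad f r x) / sharp_bound) * indicator \<Omega> x \<le>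
    \<phi> x (1 / r * sharp_mean (ball x r) f) * indicator (inner_part \<Omega> r) x"
  proof (cases "x \<in> inner_part \<Omega> r")
    case True
    note ip = inner_partD[OF True r]
    have "set_integrable lebesgue (cball x r) f"
      using f ip(2) compact_cball unfolding locally_integrable_on_def by blast
    then have "norm (discrete_grad f r x) \<le> sharp_bound * (1 / r * sharp_mean (ball x r) f)"
      unfolding sharp_bound_def discrete_grad_def using norm_conv_grad_moll_le[OF _ r, of x f] True by simp
    then have "norm (discrete_grad f r x) / sharp_bound \<le> 1 / r * sharp_mean (ball x r) f"
      using sharp_bound_pos by (simp add: field_simps)
    then show ?thesis using True ip sharp_bound_pos by (auto intro!: phi_mono)
  next
    case False
    then show ?thesis using phi_0[of x] by (cases "x \<in> \<Omega>") (auto simp: discrete_grad_def)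
  qed
qed

text \<open>For small radii the mollified gradient agrees on the support of the test function with
  that of one globally integrable function \<open>F\<close>. Integration by parts moves mollifier
  and derivative to the test function, whose mollified derivatives converge boundedly almost
  everywhere.\<close>

lemma discrete_grad_test:
  assumes f: "f locally_integrable_on \<Omega>" and \<eta>: "test_function \<Omega> \<eta>"
    and r: "\<And>j. 0 < r j" "r \<longlonglongrightarrow> 0"
  shows "(\<lambda>j. LINT x:\<Omega>|lebesgue. discrete_grad f (r j) x $ i * \<eta> x) \<longlonglongrightarrow> - (LINT x:\<Omega>|lebesgue. f x * partial_deriv i \<eta> x)"
proof -
  obtain K where K: "compact K" "K \<subseteq> \<Omega>" "\<And>x. x \<notin> K \<Longrightarrow> \<eta> x = 0" "\<And>i x. x \<notin> K \<Longrightarrow> partial_deriv i \<eta> x = 0"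
    "\<And>x. \<eta> differentiable (at x)" "continuous_on UNIV \<eta>" "\<And>i. continuous_on UNIV (partial_deriv i \<eta>)"
    using test_functionD[OF \<eta>] by blast
  obtain d where d: "0 < d" "\<And>r. r < d \<Longrightarrow> K \<subseteq> inner_part \<Omega> r" using inner_part_compact[OF open_Omega K(1,2)] by blast
  obtain e where e: "0 < e" "(\<Union>x\<in>K. cball x e) \<subseteq> \<Omega>"
    using compact_subset_open_imp_cball_epsilon_subset[OF K(1) open_Omega K(2)] by blast
  \<comment> \<open>The closed e-neighbourhood of the support, written as a sum of compact sets so
    that compactness is immediate; it contains every ball used for radii below
    \<open>e\<close>.\<close>
  define K1 where "K1 = {x + y |x y. x \<in> K \<and> y \<in> cball 0 e}"
  have K1c: "compact K1" unfolding K1_def by (rule compact_sums[OF K(1) compact_cball])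
  have cK1: "cball x e \<subseteq> K1" if "x \<in> K" for x
  proof
    fix z assume z: "z \<in> cball x e"
    have "z = x + (z - x)" "z - x \<in> cball 0 e" using z by (simp_all add: dist_norm norm_minus_commute)
    with that show "z \<in> K1" unfolding K1_def by blast
  qed
  have K1O: "K1 \<subseteq> \<Omega>"
  proof
    fix z assume "z \<in> K1"
    then obtain x y where "z = x + y" "x \<in> K" "norm y \<le> e" by (auto simp: K1_def)
    then have "z \<in> cball x e" by (simp add: dist_norm)
    then show "z \<in> \<Omega>" using e(2) \<open>x \<in> K\<close> by blast
  qed
  define F where "F = (\<lambda>w. indicator K1 w *\<^sub>R f w)"
  have Fi: "integrable lebesgue F" unfolding F_def by (rule locally_integrable_on_compact[OF f K1c]) (rule K1O)
  have KK1: "K \<subseteq> K1" using cK1 e(1) by force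
  let ?p = "partial_deriv i \<eta>"
  obtain B where B: "0 \<le> B" "\<And>x. \<bar>?p x\<bar> \<le> B" using compact_support_bounded[OF K(7) K(1) K(4)] by blast
  have pm: "?p \<in> borel_measurable borel" by (rule borel_measurable_continuous_onI[OF K(7)])
  obtain R where "\<forall>x\<in>K. norm x \<le> R" using compact_imp_bounded[OF K(1)] unfolding bounded_iff by blast
  then have R: "K \<subseteq> cball 0 R" by auto
  have pi: "integrable lebesgue ?p"
  proof -
    have "integrable lborel ?p"
    proof (rule integrable_bounded_support[OF pm, of B 0 R])
      show "?p x = 0" if "x \<notin> cball 0 R" for x using K(4)[of x i] R that by blast
    qed (use B in simp)
    then show ?thesis using pm by (simp add: integrable_completion)
  qed
  have rr: "filterlim r (at_right 0) sequentially"
    using r less_imp_neq[OF r(1), symmetric] by (auto simp: filterlim_at intro!: always_eventually)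
  have eq: "(LINT x:\<Omega>|lebesgue. discrete_grad f (r j) x $ i * \<eta> x) = - (LINT w|lebesgue. conv_moll ?p (r j) w * F w)"
    if j: "r j < min d e" for j
  proof -
    have "indicator \<Omega> x *\<^sub>R (discrete_grad f (r j) x $ i * \<eta> x) = conv_grad_moll F (r j) x $ i * \<eta> x" for x
    proof (cases "x \<in> K")
      case True
      have "cball x (r j) \<subseteq> cball x e" using j by auto
      also have "\<dots> \<subseteq> K1" by (rule cK1[OF True])
      finally have "conv_grad_moll F (r j) x = conv_grad_moll (\<lambda>w. indicator (cball x (r j)) w *\<^sub>R f w) (r j) x"
        unfolding F_def by (rule conv_grad_moll_cutoff[OF r(1)])
      moreover have "x \<in> inner_part \<Omega> (r j)" "x \<in> \<Omega>" using d(2)[of "r j"] j True K(2) by auto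
      ultimately show ?thesis by (simp add: discrete_grad_def)
    qed (simp add: K(3))
    then have "(LINT x:\<Omega>|lebesgue. discrete_grad f (r j) x $ i * \<eta> x) = (LINT x|lebesgue. conv_grad_moll F (r j) x $ i * \<eta> x)"
      unfolding set_lebesgue_integral_def by (rule Bochner_Integration.integral_cong[OF refl])
    then show ?thesis using integral_conv_grad_moll_test[OF Fi r(1) K(5,6,7) K(1,3,4)] by simp
  qed
  have "(\<lambda>j. LINT w|lebesgue. conv_moll ?p (r j) w * F w) \<longlonglongrightarrow> (LINT w|lebesgue. ?p w * F w)"
  proof (rule integral_dominated_convergence[where w="\<lambda>w. B * \<bar>F w\<bar>"])
    show "(\<lambda>w. ?p w * F w) \<in> borel_measurable lebesgue"
      using borel_measurable_integrable[OF pi] borel_measurable_integrable[OF Fi] by (intro borel_measurable_times)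
    show "(\<lambda>w. conv_moll ?p (r j) w * F w) \<in> borel_measurable lebesgue" for j
      by (rule borel_measurable_times[OF _ borel_measurable_integrable[OF Fi]])
        (intro borel_measurable_lebesgueI borel_measurable_continuous_onI
          continuous_at_imp_continuous_on ballI isCont_conv_moll pi r(1))
    show "integrable lebesgue (\<lambda>w. B * \<bar>F w\<bar>)" using Fi by simp
    show "AE w in lebesgue. (\<lambda>j. conv_moll ?p (r j) w * F w) \<longlonglongrightarrow> ?p w * F w"
      using AE_lebesgue_point[OF open_UNIV integrable_imp_locally_integrable_on[OF pi]]
    proof eventually_elim
      case (elim w)
      then have "((\<lambda>r. conv_moll ?p r w) \<longlongrightarrow> ?p w) (at_right 0)" by (intro conv_moll_tendsto[OF pi]) simp
      then show ?case by (intro tendsto_mult tendsto_const filterlim_compose[OF _ rr])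
    qed
    show "AE w in lebesgue. norm (conv_moll ?p (r j) w * F w) \<le> B * \<bar>F w\<bar>" for j
      using conv_moll_bounded[OF pi B(2) r(1)] by (intro AE_I2) (simp add: abs_mult mult_right_mono)
  qed
  then have l: "(\<lambda>j. - (LINT w|lebesgue. conv_moll ?p (r j) w * F w)) \<longlonglongrightarrow> - (LINT w|lebesgue. ?p w * F w)" by (rule tendsto_minus)
  have Feq: "(LINT w|lebesgue. ?p w * F w) = (LINT x:\<Omega>|lebesgue. f x * ?p x)"
    unfolding set_lebesgue_integral_def
  proof (intro Bochner_Integration.integral_cong refl)
    fix w show "?p w * F w = indicator \<Omega> w *\<^sub>R (f w * ?p w)"
    proof (cases "w \<in> K")
      case True
      then have "w \<in> K1" "w \<in> \<Omega>" using KK1 K(2) by auto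
      then show ?thesis by (simp add: F_def)
    qed (simp add: K(4))
  qed
  have ev: "\<forall>\<^sub>F j in sequentially. r j < min d e" using order_tendstoD(2)[OF r(2), of "min d e"] d e by simp
  show ?thesis
  proof (rule Lim_transform_eventually[OF l[unfolded Feq]])
    show "\<forall>\<^sub>F j in sequentially. - (LINT w|lebesgue. conv_moll ?p (r j) w * F w) = (LINT x:\<Omega>|lebesgue. discrete_grad f (r j) x $ i * \<eta> x)"
      using ev by eventually_elim (simp add: eq)
  qed
qed


text \<open>\<Omega> may have infinite measure, while \<open>bracket\<close> is at least 1, so the
  compactness theorem is applied to a weighted measure with the same null sets in \<Omega>. The
  modular bound passes to the limit by Fatou and continuity of \<open>P x\<close>.\<close>

lemma modular_compactness:
  fixes S :: "nat \<Rightarrow> (real^'n \<Rightarrow> real^'n) set"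
  assumes ne: "\<And>j. S j \<noteq> {}" and dec: "\<And>i j. i \<le> j \<Longrightarrow> S j \<subseteq> S i"
    and mid: "\<And>j u v. u \<in> S j \<Longrightarrow> v \<in> S j \<Longrightarrow> (\<lambda>x. (1 / 2) *\<^sub>R (u x + v x)) \<in> S j"
    and meas: "\<And>u. u \<in> S 0 \<Longrightarrow> u \<in> borel_measurable lebesgue"
    and bound: "\<And>u. u \<in> S 0 \<Longrightarrow> (\<integral>\<^sup>+x\<in>\<Omega>. \<phi> x (norm (u x) / L) \<partial>lebesgue) \<le> ennreal C"
    and C: "0 \<le> C" and L: "0 < L"
  shows "\<exists>g G. (\<forall>j. g j \<in> S j) \<and> G \<in> borel_measurable lebesgue \<and>
    (AE x in lebesgue. x \<in> \<Omega> \<longrightarrow> (\<lambda>j. g j x) \<longlonglongrightarrow> G x) \<and> (\<integral>\<^sup>+x\<in>\<Omega>. \<phi> x (norm (G x) / L) \<partial>lebesgue) \<le> ennreal C"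
proof -
  obtain h :: "real^'n \<Rightarrow> ennreal" where h: "h \<in> borel_measurable lebesgue" "(\<integral>\<^sup>+x. h x \<partial>lebesgue) \<noteq> \<infinity>" "\<And>x. 0 < h x"
    using sigma_finite_measure.Ex_finite_integrable_function[OF sigma_finite_lebesgue] by auto
  \<comment> \<open>The bound by \<open>h\<close> makes the constant part of the estimate
    integrable, the bound by 1 leaves the modular part unweighted, and positivity on \<Omega> keeps
    almost everywhere statements there unchanged.\<close>
  define wt where "wt x = min 1 (h x) * indicator \<Omega> x" for x
  have wm: "wt \<in> borel_measurable lebesgue"
  proof -
    have [measurable]: "h \<in> borel_measurable lebesgue" by (rule h(1))
    show ?thesis unfolding wt_def[abs_def] by measurable
  qed
  define M where "M = density lebesgue wt"
  obtain H where H: "(\<integral>\<^sup>+x. h x \<partial>lebesgue) = ennreal H" "0 \<le> H"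
    using h(2) by (cases "\<integral>\<^sup>+x. h x \<partial>lebesgue") auto
  have lm: "u \<in> borel_measurable (lebesgue_on \<Omega>)" if "u \<in> borel_measurable lebesgue" for u :: "real^'n \<Rightarrow> real^'n"
    using that by (rule measurable_restrict_space1)
  have phim: "(\<lambda>x. \<phi> x (norm (u x) / L) * indicator \<Omega> x) \<in> borel_measurable lebesgue"
    if "u \<in> borel_measurable lebesgue" for u :: "real^'n \<Rightarrow> real^'n"
  proof (rule borel_measurable_phi_indicator)
    have [measurable]: "u \<in> borel_measurable (lebesgue_on \<Omega>)" by (rule lm[OF that])
    show "(\<lambda>x. norm (u x) / L) \<in> borel_measurable (lebesgue_on \<Omega>)" by measurable
  qed (use L in simp)
  have pt: "AE x in lebesgue. wt x * ennreal (bracket (u x)) \<le>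
      ennreal (1 + L * \<sigma>) * h x + ennreal (L * \<sigma>) * (\<phi> x (norm (u x) / L) * indicator \<Omega> x)" for u :: "real^'n \<Rightarrow> real^'n"
    using AE_good
  proof eventually_elim
    case (elim x)
    show ?case
    proof (cases "x \<in> \<Omega>")
      case True
      then have g: "good x" using elim by simp
      let ?t = "norm (u x) / L"
      have t: "0 \<le> ?t" using L by simp
      have "bracket (u x) \<le> 1 + norm (u x)"
        unfolding bracket_def by (rule real_le_lsqrt) (auto simp: power2_eq_square algebra_simps dot_square_norm)
      also have "norm (u x) = L * ?t" using L by simp
      also have "\<dots> \<le> L * (\<sigma> + \<sigma> * P x ?t)" by (rule mult_left_mono[OF le_sigma_P[OF g t]]) (use L in simp)
      finally have "bracket (u x) \<le> (1 + L * \<sigma>) + L * \<sigma> * P x ?t" by (simp add: algebra_simps)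
      then have "ennreal (bracket (u x)) \<le> ennreal (1 + L * \<sigma>) + ennreal (L * \<sigma>) * \<phi> x ?t"
        using L \<sigma> P_nonneg[of x ?t] by (simp add: phi_eq_P[OF g t] ennreal_mult[symmetric] ennreal_plus[symmetric] del: ennreal_plus)
      then have "wt x * ennreal (bracket (u x)) \<le> wt x * (ennreal (1 + L * \<sigma>) + ennreal (L * \<sigma>) * \<phi> x ?t)"
        by (rule mult_left_mono) simp
      also have "\<dots> = ennreal (1 + L * \<sigma>) * wt x + wt x * (ennreal (L * \<sigma>) * \<phi> x ?t)"
        by (simp add: distrib_left mult.commute)
      also have "\<dots> \<le> ennreal (1 + L * \<sigma>) * h x + 1 * (ennreal (L * \<sigma>) * \<phi> x ?t)"
        using True by (intro add_mono mult_left_mono mult_right_mono) (auto simp: wt_def)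
      finally show ?thesis using True by simp
    qed (simp add: wt_def)
  qed
  have "\<exists>g G. (\<forall>j. g j \<in> S j) \<and> G \<in> borel_measurable M \<and> (AE x in M. (\<lambda>j. g j x) \<longlonglongrightarrow> G x)"
  proof (rule midpoint_convex_AE_convergent[OF ne dec mid])
    show "u \<in> borel_measurable M" if "u \<in> S 0" for u using meas[OF that] by (simp add: M_def)
    show "(\<integral>\<^sup>+x. ennreal (bracket (u x)) \<partial>M) \<le> ennreal ((1 + L * \<sigma>) * H + L * \<sigma> * C)" if u: "u \<in> S 0" for u
    proof -
      have bm: "(\<lambda>x. ennreal (bracket (u x))) \<in> borel_measurable lebesgue"
        using measurable_compose[OF meas[OF u] borel_measurable_bracket] by simp
      have "(\<integral>\<^sup>+x. ennreal (bracket (u x)) \<partial>M) = (\<integral>\<^sup>+x. wt x * ennreal (bracket (u x)) \<partial>lebesgue)"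
        unfolding M_def by (rule nn_integral_density[OF wm bm])
      also have "\<dots> \<le> (\<integral>\<^sup>+x. ennreal (1 + L * \<sigma>) * h x + ennreal (L * \<sigma>) * (\<phi> x (norm (u x) / L) * indicator \<Omega> x) \<partial>lebesgue)"
        by (rule nn_integral_mono_AE[OF pt])
      also have "\<dots> = ennreal (1 + L * \<sigma>) * ennreal H + ennreal (L * \<sigma>) * (\<integral>\<^sup>+x\<in>\<Omega>. \<phi> x (norm (u x) / L) \<partial>lebesgue)"
        using h(1) phim[OF meas[OF u]] by (subst nn_integral_add) (auto simp: nn_integral_cmult H)
      also have "\<dots> \<le> ennreal (1 + L * \<sigma>) * ennreal H + ennreal (L * \<sigma>) * ennreal C"
        by (intro add_left_mono mult_left_mono bound u) simp
      also have "\<dots> = ennreal ((1 + L * \<sigma>) * H + L * \<sigma> * C)"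
        using L \<sigma> H(2) C by (simp add: ennreal_mult ennreal_plus del: ennreal_plus[symmetric])
      finally show ?thesis .
    qed
    show "0 \<le> (1 + L * \<sigma>) * H + L * \<sigma> * C" using L \<sigma> H(2) C by simp
  qed
  then obtain g G where g: "\<And>j. g j \<in> S j" and G: "G \<in> borel_measurable M" "AE x in M. (\<lambda>j. g j x) \<longlonglongrightarrow> G x" by blast
  have Gm: "G \<in> borel_measurable lebesgue" using G(1) by (simp add: M_def)
  have lim: "AE x in lebesgue. x \<in> \<Omega> \<longrightarrow> (\<lambda>j. g j x) \<longlonglongrightarrow> G x"
  proof -
    have "AE x in lebesgue. 0 < wt x \<longrightarrow> (\<lambda>j. g j x) \<longlonglongrightarrow> G x" using G(2) unfolding M_def AE_density[OF wm] .
    then show ?thesis by eventually_elim (use h(3) in \<open>simp add: wt_def\<close>)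
  qed
  have g0: "g j \<in> S 0" for j using g[of j] dec[of 0 j] by blast
  have "(\<integral>\<^sup>+x\<in>\<Omega>. \<phi> x (norm (G x) / L) \<partial>lebesgue) \<le>
      (\<integral>\<^sup>+x. liminf (\<lambda>j. \<phi> x (norm (g j x) / L) * indicator \<Omega> x) \<partial>lebesgue)"
  proof (rule nn_integral_mono_AE)
    show "AE x in lebesgue. \<phi> x (norm (G x) / L) * indicator \<Omega> x \<le> liminf (\<lambda>j. \<phi> x (norm (g j x) / L) * indicator \<Omega> x)"
      using lim AE_good
    proof eventually_elim
      case (elim x)
      show ?case
      proof (cases "x \<in> \<Omega>")
        case True
        then have gx: "good x" and l: "(\<lambda>j. norm (g j x) / L) \<longlonglongrightarrow> norm (G x) / L"
          using elim L by (auto intro!: tendsto_intros)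
        have "(\<lambda>j. P x (norm (g j x) / L)) \<longlonglongrightarrow> P x (norm (G x) / L)"
          by (rule continuous_on_tendsto_compose[OF P_cont[OF gx] l]) (use L in auto)
        then have "(\<lambda>j. ennreal (P x (norm (g j x) / L))) \<longlonglongrightarrow> ennreal (P x (norm (G x) / L))" by (rule tendsto_ennrealI)
        then have "(\<lambda>j. \<phi> x (norm (g j x) / L)) \<longlonglongrightarrow> \<phi> x (norm (G x) / L)" using L by (simp add: phi_eq_P[OF gx])
        from lim_imp_Liminf[OF _ this] show ?thesis using True by simp
      qed simp
    qed
  qed
  also have "\<dots> \<le> liminf (\<lambda>j. \<integral>\<^sup>+x\<in>\<Omega>. \<phi> x (norm (g j x) / L) \<partial>lebesgue)"
    by (rule nn_integral_liminf) (rule phim[OF meas[OF g0]])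
  also have "\<dots> \<le> liminf (\<lambda>j. ennreal C)"
    by (rule Liminf_mono) (simp add: bound g0)
  also have "\<dots> = ennreal C" by (simp add: Liminf_const)
  finally show ?thesis using g Gm lim by blast
qed

lemma locally_integrable_of_modular:
  fixes u :: "real^'n \<Rightarrow> real^'n"
  assumes um: "u \<in> borel_measurable lebesgue" and fin: "(\<integral>\<^sup>+x\<in>\<Omega>. \<phi> x (norm (u x) / L) \<partial>lebesgue) < \<infinity>" and L: "0 < L"
  shows "u locally_integrable_on \<Omega>"
proof -
  have lm[measurable]: "u \<in> borel_measurable (lebesgue_on \<Omega>)" using um by (rule measurable_restrict_space1)
  show ?thesis
    unfolding locally_integrable_on_def
  proof (intro allI impI, elim conjE)
    fix K' :: "(real^'n) set" assume K': "compact K'" "K' \<subseteq> \<Omega>"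
    have i: "integrable lebesgue (\<lambda>x. indicator K' x *\<^sub>R (norm (u x) / L))"
      by (rule integrable_of_modular[OF _ _ fin K'(2)]) (use L K' in \<open>auto intro: lmeasurable_compact\<close>)
    show "set_integrable lebesgue K' u"
      unfolding set_integrable_def
    proof (rule Bochner_Integration.integrable_bound[OF integrable_mult_right[OF i, of L]])
      show "(\<lambda>x. indicator K' x *\<^sub>R u x) \<in> borel_measurable lebesgue"
        using um K'(1) lmeasurable_compact by (intro borel_measurable_scaleR borel_measurable_indicator) (auto simp: fmeasurableD)
      show "AE x in lebesgue. norm (indicator K' x *\<^sub>R u x) \<le> norm (L * (indicator K' x *\<^sub>R (norm (u x) / L)))"
        using L by (auto simp: indicator_def)
    qed
  qed
qed

text \<open>The pairing with a fixed test function is linear, so its limit along the mollified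
  gradients is inherited by their iterated midpoints. These converge almost everywhere, and by
  \<open>L1_tendsto_0\<close> also in the mean on the support of the test function, so the pairing
  with the limit function has the required value.\<close>

theorem weak_gradient_of_sharp_integral_bounded:
  assumes f: "f locally_integrable_on \<Omega>" and r: "\<And>j. 0 < r j" "r \<longlonglongrightarrow> 0"
    and bd: "\<And>j. sharp_integral f (r j) \<le> ennreal C" and C: "0 \<le> C"
  shows "\<exists>G. weak_gradient \<Omega> f G \<and> G \<in> Lphi \<phi> \<Omega>"
proof -
  define D where "D j = discrete_grad f (r j)" for j
  define S where "S = midpoint_hull D"
  let ?L = sharp_bound
  have S0: "u \<in> borel_measurable lebesgue \<and> (\<integral>\<^sup>+x\<in>\<Omega>. \<phi> x (norm (u x) / ?L) \<partial>lebesgue) \<le> ennreal C" if "u \<in> S 0" for u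
    using that unfolding S_def
  proof induction
    case (base j)
    show ?case using borel_measurable_discrete_grad[OF f r(1)] order_trans[OF nn_integral_phi_discrete_grad[OF f r(1)] bd]
      by (simp add: D_def)
  next
    case (mid u v)
    then have [measurable]: "u \<in> borel_measurable lebesgue" "v \<in> borel_measurable lebesgue" by auto
    have "(\<lambda>x. (1 / 2) *\<^sub>R (u x + v x)) \<in> borel_measurable lebesgue" by measurable
    moreover have "(\<integral>\<^sup>+x\<in>\<Omega>. \<phi> x (norm ((1 / 2) *\<^sub>R (u x + v x)) / ?L) \<partial>lebesgue) \<le> ennreal C"
      using mid by (intro nn_integral_phi_midpoint sharp_bound_pos C) (auto intro: measurable_restrict_space1)
    ultimately show ?case by blast
  qed
  have dec: "S j \<subseteq> S i" if "i \<le> j" for i j unfolding S_def by (rule midpoint_hull_antimono[OF that])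
  have ex: "\<exists>g G. (\<forall>j. g j \<in> S j) \<and> G \<in> borel_measurable lebesgue \<and>
    (AE x in lebesgue. x \<in> \<Omega> \<longrightarrow> (\<lambda>j. g j x) \<longlonglongrightarrow> G x) \<and> (\<integral>\<^sup>+x\<in>\<Omega>. \<phi> x (norm (G x) / ?L) \<partial>lebesgue) \<le> ennreal C"
  proof (rule modular_compactness[OF _ dec])
    show "S j \<noteq> {}" for j using midpoint_hull.base[of j j D] by (auto simp: S_def)
    show "(\<lambda>x. (1 / 2) *\<^sub>R (u x + v x)) \<in> S j" if "u \<in> S j" "v \<in> S j" for j u v
      using that unfolding S_def by (rule midpoint_hull.mid)
  qed (use S0 C sharp_bound_pos in auto)
  then obtain g G where g: "\<And>j. g j \<in> S j" and Gm: "G \<in> borel_measurable lebesgue"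
    and lim: "AE x in lebesgue. x \<in> \<Omega> \<longrightarrow> (\<lambda>j. g j x) \<longlonglongrightarrow> G x"
    and GC: "(\<integral>\<^sup>+x\<in>\<Omega>. \<phi> x (norm (G x) / ?L) \<partial>lebesgue) \<le> ennreal C" by blast
  have fin: "x < \<infinity>" if "x \<le> ennreal C" for x using that by (auto intro: le_less_trans)
  have g0: "g j \<in> S 0" for j using g[of j] dec[of 0 j] by blast
  have li: "u locally_integrable_on \<Omega>" if "u \<in> borel_measurable lebesgue" "(\<integral>\<^sup>+x\<in>\<Omega>. \<phi> x (norm (u x) / ?L) \<partial>lebesgue) \<le> ennreal C" for u :: "real^'n \<Rightarrow> real^'n"
    by (rule locally_integrable_of_modular[OF that(1) fin[OF that(2)] sharp_bound_pos])
  have Gr[measurable]: "G \<in> borel_measurable (lebesgue_on \<Omega>)" using Gm by (rule measurable_restrict_space1)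
  have GL: "G \<in> Lphi \<phi> \<Omega>"
  proof -
    have "modular \<phi> \<Omega> (\<lambda>x. (1 / ?L) *\<^sub>R G x) < \<infinity>"
      using fin[OF GC] sharp_bound_pos by (simp add: modular_def)
    then show ?thesis using Gr sharp_bound_pos unfolding Lphi_def by (intro CollectI conjI exI[of _ "1 / ?L"]) auto
  qed
  have "(LINT x:\<Omega>|lebesgue. f x * partial_deriv i \<eta> x) = - (LINT x:\<Omega>|lebesgue. G x $ i * \<eta> x)" if \<eta>: "test_function \<Omega> \<eta>" for \<eta> i
  proof -
    obtain K where K: "compact K" "K \<subseteq> \<Omega>" "\<And>x. x \<notin> K \<Longrightarrow> \<eta> x = 0" "continuous_on UNIV \<eta>"
      using test_functionD[OF \<eta>] by metis
    obtain B where B: "0 \<le> B" "\<And>x. \<bar>\<eta> x\<bar> \<le> B" using compact_support_bounded[OF K(4) K(1,3)] by blast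
    define T where "T u = (LINT x:\<Omega>|lebesgue. u x $ i * \<eta> x)" for u :: "real^'n \<Rightarrow> real^'n"
    define l where "l = - (LINT x:\<Omega>|lebesgue. f x * partial_deriv i \<eta> x)"
    have ti: "set_integrable lebesgue \<Omega> (\<lambda>x. u x $ i * \<eta> x)"
      if "u \<in> borel_measurable lebesgue" "(\<integral>\<^sup>+x\<in>\<Omega>. \<phi> x (norm (u x) / ?L) \<partial>lebesgue) \<le> ennreal C" for u :: "real^'n \<Rightarrow> real^'n"
    proof -
      have "integrable lebesgue (\<lambda>x. (indicator \<Omega> x *\<^sub>R (\<eta> x *\<^sub>R u x)) $ i)"
        by (rule integrable_bounded_linear[OF bounded_linear_vec_nth integrable_mult_compact_support[OF li[OF that] K(4,1,2,3)]])
      then show ?thesis by (simp add: set_integrable_def mult_ac)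
    qed
    have TD: "(\<lambda>j. T (D j)) \<longlonglongrightarrow> l" unfolding T_def l_def D_def by (rule discrete_grad_test[OF f \<eta> r])
    have "(\<lambda>j. T (g j)) \<longlonglongrightarrow> l"
    proof (rule LIMSEQ_I)
      fix e :: real assume e: "0 < e"
      obtain N where N: "\<And>j. N \<le> j \<Longrightarrow> \<bar>T (D j) - l\<bar> \<le> e / 2"
        using LIMSEQ_D[OF TD, of "e / 2"] e by (auto intro: less_imp_le)
      \<comment> \<open>The condition of being within e/2 of \<open>l\<close> is convex, and the
        functional is linear, so it passes from the tail to its midpoint hull.\<close>
      have hull: "\<bar>T u - l\<bar> \<le> e / 2" if "u \<in> S N" for u
        using that unfolding S_def
      proof induction
        case (base j)
        then show ?case by (rule N)
      next
        case (mid u v)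
        then have uv: "u \<in> S 0" "v \<in> S 0" using dec[of 0 N] by (auto simp: S_def)
        note i = ti[OF S0[OF uv(1), THEN conjunct1] S0[OF uv(1), THEN conjunct2]]
          ti[OF S0[OF uv(2), THEN conjunct1] S0[OF uv(2), THEN conjunct2]]
        have "T (\<lambda>x. (1 / 2) *\<^sub>R (u x + v x)) = (LINT x:\<Omega>|lebesgue. 1 / 2 * (u x $ i * \<eta> x + v x $ i * \<eta> x))"
          unfolding T_def by (simp add: algebra_simps)
        also have "\<dots> = 1 / 2 * (T u + T v)" using set_integral_add(2)[OF i] by (simp add: T_def)
        finally have eq: "T (\<lambda>x. (1 / 2) *\<^sub>R (u x + v x)) = 1 / 2 * (T u + T v)" .
        show ?case using mid.IH unfolding eq abs_le_iff distrib_left by (intro conjI; linarith)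
      qed
      have "norm (T (g j) - l) < e" if "N \<le> j" for j
        using hull[of "g j"] g[of j] dec[OF that] e by auto
      then show "\<exists>N. \<forall>j\<ge>N. norm (T (g j) - l) < e" by blast
    qed
    moreover have "(\<lambda>j. T (g j)) \<longlonglongrightarrow> T G"
    proof -
      \<comment> \<open>Half the difference is the midpoint of \<open>g j\<close> and
        \<open>- G\<close>, so its modular is bounded by C; the lost factor returns as the 2 in the
        final constant.\<close>
      define y where "y j x = norm ((1 / 2) *\<^sub>R (g j x + - G x)) / ?L" for j x
      have y0: "0 \<le> y j x" for j x using sharp_bound_pos by (simp add: y_def)
      have ym: "y j \<in> borel_measurable (lebesgue_on \<Omega>)" for j
      proof -
        have [measurable]: "g j \<in> borel_measurable (lebesgue_on \<Omega>)" using S0[OF g0] by (auto intro: measurable_restrict_space1)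
        show ?thesis unfolding y_def[abs_def] by measurable
      qed
      have yC: "(\<integral>\<^sup>+x\<in>\<Omega>. \<phi> x (y j x) \<partial>lebesgue) \<le> ennreal C" for j
        unfolding y_def by (rule nn_integral_phi_midpoint) (use S0[OF g0] GC Gr C sharp_bound_pos in \<open>auto intro: measurable_restrict_space1\<close>)
      have "AE x in lebesgue. x \<in> \<Omega> \<longrightarrow> (\<lambda>j. y j x) \<longlonglongrightarrow> 0"
        using lim
      proof eventually_elim
        case (elim x)
        show ?case
        proof
          assume "x \<in> \<Omega>"
          then have "(\<lambda>j. norm ((1 / 2) *\<^sub>R (g j x + - G x)) / ?L) \<longlonglongrightarrow> norm ((1 / 2) *\<^sub>R (G x + - G x)) / ?L"
            using elim sharp_bound_pos by (intro tendsto_intros) auto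
          then show "(\<lambda>j. y j x) \<longlonglongrightarrow> 0" by (simp add: y_def)
        qed
      qed
      from L1_tendsto_0[OF ym y0 yC C this K(1,2)]
      have l0: "(\<lambda>j. 2 * ?L * B * (LINT x|lebesgue. indicator K x *\<^sub>R y j x)) \<longlonglongrightarrow> 2 * ?L * B * 0" by (intro tendsto_intros)
      have "norm (T (g j) - T G) \<le> 2 * ?L * B * (LINT x|lebesgue. indicator K x *\<^sub>R y j x)" for j
      proof -
        note i = ti[OF S0[OF g0, THEN conjunct1] S0[OF g0, THEN conjunct2], of j] ti[OF Gm GC]
        have yi: "integrable lebesgue (\<lambda>x. indicator K x *\<^sub>R y j x)"
          by (rule integrable_of_modular[OF ym y0 fin[OF yC] K(2) lmeasurable_compact[OF K(1)]])
        have d: "T (g j) - T G = (LINT x|lebesgue. indicator \<Omega> x *\<^sub>R (g j x $ i * \<eta> x - G x $ i * \<eta> x))"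
          unfolding T_def using set_integral_diff(2)[OF i] by (simp add: set_lebesgue_integral_def)
        have "norm (T (g j) - T G) \<le> (LINT x|lebesgue. norm (indicator \<Omega> x *\<^sub>R (g j x $ i * \<eta> x - G x $ i * \<eta> x)))"
          unfolding d by (rule integral_norm_bound)
        also have "\<dots> \<le> (LINT x|lebesgue. 2 * ?L * B * (indicator K x *\<^sub>R y j x))"
        proof (rule integral_mono)
          show "integrable lebesgue (\<lambda>x. norm (indicator \<Omega> x *\<^sub>R (g j x $ i * \<eta> x - G x $ i * \<eta> x)))"
            using set_integral_diff(1)[OF i] unfolding set_integrable_def by (rule integrable_norm)
          show "integrable lebesgue (\<lambda>x. 2 * ?L * B * (indicator K x *\<^sub>R y j x))" using yi by (rule integrable_mult_right)
          fix x
          show "norm (indicator \<Omega> x *\<^sub>R (g j x $ i * \<eta> x - G x $ i * \<eta> x)) \<le> 2 * ?L * B * (indicator K x *\<^sub>R y j x)"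
          proof (cases "x \<in> K")
            case True
            have "norm (g j x $ i * \<eta> x - G x $ i * \<eta> x) = \<bar>(g j x + - G x) $ i\<bar> * \<bar>\<eta> x\<bar>"
              by (simp add: left_diff_distrib[symmetric] abs_mult)
            also have "\<dots> \<le> norm (g j x + - G x) * B" by (intro mult_mono component_le_norm_cart B) auto
            also have "\<dots> = 2 * ?L * B * y j x" using sharp_bound_pos unfolding y_def norm_scaleR by simp
            finally show ?thesis using True K(2) by auto
          qed (simp add: K(3))
        qed
        finally show ?thesis by simp
      qed
      then have "\<forall>\<^sub>F j in sequentially. norm (T (g j) - T G) \<le> 2 * ?L * B * (LINT x|lebesgue. indicator K x *\<^sub>R y j x)"
        by (intro always_eventually allI)
      then have "(\<lambda>j. T (g j) - T G) \<longlonglongrightarrow> 0"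
        by (rule Lim_null_comparison) (use l0 in \<open>simp only: mult_zero_right\<close>)
      then show ?thesis by (simp add: LIM_zero_iff)
    qed
    ultimately have "l = T G" by (rule LIMSEQ_unique)
    then show ?thesis by (simp add: l_def T_def)
  qed
  then show ?thesis using GL li[OF Gm GC] unfolding weak_gradient_def by blast
qed


text \<open>If the inner integrals exceeded 2m for all radii up to some \<gamma>, then, as the
  weights eventually put more than half of their mass there, the sharp modular would be at least m,
  contrary to the choice of m above the upper limit. Hence good radii exist below every
  \<gamma>.\<close>

lemma sharp_integral_bounded_along_sequence:
  fixes \<psi> :: "real \<Rightarrow> real \<Rightarrow> real"
  assumes \<psi>: "\<And>\<epsilon>. 0 < \<epsilon> \<Longrightarrow> set_integrable lebesgue {0<..} (\<psi> \<epsilon>)"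
     "\<And>\<epsilon> r. 0 < \<epsilon> \<Longrightarrow> 0 < r \<Longrightarrow> 0 \<le> \<psi> \<epsilon> r"
     "\<And>\<epsilon>. 0 < \<epsilon> \<Longrightarrow> (LINT r:{0<..}|lebesgue. \<psi> \<epsilon> r) = 1"
     "\<And>\<gamma>. 0 < \<gamma> \<Longrightarrow> ((\<lambda>\<epsilon>. LINT r:{\<gamma><..}|lebesgue. \<psi> \<epsilon> r) \<longlongrightarrow> 0) (at_right 0)"
    and lim: "Limsup (at_right 0) (\<lambda>\<epsilon>. sharp_modular \<phi> \<Omega> (\<psi> \<epsilon>) f) < \<infinity>"
  obtains r C where "\<And>j. 0 < r j" "r \<longlonglongrightarrow> 0" "0 \<le> C" "\<And>j. sharp_integral f (r j) \<le> ennreal C"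
proof -
  let ?I = "sharp_integral f"
  obtain m where m: "Limsup (at_right 0) (\<lambda>\<epsilon>. sharp_modular \<phi> \<Omega> (\<psi> \<epsilon>) f) < ennreal m" "0 \<le> m"
  proof -
    obtain q where "Limsup (at_right 0) (\<lambda>\<epsilon>. sharp_modular \<phi> \<Omega> (\<psi> \<epsilon>) f) < q" "q < top" using dense[of _ top] lim by auto
    then show ?thesis using that[of "enn2real q"] by simp
  qed
  have ex: "\<exists>r. 0 < r \<and> r \<le> \<gamma> \<and> ?I r \<le> ennreal (2 * m)" if \<gamma>: "0 < \<gamma>" for \<gamma>
  proof (rule ccontr)
    assume "\<not> ?thesis"
    then have big: "ennreal (2 * m) \<le> ?I r" if "0 < r" "r \<le> \<gamma>" for r using that by (auto intro: less_imp_le)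
    have "\<forall>\<^sub>F \<epsilon> in at_right 0. ennreal (1 / 2) < (\<integral>\<^sup>+r\<in>{0<..\<gamma>}. ennreal (\<psi> \<epsilon> r) \<partial>lebesgue)"
    proof (rule order_tendstoD(1)[OF weighted_average_head[OF \<psi> \<gamma>]])
      show "ennreal (1 / 2) < 1" unfolding ennreal_1[symmetric] by (rule ennreal_lessI) auto
    qed
    moreover have "\<forall>\<^sub>F \<epsilon> in at_right 0. sharp_modular \<phi> \<Omega> (\<psi> \<epsilon>) f < ennreal m" by (rule Limsup_lessD[OF m(1)])
    moreover have "\<forall>\<^sub>F \<epsilon> in at_right (0::real). 0 < \<epsilon>" by (rule eventually_at_right_less)
    ultimately have "\<forall>\<^sub>F \<epsilon> in at_right 0. 0 < \<epsilon> \<and> sharp_modular \<phi> \<Omega> (\<psi> \<epsilon>) f < ennreal m \<and>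
        ennreal (1 / 2) < (\<integral>\<^sup>+r\<in>{0<..\<gamma>}. ennreal (\<psi> \<epsilon> r) \<partial>lebesgue)"
      by eventually_elim blast
    then obtain \<epsilon> where \<epsilon>: "0 < \<epsilon>" "sharp_modular \<phi> \<Omega> (\<psi> \<epsilon>) f < ennreal m"
        "ennreal (1 / 2) < (\<integral>\<^sup>+r\<in>{0<..\<gamma>}. ennreal (\<psi> \<epsilon> r) \<partial>lebesgue)"
      using eventually_happens'[OF trivial_limit_at_right_real] by blast
    have "set_integrable lebesgue {0<..\<gamma>} (\<psi> \<epsilon>)" by (rule set_integrable_subset[OF \<psi>(1)[OF \<epsilon>(1)]]) auto
    then have pm: "(\<lambda>r. ennreal (indicator {0<..\<gamma>} r *\<^sub>R \<psi> \<epsilon> r)) \<in> borel_measurable lebesgue"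
      unfolding set_integrable_def by (intro measurable_compose[OF borel_measurable_integrable measurable_ennreal])
    have pe: "ennreal (indicator {0<..\<gamma>} r *\<^sub>R \<psi> \<epsilon> r) = ennreal (\<psi> \<epsilon> r) * indicator {0<..\<gamma>} r" for r
      by (simp add: indicator_def)
    have "ennreal m = ennreal (2 * m) * ennreal (1 / 2)" using m(2) ennreal_mult[of "2 * m" "1 / 2"] by (simp only: mult_nonneg_nonneg zero_le_numeral zero_le_divide_1_iff) simp
    also have "\<dots> \<le> ennreal (2 * m) * (\<integral>\<^sup>+r\<in>{0<..\<gamma>}. ennreal (\<psi> \<epsilon> r) \<partial>lebesgue)"
      by (rule mult_left_mono[OF less_imp_le[OF \<epsilon>(3)]]) simp
    also have "\<dots> = (\<integral>\<^sup>+r. ennreal (2 * m) * (ennreal (\<psi> \<epsilon> r) * indicator {0<..\<gamma>} r) \<partial>lebesgue)"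
      by (rule nn_integral_cmult[OF pm[unfolded pe], symmetric])
    also have "\<dots> \<le> sharp_modular \<phi> \<Omega> (\<psi> \<epsilon>) f"
      unfolding sharp_modular_eq
    proof (rule nn_integral_mono)
      fix r
      show "ennreal (2 * m) * (ennreal (\<psi> \<epsilon> r) * indicator {0<..\<gamma>} r) \<le> ?I r * ennreal (\<psi> \<epsilon> r) * indicator {0<..} r"
        using big[of r] by (auto simp: indicator_def intro!: mult_right_mono)
    qed
    finally show False using \<epsilon>(2) by simp
  qed
  define r where "r j = (SOME r. 0 < r \<and> r \<le> 1 / real (Suc j) \<and> ?I r \<le> ennreal (2 * m))" for j
  have r: "0 < r j \<and> r j \<le> 1 / real (Suc j) \<and> ?I (r j) \<le> ennreal (2 * m)" for j
    unfolding r_def by (rule someI_ex) (rule ex, simp)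
  have "r \<longlonglongrightarrow> 0"
  proof (rule tendsto_sandwich[OF _ _ tendsto_const])
    show "(\<lambda>j. 1 / real (Suc j)) \<longlonglongrightarrow> 0" using LIMSEQ_inverse_real_of_nat by (simp add: inverse_eq_divide)
  qed (use r in \<open>auto intro!: always_eventually less_imp_le\<close>)
  then show ?thesis using that[of r "2 * m"] r m(2) by auto
qed

end

section \<open>Both implications and the two limits, from the fixed setting\<close>

theorem theorem1p1:
  fixes \<Omega> :: "(real^'n::finite) set"
    and \<phi> :: "real^'n \<Rightarrow> real \<Rightarrow> ennreal"
    and \<psi> :: "real \<Rightarrow> real \<Rightarrow> real"
    and f :: "real^'n \<Rightarrow> real"
    and k :: 'n
  assumes "open \<Omega>"
    and "generalized_Phi_function \<Omega> \<phi>"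
    and "condA \<Omega> \<phi>" and "aInc \<Omega> \<phi>" and "aDec \<Omega> \<phi>"
    and "\<And>\<epsilon>. 0 < \<epsilon> \<Longrightarrow> set_integrable lebesgue {0<..} (\<psi> \<epsilon>)"
    and "\<And>\<epsilon> r. 0 < \<epsilon> \<Longrightarrow> 0 < r \<Longrightarrow> 0 \<le> \<psi> \<epsilon> r"
    and "\<And>\<epsilon>. 0 < \<epsilon> \<Longrightarrow> (LINT r:{0<..}|lebesgue. \<psi> \<epsilon> r) = 1"
    and "\<And>\<gamma>. 0 < \<gamma> \<Longrightarrow> ((\<lambda>\<epsilon>. LINT r:{\<gamma><..}|lebesgue. \<psi> \<epsilon> r) \<longlongrightarrow> 0) (at_right 0)"
    and "f locally_integrable_on \<Omega>"
  shows "((\<exists>G. weak_gradient \<Omega> f G \<and> G \<in> Lphi \<phi> \<Omega>) \<longleftrightarrow>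
            Limsup (at_right 0) (\<lambda>\<epsilon>. sharp_modular \<phi> \<Omega> (\<psi> \<epsilon>) f) < \<infinity>) \<and>
         (\<forall>G. weak_gradient \<Omega> f G \<and> G \<in> Lphi \<phi> \<Omega> \<longrightarrow>
            ((\<lambda>\<epsilon>. sharp_modular \<phi> \<Omega> (\<psi> \<epsilon>) f) \<longlongrightarrow>
               modular \<phi> \<Omega> (\<lambda>x. c_const k * norm (G x))) (at_right 0) \<and>
            ((\<lambda>\<epsilon>. sharp_norm \<phi> \<Omega> (\<psi> \<epsilon>) f) \<longlongrightarrow>
               ennreal (c_const k) * phi_norm \<phi> \<Omega> G) (at_right 0))"
proof -
  note \<psi> = assms(6-9) and f = assms(10)
  obtain \<beta> \<sigma> where A: "0 < \<beta>" "0 < \<sigma>" "condA0 \<Omega> \<phi> \<beta> \<sigma>" "condA1 \<Omega> \<phi> \<beta> \<sigma>" "condA2 \<Omega> \<phi> \<beta> \<sigma>"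
    using assms(3) by (auto simp: condA_def)
  obtain h where h: "integrable (lebesgue_on \<Omega>) h"
    "AE x in lebesgue_on \<Omega>. AE y in lebesgue_on \<Omega>. \<forall>t\<in>{0..\<sigma>}.
       enn2ereal (\<phi> x (\<beta> * t)) \<le> enn2ereal (\<phi> y t) + ereal (h x + h y)"
    using A(5) unfolding condA2_def by blast
  obtain a ca where a: "1 < a" "0 < ca"
    "AE x in lebesgue_on \<Omega>. almost_increasing_on {0<..} ca (\<lambda>s. ennreal (s powr (- a)) * \<phi> x s)"
    using assms(4) unfolding aInc_def by blast
  obtain b cb where b: "1 < b" "0 < cb"
    "AE x in lebesgue_on \<Omega>. almost_decreasing_on {0<..} cb (\<lambda>s. ennreal (s powr (- b)) * \<phi> x s)"
    using assms(5) unfolding aDec_def by blast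
  interpret phi_setting \<Omega> \<phi> \<beta> \<sigma> h a ca b cb
    by (unfold_locales) (fact assms A h a b)+
  show ?thesis
  proof (intro conjI iffI allI impI)
    assume "\<exists>G. weak_gradient \<Omega> f G \<and> G \<in> Lphi \<phi> \<Omega>"
    then obtain G where G: "weak_gradient \<Omega> f G" "G \<in> Lphi \<phi> \<Omega>" by blast
    have "Limsup (at_right 0) (\<lambda>\<epsilon>. sharp_modular \<phi> \<Omega> (\<psi> \<epsilon>) f) = modular \<phi> \<Omega> (\<lambda>x. c_const k * norm (G x))"
      by (rule lim_imp_Limsup[OF _ sharp_modular_limit[OF \<psi> f G]]) simp
    then show "Limsup (at_right 0) (\<lambda>\<epsilon>. sharp_modular \<phi> \<Omega> (\<psi> \<epsilon>) f) < \<infinity>"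
      using sharp_integral_limit(3)[OF f G, of k] by simp
  next
    assume "Limsup (at_right 0) (\<lambda>\<epsilon>. sharp_modular \<phi> \<Omega> (\<psi> \<epsilon>) f) < \<infinity>"
    then obtain r C where "\<And>j. 0 < r j" "r \<longlonglongrightarrow> 0" "0 \<le> C" "\<And>j. sharp_integral f (r j) \<le> ennreal C"
      using sharp_integral_bounded_along_sequence[OF \<psi>, of f] by blast
    then show "\<exists>G. weak_gradient \<Omega> f G \<and> G \<in> Lphi \<phi> \<Omega>"
      using weak_gradient_of_sharp_integral_bounded[OF f, of r C] by blast
  qed (use sharp_limits[OF \<psi> f] in blast)+
qed

end
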